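(* Let $S(u)=u^2$ and let $(u_h,q_h)$ be the LDG approximation defined in the context, with numerical fluxes $\mathcal{F}_u$ and $(\widetilde{\mathcal{F}}_u,\widetilde{\mathcal{F}}_q)$ given there (parameters $\gamma,\theta\in[0,1]$, $\widetilde\gamma,\eta_u,\eta_q\ge0$). Then, with the cell energy and the numerical energy flux $$S_j(t):=\int_{I_j}S(u_h(t))\,dx,\qquad Q_{j+\frac12}(t):=2\Phi_{j+\frac12}(t)+\Lambda_{j+\frac12}(t),$$ the following local in-cell energy identity holds: $$\begin{aligned}dS_j(t)&+\int_{I_j}S'(u_h(t))q_h(t)\,dx\,dW_t-\bigl(Q_{j+\frac12}(t)-Q_{j-\frac12}(t)\bigr)dt\\&+\tfrac1{8}(\gamma+2\widetilde\gamma)\Bigl(|(\sigma^2)'|\,\llbracket S'(u_h(t))\rrbracket^2\Bigr)_{j-\frac12}dt+\Bigl(|\sigma|\bigl(\eta_u\llbracket q_h(t)\rrbracket^2+\tfrac{\eta_q}{2}\llbracket S'(u_h(t))\rrbracket^2\bigr)\Bigr)_{j-\frac12}dt\\&=\int_{I_j}\Bigl((\sigma')^2-\tfrac14(\sigma^2)''\Bigr)S(u_h(t))\,dx\,dt .\end{aligned}$$ Moreover, taking expectations yields the mean cell energy inequality $$\frac{d}{dt}\mathbb{E}[S_j(t)]\le\int_{I_j}\Bigl((\sigma')^2-\tfrac14(\sigma^2)''\Bigr)\mathbb{E}[S(u_h(t))]\,dx+\mathbb{E}\bigl[Q_{j+\frac12}(t)-Q_{j-\frac12}(t)\bigr],$$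 with equality if $\gamma=\widetilde\gamma=0$ and $\eta_u=\eta_q=0$.
   Context: Setting. $T>0$; $W$ is a one-dimensional Brownian motion on a filtered probability space satisfying the usual conditions; $\sigma\in C^2(\mathbb{R})$ with $\sigma',\sigma'',(\sigma^2)''\in L^\infty(\mathbb{R})$; $\bar u\in L^2(\mathbb{R})$ is deterministic. The SPDE is $du-\tfrac12\partial_x(\sigma\partial_x(\sigma u))\,dt+\partial_x(\sigma u)\,dW_t=0$, $u(0)=\bar u$. Mesh. A bounded computational interval is partitioned into finitely many cells $I_j=[x_{j-\frac12},x_{j+\frac12}]$; $\mathcal{V}^k$ is the space of functions whose restriction to each $I_j$ is a polynomial of degree $\le k$ ($k\ge0$). $v^\pm_{j+\frac12}$ are right/left traces at $x_{j+\frac12}$, $\llbracket v\rrbracket=v^+-v^-$, $\{\!\{v\}\!\}=\tfrac12(v^++v^-)$; $(\cdot)_{j\pm\frac12}$ denotes evaluation at $x_{j\pm\frac12}$. At the two end points of the domain zeroth-order extrapolation is used (the exterior trace is taken equal to the interior trace, so numerical fluxes reduce to the interior trace). LDG scheme. $(u_h,q_h)$ are adapted continuous $\mathcal{V}^k$-valued processes such that for all $j$ and $\varphi,\psi\in\mathcal{V}^k$ $$d\int_{I_j}\varphi u_h\,dx=\bigl(a_j(u_h,\varphi)+b_j(q_h,\varphi)\bigr)dt-\int_{I_j}\varphi q_h\,dx\,dW_t,$$ $$\int_{I_j}\psi q_h\,dx=-\int_{I_j}(\partial_x\psi)\sigma u_h\,dx+(\sigma\widetilde{\mathcal{F}}_u\psi^-)_{j+\frac12}-(\sigma\widetilde{\mathcal{F}}_u\psi^+)_{j-\frac12},$$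 $$a_j(u_h,\varphi)=-\tfrac12\int_{I_j}\partial_x(\sigma'\varphi)\sigma u_h\,dx+\tfrac14\Bigl(((\sigma^2)'\mathcal{F}_u\varphi^-)_{j+\frac12}-((\sigma^2)'\mathcal{F}_u\varphi^+)_{j-\frac12}\Bigr),$$ $$b_j(q_h,\varphi)=-\tfrac12\int_{I_j}\partial_x(\sigma\varphi)q_h\,dx+\tfrac12\Bigl((\sigma\widetilde{\mathcal{F}}_q\varphi^-)_{j+\frac12}-(\sigma\widetilde{\mathcal{F}}_q\varphi^+)_{j-\frac12}\Bigr),$$ and $u_h(0)$ is the $L^2$-projection of $\bar u$ onto $\mathcal{V}^k$. Fluxes. $\mathcal{F}_u=\gamma\check{\mathcal{F}}(u_h;(\sigma^2)')+(1-\gamma)\{\!\{u_h\}\!\}+\widetilde\gamma\,\mathrm{sgn}((\sigma^2)')\llbracket u_h\rrbracket$, where $\check{\mathcal{F}}(u;b)=u^+$ if $b\ge0$ and $u^-$ if $b<0$; $\widetilde{\mathcal{F}}_u=\theta u_h^-+(1-\theta)u_h^++\eta_u\,\mathrm{sgn}(\sigma)\llbracket q_h\rrbracket$; $\widetilde{\mathcal{F}}_q=(1-\theta)q_h^-+\theta q_h^++\eta_q\,\mathrm{sgn}(\sigma)\llbracket u_h\rrbracket$. Energy fluxes. $\Phi_{j+\frac12}=\tfrac18\bigl((\sigma^2)'(2\mathcal{F}_u-u_h^-)u_h^-\bigr)_{j+\frac12}$, $\Lambda_{j+\frac12}=\bigl(\sigma(u_h^-\widetilde{\mathcal{F}}_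q+\widetilde{\mathcal{F}}_uq_h^--u_h^-q_h^-)\bigr)_{j+\frac12}$.
   Formalization: The printed dissipation coefficients are too large by a factor 2 since [[S'(u)]]^2 = 4[[u]]^2: 1/8 (γ+2γ̃) is corrected to 1/16 (γ+2γ̃), and η_q/2 to η_q/4. The printed identity fails e.g. for σ=1, k=0, two cells, θ=η_q=1, other parameters 0. *)

theory Defs
  imports "HOL-Probability.Probability"
begin

section \<open>Stochastic basis on the time interval [0,T]\<close>

text \<open>
  Filtrations are indexed by \<^typ>\<open>real\<close> so that the library locale \<^locale>\<open>filtration\<close> applies;
  only indices in \<open>[0,T]\<close> carry meaning (a filtration on \<open>[0,T]\<close> extends constantly to the
  remaining indices).
\<close>

definition usual_conditions :: "'w measure \<Rightarrow> (real \<Rightarrow> 'w measure) \<Rightarrow> real \<Rightarrow> bool" where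
  "usual_conditions M F T \<longleftrightarrow>
     complete_measure M \<and> null_sets M \<subseteq> sets (F 0) \<and>
     (\<forall>t\<in>{0..<T}. sets (F t) = (\<Inter>s\<in>{t<..T}. sets (F s)))"

definition filtered_prob_space :: "'w measure \<Rightarrow> (real \<Rightarrow> 'w measure) \<Rightarrow> real \<Rightarrow> bool" where
  "filtered_prob_space M F T \<longleftrightarrow>
     prob_space M \<and> filtration (space M) F \<and> (\<forall>t\<in>{0..T}. subalgebra M (F t)) \<and>
     usual_conditions M F T"

definition adapted :: "(real \<Rightarrow> 'w measure) \<Rightarrow> real \<Rightarrow> (real \<Rightarrow> 'w \<Rightarrow> real) \<Rightarrow> bool" where
  "adapted F T X \<longleftrightarrow> (\<forall>t\<in>{0..T}. X t \<in> borel_measurable (F t))"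

definition brownian_motion ::
  "'w measure \<Rightarrow> (real \<Rightarrow> 'w measure) \<Rightarrow> real \<Rightarrow> (real \<Rightarrow> 'w \<Rightarrow> real) \<Rightarrow> bool" where
  "brownian_motion M F T W \<longleftrightarrow>
     adapted F T W \<and>
     (AE \<omega> in M. W 0 \<omega> = 0) \<and>
     (AE \<omega> in M. continuous_on {0..T} (\<lambda>t. W t \<omega>)) \<and>
     (\<forall>s t. 0 \<le> s \<and> s < t \<and> t \<le> T \<longrightarrow>
        distributed M lborel (\<lambda>\<omega>. W t \<omega> - W s \<omega>) (normal_density 0 (sqrt (t - s))) \<and>
        prob_space.indep_set M (sets (F s))
          {(\<lambda>\<omega>. W t \<omega> - W s \<omega>) -` B \<inter> space M | B. B \<in> sets borel})"


section \<open>The Ito integral\<close>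

definition tends_in_prob :: "'w measure \<Rightarrow> (nat \<Rightarrow> 'w \<Rightarrow> real) \<Rightarrow> ('w \<Rightarrow> real) \<Rightarrow> bool" where
  "tends_in_prob M X Y \<longleftrightarrow>
     (\<forall>m. X m \<in> borel_measurable M) \<and> Y \<in> borel_measurable M \<and>
     (\<forall>e>0. (\<lambda>m. measure M {\<omega> \<in> space M. e < \<bar>X m \<omega> - Y \<omega>\<bar>}) \<longlonglongrightarrow> 0)"

text \<open>
  The data \<open>(n, \<tau>, \<xi>)\<close> encode the simple predictable process
  \<open>\<Sum>i<n. \<xi> i * indicator {\<tau> i <.. \<tau> (i+1)}\<close>.
\<close>

definition simple_integrand ::
  "'w measure \<Rightarrow> (real \<Rightarrow> 'w measure) \<Rightarrow> real \<Rightarrow> nat \<Rightarrow> (nat \<Rightarrow> real) \<Rightarrow> (nat \<Rightarrow> 'w \<Rightarrow> real) \<Rightarrow> bool"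
  where
  "simple_integrand M F T n \<tau> \<xi> \<longleftrightarrow>
     0 \<le> \<tau> 0 \<and> \<tau> n \<le> T \<and>
     (\<forall>i<n. \<tau> i \<le> \<tau> (Suc i) \<and> \<xi> i \<in> borel_measurable (F (\<tau> i)) \<and>
            (\<exists>B. \<forall>\<omega>\<in>space M. \<bar>\<xi> i \<omega>\<bar> \<le> B))"

definition simple_process ::
  "nat \<Rightarrow> (nat \<Rightarrow> real) \<Rightarrow> (nat \<Rightarrow> 'w \<Rightarrow> real) \<Rightarrow> real \<Rightarrow> 'w \<Rightarrow> real" where
  "simple_process n \<tau> \<xi> s \<omega> = (\<Sum>i<n. \<xi> i \<omega> * indicator {\<tau> i<..\<tau> (Suc i)} s)"

definition simple_ito ::
  "(real \<Rightarrow> 'w \<Rightarrow> real) \<Rightarrow> nat \<Rightarrow> (nat \<Rightarrow> real) \<Rightarrow> (nat \<Rightarrow> 'w \<Rightarrow> real) \<Rightarrow> real \<Rightarrow> 'w \<Rightarrow> real" where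
  "simple_ito W n \<tau> \<xi> t \<omega> = (\<Sum>i<n. \<xi> i \<omega> * (W (min t (\<tau> (Suc i))) \<omega> - W (min t (\<tau> i)) \<omega>))"

text \<open>Progressively measurable processes with almost surely square integrable paths.\<close>

definition ito_integrand ::
  "'w measure \<Rightarrow> (real \<Rightarrow> 'w measure) \<Rightarrow> real \<Rightarrow> (real \<Rightarrow> 'w \<Rightarrow> real) \<Rightarrow> bool" where
  "ito_integrand M F T H \<longleftrightarrow>
     (\<forall>t\<in>{0..T}. (\<lambda>(s, \<omega>). H s \<omega>) \<in>
        borel_measurable (restrict_space borel {0..t} \<Otimes>\<^sub>M F t)) \<and>
     (AE \<omega> in M. set_integrable lborel {0..T} (\<lambda>s. (H s \<omega>)\<^sup>2))"

text \<open>
  \<open>I\<close> is the (continuous version of the) process \<open>t \<mapsto> \<integral>\<^sub>0\<^sup>t H dW\<close> on \<open>[0,T]\<close>: the limit in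
  probability of the elementary integrals of simple processes converging to \<open>H\<close> in
  \<open>L\<^sup>2(0,T)\<close> in probability. It is unique up to indistinguishability.
\<close>

definition has_ito_integral ::
  "'w measure \<Rightarrow> (real \<Rightarrow> 'w measure) \<Rightarrow> real \<Rightarrow> (real \<Rightarrow> 'w \<Rightarrow> real) \<Rightarrow>
   (real \<Rightarrow> 'w \<Rightarrow> real) \<Rightarrow> (real \<Rightarrow> 'w \<Rightarrow> real) \<Rightarrow> bool" where
  "has_ito_integral M F T W H I \<longleftrightarrow>
     ito_integrand M F T H \<and>
     adapted F T I \<and> (AE \<omega> in M. continuous_on {0..T} (\<lambda>t. I t \<omega>)) \<and>
     (\<exists>n \<tau> \<xi>.
        (\<forall>m. simple_integrand M F T (n m) (\<tau> m) (\<xi> m)) \<and>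
        tends_in_prob M
          (\<lambda>m \<omega>. LINT s:{0..T}|lborel. (simple_process (n m) (\<tau> m) (\<xi> m) s \<omega> - H s \<omega>)\<^sup>2) (\<lambda>_. 0) \<and>
        (\<forall>t\<in>{0..T}. tends_in_prob M (\<lambda>m. simple_ito W (n m) (\<tau> m) (\<xi> m) t) (I t)))"

text \<open>\<open>dX = A dt + H dW\<close> on \<open>[0,T]\<close>.\<close>

definition has_ito_differential ::
  "'w measure \<Rightarrow> (real \<Rightarrow> 'w measure) \<Rightarrow> real \<Rightarrow> (real \<Rightarrow> 'w \<Rightarrow> real) \<Rightarrow>
   (real \<Rightarrow> 'w \<Rightarrow> real) \<Rightarrow> (real \<Rightarrow> 'w \<Rightarrow> real) \<Rightarrow> (real \<Rightarrow> 'w \<Rightarrow> real) \<Rightarrow> bool" where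
  "has_ito_differential M F T W X A H \<longleftrightarrow>
     (\<exists>I. has_ito_integral M F T W H I \<and>
        (AE \<omega> in M. \<forall>t\<in>{0..T}.
           (\<lambda>s. A s \<omega>) integrable_on {0..t} \<and>
           X t \<omega> = X 0 \<omega> + integral {0..t} (\<lambda>s. A s \<omega>) + I t \<omega>))"


section \<open>Coefficients\<close>

definition C2_real :: "(real \<Rightarrow> real) \<Rightarrow> bool" where
  "C2_real f \<longleftrightarrow>
     (\<forall>y. f field_differentiable (at y)) \<and>
     (\<forall>y. deriv f field_differentiable (at y)) \<and>
     continuous_on UNIV (deriv (deriv f))"

text \<open>For \<^term>\<open>C2_real \<sigma>\<close> the three functions below are continuous, so membership in \<open>L\<^sup>\<infinity>\<close> is
  boundedness.\<close>

definition sigma_admissible :: "(real \<Rightarrow> real) \<Rightarrow> bool" where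
  "sigma_admissible \<sigma> \<longleftrightarrow>
     C2_real \<sigma> \<and> bounded (range (deriv \<sigma>)) \<and> bounded (range (deriv (deriv \<sigma>))) \<and>
     bounded (range (deriv (deriv (\<lambda>y. (\<sigma> y)\<^sup>2))))"

definition L2_real :: "(real \<Rightarrow> real) \<Rightarrow> bool" where
  "L2_real f \<longleftrightarrow> f \<in> borel_measurable lebesgue \<and> integrable lebesgue (\<lambda>y. (f y)\<^sup>2)"


section \<open>Mesh, broken polynomials and traces\<close>

text \<open>
  The cells are \<open>cell x j = [x j, x (j+1)]\<close> for \<open>j < N\<close>, so that node \<open>j\<close> is the left and
  node \<open>j+1\<close> the right end point of cell \<open>j\<close> (that is, \<open>x j\<close> is \<open>x\<^bsub>j-1/2\<^esub>\<close>). A broken polynomial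
  \<open>v\<close> is the family of its restrictions: \<open>v j\<close> is the polynomial on cell \<open>j\<close>.
\<close>

definition mesh :: "nat \<Rightarrow> (nat \<Rightarrow> real) \<Rightarrow> bool" where
  "mesh N x \<longleftrightarrow> 0 < N \<and> (\<forall>j<N. x j < x (Suc j))"

definition cell :: "(nat \<Rightarrow> real) \<Rightarrow> nat \<Rightarrow> real set" where
  "cell x j = {x j..x (Suc j)}"

type_synonym broken_poly = "nat \<Rightarrow> real poly"

definition broken_space :: "nat \<Rightarrow> nat \<Rightarrow> broken_poly set" where
  "broken_space N k = {v. \<forall>j<N. degree (v j) \<le> k}"

text \<open>Traces at node \<open>i \<le> N\<close>. At the two end nodes the missing exterior trace is the interior one.\<close>

definition trm :: "(nat \<Rightarrow> real) \<Rightarrow> broken_poly \<Rightarrow> nat \<Rightarrow> real" where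
  "trm x v i = (if i = 0 then poly (v 0) (x 0) else poly (v (i - 1)) (x i))"

definition trp :: "nat \<Rightarrow> (nat \<Rightarrow> real) \<Rightarrow> broken_poly \<Rightarrow> nat \<Rightarrow> real" where
  "trp N x v i = (if i = N then poly (v (N - 1)) (x N) else poly (v i) (x i))"

definition jump :: "nat \<Rightarrow> (nat \<Rightarrow> real) \<Rightarrow> broken_poly \<Rightarrow> nat \<Rightarrow> real" where
  "jump N x v i = trp N x v i - trm x v i"

definition jump_comp :: "nat \<Rightarrow> (nat \<Rightarrow> real) \<Rightarrow> (real \<Rightarrow> real) \<Rightarrow> broken_poly \<Rightarrow> nat \<Rightarrow> real" where
  "jump_comp N x f v i = f (trp N x v i) - f (trm x v i)"

definition avg :: "nat \<Rightarrow> (nat \<Rightarrow> real) \<Rightarrow> broken_poly \<Rightarrow> nat \<Rightarrow> real" where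
  "avg N x v i = (trp N x v i + trm x v i) / 2"

text \<open>Continuous adapted process with values in the finite-dimensional space
  \<^term>\<open>broken_space N k\<close>, expressed through its coefficients.\<close>

definition broken_process ::
  "'w measure \<Rightarrow> (real \<Rightarrow> 'w measure) \<Rightarrow> real \<Rightarrow> nat \<Rightarrow> nat \<Rightarrow> (real \<Rightarrow> 'w \<Rightarrow> broken_poly) \<Rightarrow> bool" where
  "broken_process M F T N k v \<longleftrightarrow>
     (\<forall>t\<in>{0..T}. \<forall>\<omega>\<in>space M. v t \<omega> \<in> broken_space N k) \<and>
     (\<forall>j<N. \<forall>i. adapted F T (\<lambda>t \<omega>. coeff (v t \<omega> j) i) \<and>
                (\<forall>\<omega>\<in>space M. continuous_on {0..T} (\<lambda>t. coeff (v t \<omega> j) i)))"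

definition is_L2_projection ::
  "nat \<Rightarrow> (nat \<Rightarrow> real) \<Rightarrow> nat \<Rightarrow> (real \<Rightarrow> real) \<Rightarrow> broken_poly \<Rightarrow> bool" where
  "is_L2_projection N x k f v \<longleftrightarrow>
     v \<in> broken_space N k \<and>
     (\<forall>\<phi>\<in>broken_space N k.
        (\<Sum>j<N. integral (cell x j) (\<lambda>y. poly (\<phi> j) y * (poly (v j) y - f y))) = 0)"


section \<open>Numerical fluxes\<close>

text \<open>\<open>dsq \<sigma>\<close> is \<open>(\<sigma>\<^sup>2)'\<close>; \<open>\<gamma>t\<close> is the penalty parameter \<open>\<gamma>\<close> with a tilde.\<close>

abbreviation dsq :: "(real \<Rightarrow> real) \<Rightarrow> real \<Rightarrow> real" where
  "dsq \<sigma> \<equiv> deriv (\<lambda>y. (\<sigma> y)\<^sup>2)"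

definition upwind :: "nat \<Rightarrow> (nat \<Rightarrow> real) \<Rightarrow> broken_poly \<Rightarrow> nat \<Rightarrow> real \<Rightarrow> real" where
  "upwind N x u i b = (if b \<ge> 0 then trp N x u i else trm x u i)"

definition flux_Fu ::
  "nat \<Rightarrow> (nat \<Rightarrow> real) \<Rightarrow> (real \<Rightarrow> real) \<Rightarrow> real \<Rightarrow> real \<Rightarrow> broken_poly \<Rightarrow> nat \<Rightarrow> real" where
  "flux_Fu N x \<sigma> \<gamma> \<gamma>t u i =
     \<gamma> * upwind N x u i (dsq \<sigma> (x i)) + (1 - \<gamma>) * avg N x u i
     + \<gamma>t * sgn (dsq \<sigma> (x i)) * jump N x u i"

definition flux_tFu ::
  "nat \<Rightarrow> (nat \<Rightarrow> real) \<Rightarrow> (real \<Rightarrow> real) \<Rightarrow> real \<Rightarrow> real \<Rightarrow> broken_poly \<Rightarrow> broken_poly \<Rightarrow> nat \<Rightarrow> real" where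
  "flux_tFu N x \<sigma> \<theta> \<eta>u u q i =
     \<theta> * trm x u i + (1 - \<theta>) * trp N x u i + \<eta>u * sgn (\<sigma> (x i)) * jump N x q i"

definition flux_tFq ::
  "nat \<Rightarrow> (nat \<Rightarrow> real) \<Rightarrow> (real \<Rightarrow> real) \<Rightarrow> real \<Rightarrow> real \<Rightarrow> broken_poly \<Rightarrow> broken_poly \<Rightarrow> nat \<Rightarrow> real" where
  "flux_tFq N x \<sigma> \<theta> \<eta>q u q i =
     (1 - \<theta>) * trm x q i + \<theta> * trp N x q i + \<eta>q * sgn (\<sigma> (x i)) * jump N x u i"


section \<open>The LDG scheme\<close>

text \<open>On cell \<open>j\<close> the test function enters through its interior traces
  \<open>poly (\<phi> j) (x (j+1))\<close> (right end, \<open>\<phi>\<^sup>-\<close>) and \<open>poly (\<phi> j) (x j)\<close> (left end, \<open>\<phi>\<^sup>+\<close>) only.\<close>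

definition a_form ::
  "nat \<Rightarrow> (nat \<Rightarrow> real) \<Rightarrow> (real \<Rightarrow> real) \<Rightarrow> real \<Rightarrow> real \<Rightarrow> nat \<Rightarrow> broken_poly \<Rightarrow> broken_poly \<Rightarrow> real" where
  "a_form N x \<sigma> \<gamma> \<gamma>t j u \<phi> =
     - (1/2) * integral (cell x j)
         (\<lambda>y. deriv (\<lambda>z. deriv \<sigma> z * poly (\<phi> j) z) y * \<sigma> y * poly (u j) y)
     + (1/4) * (dsq \<sigma> (x (Suc j)) * flux_Fu N x \<sigma> \<gamma> \<gamma>t u (Suc j) * poly (\<phi> j) (x (Suc j))
                - dsq \<sigma> (x j) * flux_Fu N x \<sigma> \<gamma> \<gamma>t u j * poly (\<phi> j) (x j))"

definition b_form ::
  "nat \<Rightarrow> (nat \<Rightarrow> real) \<Rightarrow> (real \<Rightarrow> real) \<Rightarrow> real \<Rightarrow> real \<Rightarrow> nat \<Rightarrow>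
   broken_poly \<Rightarrow> broken_poly \<Rightarrow> broken_poly \<Rightarrow> real" where
  "b_form N x \<sigma> \<theta> \<eta>q j u q \<phi> =
     - (1/2) * integral (cell x j) (\<lambda>y. deriv (\<lambda>z. \<sigma> z * poly (\<phi> j) z) y * poly (q j) y)
     + (1/2) * (\<sigma> (x (Suc j)) * flux_tFq N x \<sigma> \<theta> \<eta>q u q (Suc j) * poly (\<phi> j) (x (Suc j))
                - \<sigma> (x j) * flux_tFq N x \<sigma> \<theta> \<eta>q u q j * poly (\<phi> j) (x j))"

definition q_equation ::
  "nat \<Rightarrow> (nat \<Rightarrow> real) \<Rightarrow> (real \<Rightarrow> real) \<Rightarrow> real \<Rightarrow> real \<Rightarrow> nat \<Rightarrow>
   broken_poly \<Rightarrow> broken_poly \<Rightarrow> broken_poly \<Rightarrow> bool" where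
  "q_equation N x \<sigma> \<theta> \<eta>u j u q \<psi> \<longleftrightarrow>
     integral (cell x j) (\<lambda>y. poly (\<psi> j) y * poly (q j) y) =
     - integral (cell x j) (\<lambda>y. deriv (poly (\<psi> j)) y * \<sigma> y * poly (u j) y)
     + (\<sigma> (x (Suc j)) * flux_tFu N x \<sigma> \<theta> \<eta>u u q (Suc j) * poly (\<psi> j) (x (Suc j))
        - \<sigma> (x j) * flux_tFu N x \<sigma> \<theta> \<eta>u u q j * poly (\<psi> j) (x j))"

definition ldg_solution ::
  "'w measure \<Rightarrow> (real \<Rightarrow> 'w measure) \<Rightarrow> real \<Rightarrow> (real \<Rightarrow> 'w \<Rightarrow> real) \<Rightarrow>
   (real \<Rightarrow> real) \<Rightarrow> (real \<Rightarrow> real) \<Rightarrow> nat \<Rightarrow> (nat \<Rightarrow> real) \<Rightarrow> nat \<Rightarrow>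
   real \<Rightarrow> real \<Rightarrow> real \<Rightarrow> real \<Rightarrow> real \<Rightarrow>
   (real \<Rightarrow> 'w \<Rightarrow> broken_poly) \<Rightarrow> (real \<Rightarrow> 'w \<Rightarrow> broken_poly) \<Rightarrow> bool" where
  "ldg_solution M F T W \<sigma> ubar N x k \<gamma> \<gamma>t \<theta> \<eta>u \<eta>q u q \<longleftrightarrow>
     broken_process M F T N k u \<and> broken_process M F T N k q \<and>
     (\<forall>j<N. \<forall>\<phi>\<in>broken_space N k.
        has_ito_differential M F T W
          (\<lambda>t \<omega>. integral (cell x j) (\<lambda>y. poly (\<phi> j) y * poly (u t \<omega> j) y))
          (\<lambda>t \<omega>. a_form N x \<sigma> \<gamma> \<gamma>t j (u t \<omega>) \<phi> + b_form N x \<sigma> \<theta> \<eta>q j (u t \<omega>) (q t \<omega>) \<phi>)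
          (\<lambda>t \<omega>. - integral (cell x j) (\<lambda>y. poly (\<phi> j) y * poly (q t \<omega> j) y))) \<and>
     (AE \<omega> in M. \<forall>t\<in>{0..T}. \<forall>j<N. \<forall>\<psi>\<in>broken_space N k.
        q_equation N x \<sigma> \<theta> \<eta>u j (u t \<omega>) (q t \<omega>) \<psi>) \<and>
     (AE \<omega> in M. is_L2_projection N x k ubar (u 0 \<omega>))"


section \<open>Energy fluxes\<close>

definition Phi_flux ::
  "nat \<Rightarrow> (nat \<Rightarrow> real) \<Rightarrow> (real \<Rightarrow> real) \<Rightarrow> real \<Rightarrow> real \<Rightarrow> broken_poly \<Rightarrow> nat \<Rightarrow> real" where
  "Phi_flux N x \<sigma> \<gamma> \<gamma>t u i =
     (1/8) * (dsq \<sigma> (x i) * (2 * flux_Fu N x \<sigma> \<gamma> \<gamma>t u i - trm x u i) * trm x u i)"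

definition Lambda_flux ::
  "nat \<Rightarrow> (nat \<Rightarrow> real) \<Rightarrow> (real \<Rightarrow> real) \<Rightarrow> real \<Rightarrow> real \<Rightarrow> real \<Rightarrow>
   broken_poly \<Rightarrow> broken_poly \<Rightarrow> nat \<Rightarrow> real" where
  "Lambda_flux N x \<sigma> \<theta> \<eta>u \<eta>q u q i =
     \<sigma> (x i) * (trm x u i * flux_tFq N x \<sigma> \<theta> \<eta>q u q i
                + flux_tFu N x \<sigma> \<theta> \<eta>u u q i * trm x q i
                - trm x u i * trm x q i)"

end

theory Submission
  imports Defs
begin

text \<open>
  The energy identity is Ito's formula for the squared \<open>L\<^sup>2\<close> coordinates of \<open>u\<^sub>h\<close> in an orthonormal
  polynomial basis of the cell; each coordinate is an Ito process because the scheme may be tested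
  with the basis functions. Integration by parts, together with the equation for \<open>q\<^sub>h\<close> tested with
  \<open>q\<^sub>h\<close> itself, turns the resulting drift into flux differences, jump penalties at the left node and the
  reaction term.

  For continuous adapted integrands an Ito integral is the limit in probability of Riemann sums, so
  the product rule and the rule for reciprocals reduce to telescoping sums and the convergence of
  quadratic variations.

  Taking expectations needs a second moment of the total energy \<open>E\<close>. The \<open>q\<^sub>h\<close>-equation is coercive, so
  \<open>q\<^sub>h\<close>, the drift and the diffusion are controlled by \<open>u\<^sub>h\<close>; Ito's formula for
  \<open>exp (- c t) Z / (1 + \<epsilon> Z)\<close> with \<open>Z = E\<^sup>2\<close> has bounded diffusion and nonpositive drift, which bounds
  the moment uniformly in \<open>\<epsilon>\<close> without stopping times.
\<close>

section \<open>Convergence in probability\<close>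

text \<open>The stochastic integral is given only through some simple processes that converge to the
  integrand, so nothing can be computed from it until they are exchanged for sums on one fixed
  partition. No moments are at hand at that stage; the exchange rests on a tail bound in which a
  small quadratic variation of the error forces a small error in probability. Moments arise only
  from the energy of all cells together: the jump term with weight \<open>\<eta>u\<close> has no
  sign on a single cell, and only after summation, the end nodes carrying no jump, does it help to
  bound \<open>q\<close> by \<open>u\<close>. The diffusion of a cell energy is then quadratic in
  the size of \<open>u\<close>, so its square is controlled by the squared energy; this makes the
  Ito integral centred and expectations continuous in time. The datum is deterministic, hence the
  initial energy is almost surely constant. The penalties sit at the left node because
  \<open>Q\<close> uses the traces from the left there, whereas integration by parts on the cell
  produces those from the right; at the right node both are interior.\<close>

lemma (in prob_space) tends_in_prob_iff_L1:
  assumes [measurable]: "\<And>m. X m \<in> borel_measurable M" "Y \<in> borel_measurable M"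
  shows "tends_in_prob M X Y \<longleftrightarrow> (\<lambda>m. \<integral>\<omega>. min 1 \<bar>X m \<omega> - Y \<omega>\<bar> \<partial>M) \<longlonglongrightarrow> 0"
proof
  define E where "E m = (\<integral>\<omega>. min 1 \<bar>X m \<omega> - Y \<omega>\<bar> \<partial>M)" for m
  have int: "integrable M (\<lambda>\<omega>. min 1 \<bar>X m \<omega> - Y \<omega>\<bar>)" for m
    by (rule integrable_const_bound[of _ 1]) auto
  have E_nonneg: "0 \<le> E m" for m
    unfolding E_def by (rule integral_nonneg_AE) auto
  {
    assume tip: "tends_in_prob M X Y"
    show "E \<longlonglongrightarrow> 0"
    proof (rule LIMSEQ_I)
      fix e :: real assume "0 < e"
      then have "(\<lambda>m. measure M {\<omega> \<in> space M. e/2 < \<bar>X m \<omega> - Y \<omega>\<bar>}) \<longlonglongrightarrow> 0"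
        using tip half_gt_zero[OF \<open>0 < e\<close>] unfolding tends_in_prob_def by blast
      then obtain n0 where n0: "\<And>m. m \<ge> n0 \<Longrightarrow> measure M {\<omega> \<in> space M. e/2 < \<bar>X m \<omega> - Y \<omega>\<bar>} < e/2"
        using LIMSEQ_D[of _ 0 "e/2"] half_gt_zero[OF \<open>0 < e\<close>] by fastforce
      have "norm (E m - 0) < e" if "m \<ge> n0" for m
      proof -
        let ?A = "{\<omega> \<in> space M. e/2 < \<bar>X m \<omega> - Y \<omega>\<bar>}"
        have intA: "integrable M (indicator ?A :: _ \<Rightarrow> real)"
          by (rule integrable_real_indicator) (auto simp: less_top[symmetric])
        have "E m \<le> (\<integral>\<omega>. e/2 + indicator ?A \<omega> \<partial>M)"
          unfolding E_def
        proof (rule integral_mono[OF int])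
          show "min 1 \<bar>X m \<omega> - Y \<omega>\<bar> \<le> e/2 + indicator ?A \<omega>" if "\<omega> \<in> space M" for \<omega>
            using \<open>0 < e\<close> that by (auto simp: indicator_def min_def)
        qed (intro Bochner_Integration.integrable_add integrable_const intA)
        also have "\<dots> = e/2 + measure M ?A"
          using Bochner_Integration.integral_add[OF integrable_const[of "e/2"] intA]
          by (simp add: prob_space)
        finally show ?thesis using n0[OF that] E_nonneg[of m] by simp
      qed
      then show "\<exists>no. \<forall>n\<ge>no. norm (E n - 0) < e" by blast
    qed
  }
  assume lim: "E \<longlonglongrightarrow> 0"
  show "tends_in_prob M X Y"
    unfolding tends_in_prob_def
  proof (intro conjI allI impI)
    fix e :: real assume "0 < e"
    \<comment> \<open>Thresholds above 1 are invisible after truncation, so Markov's inequality is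
      applied at the level \<open>min 1 e\<close>.\<close>
    have le: "measure M {\<omega> \<in> space M. e < \<bar>X m \<omega> - Y \<omega>\<bar>} \<le> E m / min 1 e" for m
    proof -
      have "measure M {\<omega> \<in> space M. e < \<bar>X m \<omega> - Y \<omega>\<bar>}
          \<le> measure M {\<omega> \<in> space M. min 1 e \<le> min 1 \<bar>X m \<omega> - Y \<omega>\<bar>}"
        by (rule finite_measure_mono) auto
      also have "\<dots> \<le> E m / min 1 e"
        unfolding E_def using \<open>0 < e\<close> by (intro integral_Markov_inequality_measure[where A="{}"] int) auto
      finally show ?thesis .
    qed
    show "(\<lambda>m. measure M {\<omega> \<in> space M. e < \<bar>X m \<omega> - Y \<omega>\<bar>}) \<longlonglongrightarrow> 0"
    proof (rule tendsto_sandwich[where f="\<lambda>_. 0" and h="\<lambda>m. E m / min 1 e"])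
      show "(\<lambda>m. E m / min 1 e) \<longlonglongrightarrow> 0"
        using tendsto_divide[OF lim tendsto_const[of "min 1 e"]] \<open>0 < e\<close> by (simp split: if_splits add: min_def)
    qed (use le in auto)
  qed auto
qed

lemma tends_in_prob_measurable:
  assumes "tends_in_prob M X Y"
  shows "X m \<in> borel_measurable M" "Y \<in> borel_measurable M"
  using assms unfolding tends_in_prob_def by auto

lemma (in prob_space) tends_in_prob_AE_subseq:
  assumes tip: "tends_in_prob M X Y"
  shows "\<exists>r::nat\<Rightarrow>nat. strict_mono r \<and> (AE \<omega> in M. (\<lambda>m. X (r m) \<omega>) \<longlonglongrightarrow> Y \<omega>)"
proof -
  note [measurable] = tends_in_prob_measurable[OF tip]
  have "(\<lambda>m. \<integral>\<omega>. norm (min 1 \<bar>X m \<omega> - Y \<omega>\<bar>) \<partial>M) \<longlonglongrightarrow> 0"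
    using tip tends_in_prob_iff_L1[of X Y] by simp
  moreover have "integrable M (\<lambda>\<omega>. min 1 \<bar>X m \<omega> - Y \<omega>\<bar>)" for m
    by (rule integrable_const_bound[of _ 1]) auto
  ultimately obtain r :: "nat \<Rightarrow> nat" where r: "strict_mono r"
    and AE: "AE \<omega> in M. (\<lambda>m. min 1 \<bar>X (r m) \<omega> - Y \<omega>\<bar>) \<longlonglongrightarrow> 0"
    using tendsto_L1_AE_subseq[of M "\<lambda>m \<omega>. min 1 \<bar>X m \<omega> - Y \<omega>\<bar>"] by auto
  \<comment> \<open>Eventually all distances are below 1, where the truncation is inactive.\<close>
  have "(\<lambda>m. f m) \<longlonglongrightarrow> y" if "(\<lambda>m. min 1 \<bar>f m - y\<bar>) \<longlonglongrightarrow> 0" for f :: "nat \<Rightarrow> real" and y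
  proof -
    have "eventually (\<lambda>m. min 1 \<bar>f m - y\<bar> < 1) sequentially"
      using order_tendstoD(2)[OF that, of 1] by simp
    then have "eventually (\<lambda>m. min 1 \<bar>f m - y\<bar> = \<bar>f m - y\<bar>) sequentially"
      by eventually_elim auto
    then have "(\<lambda>m. \<bar>f m - y\<bar>) \<longlonglongrightarrow> 0"
      using that by (simp add: tendsto_cong)
    then show ?thesis
      using LIM_zero_iff tendsto_rabs_zero_iff by blast
  qed
  then have "AE \<omega> in M. (\<lambda>m. X (r m) \<omega>) \<longlonglongrightarrow> Y \<omega>"
    using AE by (auto elim!: eventually_mono)
  then show ?thesis using r by blast
qed

text \<open>Indices at which the truncated distance stays above some \<open>e\<close> would form a
  sequence of their own; the almost surely convergent subsequence that \<open>sub\<close> extracts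
  from it contradicts this by dominated convergence with the bound 1.\<close>

lemma (in prob_space) tends_in_prob_subseqI:
  assumes [measurable]: "\<And>m. X m \<in> borel_measurable M" "Y \<in> borel_measurable M"
  assumes sub: "\<And>r::nat\<Rightarrow>nat. strict_mono r \<Longrightarrow>
     \<exists>s::nat\<Rightarrow>nat. strict_mono s \<and> (AE \<omega> in M. (\<lambda>m. X (r (s m)) \<omega>) \<longlonglongrightarrow> Y \<omega>)"
  shows "tends_in_prob M X Y"
proof (rule ccontr)
  define E where "E m = (\<integral>\<omega>. min 1 \<bar>X m \<omega> - Y \<omega>\<bar> \<partial>M)" for m
  assume "\<not> tends_in_prob M X Y"
  then have "\<not> E \<longlonglongrightarrow> 0"
    using tends_in_prob_iff_L1[of X Y] by (simp add: E_def[abs_def])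
  then obtain e where "0 < e" and e: "\<And>no. \<exists>n\<ge>no. \<not> norm (E n - 0) < e"
    unfolding LIMSEQ_iff by blast
  then have inf: "infinite {n. e \<le> \<bar>E n\<bar>}"
    unfolding infinite_nat_iff_unbounded_le by (simp add: not_less)
  define r where "r = enumerate {n. e \<le> \<bar>E n\<bar>}"
  have r: "strict_mono r" "\<And>n. e \<le> \<bar>E (r n)\<bar>"
    using inf strict_mono_enumerate enumerate_in_set[OF inf] by (auto simp: r_def)
  obtain s :: "nat \<Rightarrow> nat" where s: "strict_mono s" "AE \<omega> in M. (\<lambda>m. X (r (s m)) \<omega>) \<longlonglongrightarrow> Y \<omega>"
    using sub[OF r(1)] by blast
  have "(\<lambda>m. E (r (s m))) \<longlonglongrightarrow> (\<integral>\<omega>. 0 \<partial>M)"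
    unfolding E_def
  proof (rule integral_dominated_convergence[where w="\<lambda>_. 1"])
    show "AE \<omega> in M. (\<lambda>m. min 1 \<bar>X (r (s m)) \<omega> - Y \<omega>\<bar>) \<longlonglongrightarrow> 0"
      using s(2)
    proof eventually_elim
      case (elim \<omega>)
      have "(\<lambda>m. min 1 \<bar>X (r (s m)) \<omega> - Y \<omega>\<bar>) \<longlonglongrightarrow> min 1 \<bar>Y \<omega> - Y \<omega>\<bar>"
        by (intro tendsto_intros elim)
      then show ?case by simp
    qed
  qed auto
  then have "(\<lambda>m. E (r (s m))) \<longlonglongrightarrow> 0" by simp
  then obtain m where "\<bar>E (r (s m))\<bar> < e"
    using LIMSEQ_D[OF _ \<open>0 < e\<close>] by fastforce
  then show False using r(2)[of "s m"] by simp
qed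

lemma (in prob_space) tends_in_prob_AE:
  assumes "\<And>m. X m \<in> borel_measurable M" "Y \<in> borel_measurable M"
  assumes lim: "AE \<omega> in M. (\<lambda>m. X m \<omega>) \<longlonglongrightarrow> Y \<omega>"
  shows "tends_in_prob M X Y"
proof (rule tends_in_prob_subseqI)
  fix r :: "nat \<Rightarrow> nat" assume r: "strict_mono r"
  have "AE \<omega> in M. (\<lambda>m. X (r (id m)) \<omega>) \<longlonglongrightarrow> Y \<omega>"
    using lim by eventually_elim (use LIMSEQ_subseq_LIMSEQ[OF _ r] in \<open>auto simp: o_def\<close>)
  then show "\<exists>s. strict_mono s \<and> (AE \<omega> in M. (\<lambda>m. X (r (s m)) \<omega>) \<longlonglongrightarrow> Y \<omega>)"
    using strict_mono_id by blast
qed (use assms in auto)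

lemma tends_in_prob_subseq:
  assumes "tends_in_prob M X Y" "strict_mono (r :: nat \<Rightarrow> nat)"
  shows "tends_in_prob M (\<lambda>m. X (r m)) Y"
  using assms LIMSEQ_subseq_LIMSEQ[OF _ assms(2)]
  unfolding tends_in_prob_def by (auto simp: o_def)

text \<open>By the subsequence criterion, limits of sums of increments can be computed path by path.\<close>

lemma (in prob_space) tends_in_prob_combine:
  assumes 1: "tends_in_prob M X1 Y1" and 2: "tends_in_prob M X2 Y2"
  assumes Z: "\<And>m. Z m \<in> borel_measurable M" "V \<in> borel_measurable M"
  assumes *: "AE \<omega> in M. \<forall>r::nat\<Rightarrow>nat. strict_mono r \<longrightarrow> (\<lambda>m. X1 (r m) \<omega>) \<longlonglongrightarrow> Y1 \<omega> \<longrightarrow>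
     (\<lambda>m. X2 (r m) \<omega>) \<longlonglongrightarrow> Y2 \<omega> \<longrightarrow> (\<lambda>m. Z (r m) \<omega>) \<longlonglongrightarrow> V \<omega>"
  shows "tends_in_prob M Z V"
proof (rule tends_in_prob_subseqI[OF Z])
  fix r :: "nat \<Rightarrow> nat" assume r: "strict_mono r"
  obtain s1 :: "nat \<Rightarrow> nat" where s1: "strict_mono s1" "AE \<omega> in M. (\<lambda>m. X1 (r (s1 m)) \<omega>) \<longlonglongrightarrow> Y1 \<omega>"
    using tends_in_prob_AE_subseq[OF tends_in_prob_subseq[OF 1 r]] by blast
  have rs1: "strict_mono (\<lambda>m. r (s1 m))" using r s1(1) by (simp add: strict_mono_def)
  obtain s2 :: "nat \<Rightarrow> nat" where s2: "strict_mono s2" "AE \<omega> in M. (\<lambda>m. X2 (r (s1 (s2 m))) \<omega>) \<longlonglongrightarrow> Y2 \<omega>"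
    using tends_in_prob_AE_subseq[OF tends_in_prob_subseq[OF 2 rs1]] by blast
  have s: "strict_mono (\<lambda>m. s1 (s2 m))" "strict_mono (\<lambda>m. r (s1 (s2 m)))"
    using r s1(1) s2(1) by (auto simp: strict_mono_def)
  have "AE \<omega> in M. (\<lambda>m. Z (r (s1 (s2 m))) \<omega>) \<longlonglongrightarrow> V \<omega>"
    using s1(2) s2(2) *
  proof eventually_elim
    case (elim \<omega>)
    have "(\<lambda>m. X1 (r (s1 (s2 m))) \<omega>) \<longlonglongrightarrow> Y1 \<omega>"
      using LIMSEQ_subseq_LIMSEQ[OF elim(1) s2(1)] by (simp add: o_def)
    then show ?case using elim(2,3) s(2) by blast
  qed
  then show "\<exists>s. strict_mono s \<and> (AE \<omega> in M. (\<lambda>m. Z (r (s m)) \<omega>) \<longlonglongrightarrow> V \<omega>)"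
    using s(1) by (intro exI[of _ "\<lambda>m. s1 (s2 m)"]) auto
qed

lemma (in prob_space) tends_in_prob_combine1:
  assumes "tends_in_prob M X Y"
  assumes "\<And>m. Z m \<in> borel_measurable M" "V \<in> borel_measurable M"
  assumes "AE \<omega> in M. \<forall>r::nat\<Rightarrow>nat. strict_mono r \<longrightarrow> (\<lambda>m. X (r m) \<omega>) \<longlonglongrightarrow> Y \<omega> \<longrightarrow>
     (\<lambda>m. Z (r m) \<omega>) \<longlonglongrightarrow> V \<omega>"
  shows "tends_in_prob M Z V"
  by (rule tends_in_prob_combine[OF assms(1,1,2,3)]) (use assms(4) in auto)

lemma (in prob_space) tends_in_prob_add:
  assumes "tends_in_prob M X1 Y1" "tends_in_prob M X2 Y2"
  shows "tends_in_prob M (\<lambda>m \<omega>. X1 m \<omega> + X2 m \<omega>) (\<lambda>\<omega>. Y1 \<omega> + Y2 \<omega>)"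
proof -
  note [measurable] = assms[THEN tends_in_prob_measurable(1)] assms[THEN tends_in_prob_measurable(2)]
  show ?thesis by (rule tends_in_prob_combine[OF assms]) (auto intro!: tendsto_add)
qed

lemma (in prob_space) tends_in_prob_cmult:
  assumes "tends_in_prob M X Y"
  shows "tends_in_prob M (\<lambda>m \<omega>. c * X m \<omega>) (\<lambda>\<omega>. c * Y \<omega>)"
proof -
  note [measurable] = tends_in_prob_measurable[OF assms]
  show ?thesis by (rule tends_in_prob_combine1[OF assms]) (auto intro!: tendsto_mult)
qed

lemma (in prob_space) tends_in_prob_diff:
  assumes "tends_in_prob M X1 Y1" "tends_in_prob M X2 Y2"
  shows "tends_in_prob M (\<lambda>m \<omega>. X1 m \<omega> - X2 m \<omega>) (\<lambda>\<omega>. Y1 \<omega> - Y2 \<omega>)"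
  using tends_in_prob_add[OF assms(1) tends_in_prob_cmult[OF assms(2), of "-1"]] by simp

lemma (in prob_space) tends_in_prob_sum:
  assumes "finite J" "\<And>j. j \<in> J \<Longrightarrow> tends_in_prob M (X j) (Y j)"
  shows "tends_in_prob M (\<lambda>m \<omega>. \<Sum>j\<in>J. X j m \<omega>) (\<lambda>\<omega>. \<Sum>j\<in>J. Y j \<omega>)"
  using assms
proof (induction J)
  case empty
  show ?case by (rule tends_in_prob_AE) auto
next
  case (insert j J)
  then show ?case using tends_in_prob_add[of "X j" "Y j"] by simp
qed

lemma (in prob_space) tends_in_prob_cong_AE:
  assumes "tends_in_prob M X Y" "\<And>m. Z m \<in> borel_measurable M" "V \<in> borel_measurable M"
    and "AE \<omega> in M. (\<forall>m. Z m \<omega> = X m \<omega>) \<and> V \<omega> = Y \<omega>"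
  shows "tends_in_prob M Z V"
proof (rule tends_in_prob_combine1[OF assms(1-3)])
  show "AE \<omega> in M. \<forall>r::nat\<Rightarrow>nat. strict_mono r \<longrightarrow> (\<lambda>m. X (r m) \<omega>) \<longlonglongrightarrow> Y \<omega> \<longrightarrow> (\<lambda>m. Z (r m) \<omega>) \<longlonglongrightarrow> V \<omega>"
    using assms(4) by eventually_elim simp
qed

lemma (in prob_space) tends_in_prob_unique:
  assumes "tends_in_prob M X Y" "tends_in_prob M X Z"
  shows "AE \<omega> in M. Y \<omega> = Z \<omega>"
proof -
  obtain r :: "nat \<Rightarrow> nat" where r: "strict_mono r" "AE \<omega> in M. (\<lambda>m. X (r m) \<omega>) \<longlonglongrightarrow> Y \<omega>"
    using tends_in_prob_AE_subseq[OF assms(1)] by blast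
  obtain s :: "nat \<Rightarrow> nat" where s: "strict_mono s" "AE \<omega> in M. (\<lambda>m. X (r (s m)) \<omega>) \<longlonglongrightarrow> Z \<omega>"
    using tends_in_prob_AE_subseq[OF tends_in_prob_subseq[OF assms(2) r(1)]] by blast
  show ?thesis
    using r(2) s(2)
  proof eventually_elim
    case (elim \<omega>)
    show ?case
      using LIMSEQ_unique[OF LIMSEQ_subseq_LIMSEQ[OF elim(1) s(1)]] elim(2) by (simp add: o_def)
  qed
qed

text \<open>Lenglart's argument in abstract form, with \<open>B\<close> in the role of the quadratic
  variation of \<open>Z\<close>. The threshold \<open>\<delta>\<close> is free: it is fixed first so
  that the term \<open>c * \<delta> / e\<close> is small, and then the tail of \<open>B\<close>
  vanishes with \<open>m\<close>.\<close>

lemma (in prob_space) tends_in_prob_zero_dominated: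
  assumes B: "tends_in_prob M B (\<lambda>_. 0)" and Z: "\<And>m. Z m \<in> borel_measurable M"
    and "0 \<le> c" "0 < d"
    and le: "\<And>m e \<delta>. 0 < e \<Longrightarrow> 0 < \<delta> \<Longrightarrow> measure M {\<omega>\<in>space M. e < \<bar>Z m \<omega>\<bar>}
        \<le> c * \<delta> / e + measure M {\<omega>\<in>space M. d * \<delta> < \<bar>B m \<omega>\<bar>}"
  shows "tends_in_prob M Z (\<lambda>_. 0)"
  unfolding tends_in_prob_def
proof (intro conjI allI impI)
  fix e :: real assume "0 < e"
  show "(\<lambda>m. measure M {\<omega> \<in> space M. e < \<bar>Z m \<omega> - 0\<bar>}) \<longlonglongrightarrow> 0"
  proof (rule LIMSEQ_I)
    fix \<rho> :: real assume "0 < \<rho>"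
    \<comment> \<open>This value makes the first summand at most half of \<open>\<rho>\<close>; the
      \<open>+ 1\<close> guards against \<open>c = 0\<close>.\<close>
    define \<delta> where "\<delta> = \<rho> * e / (2 * (c + 1))"
    have "0 < \<delta>" using \<open>0 < \<rho>\<close> \<open>0 < e\<close> \<open>0 \<le> c\<close> by (simp add: \<delta>_def)
    have "c * \<delta> / e = c * \<rho> / (2 * (c + 1))"
      using \<open>0 < e\<close> by (simp add: \<delta>_def)
    also have "\<dots> \<le> \<rho>/2"
      using \<open>0 < \<rho>\<close> \<open>0 \<le> c\<close> by (simp add: field_simps)
    finally have c: "c * \<delta> / e \<le> \<rho>/2" .
    have "(\<lambda>m. measure M {\<omega>\<in>space M. d * \<delta> < \<bar>B m \<omega> - 0\<bar>}) \<longlonglongrightarrow> 0"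
      using B \<open>0 < \<delta>\<close> \<open>0 < d\<close> unfolding tends_in_prob_def by simp
    then obtain n0 where n0: "\<And>m. m \<ge> n0 \<Longrightarrow> measure M {\<omega>\<in>space M. d * \<delta> < \<bar>B m \<omega>\<bar>} < \<rho>/2"
      using LIMSEQ_D[of _ 0 "\<rho>/2"] \<open>0 < \<rho>\<close> by fastforce
    have "norm (measure M {\<omega> \<in> space M. e < \<bar>Z m \<omega> - 0\<bar>} - 0) < \<rho>" if "m \<ge> n0" for m
    proof -
      have "measure M {\<omega> \<in> space M. e < \<bar>Z m \<omega>\<bar>} < \<rho>"
        using le[OF \<open>0 < e\<close> \<open>0 < \<delta>\<close>, of m] n0[OF that] c by linarith
      then show ?thesis by simp
    qed
    then show "\<exists>no. \<forall>n\<ge>no. norm (measure M {\<omega> \<in> space M. e < \<bar>Z n \<omega> - 0\<bar>} - 0) < \<rho>"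
      by blast
  qed
qed (use Z in auto)

section \<open>Second moments and convergence of expectations\<close>

lemma (in prob_space) tends_in_prob_square_bound:
  assumes tip: "tends_in_prob M X Y"
    and int: "\<And>m. integrable M (\<lambda>\<omega>. (X m \<omega>)\<^sup>2)" and le: "\<And>m. (\<integral>\<omega>. (X m \<omega>)\<^sup>2 \<partial>M) \<le> C"
  shows "integrable M (\<lambda>\<omega>. (Y \<omega>)\<^sup>2)" "(\<integral>\<omega>. (Y \<omega>)\<^sup>2 \<partial>M) \<le> C"
proof -
  note [measurable] = tends_in_prob_measurable[OF tip]
  obtain r :: "nat \<Rightarrow> nat" where r: "strict_mono r" "AE \<omega> in M. (\<lambda>m. X (r m) \<omega>) \<longlonglongrightarrow> Y \<omega>"
    using tends_in_prob_AE_subseq[OF tip] by blast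
  have C: "0 \<le> C" using le[of 0] by (rule order_trans[rotated]) auto
  \<comment> \<open>Fatou's lemma along an almost surely convergent subsequence.\<close>
  have "(\<integral>\<^sup>+\<omega>. ennreal ((Y \<omega>)\<^sup>2) \<partial>M) = (\<integral>\<^sup>+\<omega>. liminf (\<lambda>m. ennreal ((X (r m) \<omega>)\<^sup>2)) \<partial>M)"
  proof (rule nn_integral_cong_AE)
    show "AE \<omega> in M. ennreal ((Y \<omega>)\<^sup>2) = liminf (\<lambda>m. ennreal ((X (r m) \<omega>)\<^sup>2))"
      using r(2)
    proof eventually_elim
      case (elim \<omega>)
      have "(\<lambda>m. ennreal ((X (r m) \<omega>)\<^sup>2)) \<longlonglongrightarrow> ennreal ((Y \<omega>)\<^sup>2)"
        by (intro tendsto_intros elim)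
      then show ?case using lim_imp_Liminf[OF sequentially_bot] by metis
    qed
  qed
  also have "\<dots> \<le> liminf (\<lambda>m. \<integral>\<^sup>+\<omega>. ennreal ((X (r m) \<omega>)\<^sup>2) \<partial>M)"
    by (rule nn_integral_liminf) auto
  also have "\<dots> \<le> liminf (\<lambda>m. ennreal C)"
    by (intro Liminf_mono always_eventually allI)
       (use le int in \<open>simp add: nn_integral_eq_integral ennreal_leI\<close>)
  finally have nn: "(\<integral>\<^sup>+\<omega>. ennreal ((Y \<omega>)\<^sup>2) \<partial>M) \<le> ennreal C"
    by (simp add: Liminf_const)
  show int: "integrable M (\<lambda>\<omega>. (Y \<omega>)\<^sup>2)"
    by (rule integrableI_nonneg) (use nn in \<open>auto simp: less_top[symmetric] top_unique\<close>)
  show "(\<integral>\<omega>. (Y \<omega>)\<^sup>2 \<partial>M) \<le> C"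
    using nn C by (simp add: nn_integral_eq_integral[OF int] ennreal_le_iff)
qed

lemma (in prob_space) integrable_of_square:
  fixes X :: "'a \<Rightarrow> real"
  assumes [measurable]: "X \<in> borel_measurable M" and "integrable M (\<lambda>\<omega>. (X \<omega>)\<^sup>2)"
  shows "integrable M X"
proof (rule Bochner_Integration.integrable_bound)
  show "integrable M (\<lambda>\<omega>. 1 + (X \<omega>)\<^sup>2)" using assms by simp
  have "\<bar>y\<bar> \<le> 1 + y\<^sup>2" for y :: real
    using sum_squares_bound[of "\<bar>y\<bar>" 1] by simp
  then show "AE \<omega> in M. norm (X \<omega>) \<le> norm (1 + (X \<omega>)\<^sup>2)" by simp
qed simp

lemma (in prob_space) integrable_mult_of_squares:
  fixes X Y :: "'a \<Rightarrow> real"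
  assumes [measurable]: "X \<in> borel_measurable M" "Y \<in> borel_measurable M"
    and "integrable M (\<lambda>\<omega>. (X \<omega>)\<^sup>2)" "integrable M (\<lambda>\<omega>. (Y \<omega>)\<^sup>2)"
  shows "integrable M (\<lambda>\<omega>. X \<omega> * Y \<omega>)"
proof (rule Bochner_Integration.integrable_bound)
  show "integrable M (\<lambda>\<omega>. (X \<omega>)\<^sup>2 + (Y \<omega>)\<^sup>2)" using assms by simp
  have "\<bar>x * y\<bar> \<le> x\<^sup>2 + y\<^sup>2" for x y :: real
    using sum_squares_bound[of "\<bar>x\<bar>" "\<bar>y\<bar>"] mult_nonneg_nonneg[of "\<bar>x\<bar>" "\<bar>y\<bar>"]
    by (simp add: abs_mult del: mult_nonneg_nonneg abs_ge_zero zero_le_mult_iff) linarith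
  then show "AE \<omega> in M. norm (X \<omega> * Y \<omega>) \<le> norm ((X \<omega>)\<^sup>2 + (Y \<omega>)\<^sup>2)" by simp
qed simp

text \<open>A uniform second moment is a form of uniform integrability: values of the distance above
  \<open>K\<close> contribute at most a multiple of \<open>C / K\<close>, and below \<open>K\<close>
  the truncated distance decides.\<close>

lemma (in prob_space) tends_in_prob_expectation:
  assumes tip: "tends_in_prob M X Y"
    and int: "\<And>m. integrable M (\<lambda>\<omega>. (X m \<omega>)\<^sup>2)" and le: "\<And>m. (\<integral>\<omega>. (X m \<omega>)\<^sup>2 \<partial>M) \<le> C"
  shows "(\<lambda>m. \<integral>\<omega>. X m \<omega> \<partial>M) \<longlonglongrightarrow> (\<integral>\<omega>. Y \<omega> \<partial>M)"
proof -
  note [measurable] = tends_in_prob_measurable[OF tip]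
  note Y2 = tends_in_prob_square_bound[OF tip int le]
  have C: "0 \<le> C" using le[of 0] by (rule order_trans[rotated]) auto
  have intX: "integrable M (X m)" for m by (rule integrable_of_square) (use int in auto)
  have intY: "integrable M Y" by (rule integrable_of_square) (use Y2 in auto)
  define E where "E m = (\<integral>\<omega>. min 1 \<bar>X m \<omega> - Y \<omega>\<bar> \<partial>M)" for m
  have E: "E \<longlonglongrightarrow> 0" using tip tends_in_prob_iff_L1[of X Y] by (simp add: E_def[abs_def])
  have intE: "integrable M (\<lambda>\<omega>. min 1 \<bar>X m \<omega> - Y \<omega>\<bar>)" for m
    by (rule integrable_const_bound[of _ 1]) auto
  have bound: "\<bar>(\<integral>\<omega>. X m \<omega> \<partial>M) - (\<integral>\<omega>. Y \<omega> \<partial>M)\<bar> \<le> K * E m + 4 * C / K" if "1 \<le> K" for K m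
  proof -
    \<comment> \<open>Up to \<open>K\<close> the distance is dominated by \<open>K\<close> times its
      truncation, because \<open>1 \<le> K\<close>; beyond \<open>K\<close> it is at most its own
      square divided by \<open>K\<close>.\<close>
    have pw: "\<bar>x - y\<bar> \<le> K * min 1 \<bar>x - y\<bar> + (2 / K) * (x\<^sup>2 + y\<^sup>2)" for x y :: real
    proof (cases "\<bar>x - y\<bar> \<le> K")
      case True
      have "\<bar>x - y\<bar> \<le> K * min 1 \<bar>x - y\<bar>"
      proof (cases "\<bar>x - y\<bar> \<le> 1")
        case True
        then show ?thesis using mult_right_mono[of 1 K "\<bar>x-y\<bar>"] that by (simp add: min_def)
      qed (use \<open>\<bar>x - y\<bar> \<le> K\<close> in \<open>simp add: min_def\<close>)
      moreover have "0 \<le> (2 / K) * (x\<^sup>2 + y\<^sup>2)" using that by simp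
      ultimately show ?thesis by linarith
    next
      case False
      then have "K * \<bar>x - y\<bar> \<le> \<bar>x - y\<bar> * \<bar>x - y\<bar>" by (intro mult_right_mono) auto
      also have "\<dots> = (x - y)\<^sup>2" by (simp add: power2_eq_square)
      also have "\<dots> \<le> 2 * (x\<^sup>2 + y\<^sup>2)"
        using sum_squares_bound[of x "-y"] by (simp add: power2_diff)
      finally have "\<bar>x - y\<bar> \<le> (2 / K) * (x\<^sup>2 + y\<^sup>2)"
        using that by (simp add: field_simps)
      moreover have "0 \<le> K * min 1 \<bar>x - y\<bar>" using that by simp
      ultimately show ?thesis by linarith
    qed
    have "\<bar>(\<integral>\<omega>. X m \<omega> \<partial>M) - (\<integral>\<omega>. Y \<omega> \<partial>M)\<bar> = \<bar>\<integral>\<omega>. X m \<omega> - Y \<omega> \<partial>M\<bar>"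
      using intX intY by simp
    also have "\<dots> \<le> (\<integral>\<omega>. \<bar>X m \<omega> - Y \<omega>\<bar> \<partial>M)" by (rule integral_abs_bound)
    also have "\<dots> \<le> (\<integral>\<omega>. K * min 1 \<bar>X m \<omega> - Y \<omega>\<bar> + (2 / K) * ((X m \<omega>)\<^sup>2 + (Y \<omega>)\<^sup>2) \<partial>M)"
      using intX intY intE int Y2(1) pw by (intro integral_mono) auto
    also have "\<dots> = K * E m + (2 / K) * ((\<integral>\<omega>. (X m \<omega>)\<^sup>2 \<partial>M) + (\<integral>\<omega>. (Y \<omega>)\<^sup>2 \<partial>M))"
      using intE int Y2(1) by (simp add: E_def)
    also have "\<dots> \<le> K * E m + (2 / K) * (C + C)"
      using le Y2(2) that by (intro add_left_mono mult_left_mono add_mono) auto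
    finally show ?thesis by (simp add: field_simps)
  qed
  show ?thesis
  proof (rule LIMSEQ_I)
    fix e :: real assume "0 < e"
    \<comment> \<open>Large enough for the moment term \<open>4 * C / K\<close> to fall below
      \<open>e / 2\<close>; the index is chosen only afterwards.\<close>
    define K where "K = max 1 (8 * C / e + 1)"
    have "1 \<le> K" "4 * C < K * (e/2)"
      using \<open>0 < e\<close> C by (auto simp: K_def max_def field_simps)
    then have K: "1 \<le> K" "4 * C / K < e / 2" by (auto simp: field_simps)
    obtain n0 where n0: "\<And>m. m \<ge> n0 \<Longrightarrow> \<bar>E m\<bar> < e / (2 * K)"
      using LIMSEQ_D[OF E, of "e / (2 * K)"] \<open>0 < e\<close> K by fastforce
    have "norm ((\<integral>\<omega>. X m \<omega> \<partial>M) - (\<integral>\<omega>. Y \<omega> \<partial>M)) < e" if "m \<ge> n0" for m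
    proof -
      have "K * E m < e / 2" using n0[OF that] K by (simp add: field_simps abs_less_iff)
      then show ?thesis using bound[OF K(1), of m] K(2) by simp
    qed
    then show "\<exists>no. \<forall>n\<ge>no. norm ((\<integral>\<omega>. X n \<omega> \<partial>M) - (\<integral>\<omega>. Y \<omega> \<partial>M)) < e" by blast
  qed
qed

section \<open>Tail bounds for innovations\<close>

locale brownian_basis =
  fixes M :: "'w measure" and F :: "real \<Rightarrow> 'w measure" and T :: real and W :: "real \<Rightarrow> 'w \<Rightarrow> real"
  assumes T_pos: "0 < T" and basis: "filtered_prob_space M F T" and bm: "brownian_motion M F T W"

sublocale brownian_basis \<subseteq> prob_space M
  using basis unfolding filtered_prob_space_def by simp

section \<open>Brownian increments as centred innovations\<close>

context brownian_basis
begin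

lemma space_F: "space (F t) = space M"
  using basis unfolding filtered_prob_space_def filtration_def by auto

lemma sets_F_mono: "s \<le> t \<Longrightarrow> sets (F s) \<subseteq> sets (F t)"
  using basis unfolding filtered_prob_space_def filtration_def by auto

lemma sets_F_subset: "t \<in> {0..T} \<Longrightarrow> sets (F t) \<subseteq> sets M"
  using basis unfolding filtered_prob_space_def subalgebra_def by auto

lemma measurable_F_mono: "f \<in> borel_measurable (F s) \<Longrightarrow> s \<le> t \<Longrightarrow> f \<in> borel_measurable (F t)"
  using sets_F_mono[of s t] space_F unfolding measurable_def by auto

lemma measurable_F: "f \<in> borel_measurable (F s) \<Longrightarrow> s \<in> {0..T} \<Longrightarrow> f \<in> borel_measurable M"
  using sets_F_subset[of s] space_F unfolding measurable_def by auto

lemma W_measurable: "t \<in> {0..T} \<Longrightarrow> W t \<in> borel_measurable (F t)"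
  using bm unfolding brownian_motion_def adapted_def by auto

text \<open>Conditional mean zero and conditional variance \<open>v\<close> given
  \<open>F s\<close>, expressed by testing with integrable \<open>Z\<close> instead of conditional
  expectations. Increments of \<open>W\<close> are of this kind, and so are their centred squares,
  so one tail bound serves stochastic integrals and quadratic variations alike.\<close>

definition innovation :: "real \<Rightarrow> real \<Rightarrow> ('w \<Rightarrow> real) \<Rightarrow> real \<Rightarrow> bool" where
  "innovation s t d v \<longleftrightarrow> d \<in> borel_measurable (F t) \<and>
     (\<forall>Z\<in>borel_measurable (F s). integrable M Z \<longrightarrow>
        integrable M (\<lambda>\<omega>. Z \<omega> * d \<omega>) \<and> (\<integral>\<omega>. Z \<omega> * d \<omega> \<partial>M) = 0 \<and>
        integrable M (\<lambda>\<omega>. Z \<omega> * (d \<omega>)\<^sup>2) \<and> (\<integral>\<omega>. Z \<omega> * (d \<omega>)\<^sup>2 \<partial>M) = v * (\<integral>\<omega>. Z \<omega> \<partial>M))"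

text \<open>Independence from the whole past is cut down to the sigma-algebra generated by
  \<open>Z\<close>, where the product formula for expectations applies.\<close>

lemma indep_var_increment:
  assumes "0 \<le> s" "s < t" "t \<le> T" and Z: "(Z :: 'w \<Rightarrow> real) \<in> borel_measurable (F s)"
  shows "indep_var borel Z borel (\<lambda>\<omega>. W t \<omega> - W s \<omega>)"
proof -
  have meas [measurable]: "W t \<in> borel_measurable M" "W s \<in> borel_measurable M" "Z \<in> borel_measurable M"
    using assms measurable_F[OF W_measurable] measurable_F[OF Z] by auto
  have "indep_set (sets (F s)) {(\<lambda>\<omega>. W t \<omega> - W s \<omega>) -` B \<inter> space M | B. B \<in> sets borel}"
    using bm assms unfolding brownian_motion_def by auto
  moreover have "sigma_sets (space M) {Z -` A \<inter> space M | A. A \<in> sets borel} \<subseteq> sets (F s)"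
  proof -
    have "{Z -` A \<inter> space M | A. A \<in> sets borel} \<subseteq> sets (F s)"
      using measurable_sets[OF Z] by (auto simp: space_F)
    then show ?thesis using sets.sigma_sets_subset[of _ "F s"] by (simp add: space_F)
  qed
  moreover have "sigma_sets (space M) {(\<lambda>\<omega>. W t \<omega> - W s \<omega>) -` B \<inter> space M | B. B \<in> sets borel}
      = {(\<lambda>\<omega>. W t \<omega> - W s \<omega>) -` B \<inter> space M | B. B \<in> sets borel}"
    using sets_vimage_algebra2[of "\<lambda>\<omega>. W t \<omega> - W s \<omega>" "space M" borel]
    by (simp add: sets_vimage_algebra)
  ultimately have "indep_set (sigma_sets (space M) {Z -` A \<inter> space M | A. A \<in> sets borel})
      (sigma_sets (space M) {(\<lambda>\<omega>. W t \<omega> - W s \<omega>) -` B \<inter> space M | B. B \<in> sets borel})"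
    unfolding indep_set_def by (elim indep_sets_mono_sets) (simp split: bool.split)
  then show ?thesis
    unfolding indep_var_eq by simp
qed

lemma innovationI:
  assumes st: "0 \<le> s" "s < t" "t \<le> T" and [measurable]: "g \<in> borel_measurable borel"
    and g: "has_bochner_integral M (\<lambda>\<omega>. g (W t \<omega> - W s \<omega>)) 0"
      "has_bochner_integral M (\<lambda>\<omega>. (g (W t \<omega> - W s \<omega>))\<^sup>2) v"
  shows "innovation s t (\<lambda>\<omega>. g (W t \<omega> - W s \<omega>)) v"
  unfolding innovation_def
proof (intro conjI ballI impI)
  show "(\<lambda>\<omega>. g (W t \<omega> - W s \<omega>)) \<in> borel_measurable (F t)"
    using measurable_F_mono[OF W_measurable[of s], of t] W_measurable[of t] st by auto
next
  fix Z :: "'w \<Rightarrow> real" assume Z: "Z \<in> borel_measurable (F s)" and int: "integrable M Z"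
  note ind = indep_var_increment[OF st Z]
  have ind1: "indep_var borel Z borel (\<lambda>\<omega>. g (W t \<omega> - W s \<omega>))"
    using indep_var_compose[OF ind, of id borel g borel] by (simp add: o_def)
  have ind2: "indep_var borel Z borel (\<lambda>\<omega>. (g (W t \<omega> - W s \<omega>))\<^sup>2)"
    using indep_var_compose[OF ind, of id borel "\<lambda>x. (g x)\<^sup>2" borel] by (simp add: o_def)
  show "integrable M (\<lambda>\<omega>. Z \<omega> * g (W t \<omega> - W s \<omega>))"
    "(\<integral>\<omega>. Z \<omega> * g (W t \<omega> - W s \<omega>) \<partial>M) = 0"
    using indep_var_integrable[OF ind1 int] indep_var_lebesgue_integral[OF ind1 int] g(1)
    by (auto simp: has_bochner_integral_iff)
  show "integrable M (\<lambda>\<omega>. Z \<omega> * (g (W t \<omega> - W s \<omega>))\<^sup>2)"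
    "(\<integral>\<omega>. Z \<omega> * (g (W t \<omega> - W s \<omega>))\<^sup>2 \<partial>M) = v * (\<integral>\<omega>. Z \<omega> \<partial>M)"
    using indep_var_integrable[OF ind2 int] indep_var_lebesgue_integral[OF ind2 int] g(2)
    by (auto simp: has_bochner_integral_iff)
qed

lemma increment_moment:
  assumes "0 \<le> s" "s < t" "t \<le> T"
  shows "integrable M (\<lambda>\<omega>. (W t \<omega> - W s \<omega>) ^ k)"
    "(\<integral>\<omega>. (W t \<omega> - W s \<omega>) ^ k \<partial>M) = (\<integral>y. normal_density 0 (sqrt (t - s)) y * y ^ k \<partial>lborel)"
proof -
  have D: "distributed M lborel (\<lambda>\<omega>. W t \<omega> - W s \<omega>) (normal_density 0 (sqrt (t - s)))"
    using bm assms unfolding brownian_motion_def by auto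
  have "integrable lborel (\<lambda>y. normal_density 0 (sqrt (t - s)) y * y ^ k)"
    using integrable_normal_moment[of "sqrt (t - s)" 0 k] assms by simp
  then show "integrable M (\<lambda>\<omega>. (W t \<omega> - W s \<omega>) ^ k)"
    using distributed_integrable[OF D, of "\<lambda>y. y ^ k"] assms by simp
  show "(\<integral>\<omega>. (W t \<omega> - W s \<omega>) ^ k \<partial>M) = (\<integral>y. normal_density 0 (sqrt (t - s)) y * y ^ k \<partial>lborel)"
    using distributed_integral[OF D, of "\<lambda>y. y ^ k"] assms by simp
qed

lemma increment_expectations:
  assumes "0 \<le> s" "s < t" "t \<le> T"
  shows "(\<integral>\<omega>. W t \<omega> - W s \<omega> \<partial>M) = 0" "(\<integral>\<omega>. (W t \<omega> - W s \<omega>)\<^sup>2 \<partial>M) = t - s"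
    "(\<integral>\<omega>. (W t \<omega> - W s \<omega>) ^ 4 \<partial>M) = 3 * (t - s)\<^sup>2"
  using increment_moment(2)[OF assms, of 1] integral_normal_moment_odd[of "sqrt (t-s)" 0 0]
    increment_moment(2)[OF assms, of 2] integral_normal_moment_even[of "sqrt (t-s)" 0 1]
    increment_moment(2)[OF assms, of 4] integral_normal_moment_even[of "sqrt (t-s)" 0 2] assms
  by (simp_all add: power_divide fact_numeral)

lemma innovation_increment:
  assumes "0 \<le> s" "s < t" "t \<le> T"
  shows "innovation s t (\<lambda>\<omega>. W t \<omega> - W s \<omega>) (t - s)"
  using innovationI[OF assms, of "\<lambda>y. y" "t - s"] increment_moment(1)[OF assms, of 1]
    increment_moment(1)[OF assms, of 2] increment_expectations[OF assms]
  by (simp add: has_bochner_integral_iff)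

text \<open>The Gaussian fourth moment enters here: with \<open>h = t - s\<close> the variance is 3
  h^2 - 2 h^2 + h^2. Being of second order in \<open>h\<close>, it makes the fluctuation of the
  quadratic variation of \<open>W\<close> vanish with the mesh.\<close>

lemma innovation_increment_square:
  assumes "0 \<le> s" "s < t" "t \<le> T"
  shows "innovation s t (\<lambda>\<omega>. (W t \<omega> - W s \<omega>)\<^sup>2 - (t - s)) (2 * (t - s)\<^sup>2)"
proof (rule innovationI[OF assms, where g="\<lambda>y. y\<^sup>2 - (t - s)"])
  note i2 = increment_moment(1)[OF assms, of 2] and i4 = increment_moment(1)[OF assms, of 4]
  note E = increment_expectations[OF assms]
  show "has_bochner_integral M (\<lambda>\<omega>. (W t \<omega> - W s \<omega>)\<^sup>2 - (t - s)) 0"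
    using i2 E by (simp add: has_bochner_integral_iff prob_space)
  have eq: "((y\<^sup>2 - (t - s))\<^sup>2 :: real) = y ^ 4 + (- (2 * (t - s)) * y\<^sup>2 + (t - s)\<^sup>2)" for y
    by (simp add: power2_eq_square power4_eq_xxxx algebra_simps)
  have "has_bochner_integral M (\<lambda>\<omega>. (W t \<omega> - W s \<omega>) ^ 4 + (- (2 * (t - s)) * (W t \<omega> - W s \<omega>)\<^sup>2 + (t - s)\<^sup>2))
      (3 * (t - s)\<^sup>2 + (- (2 * (t - s)) * (t - s) + (t - s)\<^sup>2))"
  proof (intro has_bochner_integral_add has_bochner_integral_mult_right)
    show "has_bochner_integral M (\<lambda>\<omega>. (W t \<omega> - W s \<omega>) ^ 4) (3 * (t - s)\<^sup>2)"
      "has_bochner_integral M (\<lambda>\<omega>. (W t \<omega> - W s \<omega>)\<^sup>2) (t - s)"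
      using i2 i4 E by (auto simp: has_bochner_integral_iff)
    show "has_bochner_integral M (\<lambda>\<omega>. (t - s)\<^sup>2) ((t - s)\<^sup>2)"
      by (simp add: has_bochner_integral_iff prob_space)
  qed
  then show "has_bochner_integral M (\<lambda>\<omega>. ((W t \<omega> - W s \<omega>)\<^sup>2 - (t - s))\<^sup>2) (2 * (t - s)\<^sup>2)"
    unfolding eq by (simp add: power2_eq_square algebra_simps)
qed simp

text \<open>The index type carries no order; only the intervals must not overlap. This admits pairs
  of indices, as they arise from intersecting two partitions. Strict positivity of lengths and
  variances excludes the degenerate cells of a stopped grid.\<close>

definition innovation_family ::
  "'l set \<Rightarrow> ('l \<Rightarrow> real) \<Rightarrow> ('l \<Rightarrow> real) \<Rightarrow> ('l \<Rightarrow> 'w \<Rightarrow> real) \<Rightarrow> ('l \<Rightarrow> real) \<Rightarrow> bool" where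
  "innovation_family L a b d v \<longleftrightarrow> finite L \<and>
     (\<forall>l\<in>L. 0 \<le> a l \<and> a l < b l \<and> b l \<le> T \<and> 0 < v l \<and> innovation (a l) (b l) (d l) (v l)) \<and>
     (\<forall>l\<in>L. \<forall>l'\<in>L. l \<noteq> l' \<longrightarrow> b l \<le> a l' \<or> b l' \<le> a l)"

lemma innovation_family_subset:
  assumes "innovation_family L a b d v" "L' \<subseteq> L"
  shows "innovation_family L' a b d v"
  unfolding innovation_family_def
proof (intro conjI)
  show "finite L'" using assms finite_subset by (auto simp: innovation_family_def)
qed (use assms in \<open>unfold innovation_family_def, (meson subsetD)+\<close>)

text \<open>Martingale differences are orthogonal: of two distinct summands one lives on a later
  interval, and everything else in the product, namely the earlier summand and the later weight, is
  known at its left end and may serve as a test variable.\<close>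

lemma innovation_isometry:
  assumes fam: "innovation_family L a b d v"
    and K: "\<And>l. l \<in> L \<Longrightarrow> K l \<in> borel_measurable (F (a l))"
    and int: "\<And>l. l \<in> L \<Longrightarrow> integrable M (\<lambda>\<omega>. (K l \<omega>)\<^sup>2)"
  shows "integrable M (\<lambda>\<omega>. (\<Sum>l\<in>L. K l \<omega> * d l \<omega>)\<^sup>2)"
    "(\<integral>\<omega>. (\<Sum>l\<in>L. K l \<omega> * d l \<omega>)\<^sup>2 \<partial>M) = (\<Sum>l\<in>L. v l * (\<integral>\<omega>. (K l \<omega>)\<^sup>2 \<partial>M))"
    "(\<integral>\<omega>. (\<Sum>l\<in>L. K l \<omega> * d l \<omega>) \<partial>M) = 0"
proof -
  have fin: "finite L" using fam by (simp add: innovation_family_def)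
  have ab: "0 \<le> a l" "a l < b l" "b l \<le> T" "innovation (a l) (b l) (d l) (v l)" if "l \<in> L" for l
    using fam that by (auto simp: innovation_family_def)
  have KM: "K l \<in> borel_measurable M" if "l \<in> L" for l
    using measurable_F[OF K[OF that]] ab[OF that] by auto
  have d: "d l \<in> borel_measurable (F (b l))" if "l \<in> L" for l
    using ab[OF that] by (auto simp: innovation_def)
  have dM: "d l \<in> borel_measurable M" if "l \<in> L" for l
    using measurable_F[OF d[OF that]] ab[OF that] by auto
  have sq: "integrable M (\<lambda>\<omega>. (K l \<omega> * d l \<omega>)\<^sup>2)"
    "(\<integral>\<omega>. (K l \<omega> * d l \<omega>)\<^sup>2 \<partial>M) = v l * (\<integral>\<omega>. (K l \<omega>)\<^sup>2 \<partial>M)" if "l \<in> L" for l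
    using ab(4)[OF that] borel_measurable_power[OF K[OF that], of 2] int[OF that]
    unfolding innovation_def power_mult_distrib by blast+
  have ortho_aux: "(\<integral>\<omega>. (K l \<omega> * d l \<omega>) * (K l' \<omega> * d l' \<omega>) \<partial>M) = 0"
    if "l \<in> L" "l' \<in> L" "b l \<le> a l'" for l l'
  proof -
    let ?Z = "\<lambda>\<omega>. (K l \<omega> * d l \<omega>) * K l' \<omega>"
    have "?Z \<in> borel_measurable (F (a l'))"
      using measurable_F_mono[OF K[OF that(1)], of "a l'"] measurable_F_mono[OF d[OF that(1)] that(3)]
        K[OF that(2)] ab(2)[OF that(1)] that(3) by auto
    moreover have "integrable M ?Z"
      using integrable_mult_of_squares[OF _ KM[OF that(2)] sq(1)[OF that(1)] int[OF that(2)]]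
        KM[OF that(1)] dM[OF that(1)] by auto
    ultimately have "(\<integral>\<omega>. ?Z \<omega> * d l' \<omega> \<partial>M) = 0"
      using ab(4)[OF that(2)] unfolding innovation_def by blast
    then show ?thesis by (simp add: mult.assoc)
  qed
  have ortho: "(\<integral>\<omega>. (K l \<omega> * d l \<omega>) * (K l' \<omega> * d l' \<omega>) \<partial>M) = 0"
    if "l \<in> L" "l' \<in> L" "l \<noteq> l'" for l l'
  proof -
    have "b l \<le> a l' \<or> b l' \<le> a l" using fam that unfolding innovation_family_def by blast
    then show ?thesis
      using ortho_aux[of l l'] ortho_aux[of l' l] that by (auto simp: mult.commute)
  qed
  have prod: "integrable M (\<lambda>\<omega>. (K l \<omega> * d l \<omega>) * (K l' \<omega> * d l' \<omega>))" if "l \<in> L" "l' \<in> L" for l l'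
    using KM dM sq(1) that by (intro integrable_mult_of_squares) auto
  have eq: "(\<Sum>l\<in>L. K l \<omega> * d l \<omega>)\<^sup>2 = (\<Sum>l\<in>L. \<Sum>l'\<in>L. (K l \<omega> * d l \<omega>) * (K l' \<omega> * d l' \<omega>))" for \<omega>
    unfolding power2_eq_square by (rule sum_product)
  show "integrable M (\<lambda>\<omega>. (\<Sum>l\<in>L. K l \<omega> * d l \<omega>)\<^sup>2)"
    unfolding eq using prod by (intro Bochner_Integration.integrable_sum) auto
  have "(\<integral>\<omega>. (\<Sum>l\<in>L. K l \<omega> * d l \<omega>)\<^sup>2 \<partial>M)
      = (\<Sum>l\<in>L. \<Sum>l'\<in>L. (\<integral>\<omega>. (K l \<omega> * d l \<omega>) * (K l' \<omega> * d l' \<omega>) \<partial>M))"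
    unfolding eq using prod by (simp add: Bochner_Integration.integral_sum)
  also have "\<dots> = (\<Sum>l\<in>L. \<Sum>l'\<in>L. if l' = l then v l * (\<integral>\<omega>. (K l \<omega>)\<^sup>2 \<partial>M) else 0)"
    using ortho sq(2) by (intro sum.cong refl) (auto simp: power2_eq_square)
  finally show "(\<integral>\<omega>. (\<Sum>l\<in>L. K l \<omega> * d l \<omega>)\<^sup>2 \<partial>M) = (\<Sum>l\<in>L. v l * (\<integral>\<omega>. (K l \<omega>)\<^sup>2 \<partial>M))"
    using fin by simp
  have z: "integrable M (\<lambda>\<omega>. K l \<omega> * d l \<omega>)" "(\<integral>\<omega>. K l \<omega> * d l \<omega> \<partial>M) = 0" if "l \<in> L" for l
    using ab(4)[OF that] K[OF that] integrable_of_square[OF KM[OF that] int[OF that]]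
    unfolding innovation_def by blast+
  then show "(\<integral>\<omega>. (\<Sum>l\<in>L. K l \<omega> * d l \<omega>) \<partial>M) = 0"
    by (simp add: Bochner_Integration.integral_sum)
qed

text \<open>Stopping the sum as soon as its quadratic variation exceeds \<open>\<delta>\<close> needs no stopping time:
  the weight on \<open>{a l<..b l}\<close> is switched off by an event that is already known at time \<open>a l\<close>.\<close>

lemma innovation_tail_bound:
  assumes fam: "innovation_family L a b d v"
    and K: "\<And>l. l \<in> L \<Longrightarrow> K l \<in> borel_measurable (F (a l))"
    and "finite C" and part: "\<And>c. c \<in> C \<Longrightarrow> G c \<subseteq> L" "disjoint_family_on G C"
    and "0 < e" "0 < \<delta>"
  shows "measure M {\<omega>\<in>space M. e < (\<Sum>c\<in>C. (\<Sum>l\<in>G c. K l \<omega> * d l \<omega>)\<^sup>2)}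
     \<le> \<delta> / e + measure M {\<omega>\<in>space M. \<delta> < (\<Sum>l\<in>L. v l * (K l \<omega>)\<^sup>2)}"
proof -
  have fin: "finite L" using fam by (simp add: innovation_family_def)
  have finG: "finite (G c)" if "c \<in> C" for c using part(1)[OF that] fin by (rule finite_subset)
  have ab: "0 \<le> a l" "a l < b l" "b l \<le> T" "0 < v l" "innovation (a l) (b l) (d l) (v l)" if "l \<in> L" for l
    using fam that by (auto simp: innovation_family_def)
  have KM: "K l \<in> borel_measurable M" if "l \<in> L" for l
    using measurable_F[OF K[OF that]] ab[OF that] by auto
  have dM: "d l \<in> borel_measurable M" if "l \<in> L" for l
  proof -
    have "d l \<in> borel_measurable (F (b l))" using ab[OF that] by (auto simp: innovation_def)
    then show ?thesis using measurable_F[of _ "b l"] ab[OF that] by auto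
  qed
  \<comment> \<open>Quadratic variation up to and including the interval \<open>l\<close>. The
    variances are deterministic and the weights concerned are known at \<open>a l\<close>, so the
    decision to switch \<open>l\<close> off is made in time.\<close>
  define A where "A l \<omega> = (\<Sum>l'\<in>{l'\<in>L. b l' \<le> b l}. v l' * (K l' \<omega>)\<^sup>2)" for l \<omega>
  define H where "H l \<omega> = (if A l \<omega> \<le> \<delta> then K l \<omega> else 0)" for l \<omega>
  have A_meas: "A l \<in> borel_measurable (F (a l))" if "l \<in> L" for l
    unfolding A_def
  proof (rule borel_measurable_sum)
    fix l' assume l': "l' \<in> {l' \<in> L. b l' \<le> b l}"
    have "a l' \<le> a l"
    proof (cases "l' = l")
      case False
      then have "b l' \<le> a l \<or> b l \<le> a l'" using fam that l' unfolding innovation_family_def by blast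
      then show ?thesis using ab(2)[of l'] l' by auto
    qed simp
    then have [measurable]: "K l' \<in> borel_measurable (F (a l))"
      using measurable_F_mono[OF K] l' by auto
    show "(\<lambda>\<omega>. v l' * (K l' \<omega>)\<^sup>2) \<in> borel_measurable (F (a l))" by simp
  qed
  have H_meas: "H l \<in> borel_measurable (F (a l))" if "l \<in> L" for l
  proof -
    note [measurable] = A_meas[OF that] K[OF that]
    show ?thesis unfolding H_def by measurable
  qed
  have HM: "H l \<in> borel_measurable M" if "l \<in> L" for l
    using measurable_F[OF H_meas[OF that]] ab[OF that] by auto
  \<comment> \<open>The switch bounds each weight, which provides the square integrability that is
    not assumed of \<open>K\<close>.\<close>
  have H_sq: "v l * (H l \<omega>)\<^sup>2 \<le> \<delta>" if "l \<in> L" for l \<omega>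
  proof (cases "A l \<omega> \<le> \<delta>")
    case True
    have "v l * (K l \<omega>)\<^sup>2 \<le> A l \<omega>"
      unfolding A_def using fin that ab(4)
      by (intro member_le_sum[where f = "\<lambda>l. v l * (K l \<omega>)\<^sup>2"]) (auto simp: less_imp_le)
    then show ?thesis using True by (simp add: H_def)
  qed (use \<open>0 < \<delta>\<close> in \<open>simp add: H_def\<close>)
  have H_int: "integrable M (\<lambda>\<omega>. (H l \<omega>)\<^sup>2)" if "l \<in> L" for l
  proof (rule integrable_const_bound[of _ "\<delta> / v l"])
    show "AE \<omega> in M. norm ((H l \<omega>)\<^sup>2) \<le> \<delta> / v l"
      using H_sq[OF that] ab(4)[OF that] by (auto simp: field_simps)
  qed (use HM[OF that] in auto)
  \<comment> \<open>Among the intervals still switched on take the one that ends last: its partial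
    quadratic variation contains the contributions of all the others and is at most
    \<open>\<delta>\<close>.\<close>
  have H_sum: "(\<Sum>l\<in>L. v l * (H l \<omega>)\<^sup>2) \<le> \<delta>" for \<omega>
  proof (cases "\<exists>l\<in>L. A l \<omega> \<le> \<delta>")
    case True
    let ?B = "{l\<in>L. A l \<omega> \<le> \<delta>}"
    have B: "finite (b ` ?B)" "b ` ?B \<noteq> {}" using fin True by auto
    obtain m where m: "m \<in> ?B" "Max (b ` ?B) = b m" using Max_in[OF B] by auto
    have le: "b l \<le> b m" if "l \<in> ?B" for l
      using Max_ge[OF B(1), of "b l"] that m(2) by auto
    have "(\<Sum>l\<in>L. v l * (H l \<omega>)\<^sup>2) = (\<Sum>l\<in>?B. v l * (K l \<omega>)\<^sup>2)"
      using fin by (intro sum.mono_neutral_cong_right) (auto simp: H_def)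
    also have "\<dots> \<le> (\<Sum>l'\<in>{l'\<in>L. b l' \<le> b m}. v l' * (K l' \<omega>)\<^sup>2)"
    proof (rule sum_mono2)
      show "?B \<subseteq> {l'\<in>L. b l' \<le> b m}" using le by blast
    qed (use fin ab(4) in \<open>auto simp: less_imp_le\<close>)
    also have "\<dots> = A m \<omega>" by (simp add: A_def)
    also have "\<dots> \<le> \<delta>" using m by simp
    finally show ?thesis .
  next
    case False
    then have "(\<Sum>l\<in>L. v l * (H l \<omega>)\<^sup>2) = 0" by (intro sum.neutral) (auto simp: H_def)
    then show ?thesis using \<open>0 < \<delta>\<close> by simp
  qed
  \<comment> \<open>Squares of group sums cover two uses at once: a single group of all indices
    gives the square of a stochastic integral, singleton groups give a sum of squared increments.
    Since the groups are disjoint, their isometries add up to at most the full sum.\<close>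
  define Y where "Y \<omega> = (\<Sum>c\<in>C. (\<Sum>l\<in>G c. H l \<omega> * d l \<omega>)\<^sup>2)" for \<omega>
  have famG: "innovation_family (G c) a b d v" if "c \<in> C" for c
    by (rule innovation_family_subset[OF fam part(1)[OF that]])
  have iso: "integrable M (\<lambda>\<omega>. (\<Sum>l\<in>G c. H l \<omega> * d l \<omega>)\<^sup>2)"
    "(\<integral>\<omega>. (\<Sum>l\<in>G c. H l \<omega> * d l \<omega>)\<^sup>2 \<partial>M) = (\<Sum>l\<in>G c. v l * (\<integral>\<omega>. (H l \<omega>)\<^sup>2 \<partial>M))" if "c \<in> C" for c
    using innovation_isometry[OF famG[OF that], of H] H_meas H_int part(1)[OF that] by blast+
  have Y_int: "integrable M Y"
    unfolding Y_def using iso(1) by (intro Bochner_Integration.integrable_sum) auto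
  have "(\<integral>\<omega>. Y \<omega> \<partial>M) = (\<Sum>c\<in>C. \<Sum>l\<in>G c. v l * (\<integral>\<omega>. (H l \<omega>)\<^sup>2 \<partial>M))"
    unfolding Y_def using iso by (simp add: Bochner_Integration.integral_sum)
  also have "\<dots> = (\<Sum>l\<in>(\<Union>c\<in>C. G c). v l * (\<integral>\<omega>. (H l \<omega>)\<^sup>2 \<partial>M))"
    using part(2) finG \<open>finite C\<close>
    by (intro sum.UNION_disjoint[symmetric]) (auto simp: disjoint_family_on_def)
  also have "\<dots> \<le> (\<Sum>l\<in>L. v l * (\<integral>\<omega>. (H l \<omega>)\<^sup>2 \<partial>M))"
    using fin part(1) ab(4) by (intro sum_mono2) (auto simp: less_imp_le)
  also have "\<dots> = (\<integral>\<omega>. (\<Sum>l\<in>L. v l * (H l \<omega>)\<^sup>2) \<partial>M)"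
    using H_int by (simp add: Bochner_Integration.integral_sum)
  also have "\<dots> \<le> (\<integral>\<omega>. \<delta> \<partial>M)"
    using H_int H_sum by (intro integral_mono Bochner_Integration.integrable_sum) auto
  finally have EY: "(\<integral>\<omega>. Y \<omega> \<partial>M) \<le> \<delta>" by (simp add: prob_space)
  have Y_nonneg: "0 \<le> Y \<omega>" for \<omega> unfolding Y_def by (intro sum_nonneg) auto
  have [measurable]: "Y \<in> borel_measurable M" using Y_int by auto
  have QM [measurable]: "(\<lambda>\<omega>. \<Sum>l\<in>L. v l * (K l \<omega>)\<^sup>2) \<in> borel_measurable M"
    using KM by auto
  let ?B = "{\<omega>\<in>space M. \<delta> < (\<Sum>l\<in>L. v l * (K l \<omega>)\<^sup>2)}"
  \<comment> \<open>Where the full quadratic variation is at most \<open>\<delta>\<close>, no weight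
    has been switched off.\<close>
  have eq: "(\<Sum>c\<in>C. (\<Sum>l\<in>G c. K l \<omega> * d l \<omega>)\<^sup>2) = Y \<omega>" if "\<not> \<delta> < (\<Sum>l\<in>L. v l * (K l \<omega>)\<^sup>2)" for \<omega>
  proof -
    have "A l \<omega> \<le> \<delta>" for l
    proof -
      have "A l \<omega> \<le> (\<Sum>l\<in>L. v l * (K l \<omega>)\<^sup>2)"
        unfolding A_def using fin ab(4) by (intro sum_mono2) (auto simp: less_imp_le)
      then show ?thesis using that by simp
    qed
    then show ?thesis by (simp add: Y_def H_def)
  qed
  have "measure M {\<omega>\<in>space M. e < (\<Sum>c\<in>C. (\<Sum>l\<in>G c. K l \<omega> * d l \<omega>)\<^sup>2)}
      \<le> measure M ({\<omega>\<in>space M. e \<le> Y \<omega>} \<union> ?B)"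
    using eq by (intro finite_measure_mono) (auto simp: not_less[symmetric] less_imp_le)
  also have "\<dots> \<le> measure M {\<omega>\<in>space M. e \<le> Y \<omega>} + measure M ?B"
    by (rule measure_Un_le) auto
  also have "measure M {\<omega>\<in>space M. e \<le> Y \<omega>} \<le> (\<integral>\<omega>. Y \<omega> \<partial>M) / e"
    using \<open>0 < e\<close> Y_nonneg by (intro integral_Markov_inequality_measure[where A="{}"] Y_int) auto
  also have "\<dots> \<le> \<delta> / e" using EY \<open>0 < e\<close> by (simp add: divide_right_mono)
  finally show ?thesis by simp
qed

end

section \<open>Partitions and continuous adapted processes\<close>

text \<open>The uniform partition of \<open>[0,T]\<close> into \<open>m + 1\<close> cells, stopped at \<open>t\<close>: the cells beyond \<open>t\<close>
  degenerate to the point \<open>t\<close>, so that one partition serves all \<open>t\<close>.\<close>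

definition grid :: "real \<Rightarrow> real \<Rightarrow> nat \<Rightarrow> nat \<Rightarrow> real" where
  "grid T t m i = min t (real i * T / real (Suc m))"

lemma grid_first: "0 \<le> t \<Longrightarrow> grid T t m 0 = 0"
  by (simp add: grid_def)

lemma grid_last: "t \<le> T \<Longrightarrow> grid T t m (Suc m) = t"
  by (simp add: grid_def)

lemma grid_mono: "0 \<le> T \<Longrightarrow> i \<le> j \<Longrightarrow> grid T t m i \<le> grid T t m j"
  unfolding grid_def by (intro min.mono divide_right_mono mult_right_mono) auto

lemma grid_le: "grid T t m i \<le> t"
  by (simp add: grid_def)

lemma grid_nonneg: "0 \<le> t \<Longrightarrow> 0 \<le> T \<Longrightarrow> 0 \<le> grid T t m i"
  by (simp add: grid_def)

lemma grid_step: "0 \<le> T \<Longrightarrow> grid T t m (Suc i) - grid T t m i \<le> T / real (Suc m)"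
proof -
  assume "0 \<le> T"
  have "real (Suc i) * T / real (Suc m) = real i * T / real (Suc m) + T / real (Suc m)"
    by (simp only: of_nat_Suc[of i] distrib_right add_divide_distrib mult_1_left)
  moreover have "0 \<le> T / real (Suc m)" using \<open>0 \<le> T\<close> by simp
  ultimately show ?thesis by (auto simp: grid_def min_def)
qed

lemma integral_partition:
  fixes f :: "real \<Rightarrow> real" and p :: "nat \<Rightarrow> real"
  assumes "\<And>i. i < n \<Longrightarrow> p i \<le> p (Suc i)" "f integrable_on {p 0..p n}"
  shows "integral {p 0..p n} f = (\<Sum>i<n. integral {p i..p (Suc i)} f)"
  using assms
proof (induction n)
  case (Suc n)
  have "p 0 \<le> p n" using Suc.prems(1) by (induction n) (auto intro: order_trans less_SucI)
  moreover have "p n \<le> p (Suc n)" using Suc.prems(1) by simp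
  moreover have "f integrable_on {p 0..p n}"
    using calculation by (intro integrable_on_subinterval[OF Suc.prems(2)]) auto
  ultimately show ?case
    using Suc Henstock_Kurzweil_Integration.integral_combine[of "p 0" "p n" "p (Suc n)" f] by simp
qed simp

lemma integral_grid:
  fixes f :: "real \<Rightarrow> real"
  assumes "0 \<le> t" "t \<le> T" "continuous_on {0..t} f"
  shows "integral {0..t} f = (\<Sum>i<Suc m. integral {grid T t m i..grid T t m (Suc i)} f)"
  using integral_partition[of "Suc m" "grid T t m" f] assms grid_mono[of T]
  by (simp add: grid_first grid_last integrable_continuous_real del: sum.lessThan_Suc)

text \<open>Letting the integrand depend on the left node and on the running time covers, with one
  limit, plain Riemann sums, drifts with frozen weights, and integrated squared oscillations.
  Freezing the first argument is harmless because \<open>\<psi>\<close> is uniformly continuous on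
  the compact square.\<close>

lemma grid_integral_limit:
  fixes \<psi> :: "real \<times> real \<Rightarrow> real"
  assumes t: "0 \<le> t" "t \<le> T" and \<psi>: "continuous_on ({0..t} \<times> {0..t}) \<psi>"
  shows "(\<lambda>m. \<Sum>i<Suc m. integral {grid T t m i..grid T t m (Suc i)} (\<lambda>s. \<psi> (grid T t m i, s)))
    \<longlonglongrightarrow> integral {0..t} (\<lambda>s. \<psi> (s, s))"
proof (rule LIMSEQ_I)
  fix e :: real assume "0 < e"
  \<comment> \<open>The \<open>+ 1\<close> avoids a division by zero for \<open>t = 0\<close>, and
    the factor 2 keeps the final estimate strict.\<close>
  define e' where "e' = e / (2 * (t + 1))"
  have e': "0 < e'" "e' * t < e" using \<open>0 < e\<close> t mult_nonneg_nonneg[of e t]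
    by (auto simp: e'_def field_simps intro: add_nonneg_pos)
  have "uniformly_continuous_on ({0..t} \<times> {0..t}) \<psi>"
    by (rule compact_uniformly_continuous[OF \<psi>]) (simp add: compact_Times)
  then obtain d where d: "0 < d" "\<And>x y. x \<in> {0..t} \<times> {0..t} \<Longrightarrow> y \<in> {0..t} \<times> {0..t} \<Longrightarrow> dist y x < d
      \<Longrightarrow> dist (\<psi> y) (\<psi> x) < e'"
    unfolding uniformly_continuous_on_def using e'(1) by metis
  obtain n0 :: nat where n0: "T / d < real n0" using reals_Archimedean2 by blast
  have diag: "continuous_on {0..t} (\<lambda>s. \<psi> (s, s))"
    by (rule continuous_on_compose2[OF \<psi>]) (auto intro!: continuous_intros)
  have "norm ((\<Sum>i<Suc m. integral {grid T t m i..grid T t m (Suc i)} (\<lambda>s. \<psi> (grid T t m i, s)))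
      - integral {0..t} (\<lambda>s. \<psi> (s, s))) < e" if "m \<ge> n0" for m
  proof -
    let ?p = "grid T t m"
    have step: "?p (Suc i) - ?p i < d" for i
    proof -
      have "T / d < real (Suc m)" using n0 that by simp
      then have "T / real (Suc m) < d" using d(1) by (simp add: field_simps)
      then show ?thesis using grid_step[of T t m i] t by simp
    qed
    have p: "0 \<le> ?p i" "?p i \<le> t" "?p i \<le> ?p (Suc i)" for i
      using grid_nonneg[of t T] grid_le grid_mono[of T i "Suc i"] t by auto
    have cell: "\<bar>integral {?p i..?p (Suc i)} (\<lambda>s. \<psi> (?p i, s)) - integral {?p i..?p (Suc i)} (\<lambda>s. \<psi> (s, s))\<bar>
        \<le> e' * (?p (Suc i) - ?p i)" for i
    proof -
      have c1: "continuous_on {?p i..?p (Suc i)} (\<lambda>s. \<psi> (?p i, s))"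
        using p[of i] p[of "Suc i"]
        by (intro continuous_on_compose2[OF \<psi>]) (auto intro!: continuous_intros)
      have c2: "continuous_on {?p i..?p (Suc i)} (\<lambda>s. \<psi> (s, s))"
        using p[of i] p[of "Suc i"] by (intro continuous_on_subset[OF diag]) auto
      have "integral {?p i..?p (Suc i)} (\<lambda>s. \<psi> (?p i, s)) - integral {?p i..?p (Suc i)} (\<lambda>s. \<psi> (s, s))
          = integral {?p i..?p (Suc i)} (\<lambda>s. \<psi> (?p i, s) - \<psi> (s, s))"
        using c1 c2 by (intro integral_diff[symmetric] integrable_continuous_real)
      also have "\<bar>\<dots>\<bar> \<le> e' * (?p (Suc i) - ?p i)"
        unfolding real_norm_def[symmetric]
      proof (rule integral_bound)
        fix s assume s: "s \<in> {?p i..?p (Suc i)}"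
        have "dist (?p i, s) (s, s) = \<bar>?p i - s\<bar>" by (simp add: dist_Pair_Pair dist_real_def)
        also have "\<dots> < d" using s step[of i] by auto
        finally have "dist (?p i, s) (s, s) < d" .
        then show "norm (\<psi> (?p i, s) - \<psi> (s, s)) \<le> e'"
          using d(2)[of "(s,s)" "(?p i, s)"] s p[of i] p[of "Suc i"] by (auto simp: dist_real_def)
      qed (use p c1 c2 in \<open>auto intro!: continuous_intros\<close>)
      finally show ?thesis .
    qed
    define \<Delta> where "\<Delta> i = integral {?p i..?p (Suc i)} (\<lambda>s. \<psi> (?p i, s)) - integral {?p i..?p (Suc i)} (\<lambda>s. \<psi> (s, s))" for i
    have eq: "(\<Sum>i<Suc m. integral {?p i..?p (Suc i)} (\<lambda>s. \<psi> (?p i, s))) - integral {0..t} (\<lambda>s. \<psi> (s, s))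
      = (\<Sum>i<Suc m. \<Delta> i)"
      by (simp only: integral_grid[OF t diag, of m] sum_subtractf \<Delta>_def)
    have "norm (\<Sum>i<Suc m. \<Delta> i) \<le> (\<Sum>i<Suc m. e' * (?p (Suc i) - ?p i))"
      by (rule order_trans[OF norm_sum sum_mono]) (use cell in \<open>simp add: \<Delta>_def\<close>)
    also have "\<dots> = e' * t"
      using t by (simp only: sum_distrib_left[symmetric] sum_lessThan_telescope grid_first grid_last) simp
    finally have "norm (\<Sum>i<Suc m. \<Delta> i) < e" using e'(2) by simp
    then show ?thesis unfolding eq .
  qed
  then show "\<exists>no. \<forall>m\<ge>no. norm ((\<Sum>i<Suc m. integral {grid T t m i..grid T t m (Suc i)} (\<lambda>s. \<psi> (grid T t m i, s)))
      - integral {0..t} (\<lambda>s. \<psi> (s, s))) < e" by blast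
qed

lemma continuous_on_fst_interval: "continuous_on {a..b} f \<Longrightarrow> continuous_on ({a..b} \<times> B) (\<lambda>z. f (fst z))"
  by (rule continuous_on_compose2[of _ f]) (auto intro!: continuous_intros)

lemma continuous_on_snd_interval: "continuous_on {a..b} f \<Longrightarrow> continuous_on (B \<times> {a..b}) (\<lambda>z. f (snd z))"
  by (rule continuous_on_compose2[of _ f]) (auto intro!: continuous_intros)

lemma grid_riemann_sum_limit:
  fixes f :: "real \<Rightarrow> real"
  assumes t: "0 \<le> t" "t \<le> T" and f: "continuous_on {0..t} f"
  shows "(\<lambda>m. \<Sum>i<Suc m. f (grid T t m i) * (grid T t m (Suc i) - grid T t m i)) \<longlonglongrightarrow> integral {0..t} f"
proof -
  have "integral {grid T t m i..grid T t m (Suc i)} (\<lambda>s. f (grid T t m i))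
      = f (grid T t m i) * (grid T t m (Suc i) - grid T t m i)" for m i
    using grid_mono[of T i "Suc i" t m] t by simp
  then show ?thesis
    using grid_integral_limit[OF t continuous_on_fst_interval[OF f]]
    by (simp only: fst_conv)
qed

text \<open>Pathwise the integral is a limit of Riemann sums, each of them measurable. With
  \<open>N\<close> left free, the choice \<open>F t\<close> later yields adaptedness.\<close>

lemma borel_measurable_integral_interval:
  fixes a b :: real
  assumes "a \<le> b" and meas: "\<And>s. s \<in> {a..b} \<Longrightarrow> X s \<in> borel_measurable N"
    and cont: "\<And>\<omega>. \<omega> \<in> space N \<Longrightarrow> continuous_on {a..b} (\<lambda>s. X s \<omega> :: real)"
  shows "(\<lambda>\<omega>. integral {a..b} (\<lambda>s. X s \<omega>)) \<in> borel_measurable N"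
proof (rule borel_measurable_LIMSEQ_real)
  \<comment> \<open>The grid starts at 0, hence the translation of the interval by
    \<open>a\<close>.\<close>
  let ?p = "\<lambda>m i. grid (b - a) (b - a) m i"
  have p: "0 \<le> ?p m i" "?p m i \<le> b - a" for m i
    using grid_nonneg[of "b-a" "b-a"] grid_le[of "b-a" "b-a"] \<open>a \<le> b\<close> by auto
  fix \<omega> assume "\<omega> \<in> space N"
  have c: "continuous_on {0..b-a} (\<lambda>s. X (a + s) \<omega>)"
    by (rule continuous_on_compose2[OF cont[OF \<open>\<omega> \<in> space N\<close>]]) (auto intro!: continuous_intros)
  have "integral {0..b-a} (\<lambda>s. X (a + s) \<omega>) = integral {a..b} (\<lambda>s. X s \<omega>)"
    using has_integral_affinity'[of "\<lambda>s. X s \<omega>" "integral {a..b} (\<lambda>s. X s \<omega>)" a b 1 a]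
      integrable_continuous_real[OF cont[OF \<open>\<omega> \<in> space N\<close>]]
    by (intro integral_unique) (simp add: has_integral_integral add.commute)
  then show "(\<lambda>m. \<Sum>i<Suc m. X (a + ?p m i) \<omega> * (?p m (Suc i) - ?p m i)) \<longlonglongrightarrow> integral {a..b} (\<lambda>s. X s \<omega>)"
    using grid_riemann_sum_limit[OF _ _ c, of "b-a"] \<open>a \<le> b\<close> by simp
next
  fix m
  have "X (a + grid (b - a) (b - a) m i) \<in> borel_measurable N" for i
    using grid_nonneg[of "b-a" "b-a" m i] grid_le[of "b-a" "b-a" m i] \<open>a \<le> b\<close> by (intro meas) auto
  then show "(\<lambda>\<omega>. \<Sum>i<Suc m. X (a + grid (b - a) (b - a) m i) \<omega>
      * (grid (b - a) (b - a) m (Suc i) - grid (b - a) (b - a) m i)) \<in> borel_measurable N"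
    by (intro borel_measurable_sum borel_measurable_times) auto
qed

section \<open>Continuous adapted processes\<close>

context brownian_basis
begin

text \<open>Continuity is demanded on every path, not only on almost every one, so that pathwise
  limits of sums hold on the whole space and the class is closed under algebra and integration
  without exceptional sets.\<close>

definition cont_adapted :: "(real \<Rightarrow> 'w \<Rightarrow> real) \<Rightarrow> bool" where
  "cont_adapted X \<longleftrightarrow> adapted F T X \<and> (\<forall>\<omega>\<in>space M. continuous_on {0..T} (\<lambda>t. X t \<omega>))"

lemma cont_adapted_meas: "cont_adapted X \<Longrightarrow> t \<in> {0..T} \<Longrightarrow> X t \<in> borel_measurable (F t)"
  unfolding cont_adapted_def adapted_def by auto

lemma cont_adapted_measM: "cont_adapted X \<Longrightarrow> t \<in> {0..T} \<Longrightarrow> X t \<in> borel_measurable M"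
  using measurable_F[OF cont_adapted_meas] by auto

lemma cont_adapted_cont: "cont_adapted X \<Longrightarrow> \<omega> \<in> space M \<Longrightarrow> t \<le> T \<Longrightarrow> continuous_on {0..t} (\<lambda>t. X t \<omega>)"
  unfolding cont_adapted_def by (rule continuous_on_subset[of "{0..T}"]) auto

lemma cont_adapted_comp2:
  assumes "cont_adapted X" "cont_adapted Y" and f: "continuous_on UNIV (\<lambda>(x, y). f x y :: real)"
  shows "cont_adapted (\<lambda>t \<omega>. f (X t \<omega>) (Y t \<omega>))"
  unfolding cont_adapted_def adapted_def
proof (intro conjI ballI)
  fix t assume t: "t \<in> {0..T}"
  have "(\<lambda>(x, y). f x y) \<in> borel_measurable (borel \<Otimes>\<^sub>M borel)"
    using borel_measurable_continuous_onI[OF f] by (simp add: borel_prod)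
  moreover have "(\<lambda>\<omega>. (X t \<omega>, Y t \<omega>)) \<in> F t \<rightarrow>\<^sub>M borel \<Otimes>\<^sub>M borel"
    using assms(1,2)[THEN cont_adapted_meas[OF _ t]] by simp
  ultimately show "(\<lambda>\<omega>. f (X t \<omega>) (Y t \<omega>)) \<in> borel_measurable (F t)"
    using measurable_compose by fastforce
next
  fix \<omega> assume "\<omega> \<in> space M"
  then show "continuous_on {0..T} (\<lambda>t. f (X t \<omega>) (Y t \<omega>))"
    using continuous_on_compose2[OF f continuous_on_Pair, of "{0..T}" "\<lambda>t. X t \<omega>" "\<lambda>t. Y t \<omega>"] assms(1,2)
    unfolding cont_adapted_def by simp
qed

lemma cont_adapted_deterministic: "continuous_on {0..T} f \<Longrightarrow> cont_adapted (\<lambda>t _. f t)"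
  unfolding cont_adapted_def adapted_def by auto

lemma cont_adapted_const: "cont_adapted (\<lambda>_ _. c)"
  by (rule cont_adapted_deterministic) auto

lemma cont_adapted_add: "cont_adapted X \<Longrightarrow> cont_adapted Y \<Longrightarrow> cont_adapted (\<lambda>t \<omega>. X t \<omega> + Y t \<omega>)"
  by (rule cont_adapted_comp2) (auto intro!: continuous_intros simp: case_prod_beta)

lemma cont_adapted_diff: "cont_adapted X \<Longrightarrow> cont_adapted Y \<Longrightarrow> cont_adapted (\<lambda>t \<omega>. X t \<omega> - Y t \<omega>)"
  by (rule cont_adapted_comp2) (auto intro!: continuous_intros simp: case_prod_beta)

lemma cont_adapted_mult: "cont_adapted X \<Longrightarrow> cont_adapted Y \<Longrightarrow> cont_adapted (\<lambda>t \<omega>. X t \<omega> * Y t \<omega>)"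
  by (rule cont_adapted_comp2) (auto intro!: continuous_intros simp: case_prod_beta)

lemma cont_adapted_cmult: "cont_adapted X \<Longrightarrow> cont_adapted (\<lambda>t \<omega>. c * X t \<omega>)"
  by (rule cont_adapted_mult[OF cont_adapted_const])

lemma cont_adapted_uminus: "cont_adapted X \<Longrightarrow> cont_adapted (\<lambda>t \<omega>. - X t \<omega>)"
  using cont_adapted_cmult[of X "-1"] by simp

lemma cont_adapted_power: "cont_adapted X \<Longrightarrow> cont_adapted (\<lambda>t \<omega>. X t \<omega> ^ n)"
  by (induction n) (auto intro: cont_adapted_const cont_adapted_mult)

lemma cont_adapted_sum:
  "(\<And>j. j \<in> J \<Longrightarrow> cont_adapted (X j)) \<Longrightarrow> cont_adapted (\<lambda>t \<omega>. \<Sum>j\<in>J. X j t \<omega>)"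
  by (induction J rule: infinite_finite_induct) (auto intro: cont_adapted_const cont_adapted_add)

lemma cont_adapted_inverse:
  "cont_adapted X \<Longrightarrow> (\<And>t \<omega>. X t \<omega> \<noteq> 0) \<Longrightarrow> cont_adapted (\<lambda>t \<omega>. inverse (X t \<omega>))"
  unfolding cont_adapted_def adapted_def by (auto intro!: continuous_intros)

lemma cont_adapted_integral:
  assumes X: "cont_adapted X"
  shows "cont_adapted (\<lambda>t \<omega>. integral {0..t} (\<lambda>s. X s \<omega>))"
  unfolding cont_adapted_def adapted_def
proof (intro conjI ballI)
  fix t assume t: "t \<in> {0..T}"
  show "(\<lambda>\<omega>. integral {0..t} (\<lambda>s. X s \<omega>)) \<in> borel_measurable (F t)"
  proof (rule borel_measurable_integral_interval)
    show "X s \<in> borel_measurable (F t)" if "s \<in> {0..t}" for s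
      using that t measurable_F_mono[OF cont_adapted_meas[OF X]] by auto
    show "continuous_on {0..t} (\<lambda>s. X s \<omega>)" if "\<omega> \<in> space (F t)" for \<omega>
      using that t cont_adapted_cont[OF X] by (auto simp: space_F)
  qed (use t in auto)
next
  fix \<omega> assume "\<omega> \<in> space M"
  then show "continuous_on {0..T} (\<lambda>t. integral {0..t} (\<lambda>s. X s \<omega>))"
    using cont_adapted_cont[OF X] by (intro indefinite_integral_continuous_1 integrable_continuous_real) auto
qed

lemmas cont_adapted_intros = cont_adapted_const cont_adapted_add cont_adapted_diff cont_adapted_mult
  cont_adapted_cmult cont_adapted_uminus cont_adapted_power cont_adapted_sum cont_adapted_integral

end

text \<open>The increment over the intersection of two intervals is a mixed second difference, so it
  telescopes along either partition. The inner \<open>max\<close> collapses an empty intersection to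
  a point, where the increment is 0.\<close>

lemma increment_rectangle:
  fixes f :: "real \<Rightarrow> real"
  assumes "\<tau> \<le> \<tau>'" "p \<le> p'"
  shows "f (max (max \<tau> p) (min \<tau>' p')) - f (max \<tau> p)
    = f (min p' \<tau>') - f (min p' \<tau>) - (f (min p \<tau>') - f (min p \<tau>))"
  using assms by (cases "\<tau> \<le> p"; cases "\<tau>' \<le> p'"; cases "\<tau>' \<le> p"; cases "\<tau> \<le> p'")
    (auto simp: min_def max_def intro!: arg_cong[where f=f])

lemma mono_nodes:
  fixes p :: "nat \<Rightarrow> real"
  assumes "\<forall>i<n. p i \<le> p (Suc i)" "i \<le> j" "j \<le> n"
  shows "p i \<le> p j"
  using assms(2,3)
proof (induction j)
  case (Suc j)
  then show ?case using assms(1)[rule_format, of j] by (cases "i = Suc j") (auto intro: order_trans)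
qed simp

lemma set_lebesgue_integral_Ioc:
  fixes f :: "real \<Rightarrow> real"
  assumes "continuous_on {a..b} f"
  shows "integrable lborel (\<lambda>s. indicator {a<..b} s * f s)"
    "(\<integral>s. indicator {a<..b} s * f s \<partial>lborel) = integral {a..b} f"
proof -
  have ic: "set_integrable lborel {a..b} f" by (rule borel_integrable_atLeastAtMost'[OF assms])
  have ioc: "set_integrable lborel {a<..b} f" by (rule set_integrable_subset[OF ic]) auto
  then show "integrable lborel (\<lambda>s. indicator {a<..b} s * f s)" by (simp add: set_integrable_def)
  have "(\<integral>s. indicator {a<..b} s * f s \<partial>lborel) = (\<integral>s. indicator {a..b} s * f s \<partial>lborel)"
  proof (rule integral_cong_AE)
    show "AE s in lborel. indicator {a<..b} s * f s = indicator {a..b} s * f s"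
      using AE_lborel_singleton[of a] by eventually_elim (auto simp: indicator_def)
  qed (use ic ioc in \<open>auto simp: set_integrable_def\<close>)
  also have "\<dots> = integral {a..b} f"
    using set_borel_integral_eq_integral(2)[OF ic] by (simp add: set_lebesgue_integral_def)
  finally show "(\<integral>s. indicator {a<..b} s * f s \<partial>lborel) = integral {a..b} f" .
qed

lemma simple_process_eq:
  assumes "\<forall>i<n. \<tau> i \<le> \<tau> (Suc i)" "k < n" "\<tau> k < s" "s \<le> \<tau> (Suc k)"
  shows "simple_process n \<tau> \<xi> s \<omega> = \<xi> k \<omega>"
proof -
  have "s \<notin> {\<tau> i<..\<tau> (Suc i)}" if "i < n" "i \<noteq> k" for i
  proof (cases "i < k")
    case True
    then have "\<tau> (Suc i) \<le> \<tau> k" using assms(2) by (intro mono_nodes[OF assms(1)]) auto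
    then show ?thesis using assms(3) by auto
  next
    case False
    then have "\<tau> (Suc k) \<le> \<tau> i" using that by (intro mono_nodes[OF assms(1)]) auto
    then show ?thesis using assms(4) by auto
  qed
  then have "(\<Sum>i<n. \<xi> i \<omega> * indicator {\<tau> i<..\<tau> (Suc i)} s) = (\<Sum>i<n. if i = k then \<xi> k \<omega> else 0)"
    using assms(3,4) by (intro sum.cong) (auto simp: indicator_def)
  then show ?thesis using assms(2) by (simp add: simple_process_def)
qed

section \<open>Comparison of simple integrands with a coarse partition\<close>

context brownian_basis
begin

text \<open>A step with value 0 is added on either side, so that the nodes span \<open>[0,T]\<close>
  while process and integral stay the same. Only then do increments of \<open>W\<close> over all
  nodes telescope to an increment of the coarse partition.\<close>

lemma simple_integrand_extend:
  assumes "simple_integrand M F T n \<tau> \<xi>"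
  shows "\<exists>n' \<tau>' \<xi>'. simple_integrand M F T n' \<tau>' \<xi>' \<and> \<tau>' 0 = 0 \<and> \<tau>' n' = T \<and>
     simple_process n' \<tau>' \<xi>' = simple_process n \<tau> \<xi> \<and> simple_ito W n' \<tau>' \<xi>' = simple_ito W n \<tau> \<xi>"
proof -
  \<comment> \<open>The old nodes are shifted by one: index 0 is the new left end,
    \<open>Suc n\<close> is the old last node, and every later index gives \<open>T\<close>.\<close>
  define \<tau>' where "\<tau>' i = (if i = 0 then 0 else if i \<le> Suc n then \<tau> (i - 1) else T)" for i
  define \<xi>' where "\<xi>' i \<omega> = (if 0 < i \<and> i \<le> n then \<xi> (i - 1) \<omega> else 0)" for i and \<omega> :: 'w
  have \<tau>: "0 \<le> \<tau> 0" "\<tau> n \<le> T" "\<And>i. i < n \<Longrightarrow> \<tau> i \<le> \<tau> (Suc i)"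
    using assms by (auto simp: simple_integrand_def)

  have "\<tau>' i \<le> \<tau>' (Suc i) \<and> \<xi>' i \<in> borel_measurable (F (\<tau>' i)) \<and> (\<exists>B. \<forall>\<omega>\<in>space M. \<bar>\<xi>' i \<omega>\<bar> \<le> B)"
    if "i < n + 2" for i
  proof (cases "0 < i \<and> i \<le> n")
    case True
    then obtain l where l: "i = Suc l" "l < n" by (cases i) auto
    then have "\<xi>' i = \<xi> l" "\<tau>' i = \<tau> l" "\<tau>' (Suc i) = \<tau> (Suc l)" by (auto simp: \<xi>'_def \<tau>'_def fun_eq_iff)
    then show ?thesis using assms l by (auto simp: simple_integrand_def)
  next
    case False
    then have "\<xi>' i = (\<lambda>_. 0)" by (auto simp: \<xi>'_def fun_eq_iff)
    moreover have "\<tau>' i \<le> \<tau>' (Suc i)"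
    proof (cases "i = 0")
      case False
      then have "i = Suc n" using \<open>\<not> (0 < i \<and> i \<le> n)\<close> that by auto
      then show ?thesis using \<tau>(2) by (simp add: \<tau>'_def)
    qed (use \<tau>(1) in \<open>simp add: \<tau>'_def\<close>)
    ultimately show ?thesis by auto
  qed
  then have "simple_integrand M F T (n + 2) \<tau>' \<xi>'"
    by (auto simp: simple_integrand_def \<tau>'_def)
  \<comment> \<open>A generic \<open>h\<close> serves both the process, with an indicator, and its
    integral, with an increment of \<open>W\<close>.\<close>
  moreover have sum: "(\<Sum>i<n + 2. \<xi>' i \<omega> * h (\<tau>' i) (\<tau>' (Suc i))) = (\<Sum>i<n. \<xi> i \<omega> * h (\<tau> i) (\<tau> (Suc i)))"
    for h :: "real \<Rightarrow> real \<Rightarrow> real" and \<omega>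
  proof -
    have "(\<Sum>i<n + 2. \<xi>' i \<omega> * h (\<tau>' i) (\<tau>' (Suc i)))
        = (\<Sum>i<Suc n. \<xi>' i \<omega> * h (\<tau>' i) (\<tau>' (Suc i)))" by (simp add: \<xi>'_def)
    also have "\<dots> = (\<Sum>i<n. \<xi>' (Suc i) \<omega> * h (\<tau>' (Suc i)) (\<tau>' (Suc (Suc i))))"
      by (subst sum.lessThan_Suc_shift) (simp add: \<xi>'_def)
    also have "\<dots> = (\<Sum>i<n. \<xi> i \<omega> * h (\<tau> i) (\<tau> (Suc i)))"
      by (intro sum.cong) (auto simp: \<xi>'_def \<tau>'_def)
    finally show ?thesis .
  qed
  moreover have "simple_process (n + 2) \<tau>' \<xi>' = simple_process n \<tau> \<xi>"
  proof (intro ext)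
    fix s \<omega> show "simple_process (n + 2) \<tau>' \<xi>' s \<omega> = simple_process n \<tau> \<xi> s \<omega>"
      using sum[of \<omega> "\<lambda>a b. indicator {a<..b} s"] by (simp only: simple_process_def)
  qed
  moreover have "simple_ito W (n + 2) \<tau>' \<xi>' = simple_ito W n \<tau> \<xi>"
  proof (intro ext)
    fix t \<omega> show "simple_ito W (n + 2) \<tau>' \<xi>' t \<omega> = simple_ito W n \<tau> \<xi> t \<omega>"
      using sum[of \<omega> "\<lambda>a b. W (min t b) \<omega> - W (min t a) \<omega>"] by (simp only: simple_ito_def)
  qed
  ultimately show ?thesis by (intro exI[of _ "n + 2"] exI[of _ \<tau>'] exI[of _ \<xi>']) (auto simp: \<tau>'_def)
qed

text \<open>Both the simple approximation and the coarse Riemann sum are written on the rectangular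
  intersections of the two partitions, where the tail bound for innovations applies.\<close>

lemma simple_increment_tail_bound:
  fixes p :: "nat \<Rightarrow> real"
  assumes si: "simple_integrand M F T n \<tau> \<xi>" and \<tau>: "\<tau> 0 = 0" "\<tau> n = T"
    and p: "0 \<le> p 0" "p N \<le> T" "\<And>i. i < N \<Longrightarrow> p i \<le> p (Suc i)"
    and \<zeta>: "\<And>i. i < N \<Longrightarrow> \<zeta> i \<in> borel_measurable (F (p i))"
    and \<eta>: "\<And>i. i < N \<Longrightarrow> \<eta> i \<in> borel_measurable (F (p i))"
    and H: "cont_adapted H"
    and fin: "finite C" and part: "\<And>c. c \<in> C \<Longrightarrow> G c \<subseteq> {..<N}" "disjoint_family_on G C"
    and pos: "0 < e" "0 < \<delta>"
    and D: "(\<lambda>\<omega>. LINT s:{0..T}|lborel. (simple_process n \<tau> \<xi> s \<omega> - H s \<omega>)\<^sup>2) \<in> borel_measurable M"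
  shows "measure M {\<omega>\<in>space M. e < (\<Sum>c\<in>C. (\<Sum>i\<in>G c. \<zeta> i \<omega> *
          (simple_ito W n \<tau> \<xi> (p (Suc i)) \<omega> - simple_ito W n \<tau> \<xi> (p i) \<omega> - \<eta> i \<omega> * (W (p (Suc i)) \<omega> - W (p i) \<omega>)))\<^sup>2)}
     \<le> \<delta> / e + measure M {\<omega>\<in>space M. \<delta> <
          2 * (\<Sum>i<N. (\<zeta> i \<omega>)\<^sup>2) * (LINT s:{0..T}|lborel. (simple_process n \<tau> \<xi> s \<omega> - H s \<omega>)\<^sup>2)
        + 2 * (\<Sum>i<N. (\<zeta> i \<omega>)\<^sup>2 * integral {p i..p (Suc i)} (\<lambda>s. (H s \<omega> - \<eta> i \<omega>)\<^sup>2))}"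
proof -
  \<comment> \<open>A pair \<open>(k, i)\<close> stands for a cell of the common refinement. The
    outer \<open>max\<close> in \<open>b\<close> turns empty intersections into points, and
    \<open>L\<close> keeps the cells of positive length.\<close>
  define a where "a = (\<lambda>(k, i). max (\<tau> k) (p i))"
  define b where "b = (\<lambda>(k, i). max (max (\<tau> k) (p i)) (min (\<tau> (Suc k)) (p (Suc i))))"
  define L where "L = {l\<in>{..<n} \<times> {..<N}. a l < b l}"
  define K where "K = (\<lambda>(k, i) \<omega>. \<zeta> i \<omega> * (\<xi> k \<omega> - \<eta> i \<omega>))"
  define d where "d l \<omega> = W (b l) \<omega> - W (a l) \<omega>" for l \<omega>
  define v where "v l = b l - a l" for l
  have \<tau>m: "\<forall>k<n. \<tau> k \<le> \<tau> (Suc k)" using si by (auto simp: simple_integrand_def)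
  have pm: "\<forall>i<N. p i \<le> p (Suc i)" using p(3) by simp
  have \<xi>: "\<xi> k \<in> borel_measurable (F (\<tau> k))" if "k < n" for k using si that by (auto simp: simple_integrand_def)
  have \<tau>b: "0 \<le> \<tau> k" "\<tau> k \<le> T" if "k \<le> n" for k
    using mono_nodes[OF \<tau>m, of 0 k] mono_nodes[OF \<tau>m, of k n] \<tau> that by auto
  have pb: "0 \<le> p i" "p i \<le> T" if "i \<le> N" for i
    using mono_nodes[OF pm, of 0 i] mono_nodes[OF pm, of i N] p(1,2) that by auto
  have pM: "\<zeta> i \<in> borel_measurable M" "\<eta> i \<in> borel_measurable M" if "i < N" for i
    using measurable_F[OF \<zeta>[OF that]] measurable_F[OF \<eta>[OF that]] pb[of i] that by auto
  have aleb: "a l \<le> b l" for l by (cases l) (simp add: a_def b_def)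
  have finL: "finite L" by (simp add: L_def)
  have ab: "a (k, i) = max (\<tau> k) (p i)" "b (k, i) = min (\<tau> (Suc k)) (p (Suc i))"
    "max (\<tau> k) (p i) < min (\<tau> (Suc k)) (p (Suc i))" "k < n" "i < N" if "(k, i) \<in> L" for k i
    using that by (auto simp: L_def a_def b_def max_def split: if_splits)
  have fam: "innovation_family L a b d v"
    unfolding innovation_family_def
  proof (intro conjI ballI impI)
    fix l assume l: "l \<in> L"
    obtain k i where ki: "l = (k, i)" by (cases l)
    note abl = ab[OF l[unfolded ki]]
    show "0 \<le> a l" "a l < b l" "b l \<le> T" "0 < v l"
      using abl \<tau>b[of k] \<tau>b[of "Suc k"] by (auto simp: ki v_def)
    then show "innovation (a l) (b l) (d l) (v l)"
      unfolding d_def v_def by (intro innovation_increment) auto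
  next
    fix l l' assume l: "l \<in> L" "l' \<in> L" "l \<noteq> l'"
    obtain k i k' i' where ki: "l = (k, i)" "l' = (k', i')" by (cases l, cases l')
    note abl = ab[OF l(1)[unfolded ki]] and abl' = ab[OF l(2)[unfolded ki]]
    consider "k < k'" | "k' < k" | "i < i'" | "i' < i" using l ki by force
    then show "b l \<le> a l' \<or> b l' \<le> a l"
    proof cases
      case 1
      then have "\<tau> (Suc k) \<le> \<tau> k'" using abl' by (intro mono_nodes[OF \<tau>m]) auto
      then show ?thesis using abl(1,2) abl'(1,2) by (auto simp: ki)
    next
      case 2
      then have "\<tau> (Suc k') \<le> \<tau> k" using abl by (intro mono_nodes[OF \<tau>m]) auto
      then show ?thesis using abl(1,2) abl'(1,2) by (auto simp: ki)
    next
      case 3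
      then have "p (Suc i) \<le> p i'" using abl' by (intro mono_nodes[OF pm]) auto
      then show ?thesis using abl(1,2) abl'(1,2) by (auto simp: ki)
    next
      case 4
      then have "p (Suc i') \<le> p i" using abl by (intro mono_nodes[OF pm]) auto
      then show ?thesis using abl(1,2) abl'(1,2) by (auto simp: ki)
    qed
  qed (rule finL)
  have K: "K l \<in> borel_measurable (F (a l))" if "l \<in> L" for l
  proof -
    obtain k i where ki: "l = (k, i)" by (cases l)
    note abl = ab[OF that[unfolded ki]]
    have [measurable]: "\<xi> k \<in> borel_measurable (F (a l))" "\<zeta> i \<in> borel_measurable (F (a l))"
      "\<eta> i \<in> borel_measurable (F (a l))"
      using measurable_F_mono[OF \<xi>[of k]] measurable_F_mono[OF \<zeta>[of i]] measurable_F_mono[OF \<eta>[of i]] abl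
      by (auto simp: ki)
    have "K l = (\<lambda>\<omega>. \<zeta> i \<omega> * (\<xi> k \<omega> - \<eta> i \<omega>))" by (simp add: K_def ki)
    then show ?thesis by simp
  qed
  define G' where "G' c = {l\<in>L. snd l \<in> G c}" for c
  have disj: "disjoint_family_on G' C"
    using part(2) by (auto simp: disjoint_family_on_def G'_def)
  \<comment> \<open>The error on one coarse cell becomes a sum of innovations over the fine cells
    inside it.\<close>
  have inc: "\<zeta> i \<omega> * (simple_ito W n \<tau> \<xi> (p (Suc i)) \<omega> - simple_ito W n \<tau> \<xi> (p i) \<omega> - \<eta> i \<omega> * (W (p (Suc i)) \<omega> - W (p i) \<omega>))
      = (\<Sum>l\<in>{l\<in>L. snd l = i}. K l \<omega> * d l \<omega>)" if i: "i < N" for i \<omega>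
  proof -
    let ?f = "\<lambda>x. W x \<omega>"
    have rect: "?f (b (k, i)) - ?f (a (k, i)) = ?f (min (p (Suc i)) (\<tau> (Suc k))) - ?f (min (p (Suc i)) (\<tau> k))
        - (?f (min (p i) (\<tau> (Suc k))) - ?f (min (p i) (\<tau> k)))" if "k < n" for k
      using increment_rectangle[OF \<tau>m[rule_format, OF that] p(3)[OF i], of ?f] by (simp add: a_def b_def)
    have ito: "simple_ito W n \<tau> \<xi> (p (Suc i)) \<omega> - simple_ito W n \<tau> \<xi> (p i) \<omega>
        = (\<Sum>k<n. \<xi> k \<omega> * (?f (b (k, i)) - ?f (a (k, i))))"
      by (simp add: simple_ito_def sum_subtractf[symmetric] rect right_diff_distrib)
    \<comment> \<open>Telescoping in \<open>k\<close> needs the fine nodes to run from 0 to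
      \<open>T\<close>; otherwise part of the coarse increment would be lost.\<close>
    have "(\<Sum>k<n. ?f (b (k, i)) - ?f (a (k, i)))
        = (?f (min (p (Suc i)) (\<tau> n)) - ?f (min (p (Suc i)) (\<tau> 0))) - (?f (min (p i) (\<tau> n)) - ?f (min (p i) (\<tau> 0)))"
      using sum_lessThan_telescope[of "\<lambda>k. ?f (min (p (Suc i)) (\<tau> k))" n]
        sum_lessThan_telescope[of "\<lambda>k. ?f (min (p i) (\<tau> k))" n]
      by (simp add: rect sum_subtractf)
    also have "\<dots> = ?f (p (Suc i)) - ?f (p i)"
      using pb[of i] pb[of "Suc i"] i by (simp add: \<tau> min_def)
    finally have tele: "?f (p (Suc i)) - ?f (p i) = (\<Sum>k<n. ?f (b (k, i)) - ?f (a (k, i)))" by simp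
    have "simple_ito W n \<tau> \<xi> (p (Suc i)) \<omega> - simple_ito W n \<tau> \<xi> (p i) \<omega> - \<eta> i \<omega> * (?f (p (Suc i)) - ?f (p i))
       = (\<Sum>k<n. (\<xi> k \<omega> - \<eta> i \<omega>) * (?f (b (k, i)) - ?f (a (k, i))))"
      unfolding tele ito sum_distrib_left sum_subtractf[symmetric] by (simp add: left_diff_distrib)
    then have "\<zeta> i \<omega> * (simple_ito W n \<tau> \<xi> (p (Suc i)) \<omega> - simple_ito W n \<tau> \<xi> (p i) \<omega> - \<eta> i \<omega> * (?f (p (Suc i)) - ?f (p i)))
        = (\<Sum>k<n. K (k, i) \<omega> * d (k, i) \<omega>)"
      by (simp add: sum_distrib_left K_def d_def mult.assoc)
    also have "\<dots> = (\<Sum>l\<in>(\<lambda>k. (k, i)) ` {..<n}. K l \<omega> * d l \<omega>)"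
      by (subst sum.reindex) (auto simp: inj_on_def)
    also have "\<dots> = (\<Sum>l\<in>{l\<in>L. snd l = i}. K l \<omega> * d l \<omega>)"
    proof (rule sum.mono_neutral_right)
      show "\<forall>l\<in>(\<lambda>k. (k, i)) ` {..<n} - {l \<in> L. snd l = i}. K l \<omega> * d l \<omega> = 0"
      proof
        fix l assume "l \<in> (\<lambda>k. (k, i)) ` {..<n} - {l \<in> L. snd l = i}"
        then have "\<not> a l < b l" using i by (auto simp: L_def)
        then have "a l = b l" using aleb[of l] by simp
        then show "K l \<omega> * d l \<omega> = 0" by (simp add: d_def)
      qed
    qed (auto simp: L_def)
    finally show ?thesis .
  qed
  have group: "(\<Sum>l\<in>G' c. K l \<omega> * d l \<omega>) = (\<Sum>i\<in>G c. \<zeta> i \<omega> *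
          (simple_ito W n \<tau> \<xi> (p (Suc i)) \<omega> - simple_ito W n \<tau> \<xi> (p i) \<omega> - \<eta> i \<omega> * (W (p (Suc i)) \<omega> - W (p i) \<omega>)))"
    if "c \<in> C" for c \<omega>
  proof -
    have finG: "finite (G c)" using part(1)[OF that] finite_subset by auto
    have "(\<Sum>l\<in>G' c. K l \<omega> * d l \<omega>) = (\<Sum>i\<in>G c. \<Sum>l\<in>{l\<in>G' c. snd l = i}. K l \<omega> * d l \<omega>)"
      using finL finG by (intro sum.group[symmetric]) (auto simp: G'_def)
    also have "\<dots> = (\<Sum>i\<in>G c. \<Sum>l\<in>{l\<in>L. snd l = i}. K l \<omega> * d l \<omega>)"
      by (intro sum.cong refl) (auto simp: G'_def)
    finally show ?thesis using inc part(1)[OF that] by (auto intro!: sum.cong)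
  qed
  \<comment> \<open>The gap between simple and frozen value is split at the true integrand
    \<open>H\<close>. The first part is compared with the squared distance in time, for which each
    weight is bounded by the sum of all weights; the second part keeps its own weight.\<close>
  have Q: "(\<Sum>l\<in>L. v l * (K l \<omega>)\<^sup>2)
      \<le> 2 * (\<Sum>i<N. (\<zeta> i \<omega>)\<^sup>2) * (LINT s:{0..T}|lborel. (simple_process n \<tau> \<xi> s \<omega> - H s \<omega>)\<^sup>2)
        + 2 * (\<Sum>i<N. (\<zeta> i \<omega>)\<^sup>2 * integral {p i..p (Suc i)} (\<lambda>s. (H s \<omega> - \<eta> i \<omega>)\<^sup>2))"
    if \<omega>: "\<omega> \<in> space M" for \<omega>
  proof -
    let ?sp = "\<lambda>s. simple_process n \<tau> \<xi> s \<omega>"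
    let ?Z = "\<Sum>i<N. (\<zeta> i \<omega>)\<^sup>2"
    have Hc: "continuous_on {0..T} (\<lambda>s. H s \<omega>)" using cont_adapted_cont[OF H \<omega>, of T] by simp
    have Hi: "continuous_on {p i..p (Suc i)} (\<lambda>s. (H s \<omega> - \<eta> i \<omega>)\<^sup>2)" if "i < N" for i
      using that pb[of i] pb[of "Suc i"] by (intro continuous_intros continuous_on_subset[OF Hc]) auto
    have D_int: "integrable lborel (\<lambda>s. indicator {0..T} s * (?sp s - H s \<omega>)\<^sup>2)"
    proof -
      have "bounded ((\<lambda>s. H s \<omega>) ` {0..T})"
        by (rule compact_imp_bounded[OF compact_continuous_image[OF Hc]]) simp
      then obtain B where B: "\<And>s. s \<in> {0..T} \<Longrightarrow> \<bar>H s \<omega>\<bar> \<le> B"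
        unfolding bounded_iff by (metis imageI real_norm_def)
      have spB: "\<bar>?sp s\<bar> \<le> (\<Sum>k<n. \<bar>\<xi> k \<omega>\<bar>)" for s
        unfolding simple_process_def
        by (rule order_trans[OF sum_abs sum_mono]) (auto simp: indicator_def)
      have meas: "(\<lambda>s. indicator {0..T} s * H s \<omega>) \<in> borel_measurable borel"
        using borel_measurable_continuous_on_indicator[OF _ Hc] by simp
      have [measurable]: "?sp \<in> borel_measurable borel" unfolding simple_process_def by measurable
      have eq: "indicator {0..T} s * (?sp s - H s \<omega>)\<^sup>2 = indicator {0..T} s * (?sp s - indicator {0..T} s * H s \<omega>)\<^sup>2" for s
        by (auto simp: indicator_def)
      show ?thesis
      proof (rule Bochner_Integration.integrable_bound)
        show "integrable lborel (\<lambda>s. indicator {0..T} s * ((\<Sum>k<n. \<bar>\<xi> k \<omega>\<bar>) + B)\<^sup>2)"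
          by (intro integrable_mult_left integrable_real_indicator) (auto simp: emeasure_lborel_Icc_eq)
        show "(\<lambda>s. indicator {0..T} s * (?sp s - H s \<omega>)\<^sup>2) \<in> borel_measurable lborel"
          unfolding eq using meas by measurable
        have "\<bar>?sp s - H s \<omega>\<bar> \<le> (\<Sum>k<n. \<bar>\<xi> k \<omega>\<bar>) + B" if "s \<in> {0..T}" for s
          using spB[of s] B[OF that] by linarith
        then have "(?sp s - H s \<omega>)\<^sup>2 \<le> ((\<Sum>k<n. \<bar>\<xi> k \<omega>\<bar>) + B)\<^sup>2" if "s \<in> {0..T}" for s
          using that power_mono[of "\<bar>?sp s - H s \<omega>\<bar>" _ 2] by auto
        then show "AE s in lborel. norm (indicator {0..T} s * (?sp s - H s \<omega>)\<^sup>2)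
            \<le> norm (indicator {0..T} s * ((\<Sum>k<n. \<bar>\<xi> k \<omega>\<bar>) + B)\<^sup>2)"
          by (auto simp: indicator_def)
      qed
    qed
    \<comment> \<open>As the integral of a step function in time, the sum can be estimated
      pointwise: at most one indicator is nonzero at each \<open>s\<close>.\<close>
    have "(\<Sum>l\<in>L. v l * (K l \<omega>)\<^sup>2) = (\<integral>s. (\<Sum>l\<in>L. indicator {a l<..b l} s * (K l \<omega>)\<^sup>2) \<partial>lborel)"
    proof -
      have "(\<integral>s. indicator {a l<..b l} s * (K l \<omega>)\<^sup>2 \<partial>lborel) = v l * (K l \<omega>)\<^sup>2" if "l \<in> L" for l
        using that by (cases l) (auto simp: v_def L_def)
      then show ?thesis
        by (subst Bochner_Integration.integral_sum)
          (auto intro!: integrable_mult_left integrable_real_indicator simp: aleb v_def)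
    qed
    also have "\<dots> \<le> (\<integral>s. 2 * ?Z * (indicator {0..T} s * (?sp s - H s \<omega>)\<^sup>2)
        + 2 * (\<Sum>i<N. (\<zeta> i \<omega>)\<^sup>2 * (indicator {p i<..p (Suc i)} s * (H s \<omega> - \<eta> i \<omega>)\<^sup>2)) \<partial>lborel)"
    proof (rule integral_mono)
      show "integrable lborel (\<lambda>s. \<Sum>l\<in>L. indicator {a l<..b l} s * (K l \<omega>)\<^sup>2)"
        by (intro Bochner_Integration.integrable_sum integrable_mult_left integrable_real_indicator)
          (auto simp: aleb)
      show "integrable lborel (\<lambda>s. 2 * ?Z * (indicator {0..T} s * (?sp s - H s \<omega>)\<^sup>2)
        + 2 * (\<Sum>i<N. (\<zeta> i \<omega>)\<^sup>2 * (indicator {p i<..p (Suc i)} s * (H s \<omega> - \<eta> i \<omega>)\<^sup>2)))"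
        using set_lebesgue_integral_Ioc(1)[OF Hi]
        by (intro Bochner_Integration.integrable_add integrable_mult_right Bochner_Integration.integrable_sum D_int) auto
      fix s
      let ?R = "2 * ?Z * (indicator {0..T} s * (?sp s - H s \<omega>)\<^sup>2)
        + 2 * (\<Sum>i<N. (\<zeta> i \<omega>)\<^sup>2 * (indicator {p i<..p (Suc i)} s * (H s \<omega> - \<eta> i \<omega>)\<^sup>2))"
      have R_nonneg: "0 \<le> ?R"
        by (intro add_nonneg_nonneg mult_nonneg_nonneg sum_nonneg) auto
      show "(\<Sum>l\<in>L. indicator {a l<..b l} s * (K l \<omega>)\<^sup>2) \<le> ?R"
      proof (cases "\<exists>l\<in>L. s \<in> {a l<..b l}")
        case False
        then have "(\<Sum>l\<in>L. indicator {a l<..b l} s * (K l \<omega>)\<^sup>2) = 0" by (intro sum.neutral) auto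
        then show ?thesis using R_nonneg by simp
      next
        case True
        then obtain l where l: "l \<in> L" "s \<in> {a l<..b l}" by blast
        obtain k i where ki: "l = (k, i)" by (cases l)
        note abl = ab[OF l(1)[unfolded ki]]
        have other: "s \<notin> {a l'<..b l'}" if "l' \<in> L" "l' \<noteq> l" for l'
        proof -
          have "b l \<le> a l' \<or> b l' \<le> a l" using fam l that unfolding innovation_family_def by blast
          then show ?thesis using l(2) by auto
        qed
        have "(\<Sum>l'\<in>L. indicator {a l'<..b l'} s * (K l' \<omega>)\<^sup>2) = (\<Sum>l'\<in>L. if l' = l then (K l \<omega>)\<^sup>2 else 0)"
          using l(2) other by (intro sum.cong) (auto simp: indicator_def)
        also have "\<dots> = (K l \<omega>)\<^sup>2" using finL l(1) by simp
        also have "\<dots> = (\<zeta> i \<omega>)\<^sup>2 * (\<xi> k \<omega> - \<eta> i \<omega>)\<^sup>2" by (simp add: K_def ki power_mult_distrib)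
        also have "\<dots> \<le> (\<zeta> i \<omega>)\<^sup>2 * (2 * (\<xi> k \<omega> - H s \<omega>)\<^sup>2 + 2 * (H s \<omega> - \<eta> i \<omega>)\<^sup>2)"
        proof (rule mult_left_mono)
          have "0 \<le> ((\<xi> k \<omega> - H s \<omega>) - (H s \<omega> - \<eta> i \<omega>))\<^sup>2" by simp
          then show "(\<xi> k \<omega> - \<eta> i \<omega>)\<^sup>2 \<le> 2 * (\<xi> k \<omega> - H s \<omega>)\<^sup>2 + 2 * (H s \<omega> - \<eta> i \<omega>)\<^sup>2"
            by (simp add: power2_eq_square algebra_simps)
        qed simp
        also have "\<dots> = 2 * ((\<zeta> i \<omega>)\<^sup>2 * (\<xi> k \<omega> - H s \<omega>)\<^sup>2) + 2 * ((\<zeta> i \<omega>)\<^sup>2 * (H s \<omega> - \<eta> i \<omega>)\<^sup>2)"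
          by (simp add: algebra_simps)
        also have "\<dots> \<le> ?R"
        proof (rule add_mono)
          have "s \<in> {0..T}" "\<tau> k < s" "s \<le> \<tau> (Suc k)" "p i < s" "s \<le> p (Suc i)"
            using l(2) abl \<tau>b[of k] \<tau>b[of "Suc k"] by (auto simp: ki)
          note s = this
          have "(\<zeta> i \<omega>)\<^sup>2 \<le> ?Z" using abl(5) by (intro member_le_sum[where f="\<lambda>i. (\<zeta> i \<omega>)\<^sup>2"]) auto
          moreover have "?sp s = \<xi> k \<omega>" by (rule simple_process_eq[OF \<tau>m abl(4) s(2,3)])
          ultimately show "2 * ((\<zeta> i \<omega>)\<^sup>2 * (\<xi> k \<omega> - H s \<omega>)\<^sup>2) \<le> 2 * ?Z * (indicator {0..T} s * (?sp s - H s \<omega>)\<^sup>2)"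
            using s(1) by (simp add: mult_right_mono)
          have "(\<zeta> i \<omega>)\<^sup>2 * (indicator {p i<..p (Suc i)} s * (H s \<omega> - \<eta> i \<omega>)\<^sup>2)
              \<le> (\<Sum>i<N. (\<zeta> i \<omega>)\<^sup>2 * (indicator {p i<..p (Suc i)} s * (H s \<omega> - \<eta> i \<omega>)\<^sup>2))"
            using abl(5)
            by (intro member_le_sum[where f="\<lambda>i. (\<zeta> i \<omega>)\<^sup>2 * (indicator {p i<..p (Suc i)} s * (H s \<omega> - \<eta> i \<omega>)\<^sup>2)"]) auto
          then show "2 * ((\<zeta> i \<omega>)\<^sup>2 * (H s \<omega> - \<eta> i \<omega>)\<^sup>2)
              \<le> 2 * (\<Sum>i<N. (\<zeta> i \<omega>)\<^sup>2 * (indicator {p i<..p (Suc i)} s * (H s \<omega> - \<eta> i \<omega>)\<^sup>2))"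
            using s(4,5) by simp
        qed
        finally show ?thesis .
      qed
    qed
    also have "\<dots> = 2 * ?Z * (\<integral>s. indicator {0..T} s * (?sp s - H s \<omega>)\<^sup>2 \<partial>lborel)
        + 2 * (\<Sum>i<N. (\<zeta> i \<omega>)\<^sup>2 * (\<integral>s. indicator {p i<..p (Suc i)} s * (H s \<omega> - \<eta> i \<omega>)\<^sup>2 \<partial>lborel))"
      using set_lebesgue_integral_Ioc(1)[OF Hi] D_int
      by (subst Bochner_Integration.integral_add) (auto intro!: Bochner_Integration.integrable_sum simp: Bochner_Integration.integral_sum)
    also have "\<dots> = 2 * ?Z * (LINT s:{0..T}|lborel. (?sp s - H s \<omega>)\<^sup>2)
        + 2 * (\<Sum>i<N. (\<zeta> i \<omega>)\<^sup>2 * integral {p i..p (Suc i)} (\<lambda>s. (H s \<omega> - \<eta> i \<omega>)\<^sup>2))"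
      using set_lebesgue_integral_Ioc(2)[OF Hi] by (simp add: set_lebesgue_integral_def)
    finally show ?thesis .
  qed
  have "measure M {\<omega>\<in>space M. e < (\<Sum>c\<in>C. (\<Sum>l\<in>G' c. K l \<omega> * d l \<omega>)\<^sup>2)}
     \<le> \<delta> / e + measure M {\<omega>\<in>space M. \<delta> < (\<Sum>l\<in>L. v l * (K l \<omega>)\<^sup>2)}"
    by (rule innovation_tail_bound[OF fam K fin _ disj pos]) (auto simp: G'_def)
  also have "measure M {\<omega>\<in>space M. \<delta> < (\<Sum>l\<in>L. v l * (K l \<omega>)\<^sup>2)} \<le> measure M {\<omega>\<in>space M. \<delta> <
          2 * (\<Sum>i<N. (\<zeta> i \<omega>)\<^sup>2) * (LINT s:{0..T}|lborel. (simple_process n \<tau> \<xi> s \<omega> - H s \<omega>)\<^sup>2)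
        + 2 * (\<Sum>i<N. (\<zeta> i \<omega>)\<^sup>2 * integral {p i..p (Suc i)} (\<lambda>s. (H s \<omega> - \<eta> i \<omega>)\<^sup>2))}"
  proof (rule finite_measure_mono)
    have "(\<lambda>\<omega>. integral {p i..p (Suc i)} (\<lambda>s. (H s \<omega> - \<eta> i \<omega>)\<^sup>2)) \<in> borel_measurable M" if "i < N" for i
    proof (rule borel_measurable_integral_interval)
      fix s assume "s \<in> {p i..p (Suc i)}"
      then have [measurable]: "H s \<in> borel_measurable M"
        using pb[of i] pb[of "Suc i"] that by (intro cont_adapted_measM[OF H]) auto
      show "(\<lambda>\<omega>. (H s \<omega> - \<eta> i \<omega>)\<^sup>2) \<in> borel_measurable M" using pM(2)[OF that] by measurable
    next
      fix \<omega> assume "\<omega> \<in> space M"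
      then show "continuous_on {p i..p (Suc i)} (\<lambda>s. (H s \<omega> - \<eta> i \<omega>)\<^sup>2)"
        using pb[of i] pb[of "Suc i"] that
        by (intro continuous_intros continuous_on_subset[OF cont_adapted_cont[OF H, of \<omega> T]]) auto
    qed (use p(3) that in auto)
    then show "{\<omega>\<in>space M. \<delta> <
          2 * (\<Sum>i<N. (\<zeta> i \<omega>)\<^sup>2) * (LINT s:{0..T}|lborel. (simple_process n \<tau> \<xi> s \<omega> - H s \<omega>)\<^sup>2)
        + 2 * (\<Sum>i<N. (\<zeta> i \<omega>)\<^sup>2 * integral {p i..p (Suc i)} (\<lambda>s. (H s \<omega> - \<eta> i \<omega>)\<^sup>2))} \<in> events"
      using D pM(1)
      by (intro borel_measurable_less borel_measurable_add borel_measurable_times borel_measurable_sum borel_measurable_const borel_measurable_power) auto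
  qed (use Q in \<open>force intro: less_le_trans\<close>)
  finally show ?thesis by (simp add: group)
qed

end

section \<open>Ito integrals as limits of Riemann sums\<close>

lemma node_interval_exists:
  fixes \<tau> :: "nat \<Rightarrow> real"
  assumes "\<tau> 0 < s" "s \<le> \<tau> n"
  shows "\<exists>k<n. \<tau> k < s \<and> s \<le> \<tau> (Suc k)"
  using assms
proof (induction n)
  case (Suc n)
  then show ?case by (cases "s \<le> \<tau> n") (auto simp: not_le intro: less_SucI)
qed simp

lemma (in prob_space) tends_in_prob_const:
  "X \<in> borel_measurable M \<Longrightarrow> tends_in_prob M (\<lambda>_. X) X"
  by (rule tends_in_prob_AE) auto

lemma (in prob_space) tends_in_prob_mult:
  assumes "tends_in_prob M X1 Y1" "tends_in_prob M X2 Y2"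
  shows "tends_in_prob M (\<lambda>m \<omega>. X1 m \<omega> * X2 m \<omega>) (\<lambda>\<omega>. Y1 \<omega> * Y2 \<omega>)"
proof -
  note [measurable] = assms[THEN tends_in_prob_measurable(1)] assms[THEN tends_in_prob_measurable(2)]
  show ?thesis by (rule tends_in_prob_combine[OF assms]) (auto intro!: tendsto_mult)
qed

lemma (in prob_space) tends_in_prob_zero_sqrt:
  assumes "tends_in_prob M (\<lambda>m \<omega>. (X m \<omega>)\<^sup>2) (\<lambda>_. 0)" "\<And>m. X m \<in> borel_measurable M"
  shows "tends_in_prob M X (\<lambda>_. 0)"
proof (rule tends_in_prob_combine1[OF assms(1)])
  have "(\<lambda>m. f m) \<longlonglongrightarrow> 0" if "(\<lambda>m. (f m)\<^sup>2) \<longlonglongrightarrow> 0" for f :: "nat \<Rightarrow> real"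
    using tendsto_real_sqrt[OF that] by (simp add: tendsto_rabs_zero_iff)
  then show "AE \<omega> in M. \<forall>r::nat\<Rightarrow>nat. strict_mono r \<longrightarrow> (\<lambda>m. (X (r m) \<omega>)\<^sup>2) \<longlonglongrightarrow> 0 \<longrightarrow> (\<lambda>m. X (r m) \<omega>) \<longlonglongrightarrow> 0"
    by auto
qed (use assms(2) in auto)

context brownian_basis
begin

lemma W_measurableM: "t \<in> {0..T} \<Longrightarrow> W t \<in> borel_measurable M"
  using measurable_F[OF W_measurable] by auto

lemma grid_in: "t \<in> {0..T} \<Longrightarrow> grid T t m i \<in> {0..T}"
  using grid_nonneg[of t T m i] grid_le[of T t m i] T_pos by auto

lemma grid_mono_Suc: "grid T t m i \<le> grid T t m (Suc i)"
  using grid_mono[of T i "Suc i" t m] T_pos by simp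

text \<open>Limit of the estimate for simple integrands along an approximating sequence. Halving
  \<open>e\<close> absorbs the distance to the limit \<open>V\<close>, halving
  \<open>\<delta>\<close> separates the term \<open>Z * D m\<close>, and the factor 2 in front of
  \<open>B\<close> halves once more; hence the constants 2 and 1/4.\<close>

lemma ito_increment_tail_bound:
  fixes p :: "nat \<Rightarrow> real"
  assumes I: "has_ito_integral M F T W H I" and H: "cont_adapted H"
    and p: "0 \<le> p 0" "p N \<le> T" "\<And>i. i < N \<Longrightarrow> p i \<le> p (Suc i)"
    and \<zeta>: "\<And>i. i < N \<Longrightarrow> \<zeta> i \<in> borel_measurable (F (p i))"
    and \<eta>: "\<And>i. i < N \<Longrightarrow> \<eta> i \<in> borel_measurable (F (p i))"
    and fin: "finite C" and part: "\<And>c. c \<in> C \<Longrightarrow> G c \<subseteq> {..<N}" "disjoint_family_on G C"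
    and pos: "0 < e" "0 < \<delta>"
  shows "measure M {\<omega>\<in>space M. e < (\<Sum>c\<in>C. (\<Sum>i\<in>G c. \<zeta> i \<omega> *
          (I (p (Suc i)) \<omega> - I (p i) \<omega> - \<eta> i \<omega> * (W (p (Suc i)) \<omega> - W (p i) \<omega>)))\<^sup>2)}
     \<le> 2 * \<delta> / e + measure M {\<omega>\<in>space M. 1 / 4 * \<delta> <
          (\<Sum>i<N. (\<zeta> i \<omega>)\<^sup>2 * integral {p i..p (Suc i)} (\<lambda>s. (H s \<omega> - \<eta> i \<omega>)\<^sup>2))}"
proof -
  have pm: "\<forall>i<N. p i \<le> p (Suc i)" using p(3) by simp
  have pb: "0 \<le> p i" "p i \<le> T" if "i \<le> N" for i
    using mono_nodes[OF pm, of 0 i] mono_nodes[OF pm, of i N] p(1,2) that by auto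
  obtain n0 \<tau>0 \<xi>0 where si0: "\<forall>m. simple_integrand M F T (n0 m) (\<tau>0 m) (\<xi>0 m)"
    and L2: "tends_in_prob M (\<lambda>m \<omega>. LINT s:{0..T}|lborel. (simple_process (n0 m) (\<tau>0 m) (\<xi>0 m) s \<omega> - H s \<omega>)\<^sup>2) (\<lambda>_. 0)"
    and ito: "\<forall>t\<in>{0..T}. tends_in_prob M (\<lambda>m. simple_ito W (n0 m) (\<tau>0 m) (\<xi>0 m) t) (I t)"
    using I unfolding has_ito_integral_def by (elim conjE exE) (rule that)
  have "\<forall>m. \<exists>n' \<tau>' \<xi>'. simple_integrand M F T n' \<tau>' \<xi>' \<and> \<tau>' 0 = 0 \<and> \<tau>' n' = T \<and>
     simple_process n' \<tau>' \<xi>' = simple_process (n0 m) (\<tau>0 m) (\<xi>0 m) \<and>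
     simple_ito W n' \<tau>' \<xi>' = simple_ito W (n0 m) (\<tau>0 m) (\<xi>0 m)"
    using simple_integrand_extend[OF si0[rule_format]] by blast
  then obtain n \<tau> \<xi> where ext: "\<And>m. simple_integrand M F T (n m) (\<tau> m) (\<xi> m)" "\<And>m. \<tau> m 0 = 0" "\<And>m. \<tau> m (n m) = T"
     "\<And>m. simple_process (n m) (\<tau> m) (\<xi> m) = simple_process (n0 m) (\<tau>0 m) (\<xi>0 m)"
     "\<And>m. simple_ito W (n m) (\<tau> m) (\<xi> m) = simple_ito W (n0 m) (\<tau>0 m) (\<xi>0 m)"
    by metis
  define D where "D m \<omega> = (LINT s:{0..T}|lborel. (simple_process (n m) (\<tau> m) (\<xi> m) s \<omega> - H s \<omega>)\<^sup>2)" for m \<omega>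
  have D: "tends_in_prob M D (\<lambda>_. 0)" using L2 by (simp add: D_def[abs_def] ext(4))
  have ito': "tends_in_prob M (\<lambda>m. simple_ito W (n m) (\<tau> m) (\<xi> m) t) (I t)" if "t \<in> {0..T}" for t
    using ito that by (simp add: ext(5))
  define Y where "Y m \<omega> = (\<Sum>c\<in>C. (\<Sum>i\<in>G c. \<zeta> i \<omega> *
          (simple_ito W (n m) (\<tau> m) (\<xi> m) (p (Suc i)) \<omega> - simple_ito W (n m) (\<tau> m) (\<xi> m) (p i) \<omega>
            - \<eta> i \<omega> * (W (p (Suc i)) \<omega> - W (p i) \<omega>)))\<^sup>2)" for m \<omega>
  define V where "V \<omega> = (\<Sum>c\<in>C. (\<Sum>i\<in>G c. \<zeta> i \<omega> *
          (I (p (Suc i)) \<omega> - I (p i) \<omega> - \<eta> i \<omega> * (W (p (Suc i)) \<omega> - W (p i) \<omega>)))\<^sup>2)" for \<omega>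
  define Z where "Z \<omega> = 2 * (\<Sum>i<N. (\<zeta> i \<omega>)\<^sup>2)" for \<omega>
  define B where "B \<omega> = (\<Sum>i<N. (\<zeta> i \<omega>)\<^sup>2 * integral {p i..p (Suc i)} (\<lambda>s. (H s \<omega> - \<eta> i \<omega>)\<^sup>2))" for \<omega>
  have pM [measurable]: "\<zeta> i \<in> borel_measurable M" "\<eta> i \<in> borel_measurable M" if "i < N" for i
    using measurable_F[OF \<zeta>[OF that]] measurable_F[OF \<eta>[OF that]] pb[of i] that by auto
  have finG: "finite (G c)" if "c \<in> C" for c using part(1)[OF that] finite_subset by auto
  have YV: "tends_in_prob M Y V"
  proof -
    have "tends_in_prob M (\<lambda>m \<omega>. \<zeta> i \<omega> *
          (simple_ito W (n m) (\<tau> m) (\<xi> m) (p (Suc i)) \<omega> - simple_ito W (n m) (\<tau> m) (\<xi> m) (p i) \<omega>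
            - \<eta> i \<omega> * (W (p (Suc i)) \<omega> - W (p i) \<omega>)))
        (\<lambda>\<omega>. \<zeta> i \<omega> * (I (p (Suc i)) \<omega> - I (p i) \<omega> - \<eta> i \<omega> * (W (p (Suc i)) \<omega> - W (p i) \<omega>)))"
      if i: "i < N" for i
      using W_measurableM[of "p i"] W_measurableM[of "p (Suc i)"] pM[OF i] pb[of i] pb[of "Suc i"] i
      by (intro tends_in_prob_mult tends_in_prob_diff tends_in_prob_const ito' borel_measurable_times borel_measurable_diff) auto
    then have sumlim: "tends_in_prob M (\<lambda>m \<omega>. \<Sum>i\<in>G c. \<zeta> i \<omega> *
          (simple_ito W (n m) (\<tau> m) (\<xi> m) (p (Suc i)) \<omega> - simple_ito W (n m) (\<tau> m) (\<xi> m) (p i) \<omega>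
            - \<eta> i \<omega> * (W (p (Suc i)) \<omega> - W (p i) \<omega>)))
        (\<lambda>\<omega>. \<Sum>i\<in>G c. \<zeta> i \<omega> * (I (p (Suc i)) \<omega> - I (p i) \<omega> - \<eta> i \<omega> * (W (p (Suc i)) \<omega> - W (p i) \<omega>)))"
      if "c \<in> C" for c
      using part(1)[OF that] by (intro tends_in_prob_sum finG that) auto
    show ?thesis
      unfolding Y_def V_def power2_eq_square
      by (rule tends_in_prob_sum[OF fin], rule tends_in_prob_mult) (rule sumlim, assumption)+
  qed
  note [measurable] = tends_in_prob_measurable[OF YV] tends_in_prob_measurable[OF D]
  have ZM [measurable]: "Z \<in> borel_measurable M" unfolding Z_def using pM(1) by auto
  \<comment> \<open>The random factor \<open>Z\<close> does not depend on \<open>m\<close>, so it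
    cannot prevent the product from vanishing in probability.\<close>
  have ZD: "tends_in_prob M (\<lambda>m \<omega>. Z \<omega> * D m \<omega>) (\<lambda>_. 0)"
    using tends_in_prob_mult[OF tends_in_prob_const[OF ZM] D] by simp
  have BM [measurable]: "B \<in> borel_measurable M"
    unfolding B_def
  proof (intro borel_measurable_sum borel_measurable_times borel_measurable_power pM(1))
    fix i assume i: "i \<in> {..<N}"
    show "(\<lambda>\<omega>. integral {p i..p (Suc i)} (\<lambda>s. (H s \<omega> - \<eta> i \<omega>)\<^sup>2)) \<in> borel_measurable M"
    proof (rule borel_measurable_integral_interval)
      fix s assume "s \<in> {p i..p (Suc i)}"
      then have [measurable]: "H s \<in> borel_measurable M"
        using pb[of i] pb[of "Suc i"] i by (intro cont_adapted_measM[OF H]) auto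
      show "(\<lambda>\<omega>. (H s \<omega> - \<eta> i \<omega>)\<^sup>2) \<in> borel_measurable M" using pM(2) i by auto
    next
      fix \<omega> assume "\<omega> \<in> space M"
      then show "continuous_on {p i..p (Suc i)} (\<lambda>s. (H s \<omega> - \<eta> i \<omega>)\<^sup>2)"
        using pb[of i] pb[of "Suc i"] i
        by (intro continuous_intros continuous_on_subset[OF cont_adapted_cont[OF H, of \<omega> T]]) auto
    qed (use p(3) i in auto)
  qed auto
  have bound: "measure M {\<omega>\<in>space M. e < V \<omega>} \<le> measure M {\<omega>\<in>space M. e / 2 < \<bar>Y m \<omega> - V \<omega>\<bar>}
      + (\<delta> / (e / 2) + (measure M {\<omega>\<in>space M. \<delta> / 2 < \<bar>Z \<omega> * D m \<omega> - 0\<bar>} + measure M {\<omega>\<in>space M. 1 / 4 * \<delta> < B \<omega>}))" for m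
  proof -
    have "e / 2 < \<bar>Y m \<omega> - V \<omega>\<bar> \<or> e / 2 < Y m \<omega>" if "e < V \<omega>" for \<omega>
      using that by linarith
    then have "measure M {\<omega>\<in>space M. e < V \<omega>}
        \<le> measure M ({\<omega>\<in>space M. e / 2 < \<bar>Y m \<omega> - V \<omega>\<bar>} \<union> {\<omega>\<in>space M. e / 2 < Y m \<omega>})"
      by (intro finite_measure_mono) (blast, measurable)
    also have "\<dots> \<le> measure M {\<omega>\<in>space M. e / 2 < \<bar>Y m \<omega> - V \<omega>\<bar>} + measure M {\<omega>\<in>space M. e / 2 < Y m \<omega>}"
      by (rule measure_Un_le) auto
    also have "measure M {\<omega>\<in>space M. e / 2 < Y m \<omega>}
        \<le> \<delta> / (e / 2) + measure M {\<omega>\<in>space M. \<delta> < Z \<omega> * D m \<omega> + 2 * B \<omega>}"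
      unfolding Y_def Z_def B_def D_def
    proof (rule simple_increment_tail_bound[OF ext(1-3) p \<zeta> \<eta> H fin part])
      show "(\<lambda>\<omega>. LINT s:{0..T}|lborel. (simple_process (n m) (\<tau> m) (\<xi> m) s \<omega> - H s \<omega>)\<^sup>2) \<in> borel_measurable M"
        using tends_in_prob_measurable(1)[OF D, of m] by (simp add: D_def[abs_def])
    qed (use pos in auto)
    also have "measure M {\<omega>\<in>space M. \<delta> < Z \<omega> * D m \<omega> + 2 * B \<omega>}
        \<le> measure M ({\<omega>\<in>space M. \<delta> / 2 < \<bar>Z \<omega> * D m \<omega> - 0\<bar>} \<union> {\<omega>\<in>space M. 1 / 4 * \<delta> < B \<omega>})"
      by (rule finite_measure_mono) auto
    also have "\<dots> \<le> measure M {\<omega>\<in>space M. \<delta> / 2 < \<bar>Z \<omega> * D m \<omega> - 0\<bar>} + measure M {\<omega>\<in>space M. 1 / 4 * \<delta> < B \<omega>}"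
      by (rule measure_Un_le) auto
    finally show ?thesis by simp
  qed
  have "(\<lambda>m. measure M {\<omega>\<in>space M. e / 2 < \<bar>Y m \<omega> - V \<omega>\<bar>}
      + (\<delta> / (e / 2) + (measure M {\<omega>\<in>space M. \<delta> / 2 < \<bar>Z \<omega> * D m \<omega> - 0\<bar>} + measure M {\<omega>\<in>space M. 1 / 4 * \<delta> < B \<omega>})))
    \<longlonglongrightarrow> 0 + (\<delta> / (e / 2) + (0 + measure M {\<omega>\<in>space M. 1 / 4 * \<delta> < B \<omega>}))"
    using YV ZD half_gt_zero[OF pos(1)] half_gt_zero[OF pos(2)]
    unfolding tends_in_prob_def by (intro tendsto_add tendsto_const) blast+
  \<comment> \<open>The left side is free of \<open>m\<close>, so the bound survives the passage to
    the limit.\<close>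
  then have "measure M {\<omega>\<in>space M. e < V \<omega>} \<le> 0 + (\<delta> / (e / 2) + (0 + measure M {\<omega>\<in>space M. 1 / 4 * \<delta> < B \<omega>}))"
    using bound by (intro LIMSEQ_le_const) auto
  then show ?thesis by (simp add: V_def B_def mult.commute)
qed

definition weighted_ito_error ::
  "(real \<Rightarrow> 'w \<Rightarrow> real) \<Rightarrow> (real \<Rightarrow> 'w \<Rightarrow> real) \<Rightarrow> (real \<Rightarrow> 'w \<Rightarrow> real) \<Rightarrow> real \<Rightarrow> nat \<Rightarrow> nat \<Rightarrow> 'w \<Rightarrow> real" where
  "weighted_ito_error G H I t m i \<omega> = G (grid T t m i) \<omega> *
     (I (grid T t m (Suc i)) \<omega> - I (grid T t m i) \<omega> - H (grid T t m i) \<omega> * (W (grid T t m (Suc i)) \<omega> - W (grid T t m i) \<omega>))"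

text \<open>The quadratic variation of the error is an integral of the squared oscillation of
  \<open>H\<close> on each cell, weighted by the square of \<open>G\<close>; it vanishes pathwise by
  continuity. The choice of groups decides whether the total error or the sum of squared errors is
  controlled.\<close>

lemma grouped_ito_error_limit:
  assumes I: "has_ito_integral M F T W H I" and H: "cont_adapted H" and G: "cont_adapted G"
    and t: "t \<in> {0..T}"
    and fin: "\<And>m. finite (C m)" and part: "\<And>m c. c \<in> C m \<Longrightarrow> K m c \<subseteq> {..<Suc m}" "\<And>m. disjoint_family_on (K m) (C m)"
  shows "tends_in_prob M (\<lambda>m \<omega>. \<Sum>c\<in>C m. (\<Sum>i\<in>K m c. weighted_ito_error G H I t m i \<omega>)\<^sup>2) (\<lambda>_. 0)"
proof -
  let ?p = "grid T t"
  have t': "0 \<le> t" "t \<le> T" using t by auto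
  have IM: "I s \<in> borel_measurable M" if "s \<in> {0..T}" for s
    using I that measurable_F[of "I s" s] unfolding has_ito_integral_def adapted_def by auto
  have err: "weighted_ito_error G H I t m i \<in> borel_measurable M" for m i
    unfolding weighted_ito_error_def
    using cont_adapted_measM[OF G grid_in[OF t, of m i]] cont_adapted_measM[OF H grid_in[OF t, of m i]]
      W_measurableM[OF grid_in[OF t, of m i]] W_measurableM[OF grid_in[OF t, of m "Suc i"]]
      IM[OF grid_in[OF t, of m i]] IM[OF grid_in[OF t, of m "Suc i"]] by measurable
  define B where "B m \<omega> = (\<Sum>i<Suc m. (G (?p m i) \<omega>)\<^sup>2 * integral {?p m i..?p m (Suc i)} (\<lambda>s. (H s \<omega> - H (?p m i) \<omega>)\<^sup>2))" for m \<omega>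
  have B: "tends_in_prob M B (\<lambda>_. 0)"
  proof (rule tends_in_prob_AE)
    show "B m \<in> borel_measurable M" for m
      unfolding B_def
    proof (intro borel_measurable_sum borel_measurable_times borel_measurable_power cont_adapted_measM[OF G] grid_in t)
      fix i
      show "(\<lambda>\<omega>. integral {?p m i..?p m (Suc i)} (\<lambda>s. (H s \<omega> - H (?p m i) \<omega>)\<^sup>2)) \<in> borel_measurable M"
      proof (rule borel_measurable_integral_interval)
        fix s assume "s \<in> {?p m i..?p m (Suc i)}"
        then have "s \<in> {0..T}" using grid_in[OF t, of m i] grid_in[OF t, of m "Suc i"] by auto
        then show "(\<lambda>\<omega>. (H s \<omega> - H (?p m i) \<omega>)\<^sup>2) \<in> borel_measurable M"
          using cont_adapted_measM[OF H] grid_in[OF t, of m i] by auto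
      next
        fix \<omega> assume "\<omega> \<in> space M"
        then show "continuous_on {?p m i..?p m (Suc i)} (\<lambda>s. (H s \<omega> - H (?p m i) \<omega>)\<^sup>2)"
          using grid_in[OF t, of m i] grid_in[OF t, of m "Suc i"]
          by (intro continuous_intros continuous_on_subset[OF cont_adapted_cont[OF H, of \<omega> T]]) auto
      qed (rule grid_mono_Suc)
    qed
    show "AE \<omega> in M. (\<lambda>m. B m \<omega>) \<longlonglongrightarrow> 0"
    proof (rule AE_I2)
      fix \<omega> assume \<omega>: "\<omega> \<in> space M"
      note Hc = cont_adapted_cont[OF H \<omega> t'(2)] and Gc = cont_adapted_cont[OF G \<omega> t'(2)]
      \<comment> \<open>This function of node and time vanishes on the diagonal, hence so does the
        limit of the sums.\<close>
      have c: "continuous_on ({0..t} \<times> {0..t}) (\<lambda>z. (G (fst z) \<omega>)\<^sup>2 * (H (snd z) \<omega> - H (fst z) \<omega>)\<^sup>2)"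
        using continuous_on_fst_interval[OF Hc] continuous_on_snd_interval[OF Hc] continuous_on_fst_interval[OF Gc]
        by (intro continuous_intros)
      show "(\<lambda>m. B m \<omega>) \<longlonglongrightarrow> 0"
        using grid_integral_limit[OF t' c] by (simp add: B_def[abs_def] del: sum.lessThan_Suc)
    qed
  qed auto
  have B_nonneg: "0 \<le> B m \<omega>" for m \<omega>
  proof -
    \<comment> \<open>The sign is claimed for all points, including those outside the space, where
      the integrand may fail to be integrable and the integral defaults to 0.\<close>
    have "0 \<le> integral S (\<lambda>s. (f s)\<^sup>2)" for S and f :: "real \<Rightarrow> real"
      by (cases "(\<lambda>s. (f s)\<^sup>2) integrable_on S") (auto intro: integral_nonneg simp: not_integrable_integral)
    then show ?thesis unfolding B_def by (intro sum_nonneg mult_nonneg_nonneg) auto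
  qed
  show ?thesis
  proof (rule tends_in_prob_zero_dominated[OF B, where c=2 and d="1/4"])
    show "(\<lambda>\<omega>. \<Sum>c\<in>C m. (\<Sum>i\<in>K m c. weighted_ito_error G H I t m i \<omega>)\<^sup>2) \<in> borel_measurable M" for m
      using err by (intro borel_measurable_sum borel_measurable_power)
    fix m and e \<delta> :: real assume pos: "0 < e" "0 < \<delta>"
    have "measure M {\<omega>\<in>space M. e < (\<Sum>c\<in>C m. (\<Sum>i\<in>K m c. weighted_ito_error G H I t m i \<omega>)\<^sup>2)}
        \<le> 2 * \<delta> / e + measure M {\<omega>\<in>space M. 1 / 4 * \<delta> < B m \<omega>}"
      unfolding weighted_ito_error_def B_def
    proof (rule ito_increment_tail_bound[OF I H _ _ _ _ _ fin part pos])
      show "0 \<le> ?p m 0" "?p m (Suc m) \<le> T" "?p m i \<le> ?p m (Suc i)" for i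
        using grid_in[OF t, of m 0] grid_in[OF t, of m "Suc m"] grid_mono_Suc by auto
      show "G (?p m i) \<in> borel_measurable (F (?p m i))" "H (?p m i) \<in> borel_measurable (F (?p m i))" for i
        using cont_adapted_meas[OF G grid_in[OF t]] cont_adapted_meas[OF H grid_in[OF t]] by auto
    qed auto
    then show "measure M {\<omega>\<in>space M. e < \<bar>\<Sum>c\<in>C m. (\<Sum>i\<in>K m c. weighted_ito_error G H I t m i \<omega>)\<^sup>2\<bar>}
        \<le> 2 * \<delta> / e + measure M {\<omega>\<in>space M. 1 / 4 * \<delta> < \<bar>B m \<omega>\<bar>}"
      using B_nonneg by (simp add: abs_of_nonneg sum_nonneg)
  qed auto
qed

lemma weighted_ito_error_limit:
  assumes I: "has_ito_integral M F T W H I" and H: "cont_adapted H" and G: "cont_adapted G"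
    and t: "t \<in> {0..T}"
  shows "tends_in_prob M (\<lambda>m \<omega>. \<Sum>i<Suc m. weighted_ito_error G H I t m i \<omega>) (\<lambda>_. 0)"
proof (rule tends_in_prob_zero_sqrt)
  show "tends_in_prob M (\<lambda>m \<omega>. (\<Sum>i<Suc m. weighted_ito_error G H I t m i \<omega>)\<^sup>2) (\<lambda>_. 0)"
    using grouped_ito_error_limit[OF assms, of "\<lambda>_. {0::nat}" "\<lambda>m _. {..<Suc m}"]
    by (simp add: disjoint_family_on_def del: sum.lessThan_Suc)
  fix m
  have IM: "I s \<in> borel_measurable M" if "s \<in> {0..T}" for s
    using I that measurable_F[of "I s" s] unfolding has_ito_integral_def adapted_def by auto
  show "(\<lambda>\<omega>. \<Sum>i<Suc m. weighted_ito_error G H I t m i \<omega>) \<in> borel_measurable M"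
    unfolding weighted_ito_error_def
    using cont_adapted_measM[OF G grid_in[OF t]] cont_adapted_measM[OF H grid_in[OF t]]
      W_measurableM[OF grid_in[OF t]] IM[OF grid_in[OF t]]
    by (intro borel_measurable_sum borel_measurable_times borel_measurable_diff)
qed

lemma quadratic_ito_error_limit:
  assumes I: "has_ito_integral M F T W H I" and H: "cont_adapted H" and t: "t \<in> {0..T}"
  shows "tends_in_prob M (\<lambda>m \<omega>. \<Sum>i<Suc m. (weighted_ito_error (\<lambda>_ _. 1) H I t m i \<omega>)\<^sup>2) (\<lambda>_. 0)"
  using grouped_ito_error_limit[OF I H cont_adapted_const t, of "\<lambda>m. {..<Suc m}" "\<lambda>m i. {i}" 1]
  by (simp add: disjoint_family_on_def del: sum.lessThan_Suc)

text \<open>Step functions frozen at the left nodes of a grid of \<open>[0,t]\<close> are jointly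
  measurable and converge by continuity. The time 0 lies in no half-open cell and is restored by the
  indicator of \<open>{0}\<close>.\<close>

lemma cont_adapted_progressive:
  assumes H: "cont_adapted H" and t: "t \<in> {0..T}"
  shows "(\<lambda>(s, \<omega>). H s \<omega>) \<in> borel_measurable (restrict_space borel {0..t} \<Otimes>\<^sub>M F t)"
proof (rule borel_measurable_LIMSEQ_real)
  let ?p = "grid T t"
  have t': "0 \<le> t" "t \<le> T" using t by auto
  let ?f = "\<lambda>m (s, \<omega>). simple_process (Suc m) (?p m) (\<lambda>i. H (?p m i)) s \<omega> + indicator {0} s * H 0 \<omega>"
  fix z assume "z \<in> space (restrict_space borel {0..t} \<Otimes>\<^sub>M F t)"
  then obtain s \<omega> where z: "z = (s, \<omega>)" and s: "0 \<le> s" "s \<le> t" and \<omega>: "\<omega> \<in> space M"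
    by (auto simp: space_pair_measure space_restrict_space space_F)
  show "(\<lambda>m. ?f m z) \<longlonglongrightarrow> (\<lambda>(s, \<omega>). H s \<omega>) z"
  proof (cases "s = 0")
    case True
    have "simple_process (Suc m) (?p m) (\<lambda>i. H (?p m i)) 0 \<omega> = 0" for m
      unfolding simple_process_def using grid_in[OF t, of m] by (intro sum.neutral) (auto simp: indicator_def not_less)
    then show ?thesis by (simp add: z True)
  next
    case False
    have "\<exists>k<Suc m. ?p m k < s \<and> s \<le> ?p m (Suc k)" for m
      using s False t' by (intro node_interval_exists) (auto simp: grid_first grid_last)
    then obtain k where k: "\<And>m. k m < Suc m" "\<And>m. ?p m (k m) < s" "\<And>m. s \<le> ?p m (Suc (k m))" by metis
    have sp: "simple_process (Suc m) (?p m) (\<lambda>i. H (?p m i)) s \<omega> = H (?p m (k m)) \<omega>" for m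
      using k grid_mono_Suc by (intro simple_process_eq) auto
    have "(\<lambda>m. ?p m (k m)) \<longlonglongrightarrow> s"
    proof (rule tendsto_sandwich)
      show "\<forall>\<^sub>F m in sequentially. s - T / real (Suc m) \<le> ?p m (k m)"
        using k(3) grid_step[of T t _ "k _"] T_pos by (auto intro!: always_eventually) (smt (verit))
      show "\<forall>\<^sub>F m in sequentially. ?p m (k m) \<le> s" using k(2) by (auto intro!: always_eventually less_imp_le)
      have "(\<lambda>m. s - T * inverse (real (Suc m))) \<longlonglongrightarrow> s - T * 0"
        by (intro tendsto_intros LIMSEQ_inverse_real_of_nat)
      then show "(\<lambda>m. s - T / real (Suc m)) \<longlonglongrightarrow> s" by (simp add: divide_inverse)
    qed simp
    then have "(\<lambda>m. H (?p m (k m)) \<omega>) \<longlonglongrightarrow> H s \<omega>"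
      using s grid_in[OF t] k(2) by (intro continuous_on_tendsto_compose[OF cont_adapted_cont[OF H \<omega> t'(2)]])
        (auto intro!: always_eventually simp: grid_le)
    then show ?thesis using False by (simp add: z sp)
  qed
next
  fix m
  have meas: "(\<lambda>z. H r (snd z)) \<in> borel_measurable (restrict_space borel {0..t} \<Otimes>\<^sub>M F t)" if "r \<in> {0..t}" for r
    using measurable_F_mono[OF cont_adapted_meas[OF H, of r], of t] that t
    by (intro measurable_compose[OF measurable_snd]) auto
  have ind: "(\<lambda>z. indicator A (fst z) :: real) \<in> borel_measurable (restrict_space borel {0..t} \<Otimes>\<^sub>M F t)" if "A \<in> sets borel" for A
    using that by (intro measurable_compose[OF measurable_fst] measurable_restrict_space1) auto
  have r: "grid T t m i \<in> {0..t}" for i using grid_in[OF t, of m i] grid_le by auto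
  show "(\<lambda>(s, \<omega>). simple_process (Suc m) (grid T t m) (\<lambda>i. H (grid T t m i)) s \<omega> + indicator {0} s * H 0 \<omega>)
      \<in> borel_measurable (restrict_space borel {0..t} \<Otimes>\<^sub>M F t)"
    unfolding simple_process_def case_prod_beta using r t
    by (intro borel_measurable_add borel_measurable_sum borel_measurable_times meas ind) auto
qed

lemma cont_adapted_ito_integrand:
  assumes H: "cont_adapted H" shows "ito_integrand M F T H"
  unfolding ito_integrand_def
proof (intro conjI ballI cont_adapted_progressive[OF H] AE_I2)
  fix \<omega> assume "\<omega> \<in> space M"
  then show "set_integrable lborel {0..T} (\<lambda>s. (H s \<omega>)\<^sup>2)"
    using cont_adapted_cont[OF H, of \<omega> T] by (intro borel_integrable_atLeastAtMost' continuous_intros) auto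
qed

text \<open>Every positive time up to \<open>T\<close> lies in exactly one half-open cell; the time
  0, which lies in none, is a null set.\<close>

lemma simple_process_L2_distance:
  assumes \<tau>: "\<forall>i<n. \<tau> i \<le> \<tau> (Suc i)" "\<tau> 0 = 0" "\<tau> n = T" and c: "continuous_on {0..T} h"
  shows "(LINT s:{0..T}|lborel. (simple_process n \<tau> \<xi> s \<omega> - h s)\<^sup>2)
    = (\<Sum>i<n. integral {\<tau> i..\<tau> (Suc i)} (\<lambda>s. (\<xi> i \<omega> - h s)\<^sup>2))"
proof -
  have b: "0 \<le> \<tau> i" "\<tau> i \<le> T" if "i \<le> n" for i
    using mono_nodes[OF \<tau>(1), of 0 i] mono_nodes[OF \<tau>(1), of i n] \<tau>(2,3) that by auto
  have ci: "continuous_on {\<tau> i..\<tau> (Suc i)} (\<lambda>s. (\<xi> i \<omega> - h s)\<^sup>2)" if "i < n" for i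
    using b[of i] b[of "Suc i"] that by (intro continuous_intros continuous_on_subset[OF c]) auto
  have eq: "indicator {0..T} s * (simple_process n \<tau> \<xi> s \<omega> - h s)\<^sup>2
      = (\<Sum>i<n. indicator {\<tau> i<..\<tau> (Suc i)} s * (\<xi> i \<omega> - h s)\<^sup>2)" if "s \<noteq> 0" for s
  proof (cases "s \<in> {0..T}")
    case True
    then have "\<exists>k<n. \<tau> k < s \<and> s \<le> \<tau> (Suc k)"
      using \<tau> that by (intro node_interval_exists) auto
    then obtain k where k: "k < n" "\<tau> k < s" "s \<le> \<tau> (Suc k)" by blast
    have "(\<Sum>i<n. indicator {\<tau> i<..\<tau> (Suc i)} s * (\<xi> i \<omega> - h s)\<^sup>2) = (\<xi> k \<omega> - h s)\<^sup>2"
      using simple_process_eq[OF \<tau>(1) k, of "\<lambda>i \<omega>. (\<xi> i \<omega> - h s)\<^sup>2" \<omega>]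
      by (simp add: simple_process_def mult.commute)
    then show ?thesis using True simple_process_eq[OF \<tau>(1) k, of \<xi> \<omega>] by simp
  next
    case False
    then have "s \<notin> {\<tau> i<..\<tau> (Suc i)}" if "i < n" for i
      using b[of i] b[of "Suc i"] that by auto
    then have "(\<Sum>i<n. indicator {\<tau> i<..\<tau> (Suc i)} s * (\<xi> i \<omega> - h s)\<^sup>2) = 0"
      by (intro sum.neutral) (auto simp: indicator_def)
    then show ?thesis using False by simp
  qed
  note int = set_lebesgue_integral_Ioc(1)[OF ci]
  have "(LINT s:{0..T}|lborel. (simple_process n \<tau> \<xi> s \<omega> - h s)\<^sup>2)
      = (\<integral>s. (\<Sum>i<n. indicator {\<tau> i<..\<tau> (Suc i)} s * (\<xi> i \<omega> - h s)\<^sup>2) \<partial>lborel)"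
    unfolding set_lebesgue_integral_def real_scaleR_def
  proof (rule integral_cong_AE)
    show "AE s in lborel. indicator {0..T} s * (simple_process n \<tau> \<xi> s \<omega> - h s)\<^sup>2
      = (\<Sum>i<n. indicator {\<tau> i<..\<tau> (Suc i)} s * (\<xi> i \<omega> - h s)\<^sup>2)"
      using AE_lborel_singleton[of 0] by eventually_elim (rule eq)
    have meas: "(\<lambda>s. indicator {0..T} s * h s) \<in> borel_measurable borel"
      using borel_measurable_continuous_on_indicator[OF _ c] by simp
    have [measurable]: "(\<lambda>s. simple_process n \<tau> \<xi> s \<omega>) \<in> borel_measurable borel"
      unfolding simple_process_def by measurable
    have eq: "indicator {0..T} s * (simple_process n \<tau> \<xi> s \<omega> - h s)\<^sup>2
       = indicator {0..T} s * (simple_process n \<tau> \<xi> s \<omega> - indicator {0..T} s * h s)\<^sup>2" for s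
      by (auto simp: indicator_def)
    show "(\<lambda>s. indicator {0..T} s * (simple_process n \<tau> \<xi> s \<omega> - h s)\<^sup>2) \<in> borel_measurable lborel"
      unfolding eq using meas by measurable
    show "(\<lambda>s. \<Sum>i<n. indicator {\<tau> i<..\<tau> (Suc i)} s * (\<xi> i \<omega> - h s)\<^sup>2) \<in> borel_measurable lborel"
      using int by (intro borel_measurable_sum) auto
  qed
  also have "\<dots> = (\<Sum>i<n. integral {\<tau> i..\<tau> (Suc i)} (\<lambda>s. (\<xi> i \<omega> - h s)\<^sup>2))"
    using int set_lebesgue_integral_Ioc(2)[OF ci]
    by (subst Bochner_Integration.integral_sum) (auto simp del: indicator_simps)
  finally show ?thesis .
qed

section \<open>Riemann sums as a characterisation of the Ito integral\<close>

definition ito_sum :: "(real \<Rightarrow> 'w \<Rightarrow> real) \<Rightarrow> nat \<Rightarrow> real \<Rightarrow> 'w \<Rightarrow> real" where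
  "ito_sum H m t \<omega> = (\<Sum>i<Suc m. H (grid T t m i) \<omega> * (W (grid T t m (Suc i)) \<omega> - W (grid T t m i) \<omega>))"

lemma ito_sum_measurable:
  "cont_adapted H \<Longrightarrow> t \<in> {0..T} \<Longrightarrow> ito_sum H m t \<in> borel_measurable M"
  unfolding ito_sum_def using cont_adapted_measM[OF _ grid_in] W_measurableM[OF grid_in]
  by (intro borel_measurable_sum borel_measurable_times borel_measurable_diff)

text \<open>The definition asks for bounded step values and for one sequence of simple processes
  that serves every \<open>t\<close>. Clamping \<open>H\<close> at level \<open>m\<close> on the
  grid of \<open>[0,T]\<close> provides both, and on each path the clamp is eventually inactive
  because the path is bounded.\<close>

lemma has_ito_integralI:
  assumes H: "cont_adapted H" and I: "cont_adapted I"
    and lim: "\<And>t. t \<in> {0..T} \<Longrightarrow> tends_in_prob M (\<lambda>m. ito_sum H m t) (I t)"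
  shows "has_ito_integral M F T W H I"
  unfolding has_ito_integral_def
proof (intro conjI exI allI ballI)
  let ?\<tau> = "\<lambda>m. grid T T m"
  let ?\<xi> = "\<lambda>m i \<omega>. max (- real m) (min (real m) (H (?\<tau> m i) \<omega>))"
  have TT: "T \<in> {0..T}" using T_pos by simp
  have \<tau>: "\<forall>i<Suc m. ?\<tau> m i \<le> ?\<tau> m (Suc i)" "?\<tau> m 0 = 0" "?\<tau> m (Suc m) = T" for m
    using T_pos by (auto simp: grid_mono_Suc grid_first grid_last)
  have \<xi>: "?\<xi> m i \<in> borel_measurable (F (?\<tau> m i))" for m i
    using cont_adapted_meas[OF H grid_in[OF TT]] by (intro borel_measurable_max borel_measurable_min) auto
  have \<xi>M: "?\<xi> m i \<in> borel_measurable M" for m i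
    using measurable_F[OF \<xi> grid_in[OF TT]] .
  show "ito_integrand M F T H" by (rule cont_adapted_ito_integrand[OF H])
  show "adapted F T I" "AE \<omega> in M. continuous_on {0..T} (\<lambda>t. I t \<omega>)"
    using I by (auto simp: cont_adapted_def)
  show "simple_integrand M F T (Suc m) (?\<tau> m) (?\<xi> m)" for m
    unfolding simple_integrand_def using \<tau>[of m] \<xi> by (auto intro!: exI[of _ "real m"])
  have clamp: "eventually (\<lambda>m. \<forall>i. ?\<xi> m i \<omega> = H (?\<tau> m i) \<omega>) sequentially" if \<omega>: "\<omega> \<in> space M" for \<omega>
  proof -
    have "bounded ((\<lambda>s. H s \<omega>) ` {0..T})"
      using cont_adapted_cont[OF H \<omega>, of T] by (intro compact_imp_bounded compact_continuous_image) auto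
    then obtain B where B: "\<And>s. s \<in> {0..T} \<Longrightarrow> \<bar>H s \<omega>\<bar> \<le> B"
      unfolding bounded_iff by (metis imageI real_norm_def)
    obtain n0 :: nat where n0: "B \<le> real n0" using real_arch_simple by blast
    have "\<forall>i. ?\<xi> m i \<omega> = H (?\<tau> m i) \<omega>" if "m \<ge> n0" for m
    proof
      fix i
      have "\<bar>H (?\<tau> m i) \<omega>\<bar> \<le> real m" using B[OF grid_in[OF TT, of m i]] n0 that by simp
      then show "?\<xi> m i \<omega> = H (?\<tau> m i) \<omega>" by (auto simp: min_def max_def)
    qed
    then show ?thesis unfolding eventually_sequentially by blast
  qed
  have dist: "(LINT s:{0..T}|lborel. (simple_process (Suc m) (?\<tau> m) (?\<xi> m) s \<omega> - H s \<omega>)\<^sup>2)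
      = (\<Sum>i<Suc m. integral {?\<tau> m i..?\<tau> m (Suc i)} (\<lambda>s. (?\<xi> m i \<omega> - H s \<omega>)\<^sup>2))" if "\<omega> \<in> space M" for m \<omega>
    using cont_adapted_cont[OF H that, of T] by (intro simple_process_L2_distance \<tau>) auto
  show "tends_in_prob M (\<lambda>m \<omega>. LINT s:{0..T}|lborel. (simple_process (Suc m) (?\<tau> m) (?\<xi> m) s \<omega> - H s \<omega>)\<^sup>2) (\<lambda>_. 0)"
  proof (rule tends_in_prob_AE)
    fix m
    have "(\<lambda>\<omega>. \<Sum>i<Suc m. integral {?\<tau> m i..?\<tau> m (Suc i)} (\<lambda>s. (?\<xi> m i \<omega> - H s \<omega>)\<^sup>2)) \<in> borel_measurable M"
    proof (intro borel_measurable_sum borel_measurable_integral_interval)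
      fix i s assume "s \<in> {?\<tau> m i..?\<tau> m (Suc i)}"
      then have "s \<in> {0..T}" using grid_in[OF TT, of m i] grid_in[OF TT, of m "Suc i"] by auto
      then show "(\<lambda>\<omega>. (?\<xi> m i \<omega> - H s \<omega>)\<^sup>2) \<in> borel_measurable M"
        using cont_adapted_measM[OF H] \<xi>M by (intro borel_measurable_power borel_measurable_diff)
    next
      fix i \<omega> assume "\<omega> \<in> space M"
      then show "continuous_on {?\<tau> m i..?\<tau> m (Suc i)} (\<lambda>s. (?\<xi> m i \<omega> - H s \<omega>)\<^sup>2)"
        using grid_in[OF TT, of m i] grid_in[OF TT, of m "Suc i"]
        by (intro continuous_intros continuous_on_subset[OF cont_adapted_cont[OF H, of \<omega> T]]) auto
    qed (rule grid_mono_Suc)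
    then show "(\<lambda>\<omega>. LINT s:{0..T}|lborel. (simple_process (Suc m) (?\<tau> m) (?\<xi> m) s \<omega> - H s \<omega>)\<^sup>2) \<in> borel_measurable M"
      by (subst measurable_cong[OF dist])
  next
    show "AE \<omega> in M. (\<lambda>m. LINT s:{0..T}|lborel. (simple_process (Suc m) (?\<tau> m) (?\<xi> m) s \<omega> - H s \<omega>)\<^sup>2) \<longlonglongrightarrow> 0"
    proof (rule AE_I2)
      fix \<omega> assume \<omega>: "\<omega> \<in> space M"
      note Hc = cont_adapted_cont[OF H \<omega>, of T, simplified]
      have c: "continuous_on ({0..T} \<times> {0..T}) (\<lambda>z. (H (fst z) \<omega> - H (snd z) \<omega>)\<^sup>2)"
        using continuous_on_fst_interval[OF Hc] continuous_on_snd_interval[OF Hc] by (intro continuous_intros)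
      have "(\<lambda>m. \<Sum>i<Suc m. integral {?\<tau> m i..?\<tau> m (Suc i)} (\<lambda>s. (H (?\<tau> m i) \<omega> - H s \<omega>)\<^sup>2)) \<longlonglongrightarrow> 0"
        using grid_integral_limit[OF _ _ c, of T] T_pos by (simp del: sum.lessThan_Suc)
      moreover have "\<forall>\<^sub>F m in sequentially. (LINT s:{0..T}|lborel. (simple_process (Suc m) (?\<tau> m) (?\<xi> m) s \<omega> - H s \<omega>)\<^sup>2)
         = (\<Sum>i<Suc m. integral {?\<tau> m i..?\<tau> m (Suc i)} (\<lambda>s. (H (?\<tau> m i) \<omega> - H s \<omega>)\<^sup>2))"
        using clamp[OF \<omega>] by eventually_elim (simp only: dist[OF \<omega>])
      ultimately show "(\<lambda>m. LINT s:{0..T}|lborel. (simple_process (Suc m) (?\<tau> m) (?\<xi> m) s \<omega> - H s \<omega>)\<^sup>2) \<longlonglongrightarrow> 0"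
        by (simp only: tendsto_cong)
    qed
  qed auto
  show "tends_in_prob M (\<lambda>m. simple_ito W (Suc m) (?\<tau> m) (?\<xi> m) t) (I t)" if t: "t \<in> {0..T}" for t
  proof -
    have gridT: "min t (?\<tau> m i) = grid T t m i" for m i
      using t by (auto simp: grid_def)
    \<comment> \<open>The two sums evaluate \<open>H\<close> at different nodes beyond
      \<open>t\<close>, but there the increment of \<open>W\<close> is 0 in both.\<close>
    have sum_eq: "ito_sum H m t \<omega> = (\<Sum>i<Suc m. H (?\<tau> m i) \<omega> * (W (min t (?\<tau> m (Suc i))) \<omega> - W (min t (?\<tau> m i)) \<omega>))" for m \<omega>
      unfolding ito_sum_def
    proof (rule sum.cong[OF refl])
      fix i
      show "H (grid T t m i) \<omega> * (W (grid T t m (Suc i)) \<omega> - W (grid T t m i) \<omega>)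
        = H (?\<tau> m i) \<omega> * (W (min t (?\<tau> m (Suc i))) \<omega> - W (min t (?\<tau> m i)) \<omega>)"
      proof (cases "?\<tau> m i \<le> t")
        case True
        then have "grid T t m i = ?\<tau> m i" using gridT[of m i] by simp
        then show ?thesis by (simp add: gridT)
      next
        case False
        then have "min t (?\<tau> m i) = t" "min t (?\<tau> m (Suc i)) = t"
          using grid_mono_Suc[of T m i] by auto
        then show ?thesis using gridT[of m i] gridT[of m "Suc i"] by simp
      qed
    qed
    show ?thesis
    proof (rule tends_in_prob_combine1[OF lim[OF t]])
      show "simple_ito W (Suc m) (?\<tau> m) (?\<xi> m) t \<in> borel_measurable M" for m
        unfolding simple_ito_def gridT using W_measurableM[OF grid_in[OF t]] \<xi>M
        by (intro borel_measurable_sum borel_measurable_times borel_measurable_diff)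
      show "I t \<in> borel_measurable M" by (rule cont_adapted_measM[OF I t])
      show "AE \<omega> in M. \<forall>r. strict_mono r \<longrightarrow> (\<lambda>m. ito_sum H (r m) t \<omega>) \<longlonglongrightarrow> I t \<omega> \<longrightarrow>
          (\<lambda>m. simple_ito W (Suc (r m)) (?\<tau> (r m)) (?\<xi> (r m)) t \<omega>) \<longlonglongrightarrow> I t \<omega>"
      proof (intro AE_I2 allI impI)
        fix \<omega> and r :: "nat \<Rightarrow> nat" assume \<omega>: "\<omega> \<in> space M" and r: "strict_mono r"
          and l: "(\<lambda>m. ito_sum H (r m) t \<omega>) \<longlonglongrightarrow> I t \<omega>"
        have "\<forall>\<^sub>F m in sequentially. ito_sum H m t \<omega> = simple_ito W (Suc m) (?\<tau> m) (?\<xi> m) t \<omega>"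
          using clamp[OF \<omega>] by eventually_elim (simp only: sum_eq simple_ito_def)
        then have "\<forall>\<^sub>F m in sequentially. ito_sum H (r m) t \<omega> = simple_ito W (Suc (r m)) (?\<tau> (r m)) (?\<xi> (r m)) t \<omega>"
          by (rule eventually_subseq[OF r])
        then show "(\<lambda>m. simple_ito W (Suc (r m)) (?\<tau> (r m)) (?\<xi> (r m)) t \<omega>) \<longlonglongrightarrow> I t \<omega>"
          by (rule Lim_transform_eventually[OF l])
      qed
    qed
  qed
qed

text \<open>Stopped at time 0, all nodes of a simple integrand collapse to 0 and its integral
  vanishes; the limit in probability inherits this up to a null set.\<close>

lemma has_ito_integral_initial:
  assumes I: "has_ito_integral M F T W H I"
  shows "AE \<omega> in M. I 0 \<omega> = 0"
proof -
  obtain n \<tau> \<xi> where si: "\<forall>m. simple_integrand M F T (n m) (\<tau> m) (\<xi> m)"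
    and ito: "\<forall>t\<in>{0..T}. tends_in_prob M (\<lambda>m. simple_ito W (n m) (\<tau> m) (\<xi> m) t) (I t)"
    using I unfolding has_ito_integral_def by (elim conjE exE) (rule that)
  have "simple_ito W (n m) (\<tau> m) (\<xi> m) 0 = (\<lambda>_. 0)" for m
  proof
    fix \<omega>
    have mono: "\<forall>i<n m. \<tau> m i \<le> \<tau> m (Suc i)" "0 \<le> \<tau> m 0" using si by (auto simp: simple_integrand_def)
    have "0 \<le> \<tau> m i" if "i \<le> n m" for i using mono_nodes[OF mono(1), of 0 i] mono(2) that by simp
    then show "simple_ito W (n m) (\<tau> m) (\<xi> m) 0 \<omega> = 0"
      unfolding simple_ito_def by (intro sum.neutral) (auto simp: min_def)
  qed
  then have "tends_in_prob M (\<lambda>m _. 0) (I 0)" using ito[rule_format, of 0] T_pos by simp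
  moreover have "tends_in_prob M (\<lambda>m _. 0) (\<lambda>_. 0)" by (rule tends_in_prob_const) simp
  ultimately show ?thesis using tends_in_prob_unique by blast
qed

text \<open>An Ito differential with continuous adapted coefficients whose integral is pinned to
  concrete Riemann sums. Rules of calculus thereby become statements about sums at a fixed time, and
  a continuous version of the integral comes for free as \<open>X\<close> minus its initial value
  and drift.\<close>

definition ito_process ::
  "(real \<Rightarrow> 'w \<Rightarrow> real) \<Rightarrow> (real \<Rightarrow> 'w \<Rightarrow> real) \<Rightarrow> (real \<Rightarrow> 'w \<Rightarrow> real) \<Rightarrow> bool" where
  "ito_process X A H \<longleftrightarrow> cont_adapted X \<and> cont_adapted A \<and> cont_adapted H \<and>
     (\<forall>t\<in>{0..T}. tends_in_prob M (\<lambda>m. ito_sum H m t) (\<lambda>\<omega>. X t \<omega> - X 0 \<omega> - integral {0..t} (\<lambda>s. A s \<omega>)))"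

lemma ito_process_integral:
  assumes "ito_process X A H"
  shows "has_ito_integral M F T W H (\<lambda>t \<omega>. X t \<omega> - X 0 \<omega> - integral {0..t} (\<lambda>s. A s \<omega>))"
    "cont_adapted (\<lambda>t \<omega>. X t \<omega> - X 0 \<omega> - integral {0..t} (\<lambda>s. A s \<omega>))"
proof -
  have X: "cont_adapted X" and A: "cont_adapted A" using assms by (auto simp: ito_process_def)
  have "cont_adapted (\<lambda>t \<omega>. X 0 \<omega>)"
    using measurable_F_mono[OF cont_adapted_meas[OF X, of 0]] T_pos
    unfolding cont_adapted_def adapted_def by auto
  then show "cont_adapted (\<lambda>t \<omega>. X t \<omega> - X 0 \<omega> - integral {0..t} (\<lambda>s. A s \<omega>))"
    by (intro cont_adapted_diff cont_adapted_integral X A)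
  then show "has_ito_integral M F T W H (\<lambda>t \<omega>. X t \<omega> - X 0 \<omega> - integral {0..t} (\<lambda>s. A s \<omega>))"
    using assms unfolding ito_process_def by (intro has_ito_integralI) auto
qed

lemma ito_process_differential:
  assumes "ito_process X A H"
  shows "has_ito_differential M F T W X A H"
  unfolding has_ito_differential_def
proof (intro exI[of _ "\<lambda>t \<omega>. X t \<omega> - X 0 \<omega> - integral {0..t} (\<lambda>s. A s \<omega>)"] conjI
    ito_process_integral(1)[OF assms] AE_I2 ballI)
  fix \<omega> t assume "\<omega> \<in> space M" "t \<in> {0..T}"
  then show "(\<lambda>s. A s \<omega>) integrable_on {0..t}"
    using assms cont_adapted_cont[of A \<omega> t] by (intro integrable_continuous_real) (auto simp: ito_process_def)
qed simp

text \<open>With weight 1 the local errors sum to the telescoped increment of the integral minus the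
  Riemann sum, and this total vanishes in probability. The drift may be specified by a differential
  that holds only almost surely.\<close>

lemma ito_processI:
  assumes d: "has_ito_differential M F T W X A H" and ca: "cont_adapted X" "cont_adapted A" "cont_adapted H"
  shows "ito_process X A H"
  unfolding ito_process_def
proof (intro conjI ca ballI)
  fix t assume t: "t \<in> {0..T}"
  obtain I where I: "has_ito_integral M F T W H I"
    and AE: "AE \<omega> in M. \<forall>t\<in>{0..T}. (\<lambda>s. A s \<omega>) integrable_on {0..t} \<and>
      X t \<omega> = X 0 \<omega> + integral {0..t} (\<lambda>s. A s \<omega>) + I t \<omega>"
    using d unfolding has_ito_differential_def by blast
  have IM: "I s \<in> borel_measurable M" if "s \<in> {0..T}" for s
    using I that measurable_F[of "I s" s] unfolding has_ito_integral_def adapted_def by auto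
  have "tends_in_prob M (\<lambda>m \<omega>. (I t \<omega> - I 0 \<omega>) - (\<Sum>i<Suc m. weighted_ito_error (\<lambda>_ _. 1) H I t m i \<omega>)) (\<lambda>\<omega>. (I t \<omega> - I 0 \<omega>) - 0)"
    using IM t by (intro tends_in_prob_diff tends_in_prob_const weighted_ito_error_limit I ca cont_adapted_const) auto
  moreover have "(I t \<omega> - I 0 \<omega>) - (\<Sum>i<Suc m. weighted_ito_error (\<lambda>_ _. 1) H I t m i \<omega>) = ito_sum H m t \<omega>" for m \<omega>
  proof -
    have "(\<Sum>i<Suc m. I (grid T t m (Suc i)) \<omega> - I (grid T t m i) \<omega>) = I t \<omega> - I 0 \<omega>"
      using t sum_lessThan_telescope[of "\<lambda>i. I (grid T t m i) \<omega>" "Suc m"] by (simp add: grid_first grid_last)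
    then show ?thesis
      by (simp add: weighted_ito_error_def ito_sum_def sum_subtractf del: sum.lessThan_Suc)
  qed
  ultimately have lim: "tends_in_prob M (\<lambda>m. ito_sum H m t) (\<lambda>\<omega>. I t \<omega> - I 0 \<omega>)"
    by (simp del: sum.lessThan_Suc)
  show "tends_in_prob M (\<lambda>m. ito_sum H m t) (\<lambda>\<omega>. X t \<omega> - X 0 \<omega> - integral {0..t} (\<lambda>s. A s \<omega>))"
  proof (rule tends_in_prob_cong_AE[OF lim])
    show "ito_sum H m t \<in> borel_measurable M" for m by (rule ito_sum_measurable[OF ca(3) t])
    show "(\<lambda>\<omega>. X t \<omega> - X 0 \<omega> - integral {0..t} (\<lambda>s. A s \<omega>)) \<in> borel_measurable M"
      using cont_adapted_measM[OF ca(1)] cont_adapted_measM[OF cont_adapted_integral[OF ca(2)] t] t by auto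
    show "AE \<omega> in M. (\<forall>m. ito_sum H m t \<omega> = ito_sum H m t \<omega>) \<and>
        X t \<omega> - X 0 \<omega> - integral {0..t} (\<lambda>s. A s \<omega>) = I t \<omega> - I 0 \<omega>"
      using AE has_ito_integral_initial[OF I]
    proof eventually_elim
      case (elim \<omega>)
      have "X t \<omega> = X 0 \<omega> + integral {0..t} (\<lambda>s. A s \<omega>) + I t \<omega>" using elim(1) t by blast
      then show ?case using elim(2) by simp
    qed
  qed
qed

end

section \<open>Quadratic variation\<close>

text \<open>Uniform continuity in the form that lets a sum of cubes of increments be bounded by a
  vanishing factor times a sum of squares.\<close>

lemma grid_increment_tendsto:
  fixes f :: "real \<Rightarrow> real"
  assumes "0 \<le> t" "t \<le> T" "continuous_on {0..t} f"
  shows "(\<lambda>m. Max ((\<lambda>i. \<bar>f (grid T t m (Suc i)) - f (grid T t m i)\<bar>) ` {..m})) \<longlonglongrightarrow> 0"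
proof (rule LIMSEQ_I)
  fix e :: real assume "0 < e"
  have "uniformly_continuous_on {0..t} f"
    by (rule compact_uniformly_continuous[OF assms(3)]) simp
  then obtain d where d: "0 < d" "\<And>x y. x \<in> {0..t} \<Longrightarrow> y \<in> {0..t} \<Longrightarrow> dist y x < d \<Longrightarrow> dist (f y) (f x) < e"
    unfolding uniformly_continuous_on_def using \<open>0 < e\<close> by metis
  obtain n0 :: nat where n0: "T / d < real n0" using reals_Archimedean2 by blast
  have "norm (Max ((\<lambda>i. \<bar>f (grid T t m (Suc i)) - f (grid T t m i)\<bar>) ` {..m}) - 0) < e" if "m \<ge> n0" for m
  proof -
    have "T / d < real (Suc m)" using n0 that by simp
    then have step: "T / real (Suc m) < d" using d(1) by (simp add: field_simps)
    have le: "\<bar>f (grid T t m (Suc i)) - f (grid T t m i)\<bar> < e" for i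
    proof -
      have "dist (grid T t m (Suc i)) (grid T t m i) < d"
        using grid_step[of T t m i] grid_mono[of T i "Suc i" t m] step assms(1,2) by (simp add: dist_real_def)
      moreover have "grid T t m i \<in> {0..t}" "grid T t m (Suc i) \<in> {0..t}"
        using grid_nonneg[of t T] grid_le assms(1,2) by auto
      ultimately show ?thesis using d(2) by (simp add: dist_real_def)
    qed
    let ?S = "(\<lambda>i. \<bar>f (grid T t m (Suc i)) - f (grid T t m i)\<bar>) ` {..m}"
    have "Max ?S \<in> ?S" by (rule Max_in) auto
    then obtain i where "Max ?S = \<bar>f (grid T t m (Suc i)) - f (grid T t m i)\<bar>" unfolding image_iff by blast
    then show ?thesis using le[of i] by simp
  qed
  then show "\<exists>no. \<forall>m\<ge>no. norm (Max ((\<lambda>i. \<bar>f (grid T t m (Suc i)) - f (grid T t m i)\<bar>) ` {..m}) - 0) < e"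
    by blast
qed

context brownian_basis
begin

definition grid_diff :: "(real \<Rightarrow> 'w \<Rightarrow> real) \<Rightarrow> real \<Rightarrow> nat \<Rightarrow> nat \<Rightarrow> 'w \<Rightarrow> real" where
  "grid_diff X t m i \<omega> = X (grid T t m (Suc i)) \<omega> - X (grid T t m i) \<omega>"

lemma grid_diff_measurable:
  "cont_adapted X \<Longrightarrow> t \<in> {0..T} \<Longrightarrow> grid_diff X t m i \<in> borel_measurable M"
  unfolding grid_diff_def using cont_adapted_measM[OF _ grid_in] by (intro borel_measurable_diff)

lemma grid_diff_W_measurable: "t \<in> {0..T} \<Longrightarrow> grid_diff W t m i \<in> borel_measurable M"
  unfolding grid_diff_def using W_measurableM[OF grid_in] by (intro borel_measurable_diff)

lemma grid_value_measurable:
  "cont_adapted X \<Longrightarrow> t \<in> {0..T} \<Longrightarrow> X (grid T t m i) \<in> borel_measurable M"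
  by (rule cont_adapted_measM[OF _ grid_in])

lemma sum_grid_diff:
  assumes "t \<in> {0..T}"
  shows "(\<Sum>i<Suc m. grid_diff X t m i \<omega>) = X t \<omega> - X 0 \<omega>"
  using assms sum_lessThan_telescope[of "\<lambda>i. X (grid T t m i) \<omega>" "Suc m"]
  by (simp add: grid_diff_def grid_first grid_last)

lemma cont_adapted_bounded:
  assumes X: "cont_adapted X" and \<omega>: "\<omega> \<in> space M"
  shows "\<exists>B. \<forall>s\<in>{0..T}. \<bar>X s \<omega>\<bar> \<le> B"
proof -
  have "bounded ((\<lambda>s. X s \<omega>) ` {0..T})"
    using cont_adapted_cont[OF X \<omega>, of T] by (intro compact_imp_bounded compact_continuous_image) auto
  then show ?thesis unfolding bounded_iff by (metis imageI real_norm_def)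
qed

lemma ito_process_cont_adapted:
  assumes "ito_process X A H"
  shows "cont_adapted X" "cont_adapted A" "cont_adapted H"
  using assms by (auto simp: ito_process_def)

lemma ito_process_grid_diff:
  assumes X: "ito_process X A H" and t: "t \<in> {0..T}" and \<omega>: "\<omega> \<in> space M"
  shows "grid_diff X t m i \<omega> - H (grid T t m i) \<omega> * grid_diff W t m i \<omega>
    = weighted_ito_error (\<lambda>_ _. 1) H (\<lambda>t \<omega>. X t \<omega> - X 0 \<omega> - integral {0..t} (\<lambda>s. A s \<omega>)) t m i \<omega>
      + integral {grid T t m i..grid T t m (Suc i)} (\<lambda>s. A s \<omega>)"
proof -
  let ?p = "grid T t m"
  have p: "0 \<le> ?p i" "?p i \<le> ?p (Suc i)" "?p (Suc i) \<le> T"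
    using grid_in[OF t, of m i] grid_in[OF t, of m "Suc i"] grid_mono_Suc by auto
  have "(\<lambda>s. A s \<omega>) integrable_on {0..?p (Suc i)}"
    using cont_adapted_cont[OF ito_process_cont_adapted(2)[OF X] \<omega> p(3)] by (rule integrable_continuous_real)
  then have "integral {0..?p i} (\<lambda>s. A s \<omega>) + integral {?p i..?p (Suc i)} (\<lambda>s. A s \<omega>) = integral {0..?p (Suc i)} (\<lambda>s. A s \<omega>)"
    using Henstock_Kurzweil_Integration.integral_combine[OF p(1,2)] by blast
  then show ?thesis by (simp add: weighted_ito_error_def grid_diff_def)
qed

text \<open>Each increment of \<open>X\<close> is a diffusion term frozen at the left node, a local
  Ito error and a drift integral; the weighted errors vanish. The Riemann sum of
  \<open>G * H\<close> stays inside the difference because its own convergence is still unknown: the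
  product rule and the rule for reciprocals deduce it from this lemma.\<close>

lemma weighted_increment_limit:
  assumes X: "ito_process X A H" and G: "cont_adapted G" and t: "t \<in> {0..T}"
  shows "tends_in_prob M (\<lambda>m \<omega>. (\<Sum>i<Suc m. G (grid T t m i) \<omega> * grid_diff X t m i \<omega>) - ito_sum (\<lambda>t \<omega>. G t \<omega> * H t \<omega>) m t \<omega>)
     (\<lambda>\<omega>. integral {0..t} (\<lambda>s. G s \<omega> * A s \<omega>))"
proof -
  note ca = ito_process_cont_adapted[OF X]
  have t': "0 \<le> t" "t \<le> T" using t by auto
  let ?I = "\<lambda>t \<omega>. X t \<omega> - X 0 \<omega> - integral {0..t} (\<lambda>s. A s \<omega>)"
  have 1: "tends_in_prob M (\<lambda>m \<omega>. \<Sum>i<Suc m. weighted_ito_error G H ?I t m i \<omega>) (\<lambda>_. 0)"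
    by (rule weighted_ito_error_limit[OF ito_process_integral(1)[OF X] ca(3) G t])
  have meas: "(\<lambda>\<omega>. (\<Sum>i<Suc m. G (grid T t m i) \<omega> * grid_diff X t m i \<omega>) - ito_sum (\<lambda>t \<omega>. G t \<omega> * H t \<omega>) m t \<omega>) \<in> borel_measurable M" for m
    by (intro borel_measurable_diff borel_measurable_sum borel_measurable_times grid_value_measurable G t
      grid_diff_measurable ca ito_sum_measurable cont_adapted_mult)
  have measI: "(\<lambda>\<omega>. integral {0..t} (\<lambda>s. G s \<omega> * A s \<omega>)) \<in> borel_measurable M"
    by (rule cont_adapted_measM[OF cont_adapted_integral t]) (intro cont_adapted_mult G ca)
  have eq: "(\<Sum>i<Suc m. G (grid T t m i) \<omega> * grid_diff X t m i \<omega>) - ito_sum (\<lambda>t \<omega>. G t \<omega> * H t \<omega>) m t \<omega>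
     = (\<Sum>i<Suc m. weighted_ito_error G H ?I t m i \<omega>)
       + (\<Sum>i<Suc m. integral {grid T t m i..grid T t m (Suc i)} (\<lambda>s. G (grid T t m i) \<omega> * A s \<omega>))"
    if "\<omega> \<in> space M" for m \<omega>
  proof -
    have "(\<Sum>i<Suc m. G (grid T t m i) \<omega> * grid_diff X t m i \<omega>) - ito_sum (\<lambda>t \<omega>. G t \<omega> * H t \<omega>) m t \<omega>
      = (\<Sum>i<Suc m. G (grid T t m i) \<omega> * (grid_diff X t m i \<omega> - H (grid T t m i) \<omega> * grid_diff W t m i \<omega>))"
      unfolding ito_sum_def grid_diff_def[of W] by (simp add: sum_subtractf right_diff_distrib mult.assoc del: sum.lessThan_Suc)
    also have "\<dots> = (\<Sum>i<Suc m. weighted_ito_error G H ?I t m i \<omega> + G (grid T t m i) \<omega> * integral {grid T t m i..grid T t m (Suc i)} (\<lambda>s. A s \<omega>))"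
      unfolding ito_process_grid_diff[OF X t that]
      by (intro sum.cong refl) (simp add: weighted_ito_error_def algebra_simps)
    finally show ?thesis by (simp add: sum.distrib del: sum.lessThan_Suc)
  qed
  show ?thesis
  proof (rule tends_in_prob_combine1[OF 1 meas measI], intro AE_I2 allI impI)
    fix \<omega> and r :: "nat \<Rightarrow> nat" assume \<omega>: "\<omega> \<in> space M" and r: "strict_mono r"
      and l: "(\<lambda>m. \<Sum>i<Suc (r m). weighted_ito_error G H ?I t (r m) i \<omega>) \<longlonglongrightarrow> 0"
    have c: "continuous_on ({0..t} \<times> {0..t}) (\<lambda>z. G (fst z) \<omega> * A (snd z) \<omega>)"
      using cont_adapted_cont[OF G \<omega> t'(2)] cont_adapted_cont[OF ca(2) \<omega> t'(2)]
      by (intro continuous_intros continuous_on_fst_interval continuous_on_snd_interval)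
    have "(\<lambda>m. \<Sum>i<Suc m. integral {grid T t m i..grid T t m (Suc i)} (\<lambda>s. G (grid T t m i) \<omega> * A s \<omega>))
      \<longlonglongrightarrow> integral {0..t} (\<lambda>s. G s \<omega> * A s \<omega>)"
      using grid_integral_limit[OF t' c] by (simp only: fst_conv snd_conv)
    from tendsto_add[OF l LIMSEQ_subseq_LIMSEQ[OF this r]]
    show "(\<lambda>m. (\<Sum>i<Suc (r m). G (grid T t (r m) i) \<omega> * grid_diff X t (r m) i \<omega>) - ito_sum (\<lambda>t \<omega>. G t \<omega> * H t \<omega>) (r m) t \<omega>)
       \<longlonglongrightarrow> integral {0..t} (\<lambda>s. G s \<omega> * A s \<omega>)"
      by (simp only: eq[OF \<omega>] o_def add_0)
  qed
qed

text \<open>The centred squares of the increments are innovations of variance twice the squared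
  step, so the quadratic variation \<open>B\<close> of their weighted sum is bounded by the mesh
  width times a convergent Riemann sum.\<close>

lemma brownian_quadratic_variation:
  assumes G: "cont_adapted G" and t: "t \<in> {0..T}"
  shows "tends_in_prob M (\<lambda>m \<omega>. \<Sum>i<Suc m. G (grid T t m i) \<omega> * (grid_diff W t m i \<omega>)\<^sup>2)
     (\<lambda>\<omega>. integral {0..t} (\<lambda>s. G s \<omega>))"
proof -
  have t': "0 \<le> t" "t \<le> T" using t by auto
  let ?p = "grid T t"
  let ?\<Delta> = "\<lambda>m i. ?p m (Suc i) - ?p m i"
  define B where "B m \<omega> = (\<Sum>i<Suc m. 2 * (?\<Delta> m i)\<^sup>2 * (G (?p m i) \<omega>)\<^sup>2)" for m \<omega>
  have \<Delta>: "0 \<le> ?\<Delta> m i" "?\<Delta> m i \<le> T / real (Suc m)" for m i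
    using grid_mono_Suc[of t m i] grid_step[of T t m i] T_pos by auto
  have B_nonneg: "0 \<le> B m \<omega>" for m \<omega> unfolding B_def by (intro sum_nonneg) auto
  have B: "tends_in_prob M B (\<lambda>_. 0)"
  proof (rule tends_in_prob_AE)
    show "B m \<in> borel_measurable M" for m
      unfolding B_def using grid_value_measurable[OF G t]
      by (intro borel_measurable_sum borel_measurable_times borel_measurable_power) auto
    show "AE \<omega> in M. (\<lambda>m. B m \<omega>) \<longlonglongrightarrow> 0"
    proof (rule AE_I2)
      fix \<omega> assume \<omega>: "\<omega> \<in> space M"
      have c: "continuous_on {0..t} (\<lambda>s. (G s \<omega>)\<^sup>2)" using cont_adapted_cont[OF G \<omega> t'(2)] by (intro continuous_intros)
      let ?R = "\<lambda>m. \<Sum>i<Suc m. (G (?p m i) \<omega>)\<^sup>2 * ?\<Delta> m i"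
      have "(\<lambda>m. (2 * T) * inverse (real (Suc m)) * ?R m) \<longlonglongrightarrow> (2 * T) * 0 * integral {0..t} (\<lambda>s. (G s \<omega>)\<^sup>2)"
        by (intro tendsto_mult tendsto_const LIMSEQ_inverse_real_of_nat grid_riemann_sum_limit[OF t' c])
      then have up: "(\<lambda>m. (2 * T) * inverse (real (Suc m)) * ?R m) \<longlonglongrightarrow> 0" by simp
      have "B m \<omega> \<le> (2 * T) * inverse (real (Suc m)) * ?R m" for m
      proof -
        have "B m \<omega> = (\<Sum>i<Suc m. ?\<Delta> m i * (2 * ((G (?p m i) \<omega>)\<^sup>2 * ?\<Delta> m i)))"
          unfolding B_def by (intro sum.cong refl) (simp add: power2_eq_square)
        also have "\<dots> \<le> (\<Sum>i<Suc m. T / real (Suc m) * (2 * ((G (?p m i) \<omega>)\<^sup>2 * ?\<Delta> m i)))"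
          using \<Delta> by (intro sum_mono mult_right_mono) auto
        also have "\<dots> = (2 * T) * inverse (real (Suc m)) * ?R m"
          unfolding sum_distrib_left by (intro sum.cong refl) (simp add: divide_inverse)
        finally show ?thesis .
      qed
      then show "(\<lambda>m. B m \<omega>) \<longlonglongrightarrow> 0"
        using B_nonneg by (intro tendsto_sandwich[OF _ _ tendsto_const up]) (auto intro!: always_eventually)
    qed
  qed auto
  define N where "N m \<omega> = (\<Sum>i<Suc m. G (?p m i) \<omega> * ((grid_diff W t m i \<omega>)\<^sup>2 - ?\<Delta> m i))" for m \<omega>
  have N_meas: "N m \<in> borel_measurable M" for m
    unfolding N_def using grid_value_measurable[OF G t] grid_diff_W_measurable[OF t]
    by (intro borel_measurable_sum borel_measurable_times borel_measurable_diff borel_measurable_power borel_measurable_const)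
  have N0: "tends_in_prob M N (\<lambda>_. 0)"
  proof (rule tends_in_prob_zero_sqrt[OF _ N_meas])
    show "tends_in_prob M (\<lambda>m \<omega>. (N m \<omega>)\<^sup>2) (\<lambda>_. 0)"
    proof (rule tends_in_prob_zero_dominated[OF B, where c=1 and d=1])
      show "(\<lambda>\<omega>. (N m \<omega>)\<^sup>2) \<in> borel_measurable M" for m using N_meas by (intro borel_measurable_power)
      fix m and e \<delta> :: real assume pos: "0 < e" "0 < \<delta>"
      \<comment> \<open>Cells beyond \<open>t\<close> have length 0; they contribute nothing and do
        not qualify as innovations.\<close>
      let ?L = "{i. i < Suc m \<and> ?p m i < ?p m (Suc i)}"
      let ?d = "\<lambda>i \<omega>. (W (?p m (Suc i)) \<omega> - W (?p m i) \<omega>)\<^sup>2 - ?\<Delta> m i"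
      have fam: "innovation_family ?L (?p m) (\<lambda>i. ?p m (Suc i)) ?d (\<lambda>i. 2 * (?\<Delta> m i)\<^sup>2)"
        unfolding innovation_family_def
      proof (intro conjI ballI impI)
        fix i assume i: "i \<in> ?L"
        show "0 \<le> ?p m i" "?p m i < ?p m (Suc i)" "?p m (Suc i) \<le> T" "0 < 2 * (?\<Delta> m i)\<^sup>2"
          using i grid_in[OF t, of m i] grid_in[OF t, of m "Suc i"] by auto
        then show "innovation (?p m i) (?p m (Suc i)) (?d i) (2 * (?\<Delta> m i)\<^sup>2)"
          by (intro innovation_increment_square)
      next
        fix i j assume "i \<in> ?L" "j \<in> ?L" "i \<noteq> j"
        then show "?p m (Suc i) \<le> ?p m j \<or> ?p m (Suc j) \<le> ?p m i"
          using grid_mono[of T "Suc i" j t m] grid_mono[of T "Suc j" i t m] T_pos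
          by (cases "i < j") auto
      qed simp
      have sum_N: "(\<Sum>i\<in>?L. G (?p m i) \<omega> * ?d i \<omega>) = N m \<omega>" for \<omega>
        unfolding N_def grid_diff_def
      proof (rule sum.mono_neutral_left)
        show "\<forall>i\<in>{..<Suc m} - ?L. G (?p m i) \<omega> * ?d i \<omega> = 0"
        proof
          fix i assume "i \<in> {..<Suc m} - ?L"
          then have "?p m (Suc i) = ?p m i" using grid_mono_Suc[of t m i] by auto
          then show "G (?p m i) \<omega> * ?d i \<omega> = 0" by simp
        qed
      qed auto
      have sum_B: "(\<Sum>i\<in>?L. 2 * (?\<Delta> m i)\<^sup>2 * (G (?p m i) \<omega>)\<^sup>2) \<le> B m \<omega>" for \<omega>
        unfolding B_def by (rule sum_mono2) auto
      have "measure M {\<omega>\<in>space M. e < (\<Sum>c\<in>{0::nat}. (\<Sum>i\<in>?L. G (?p m i) \<omega> * ?d i \<omega>)\<^sup>2)}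
          \<le> \<delta> / e + measure M {\<omega>\<in>space M. \<delta> < (\<Sum>i\<in>?L. 2 * (?\<Delta> m i)\<^sup>2 * (G (?p m i) \<omega>)\<^sup>2)}"
        by (rule innovation_tail_bound[OF fam, where K="\<lambda>i. G (?p m i)" and G="\<lambda>_. ?L"])
          (use pos cont_adapted_meas[OF G grid_in[OF t]] in \<open>auto simp: disjoint_family_on_def\<close>)
      also have "measure M {\<omega>\<in>space M. \<delta> < (\<Sum>i\<in>?L. 2 * (?\<Delta> m i)\<^sup>2 * (G (?p m i) \<omega>)\<^sup>2)}
          \<le> measure M {\<omega>\<in>space M. \<delta> < B m \<omega>}"
      proof (rule finite_measure_mono)
        show "{\<omega>\<in>space M. \<delta> < B m \<omega>} \<in> events"
          using tends_in_prob_measurable(1)[OF B, of m] by measurable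
      qed (use sum_B in \<open>auto intro: less_le_trans\<close>)
      finally show "measure M {\<omega>\<in>space M. e < \<bar>(N m \<omega>)\<^sup>2\<bar>} \<le> 1 * \<delta> / e + measure M {\<omega>\<in>space M. 1 * \<delta> < \<bar>B m \<omega>\<bar>}"
        using B_nonneg by (simp add: sum_N)
    qed auto
  qed
  show ?thesis
  proof (rule tends_in_prob_combine1[OF N0])
    show "(\<lambda>\<omega>. \<Sum>i<Suc m. G (?p m i) \<omega> * (grid_diff W t m i \<omega>)\<^sup>2) \<in> borel_measurable M" for m
      using grid_value_measurable[OF G t] grid_diff_W_measurable[OF t]
      by (intro borel_measurable_sum borel_measurable_times borel_measurable_power)
    show "(\<lambda>\<omega>. integral {0..t} (\<lambda>s. G s \<omega>)) \<in> borel_measurable M"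
      by (rule cont_adapted_measM[OF cont_adapted_integral[OF G] t])
    show "AE \<omega> in M. \<forall>r. strict_mono r \<longrightarrow> (\<lambda>m. N (r m) \<omega>) \<longlonglongrightarrow> 0 \<longrightarrow>
       (\<lambda>m. \<Sum>i<Suc (r m). G (?p (r m) i) \<omega> * (grid_diff W t (r m) i \<omega>)\<^sup>2) \<longlonglongrightarrow> integral {0..t} (\<lambda>s. G s \<omega>)"
    proof (intro AE_I2 allI impI)
      fix \<omega> and r :: "nat \<Rightarrow> nat" assume \<omega>: "\<omega> \<in> space M" and r: "strict_mono r" and l: "(\<lambda>m. N (r m) \<omega>) \<longlonglongrightarrow> 0"
      have eq: "(\<Sum>i<Suc m. G (?p m i) \<omega> * (grid_diff W t m i \<omega>)\<^sup>2) = N m \<omega> + (\<Sum>i<Suc m. G (?p m i) \<omega> * ?\<Delta> m i)" for m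
        unfolding N_def sum.distrib[symmetric] by (intro sum.cong refl) (simp add: algebra_simps)
      have "(\<lambda>m. \<Sum>i<Suc m. G (?p m i) \<omega> * ?\<Delta> m i) \<longlonglongrightarrow> integral {0..t} (\<lambda>s. G s \<omega>)"
        by (rule grid_riemann_sum_limit[OF t' cont_adapted_cont[OF G \<omega> t'(2)]])
      from tendsto_add[OF l LIMSEQ_subseq_LIMSEQ[OF this r]]
      show "(\<lambda>m. \<Sum>i<Suc (r m). G (?p (r m) i) \<omega> * (grid_diff W t (r m) i \<omega>)\<^sup>2) \<longlonglongrightarrow> integral {0..t} (\<lambda>s. G s \<omega>)"
        by (simp only: eq o_def add_0)
    qed
  qed
qed

text \<open>Apart from the squared Ito errors, which vanish, each cell contributes the square of a
  drift integral, of the order of the squared step; summed up this is of the order of the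
  mesh.\<close>

lemma linearization_error_limit:
  assumes X: "ito_process X A H" and t: "t \<in> {0..T}"
  shows "tends_in_prob M (\<lambda>m \<omega>. \<Sum>i<Suc m. (grid_diff X t m i \<omega> - H (grid T t m i) \<omega> * grid_diff W t m i \<omega>)\<^sup>2) (\<lambda>_. 0)"
proof -
  note ca = ito_process_cont_adapted[OF X]
  have t': "0 \<le> t" "t \<le> T" using t by auto
  let ?I = "\<lambda>t \<omega>. X t \<omega> - X 0 \<omega> - integral {0..t} (\<lambda>s. A s \<omega>)"
  let ?p = "grid T t"
  let ?e = "\<lambda>m i \<omega>. weighted_ito_error (\<lambda>_ _. 1) H ?I t m i \<omega>"
  have 1: "tends_in_prob M (\<lambda>m \<omega>. \<Sum>i<Suc m. (?e m i \<omega>)\<^sup>2) (\<lambda>_. 0)"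
    by (rule quadratic_ito_error_limit[OF ito_process_integral(1)[OF X] ca(3) t])
  show ?thesis
  proof (rule tends_in_prob_combine1[OF 1])
    show "(\<lambda>\<omega>. \<Sum>i<Suc m. (grid_diff X t m i \<omega> - H (?p m i) \<omega> * grid_diff W t m i \<omega>)\<^sup>2) \<in> borel_measurable M" for m
      by (intro borel_measurable_sum borel_measurable_power borel_measurable_diff borel_measurable_times
        grid_diff_measurable grid_diff_W_measurable grid_value_measurable ca t)
    show "AE \<omega> in M. \<forall>r. strict_mono r \<longrightarrow> (\<lambda>m. \<Sum>i<Suc (r m). (?e (r m) i \<omega>)\<^sup>2) \<longlonglongrightarrow> 0 \<longrightarrow>
       (\<lambda>m. \<Sum>i<Suc (r m). (grid_diff X t (r m) i \<omega> - H (?p (r m) i) \<omega> * grid_diff W t (r m) i \<omega>)\<^sup>2) \<longlonglongrightarrow> 0"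
    proof (intro AE_I2 allI impI)
      fix \<omega> and r :: "nat \<Rightarrow> nat" assume \<omega>: "\<omega> \<in> space M" and r: "strict_mono r"
        and l: "(\<lambda>m. \<Sum>i<Suc (r m). (?e (r m) i \<omega>)\<^sup>2) \<longlonglongrightarrow> 0"
      obtain B where B: "\<And>s. s \<in> {0..T} \<Longrightarrow> \<bar>A s \<omega>\<bar> \<le> B" using cont_adapted_bounded[OF ca(2) \<omega>] by blast
      have bound: "(\<Sum>i<Suc m. (grid_diff X t m i \<omega> - H (?p m i) \<omega> * grid_diff W t m i \<omega>)\<^sup>2)
          \<le> 2 * (\<Sum>i<Suc m. (?e m i \<omega>)\<^sup>2) + 2 * (B\<^sup>2 * T * t) * inverse (real (Suc m))" for m
      proof -
        let ?\<Delta> = "\<lambda>i. ?p m (Suc i) - ?p m i"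
        have int: "(integral {?p m i..?p m (Suc i)} (\<lambda>s. A s \<omega>))\<^sup>2 \<le> B\<^sup>2 * (T / real (Suc m)) * ?\<Delta> i" for i
        proof -
          have p: "{?p m i..?p m (Suc i)} \<subseteq> {0..T}" "?p m i \<le> ?p m (Suc i)"
            using grid_in[OF t, of m i] grid_in[OF t, of m "Suc i"] grid_mono_Suc by auto
          have "norm (integral {?p m i..?p m (Suc i)} (\<lambda>s. A s \<omega>)) \<le> B * ?\<Delta> i"
            using p B cont_adapted_cont[OF ca(2) \<omega>, of T]
            by (intro integral_bound) (auto intro: continuous_on_subset)
          then have "(integral {?p m i..?p m (Suc i)} (\<lambda>s. A s \<omega>))\<^sup>2 \<le> (B * ?\<Delta> i)\<^sup>2"
            using power_mono[of "\<bar>integral {?p m i..?p m (Suc i)} (\<lambda>s. A s \<omega>)\<bar>" "B * ?\<Delta> i" 2] by simp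
          also have "\<dots> = B\<^sup>2 * ?\<Delta> i * ?\<Delta> i" by (simp add: power2_eq_square)
          also have "\<dots> \<le> B\<^sup>2 * (T / real (Suc m)) * ?\<Delta> i"
            using grid_step[of T t m i] T_pos p(2) by (intro mult_right_mono mult_left_mono) auto
          finally show ?thesis .
        qed
        have "(\<Sum>i<Suc m. (grid_diff X t m i \<omega> - H (?p m i) \<omega> * grid_diff W t m i \<omega>)\<^sup>2)
            \<le> (\<Sum>i<Suc m. 2 * (?e m i \<omega>)\<^sup>2 + 2 * (B\<^sup>2 * (T / real (Suc m)) * ?\<Delta> i))"
        proof (rule sum_mono)
          fix i
          have sq: "(x + y)\<^sup>2 \<le> 2 * x\<^sup>2 + 2 * y\<^sup>2" for x y :: real
            using sum_squares_bound[of x y] by (simp add: power2_sum)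
          show "(grid_diff X t m i \<omega> - H (?p m i) \<omega> * grid_diff W t m i \<omega>)\<^sup>2 \<le> 2 * (?e m i \<omega>)\<^sup>2 + 2 * (B\<^sup>2 * (T / real (Suc m)) * ?\<Delta> i)"
            unfolding ito_process_grid_diff[OF X t \<omega>] by (rule order_trans[OF sq]) (use int[of i] in simp)
        qed
        also have "\<dots> = 2 * (\<Sum>i<Suc m. (?e m i \<omega>)\<^sup>2) + 2 * (B\<^sup>2 * (T / real (Suc m)) * (\<Sum>i<Suc m. ?\<Delta> i))"
          by (simp only: sum.distrib sum_distrib_left)
        also have "(\<Sum>i<Suc m. ?\<Delta> i) = t"
          using sum_lessThan_telescope[of "?p m" "Suc m"] t' by (simp add: grid_first grid_last)
        finally show ?thesis by (simp add: divide_inverse mult_ac)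
      qed
      have "(\<lambda>m. 2 * (\<Sum>i<Suc (r m). (?e (r m) i \<omega>)\<^sup>2) + 2 * (B\<^sup>2 * T * t) * inverse (real (Suc (r m))))
          \<longlonglongrightarrow> 2 * 0 + 2 * (B\<^sup>2 * T * t) * 0"
        using LIMSEQ_subseq_LIMSEQ[OF LIMSEQ_inverse_real_of_nat r]
        by (intro tendsto_add tendsto_mult tendsto_const l) (simp add: o_def)
      then have up: "(\<lambda>m. 2 * (\<Sum>i<Suc (r m). (?e (r m) i \<omega>)\<^sup>2) + 2 * (B\<^sup>2 * T * t) * inverse (real (Suc (r m)))) \<longlonglongrightarrow> 0"
        by simp
      show "(\<lambda>m. \<Sum>i<Suc (r m). (grid_diff X t (r m) i \<omega> - H (?p (r m) i) \<omega> * grid_diff W t (r m) i \<omega>)\<^sup>2) \<longlonglongrightarrow> 0"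
        by (rule tendsto_sandwich[OF _ _ tendsto_const up])
          (use bound in \<open>auto intro!: always_eventually sum_nonneg simp del: sum.lessThan_Suc\<close>)
    qed
  qed auto
qed

lemma quadratic_variation:
  assumes X: "ito_process X A H" and G: "cont_adapted G" and t: "t \<in> {0..T}"
  shows "tends_in_prob M (\<lambda>m \<omega>. \<Sum>i<Suc m. G (grid T t m i) \<omega> * (grid_diff X t m i \<omega>)\<^sup>2)
     (\<lambda>\<omega>. integral {0..t} (\<lambda>s. G s \<omega> * (H s \<omega>)\<^sup>2))"
proof -
  note ca = ito_process_cont_adapted[OF X]
  let ?p = "grid T t"
  let ?w = "\<lambda>m i \<omega>. H (?p m i) \<omega> * grid_diff W t m i \<omega>"
  let ?e = "\<lambda>m i \<omega>. grid_diff X t m i \<omega> - ?w m i \<omega>"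
  have w: "tends_in_prob M (\<lambda>m \<omega>. \<Sum>i<Suc m. (?w m i \<omega>)\<^sup>2) (\<lambda>\<omega>. integral {0..t} (\<lambda>s. (H s \<omega>)\<^sup>2))"
    using brownian_quadratic_variation[OF cont_adapted_power[OF ca(3), of 2] t]
    by (simp add: power_mult_distrib del: sum.lessThan_Suc)
  have Gw: "tends_in_prob M (\<lambda>m \<omega>. \<Sum>i<Suc m. G (?p m i) \<omega> * (?w m i \<omega>)\<^sup>2) (\<lambda>\<omega>. integral {0..t} (\<lambda>s. G s \<omega> * (H s \<omega>)\<^sup>2))"
    using brownian_quadratic_variation[OF cont_adapted_mult[OF G cont_adapted_power[OF ca(3), of 2]] t]
    by (simp add: power_mult_distrib mult.assoc del: sum.lessThan_Suc)
  note e = linearization_error_limit[OF X t]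
  have rest: "tends_in_prob M (\<lambda>m \<omega>. \<Sum>i<Suc m. G (?p m i) \<omega> * (2 * ?w m i \<omega> * ?e m i \<omega> + (?e m i \<omega>)\<^sup>2)) (\<lambda>_. 0)"
  proof (rule tends_in_prob_combine[OF w e])
    show "(\<lambda>\<omega>. \<Sum>i<Suc m. G (?p m i) \<omega> * (2 * ?w m i \<omega> * ?e m i \<omega> + (?e m i \<omega>)\<^sup>2)) \<in> borel_measurable M" for m
      by (intro borel_measurable_sum borel_measurable_power borel_measurable_diff borel_measurable_times borel_measurable_add
        borel_measurable_const grid_diff_measurable grid_diff_W_measurable grid_value_measurable ca G t)
    show "AE \<omega> in M. \<forall>r. strict_mono r \<longrightarrow> (\<lambda>m. \<Sum>i<Suc (r m). (?w (r m) i \<omega>)\<^sup>2) \<longlonglongrightarrow> integral {0..t} (\<lambda>s. (H s \<omega>)\<^sup>2) \<longrightarrow>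
       (\<lambda>m. \<Sum>i<Suc (r m). (?e (r m) i \<omega>)\<^sup>2) \<longlonglongrightarrow> 0 \<longrightarrow>
       (\<lambda>m. \<Sum>i<Suc (r m). G (?p (r m) i) \<omega> * (2 * ?w (r m) i \<omega> * ?e (r m) i \<omega> + (?e (r m) i \<omega>)\<^sup>2)) \<longlonglongrightarrow> 0"
    proof (intro AE_I2 allI impI)
      fix \<omega> and r :: "nat \<Rightarrow> nat" assume \<omega>: "\<omega> \<in> space M" and r: "strict_mono r"
        and lw: "(\<lambda>m. \<Sum>i<Suc (r m). (?w (r m) i \<omega>)\<^sup>2) \<longlonglongrightarrow> integral {0..t} (\<lambda>s. (H s \<omega>)\<^sup>2)"
        and le: "(\<lambda>m. \<Sum>i<Suc (r m). (?e (r m) i \<omega>)\<^sup>2) \<longlonglongrightarrow> 0"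
      obtain B where B: "\<And>s. s \<in> {0..T} \<Longrightarrow> \<bar>G s \<omega>\<bar> \<le> B" using cont_adapted_bounded[OF G \<omega>] by blast
      let ?Sw = "\<lambda>m. \<Sum>i<Suc m. (?w m i \<omega>)\<^sup>2" and ?Se = "\<lambda>m. \<Sum>i<Suc m. (?e m i \<omega>)\<^sup>2"
      have bound: "\<bar>\<Sum>i<Suc m. G (?p m i) \<omega> * (2 * ?w m i \<omega> * ?e m i \<omega> + (?e m i \<omega>)\<^sup>2)\<bar>
          \<le> B * (2 * sqrt (?Sw m * ?Se m) + ?Se m)" for m
      proof -
        have "\<bar>\<Sum>i<Suc m. G (?p m i) \<omega> * (2 * ?w m i \<omega> * ?e m i \<omega> + (?e m i \<omega>)\<^sup>2)\<bar>
            \<le> (\<Sum>i<Suc m. B * (2 * (\<bar>?w m i \<omega>\<bar> * \<bar>?e m i \<omega>\<bar>) + (?e m i \<omega>)\<^sup>2))"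
        proof (rule order_trans[OF sum_abs sum_mono])
          fix i
          have "\<bar>2 * ?w m i \<omega> * ?e m i \<omega> + (?e m i \<omega>)\<^sup>2\<bar> \<le> 2 * (\<bar>?w m i \<omega>\<bar> * \<bar>?e m i \<omega>\<bar>) + (?e m i \<omega>)\<^sup>2"
            by (rule order_trans[OF abs_triangle_ineq]) (simp add: abs_mult)
          then show "\<bar>G (?p m i) \<omega> * (2 * ?w m i \<omega> * ?e m i \<omega> + (?e m i \<omega>)\<^sup>2)\<bar>
              \<le> B * (2 * (\<bar>?w m i \<omega>\<bar> * \<bar>?e m i \<omega>\<bar>) + (?e m i \<omega>)\<^sup>2)"
            unfolding abs_mult[of "G (?p m i) \<omega>"] using B[OF grid_in[OF t, of m i]] by (intro mult_mono) auto
        qed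
        also have "\<dots> = B * (2 * (\<Sum>i<Suc m. \<bar>?w m i \<omega>\<bar> * \<bar>?e m i \<omega>\<bar>) + ?Se m)"
          by (simp only: sum.distrib sum_distrib_left[symmetric])
        also have "\<dots> \<le> B * (2 * sqrt (?Sw m * ?Se m) + ?Se m)"
        proof -
          have "(\<Sum>i<Suc m. \<bar>?w m i \<omega>\<bar> * \<bar>?e m i \<omega>\<bar>)\<^sup>2 \<le> ?Sw m * ?Se m"
            using Cauchy_Schwarz_ineq_sum[of "\<lambda>i. \<bar>?w m i \<omega>\<bar>" "\<lambda>i. \<bar>?e m i \<omega>\<bar>" "{..<Suc m}"] by (simp only: power2_abs)
          then have "(\<Sum>i<Suc m. \<bar>?w m i \<omega>\<bar> * \<bar>?e m i \<omega>\<bar>) \<le> sqrt (?Sw m * ?Se m)" by (rule real_le_rsqrt)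
          moreover have "0 \<le> B" using B[of 0] T_pos by auto
          ultimately show ?thesis by (intro mult_left_mono) auto
        qed
        finally show ?thesis .
      qed
      have "(\<lambda>m. B * (2 * sqrt (?Sw (r m) * ?Se (r m)) + ?Se (r m))) \<longlonglongrightarrow> B * (2 * sqrt (integral {0..t} (\<lambda>s. (H s \<omega>)\<^sup>2) * 0) + 0)"
        by (intro tendsto_intros lw le)
      then have up: "(\<lambda>m. B * (2 * sqrt (?Sw (r m) * ?Se (r m)) + ?Se (r m))) \<longlonglongrightarrow> 0" by (simp del: sum.lessThan_Suc)
      show "(\<lambda>m. \<Sum>i<Suc (r m). G (?p (r m) i) \<omega> * (2 * ?w (r m) i \<omega> * ?e (r m) i \<omega> + (?e (r m) i \<omega>)\<^sup>2)) \<longlonglongrightarrow> 0"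
        by (rule Lim_null_comparison[OF _ up]) (use bound in \<open>auto intro!: always_eventually simp del: sum.lessThan_Suc\<close>)
    qed
  qed auto
  have "(\<Sum>i<Suc m. G (?p m i) \<omega> * (grid_diff X t m i \<omega>)\<^sup>2)
      = (\<Sum>i<Suc m. G (?p m i) \<omega> * (?w m i \<omega>)\<^sup>2) + (\<Sum>i<Suc m. G (?p m i) \<omega> * (2 * ?w m i \<omega> * ?e m i \<omega> + (?e m i \<omega>)\<^sup>2))" for m \<omega>
    unfolding sum.distrib[symmetric] by (intro sum.cong refl) (simp add: power2_eq_square algebra_simps)
  then show ?thesis using tends_in_prob_add[OF Gw rest] by (simp del: sum.lessThan_Suc)
qed

end

section \<open>Stochastic calculus and moment bounds\<close>

context brownian_basis
begin

lemma ito_sum_linear: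
  "ito_sum (\<lambda>t \<omega>. a * H t \<omega> + b * K t \<omega>) m t \<omega> = a * ito_sum H m t \<omega> + b * ito_sum K m t \<omega>"
  unfolding ito_sum_def sum_distrib_left sum.distrib[symmetric]
  by (intro sum.cong refl) (simp add: algebra_simps)

lemma ito_process_target_measurable:
  assumes "cont_adapted X" "cont_adapted A" "t \<in> {0..T}"
  shows "(\<lambda>\<omega>. X t \<omega> - X 0 \<omega> - integral {0..t} (\<lambda>s. A s \<omega>)) \<in> borel_measurable M"
  using cont_adapted_measM[OF assms(1)] cont_adapted_measM[OF cont_adapted_integral[OF assms(2)] assms(3)] assms(3)
  by (intro borel_measurable_diff) auto

lemma cont_adapted_integrable:
  "cont_adapted X \<Longrightarrow> \<omega> \<in> space M \<Longrightarrow> t \<in> {0..T} \<Longrightarrow> (\<lambda>s. X s \<omega>) integrable_on {0..t}"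
  using cont_adapted_cont[of X \<omega> t] by (intro integrable_continuous_real) auto

lemma ito_process_linear:
  assumes X: "ito_process X A H" and Y: "ito_process Y B K"
  shows "ito_process (\<lambda>t \<omega>. a * X t \<omega> + b * Y t \<omega>) (\<lambda>t \<omega>. a * A t \<omega> + b * B t \<omega>) (\<lambda>t \<omega>. a * H t \<omega> + b * K t \<omega>)"
  unfolding ito_process_def
proof (intro conjI ballI)
  note caX = ito_process_cont_adapted[OF X] and caY = ito_process_cont_adapted[OF Y]
  show ca: "cont_adapted (\<lambda>t \<omega>. a * X t \<omega> + b * Y t \<omega>)" "cont_adapted (\<lambda>t \<omega>. a * A t \<omega> + b * B t \<omega>)"
    "cont_adapted (\<lambda>t \<omega>. a * H t \<omega> + b * K t \<omega>)"
    by (intro cont_adapted_intros caX caY)+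
  fix t assume t: "t \<in> {0..T}"
  have "tends_in_prob M (\<lambda>m \<omega>. a * ito_sum H m t \<omega> + b * ito_sum K m t \<omega>)
    (\<lambda>\<omega>. a * (X t \<omega> - X 0 \<omega> - integral {0..t} (\<lambda>s. A s \<omega>)) + b * (Y t \<omega> - Y 0 \<omega> - integral {0..t} (\<lambda>s. B s \<omega>)))"
    using X Y t unfolding ito_process_def by (intro tends_in_prob_add tends_in_prob_cmult) auto
  then show "tends_in_prob M (\<lambda>m. ito_sum (\<lambda>t \<omega>. a * H t \<omega> + b * K t \<omega>) m t)
      (\<lambda>\<omega>. (a * X t \<omega> + b * Y t \<omega>) - (a * X 0 \<omega> + b * Y 0 \<omega>) - integral {0..t} (\<lambda>s. a * A s \<omega> + b * B s \<omega>))"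
  proof (rule tends_in_prob_cong_AE)
    show "(\<lambda>\<omega>. (a * X t \<omega> + b * Y t \<omega>) - (a * X 0 \<omega> + b * Y 0 \<omega>) - integral {0..t} (\<lambda>s. a * A s \<omega> + b * B s \<omega>)) \<in> borel_measurable M"
      using ito_process_target_measurable[OF ca(1,2) t] .
    show "ito_sum (\<lambda>t \<omega>. a * H t \<omega> + b * K t \<omega>) m t \<in> borel_measurable M" for m
      by (rule ito_sum_measurable[OF ca(3) t])
    have "integral {0..t} (\<lambda>s. a * A s \<omega> + b * B s \<omega>) = a * integral {0..t} (\<lambda>s. A s \<omega>) + b * integral {0..t} (\<lambda>s. B s \<omega>)"
      if "\<omega> \<in> space M" for \<omega>
      using cont_adapted_integrable[OF caX(2) that t] cont_adapted_integrable[OF caY(2) that t]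
      by (subst integral_add) (auto intro!: integrable_on_mult_right)
    then show "AE \<omega> in M. (\<forall>m. ito_sum (\<lambda>t \<omega>. a * H t \<omega> + b * K t \<omega>) m t \<omega> = a * ito_sum H m t \<omega> + b * ito_sum K m t \<omega>) \<and>
       (a * X t \<omega> + b * Y t \<omega>) - (a * X 0 \<omega> + b * Y 0 \<omega>) - integral {0..t} (\<lambda>s. a * A s \<omega> + b * B s \<omega>)
       = a * (X t \<omega> - X 0 \<omega> - integral {0..t} (\<lambda>s. A s \<omega>)) + b * (Y t \<omega> - Y 0 \<omega> - integral {0..t} (\<lambda>s. B s \<omega>))"
      by (intro AE_I2) (simp add: ito_sum_linear algebra_simps)
  qed
qed

lemma ito_process_add:
  "ito_process X A H \<Longrightarrow> ito_process Y B K \<Longrightarrow>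
    ito_process (\<lambda>t \<omega>. X t \<omega> + Y t \<omega>) (\<lambda>t \<omega>. A t \<omega> + B t \<omega>) (\<lambda>t \<omega>. H t \<omega> + K t \<omega>)"
  using ito_process_linear[of X A H Y B K 1 1] by simp

lemma ito_process_diff:
  "ito_process X A H \<Longrightarrow> ito_process Y B K \<Longrightarrow>
    ito_process (\<lambda>t \<omega>. X t \<omega> - Y t \<omega>) (\<lambda>t \<omega>. A t \<omega> - B t \<omega>) (\<lambda>t \<omega>. H t \<omega> - K t \<omega>)"
  using ito_process_linear[of X A H Y B K 1 "-1"] by simp

lemma ito_process_cmult:
  "ito_process X A H \<Longrightarrow> ito_process (\<lambda>t \<omega>. c * X t \<omega>) (\<lambda>t \<omega>. c * A t \<omega>) (\<lambda>t \<omega>. c * H t \<omega>)"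
  using ito_process_linear[of X A H X A H c 0] by simp

text \<open>Supplies the constants of the calculus and the discount factor
  \<open>exp (- c * t)\<close> of the moment bound.\<close>

lemma ito_process_deterministic:
  assumes f: "\<And>t. (f has_real_derivative f' t) (at t)" and f': "continuous_on UNIV f'"
  shows "ito_process (\<lambda>t _. f t) (\<lambda>t _. f' t) (\<lambda>_ _. 0)"
  unfolding ito_process_def
proof (intro conjI ballI)
  show "cont_adapted (\<lambda>t _. f t)" "cont_adapted (\<lambda>t _. f' t)"
    using DERIV_continuous_on[of "{0..T}" f f'] f f'
    by (auto intro!: cont_adapted_deterministic intro: continuous_on_subset has_field_derivative_at_within)
  show "cont_adapted (\<lambda>_ _. 0)" by (rule cont_adapted_const)
  fix t assume t: "t \<in> {0..T}"
  have "(f' has_integral f t - f 0) {0..t}"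
    using t f by (intro fundamental_theorem_of_calculus)
      (auto intro: has_field_derivative_at_within simp: has_real_derivative_iff_has_vector_derivative[symmetric])
  then have "integral {0..t} f' = f t - f 0" by (rule integral_unique)
  moreover have "ito_sum (\<lambda>_ _. 0) m t = (\<lambda>_. 0)" for m by (simp add: ito_sum_def fun_eq_iff)
  ultimately show "tends_in_prob M (\<lambda>m. ito_sum (\<lambda>_ _. 0) m t) (\<lambda>\<omega>. f t - f 0 - integral {0..t} f')"
    by (simp add: tends_in_prob_const)
qed

lemma ito_process_const: "ito_process (\<lambda>_ _. c) (\<lambda>_ _. 0) (\<lambda>_ _. 0)"
  using ito_process_deterministic[of "\<lambda>_. c" "\<lambda>_. 0"] by auto

lemma ito_process_sum:
  assumes "finite J" "\<And>j. j \<in> J \<Longrightarrow> ito_process (X j) (A j) (H j)"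
  shows "ito_process (\<lambda>t \<omega>. \<Sum>j\<in>J. X j t \<omega>) (\<lambda>t \<omega>. \<Sum>j\<in>J. A j t \<omega>) (\<lambda>t \<omega>. \<Sum>j\<in>J. H j t \<omega>)"
  using assms by (induction J) (auto intro: ito_process_const ito_process_add)

text \<open>Polarization: the product of increments is a quarter of the difference between the
  squared increments of sum and difference.\<close>

lemma cross_variation:
  assumes X: "ito_process X A H" and Y: "ito_process Y B K" and t: "t \<in> {0..T}"
  shows "tends_in_prob M (\<lambda>m \<omega>. \<Sum>i<Suc m. grid_diff X t m i \<omega> * grid_diff Y t m i \<omega>)
     (\<lambda>\<omega>. integral {0..t} (\<lambda>s. H s \<omega> * K s \<omega>))"
proof -
  note caX = ito_process_cont_adapted[OF X] and caY = ito_process_cont_adapted[OF Y]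
  let ?P = "\<lambda>t \<omega>. X t \<omega> + Y t \<omega>" and ?Q = "\<lambda>t \<omega>. X t \<omega> - Y t \<omega>"
  have 1: "tends_in_prob M (\<lambda>m \<omega>. \<Sum>i<Suc m. 1/4 * (grid_diff ?P t m i \<omega>)\<^sup>2) (\<lambda>\<omega>. integral {0..t} (\<lambda>s. 1/4 * (H s \<omega> + K s \<omega>)\<^sup>2))"
    using quadratic_variation[OF ito_process_add[OF X Y] cont_adapted_const t, of "1/4"] .
  have 2: "tends_in_prob M (\<lambda>m \<omega>. \<Sum>i<Suc m. 1/4 * (grid_diff ?Q t m i \<omega>)\<^sup>2) (\<lambda>\<omega>. integral {0..t} (\<lambda>s. 1/4 * (H s \<omega> - K s \<omega>)\<^sup>2))"
    using quadratic_variation[OF ito_process_diff[OF X Y] cont_adapted_const t, of "1/4"] .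
  have eq: "(\<Sum>i<Suc m. grid_diff X t m i \<omega> * grid_diff Y t m i \<omega>)
      = (\<Sum>i<Suc m. 1/4 * (grid_diff ?P t m i \<omega>)\<^sup>2) - (\<Sum>i<Suc m. 1/4 * (grid_diff ?Q t m i \<omega>)\<^sup>2)" for m \<omega>
    unfolding sum_subtractf[symmetric] grid_diff_def
    by (intro sum.cong refl) (simp add: power2_eq_square field_simps)
  have int: "integral {0..t} (\<lambda>s. H s \<omega> * K s \<omega>)
      = integral {0..t} (\<lambda>s. 1/4 * (H s \<omega> + K s \<omega>)\<^sup>2) - integral {0..t} (\<lambda>s. 1/4 * (H s \<omega> - K s \<omega>)\<^sup>2)"
    if "\<omega> \<in> space M" for \<omega>
  proof -
    have "(\<lambda>s. 1/4 * (H s \<omega> + K s \<omega>)\<^sup>2) integrable_on {0..t}" "(\<lambda>s. 1/4 * (H s \<omega> - K s \<omega>)\<^sup>2) integrable_on {0..t}"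
      using cont_adapted_cont[OF caX(3) that, of t] cont_adapted_cont[OF caY(3) that, of t] t
      by (auto intro!: integrable_continuous_real continuous_intros)
    from integral_diff[OF this]
    show ?thesis by (simp add: power2_eq_square field_simps)
  qed
  have ca: "cont_adapted (\<lambda>t \<omega>. H t \<omega> * K t \<omega>)" by (intro cont_adapted_intros caX caY)
  show ?thesis
  proof (rule tends_in_prob_cong_AE[OF tends_in_prob_diff[OF 1 2]])
    show "(\<lambda>\<omega>. \<Sum>i<Suc m. grid_diff X t m i \<omega> * grid_diff Y t m i \<omega>) \<in> borel_measurable M" for m
      by (intro borel_measurable_sum borel_measurable_times grid_diff_measurable caX caY t)
    show "(\<lambda>\<omega>. integral {0..t} (\<lambda>s. H s \<omega> * K s \<omega>)) \<in> borel_measurable M"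
      by (rule cont_adapted_measM[OF cont_adapted_integral[OF ca] t])
  qed (use int in \<open>simp add: eq del: sum.lessThan_Suc\<close>)
qed

text \<open>The discrete Leibniz rule is exact, including its product of increments. Telescoped and
  solved for the Riemann sum of the new diffusion, it expresses that sum through quantities whose
  limits are known; the cross variation becomes the Ito correction of the drift.\<close>

lemma ito_process_mult:
  assumes X: "ito_process X A H" and Y: "ito_process Y B K"
  shows "ito_process (\<lambda>t \<omega>. X t \<omega> * Y t \<omega>) (\<lambda>t \<omega>. X t \<omega> * B t \<omega> + Y t \<omega> * A t \<omega> + H t \<omega> * K t \<omega>)
    (\<lambda>t \<omega>. X t \<omega> * K t \<omega> + Y t \<omega> * H t \<omega>)"
  unfolding ito_process_def
proof (intro conjI ballI)
  note caX = ito_process_cont_adapted[OF X] and caY = ito_process_cont_adapted[OF Y]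
  let ?D = "\<lambda>t \<omega>. X t \<omega> * B t \<omega> + Y t \<omega> * A t \<omega> + H t \<omega> * K t \<omega>"
  let ?K = "\<lambda>t \<omega>. X t \<omega> * K t \<omega> + Y t \<omega> * H t \<omega>"
  show ca: "cont_adapted (\<lambda>t \<omega>. X t \<omega> * Y t \<omega>)" "cont_adapted ?D" "cont_adapted ?K"
    by (intro cont_adapted_intros caX caY)+
  fix t assume t: "t \<in> {0..T}"
  let ?p = "grid T t"
  let ?S1 = "\<lambda>m \<omega>. (\<Sum>i<Suc m. X (?p m i) \<omega> * grid_diff Y t m i \<omega>) - ito_sum (\<lambda>t \<omega>. X t \<omega> * K t \<omega>) m t \<omega>"
  let ?S2 = "\<lambda>m \<omega>. (\<Sum>i<Suc m. Y (?p m i) \<omega> * grid_diff X t m i \<omega>) - ito_sum (\<lambda>t \<omega>. Y t \<omega> * H t \<omega>) m t \<omega>"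
  let ?S3 = "\<lambda>m \<omega>. \<Sum>i<Suc m. grid_diff X t m i \<omega> * grid_diff Y t m i \<omega>"
  have lim: "tends_in_prob M (\<lambda>m \<omega>. (X t \<omega> * Y t \<omega> - X 0 \<omega> * Y 0 \<omega>) - (?S1 m \<omega> + ?S2 m \<omega> + ?S3 m \<omega>))
     (\<lambda>\<omega>. (X t \<omega> * Y t \<omega> - X 0 \<omega> * Y 0 \<omega>) - (integral {0..t} (\<lambda>s. X s \<omega> * B s \<omega>)
        + integral {0..t} (\<lambda>s. Y s \<omega> * A s \<omega>) + integral {0..t} (\<lambda>s. H s \<omega> * K s \<omega>)))"
    by (intro tends_in_prob_diff tends_in_prob_add tends_in_prob_const weighted_increment_limit[OF Y caX(1) t]
      weighted_increment_limit[OF X caY(1) t] cross_variation[OF X Y t] borel_measurable_diff borel_measurable_times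
      cont_adapted_measM[OF caX(1)] cont_adapted_measM[OF caY(1)]) (use t in auto)
  have eq: "ito_sum ?K m t \<omega> = (X t \<omega> * Y t \<omega> - X 0 \<omega> * Y 0 \<omega>) - (?S1 m \<omega> + ?S2 m \<omega> + ?S3 m \<omega>)" for m \<omega>
  proof -
    have "X t \<omega> * Y t \<omega> - X 0 \<omega> * Y 0 \<omega> = (\<Sum>i<Suc m. grid_diff (\<lambda>t \<omega>. X t \<omega> * Y t \<omega>) t m i \<omega>)"
      by (simp only: sum_grid_diff[OF t])
    also have "\<dots> = (\<Sum>i<Suc m. X (?p m i) \<omega> * grid_diff Y t m i \<omega> + Y (?p m i) \<omega> * grid_diff X t m i \<omega>
        + grid_diff X t m i \<omega> * grid_diff Y t m i \<omega>)"
      unfolding grid_diff_def by (intro sum.cong refl) (simp add: algebra_simps)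
    finally show ?thesis
      using ito_sum_linear[of 1 "\<lambda>t \<omega>. X t \<omega> * K t \<omega>" 1 "\<lambda>t \<omega>. Y t \<omega> * H t \<omega>" m t \<omega>]
      by (simp add: sum.distrib del: sum.lessThan_Suc)
  qed
  show "tends_in_prob M (\<lambda>m. ito_sum ?K m t) (\<lambda>\<omega>. X t \<omega> * Y t \<omega> - X 0 \<omega> * Y 0 \<omega> - integral {0..t} (\<lambda>s. ?D s \<omega>))"
  proof (rule tends_in_prob_cong_AE[OF lim ito_sum_measurable[OF ca(3) t] ito_process_target_measurable[OF ca(1,2) t]])
    have "integral {0..t} (\<lambda>s. ?D s \<omega>) = integral {0..t} (\<lambda>s. X s \<omega> * B s \<omega>)
        + integral {0..t} (\<lambda>s. Y s \<omega> * A s \<omega>) + integral {0..t} (\<lambda>s. H s \<omega> * K s \<omega>)" if "\<omega> \<in> space M" for \<omega>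
      using cont_adapted_integrable[OF cont_adapted_mult[OF caX(1) caY(2)] that t]
        cont_adapted_integrable[OF cont_adapted_mult[OF caY(1) caX(2)] that t]
        cont_adapted_integrable[OF cont_adapted_mult[OF caX(3) caY(3)] that t]
      by (simp add: integral_add integrable_add)
    then show "AE \<omega> in M. (\<forall>m. ito_sum ?K m t \<omega> = (X t \<omega> * Y t \<omega> - X 0 \<omega> * Y 0 \<omega>) - (?S1 m \<omega> + ?S2 m \<omega> + ?S3 m \<omega>)) \<and>
      X t \<omega> * Y t \<omega> - X 0 \<omega> * Y 0 \<omega> - integral {0..t} (\<lambda>s. ?D s \<omega>) =
      (X t \<omega> * Y t \<omega> - X 0 \<omega> * Y 0 \<omega>) - (integral {0..t} (\<lambda>s. X s \<omega> * B s \<omega>)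
        + integral {0..t} (\<lambda>s. Y s \<omega> * A s \<omega>) + integral {0..t} (\<lambda>s. H s \<omega> * K s \<omega>))"
      by (intro AE_I2) (simp add: eq)
  qed
qed

text \<open>A Taylor expansion of the reciprocal to second order with an exact cubic remainder.
  Since \<open>1 \<le> V\<close>, all reciprocals are at most 1, and the remainder is bounded by the
  largest increment times the quadratic variation, which vanishes by continuity of paths.\<close>

lemma ito_process_inverse:
  assumes V: "ito_process V A K" and ge1: "\<And>t \<omega>. 1 \<le> V t \<omega>"
  shows "ito_process (\<lambda>t \<omega>. inverse (V t \<omega>))
    (\<lambda>t \<omega>. - (inverse (V t \<omega>))\<^sup>2 * A t \<omega> + inverse (V t \<omega>) ^ 3 * (K t \<omega>)\<^sup>2)
    (\<lambda>t \<omega>. - (inverse (V t \<omega>))\<^sup>2 * K t \<omega>)"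
  unfolding ito_process_def
proof (intro conjI ballI)
  note caV = ito_process_cont_adapted[OF V]
  let ?R = "\<lambda>t \<omega>. inverse (V t \<omega>)"
  let ?D = "\<lambda>t \<omega>. - (?R t \<omega>)\<^sup>2 * A t \<omega> + ?R t \<omega> ^ 3 * (K t \<omega>)\<^sup>2"
  let ?K = "\<lambda>t \<omega>. - (?R t \<omega>)\<^sup>2 * K t \<omega>"
  have V0: "V t \<omega> \<noteq> 0" for t \<omega> using ge1[of t \<omega>] by linarith
  have R1: "0 < ?R t \<omega>" "?R t \<omega> \<le> 1" for t \<omega>
    using ge1[of t \<omega>] by (auto simp: inverse_le_1_iff intro: positive_imp_inverse_positive)
  have caR: "cont_adapted ?R" by (rule cont_adapted_inverse[OF caV(1) V0])
  show ca: "cont_adapted ?R" "cont_adapted ?D" "cont_adapted ?K"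
    by (intro cont_adapted_intros caV caR)+
  fix t assume t: "t \<in> {0..T}"
  then have t': "0 \<le> t" "t \<le> T" by auto
  let ?p = "grid T t"
  let ?d = "\<lambda>m i \<omega>. grid_diff V t m i \<omega>"
  have QV: "tends_in_prob M (\<lambda>m \<omega>. \<Sum>i<Suc m. 1 * (?d m i \<omega>)\<^sup>2) (\<lambda>\<omega>. integral {0..t} (\<lambda>s. 1 * (K s \<omega>)\<^sup>2))"
    by (rule quadratic_variation[OF V cont_adapted_const t])
  let ?N = "\<lambda>m \<omega>. \<Sum>i<Suc m. ?R (?p m i) \<omega> ^ 3 * ?R (?p m (Suc i)) \<omega> * ?d m i \<omega> ^ 3"
  have rest: "tends_in_prob M ?N (\<lambda>_. 0)"
  proof (rule tends_in_prob_combine1[OF QV])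
    show "?N m \<in> borel_measurable M" for m
      by (intro borel_measurable_sum borel_measurable_times borel_measurable_power grid_value_measurable[OF caR t] grid_diff_measurable caV t)
    show "AE \<omega> in M. \<forall>r. strict_mono r \<longrightarrow> (\<lambda>m. \<Sum>i<Suc (r m). 1 * (?d (r m) i \<omega>)\<^sup>2) \<longlonglongrightarrow> integral {0..t} (\<lambda>s. 1 * (K s \<omega>)\<^sup>2) \<longrightarrow>
        (\<lambda>m. ?N (r m) \<omega>) \<longlonglongrightarrow> 0"
    proof (intro AE_I2 allI impI)
      fix \<omega> and r :: "nat \<Rightarrow> nat" assume \<omega>: "\<omega> \<in> space M" and r: "strict_mono r"
        and l: "(\<lambda>m. \<Sum>i<Suc (r m). 1 * (?d (r m) i \<omega>)\<^sup>2) \<longlonglongrightarrow> integral {0..t} (\<lambda>s. 1 * (K s \<omega>)\<^sup>2)"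
      define c where "c m = Max ((\<lambda>i. \<bar>V (?p m (Suc i)) \<omega> - V (?p m i) \<omega>\<bar>) ` {..m})" for m
      have c: "c \<longlonglongrightarrow> 0"
        using grid_increment_tendsto[OF t' cont_adapted_cont[OF caV(1) \<omega> t'(2)]] by (simp add: c_def[abs_def])
      have bound: "norm (?N m \<omega>) \<le> c m * (\<Sum>i<Suc m. 1 * (?d m i \<omega>)\<^sup>2)" for m
        unfolding real_norm_def sum_distrib_left
      proof (rule order_trans[OF sum_abs sum_mono])
        fix i assume "i \<in> {..<Suc m}"
        then have le: "\<bar>?d m i \<omega>\<bar> \<le> c m" unfolding c_def grid_diff_def by (intro Max_ge) auto
        have "\<bar>?R (?p m i) \<omega> ^ 3 * ?R (?p m (Suc i)) \<omega> * ?d m i \<omega> ^ 3\<bar>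
            = ?R (?p m i) \<omega> ^ 3 * ?R (?p m (Suc i)) \<omega> * (\<bar>?d m i \<omega>\<bar> * (?d m i \<omega>)\<^sup>2)"
          using R1(1)[of "?p m i" \<omega>] R1(1)[of "?p m (Suc i)" \<omega>]
          by (simp add: abs_mult power3_eq_cube power2_eq_square)
        also have "\<dots> \<le> 1 * (\<bar>?d m i \<omega>\<bar> * (?d m i \<omega>)\<^sup>2)"
          using R1[of "?p m i" \<omega>] R1[of "?p m (Suc i)" \<omega>]
          by (intro mult_right_mono mult_le_one power_le_one) (auto simp: less_imp_le)
        also have "\<dots> \<le> c m * (1 * (?d m i \<omega>)\<^sup>2)" using le by (simp add: mult_right_mono)
        finally show "\<bar>?R (?p m i) \<omega> ^ 3 * ?R (?p m (Suc i)) \<omega> * ?d m i \<omega> ^ 3\<bar> \<le> c m * (1 * (?d m i \<omega>)\<^sup>2)" .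
      qed
      have "(\<lambda>m. c (r m)) \<longlonglongrightarrow> 0" using LIMSEQ_subseq_LIMSEQ[OF c r] by (simp add: o_def)
      from tendsto_mult[OF this l]
      have "(\<lambda>m. c (r m) * (\<Sum>i<Suc (r m). 1 * (?d (r m) i \<omega>)\<^sup>2)) \<longlonglongrightarrow> 0" by (simp del: sum.lessThan_Suc)
      then show "(\<lambda>m. ?N (r m) \<omega>) \<longlonglongrightarrow> 0"
        by (rule Lim_null_comparison[rotated]) (intro always_eventually allI bound)
    qed
  qed auto
  have caG: "cont_adapted (\<lambda>t \<omega>. - (?R t \<omega>)\<^sup>2)" "cont_adapted (\<lambda>t \<omega>. ?R t \<omega> ^ 3)"
    by (intro cont_adapted_intros caR)+
  let ?S1 = "\<lambda>m \<omega>. (\<Sum>i<Suc m. - (?R (?p m i) \<omega>)\<^sup>2 * ?d m i \<omega>) - ito_sum (\<lambda>t \<omega>. - (?R t \<omega>)\<^sup>2 * K t \<omega>) m t \<omega>"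
  let ?S2 = "\<lambda>m \<omega>. \<Sum>i<Suc m. ?R (?p m i) \<omega> ^ 3 * (?d m i \<omega>)\<^sup>2"
  have lim: "tends_in_prob M (\<lambda>m \<omega>. (?R t \<omega> - ?R 0 \<omega>) - (?S1 m \<omega> + ?S2 m \<omega> - ?N m \<omega>))
     (\<lambda>\<omega>. (?R t \<omega> - ?R 0 \<omega>) - (integral {0..t} (\<lambda>s. - (?R s \<omega>)\<^sup>2 * A s \<omega>) + integral {0..t} (\<lambda>s. ?R s \<omega> ^ 3 * (K s \<omega>)\<^sup>2) - 0))"
    by (intro tends_in_prob_diff tends_in_prob_add tends_in_prob_const weighted_increment_limit[OF V caG(1) t]
      quadratic_variation[OF V caG(2) t] rest borel_measurable_diff cont_adapted_measM[OF caR]) (use t in auto)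
  have eq: "ito_sum ?K m t \<omega> = (?R t \<omega> - ?R 0 \<omega>) - (?S1 m \<omega> + ?S2 m \<omega> - ?N m \<omega>)" for m \<omega>
  proof -
    \<comment> \<open>An identity rather than an estimate, so no intermediate point of a mean value
      theorem enters and measurability stays evident.\<close>
    have alg: "inverse w - inverse v = - (inverse v)\<^sup>2 * (w - v) + inverse v ^ 3 * (w - v)\<^sup>2 - inverse v ^ 3 * inverse w * (w - v) ^ 3"
      if "v \<noteq> 0" "w \<noteq> 0" for v w :: real
      using that by (simp add: field_simps power2_eq_square power3_eq_cube)
    have "?R t \<omega> - ?R 0 \<omega> = (\<Sum>i<Suc m. grid_diff ?R t m i \<omega>)"
      by (simp only: sum_grid_diff[OF t])
    also have "\<dots> = (\<Sum>i<Suc m. - (?R (?p m i) \<omega>)\<^sup>2 * ?d m i \<omega> + ?R (?p m i) \<omega> ^ 3 * (?d m i \<omega>)\<^sup>2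
        - ?R (?p m i) \<omega> ^ 3 * ?R (?p m (Suc i)) \<omega> * ?d m i \<omega> ^ 3)"
      unfolding grid_diff_def by (intro sum.cong refl alg V0)
    finally show ?thesis by (simp add: sum.distrib sum_subtractf sum_negf del: sum.lessThan_Suc)
  qed
  show "tends_in_prob M (\<lambda>m. ito_sum ?K m t) (\<lambda>\<omega>. ?R t \<omega> - ?R 0 \<omega> - integral {0..t} (\<lambda>s. ?D s \<omega>))"
  proof (rule tends_in_prob_cong_AE[OF lim ito_sum_measurable[OF ca(3) t] ito_process_target_measurable[OF ca(1,2) t]])
    have "integral {0..t} (\<lambda>s. ?D s \<omega>) = integral {0..t} (\<lambda>s. - (?R s \<omega>)\<^sup>2 * A s \<omega>) + integral {0..t} (\<lambda>s. ?R s \<omega> ^ 3 * (K s \<omega>)\<^sup>2)"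
      if "\<omega> \<in> space M" for \<omega>
      using cont_adapted_integrable[OF cont_adapted_mult[OF caG(1) caV(2)] that t]
        cont_adapted_integrable[OF cont_adapted_mult[OF caG(2) cont_adapted_power[OF caV(3)]] that t]
      by (rule integral_add)
    then show "AE \<omega> in M. (\<forall>m. ito_sum ?K m t \<omega> = (?R t \<omega> - ?R 0 \<omega>) - (?S1 m \<omega> + ?S2 m \<omega> - ?N m \<omega>)) \<and>
      ?R t \<omega> - ?R 0 \<omega> - integral {0..t} (\<lambda>s. ?D s \<omega>) =
      (?R t \<omega> - ?R 0 \<omega>) - (integral {0..t} (\<lambda>s. - (?R s \<omega>)\<^sup>2 * A s \<omega>) + integral {0..t} (\<lambda>s. ?R s \<omega> ^ 3 * (K s \<omega>)\<^sup>2) - 0)"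
      by (intro AE_I2 conjI allI eq) simp
  qed
qed

section \<open>Zero mean and moment bounds\<close>

lemma ito_process_martingale_part:
  assumes X: "ito_process X A H" and t: "t \<in> {0..T}"
    and int: "\<And>s. s \<in> {0..T} \<Longrightarrow> integrable M (\<lambda>\<omega>. (H s \<omega>)\<^sup>2)"
    and le: "\<And>s. s \<in> {0..T} \<Longrightarrow> (\<integral>\<omega>. (H s \<omega>)\<^sup>2 \<partial>M) \<le> C"
  shows "integrable M (\<lambda>\<omega>. X t \<omega> - X 0 \<omega> - integral {0..t} (\<lambda>s. A s \<omega>))"
    "(\<integral>\<omega>. X t \<omega> - X 0 \<omega> - integral {0..t} (\<lambda>s. A s \<omega>) \<partial>M) = 0"
proof -
  note ca = ito_process_cont_adapted[OF X]
  let ?p = "grid T t"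
  \<comment> \<open>The isometry bounds the second moments of the centred Riemann sums uniformly in
    \<open>m\<close>. With such a bound, convergence in probability carries the mean 0 over to the
    limit.\<close>
  have sq: "integrable M (\<lambda>\<omega>. (ito_sum H m t \<omega>)\<^sup>2)" "(\<integral>\<omega>. (ito_sum H m t \<omega>)\<^sup>2 \<partial>M) \<le> C * T"
    "(\<integral>\<omega>. ito_sum H m t \<omega> \<partial>M) = 0" for m
  proof -
    let ?L = "{i. i < Suc m \<and> ?p m i < ?p m (Suc i)}"
    have fam: "innovation_family ?L (?p m) (\<lambda>i. ?p m (Suc i)) (grid_diff W t m) (\<lambda>i. ?p m (Suc i) - ?p m i)"
      unfolding innovation_family_def
    proof (intro conjI ballI impI)
      fix i assume i: "i \<in> ?L"
      show "0 \<le> ?p m i" "?p m i < ?p m (Suc i)" "?p m (Suc i) \<le> T" "0 < ?p m (Suc i) - ?p m i"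
        using i grid_in[OF t, of m i] grid_in[OF t, of m "Suc i"] by auto
      then show "innovation (?p m i) (?p m (Suc i)) (grid_diff W t m i) (?p m (Suc i) - ?p m i)"
        unfolding grid_diff_def by (intro innovation_increment)
    next
      fix i j assume "i \<in> ?L" "j \<in> ?L" "i \<noteq> j"
      then show "?p m (Suc i) \<le> ?p m j \<or> ?p m (Suc j) \<le> ?p m i"
        using grid_mono[of T "Suc i" j t m] grid_mono[of T "Suc j" i t m] T_pos
        by (cases "i < j") auto
    qed simp
    have sum_eq: "(\<Sum>i\<in>?L. H (?p m i) \<omega> * grid_diff W t m i \<omega>) = ito_sum H m t \<omega>" for \<omega>
      unfolding ito_sum_def grid_diff_def
    proof (rule sum.mono_neutral_left)
      show "\<forall>i\<in>{..<Suc m} - ?L. H (?p m i) \<omega> * (W (?p m (Suc i)) \<omega> - W (?p m i) \<omega>) = 0"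
      proof
        fix i assume "i \<in> {..<Suc m} - ?L"
        then have "?p m (Suc i) = ?p m i" using grid_mono_Suc[of t m i] by auto
        then show "H (?p m i) \<omega> * (W (?p m (Suc i)) \<omega> - W (?p m i) \<omega>) = 0" by simp
      qed
    qed auto
    note iso = innovation_isometry[OF fam, of "\<lambda>i. H (?p m i)", OF cont_adapted_meas[OF ca(3) grid_in[OF t]] int[OF grid_in[OF t]],
      unfolded sum_eq]
    show "integrable M (\<lambda>\<omega>. (ito_sum H m t \<omega>)\<^sup>2)" "(\<integral>\<omega>. ito_sum H m t \<omega> \<partial>M) = 0" by (rule iso)+
    have C: "0 \<le> C" using le[of 0] T_pos by (rule_tac order_trans[rotated]) auto
    have "(\<integral>\<omega>. (ito_sum H m t \<omega>)\<^sup>2 \<partial>M) = (\<Sum>i\<in>?L. (?p m (Suc i) - ?p m i) * (\<integral>\<omega>. (H (?p m i) \<omega>)\<^sup>2 \<partial>M))"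
      by (rule iso)
    also have "\<dots> \<le> (\<Sum>i\<in>?L. (?p m (Suc i) - ?p m i) * C)"
      using le[OF grid_in[OF t]] by (intro sum_mono mult_left_mono) auto
    also have "\<dots> \<le> (\<Sum>i<Suc m. (?p m (Suc i) - ?p m i) * C)"
      using C grid_mono_Suc by (intro sum_mono2) auto
    also have "\<dots> = t * C"
      using sum_lessThan_telescope[of "?p m" "Suc m"] t
      by (simp add: sum_distrib_right[symmetric] grid_first grid_last del: sum.lessThan_Suc)
    also have "\<dots> \<le> C * T" using t C by (simp add: mult.commute mult_left_mono)
    finally show "(\<integral>\<omega>. (ito_sum H m t \<omega>)\<^sup>2 \<partial>M) \<le> C * T" .
  qed
  have lim: "tends_in_prob M (\<lambda>m. ito_sum H m t) (\<lambda>\<omega>. X t \<omega> - X 0 \<omega> - integral {0..t} (\<lambda>s. A s \<omega>))"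
    using X t by (simp add: ito_process_def)
  show "integrable M (\<lambda>\<omega>. X t \<omega> - X 0 \<omega> - integral {0..t} (\<lambda>s. A s \<omega>))"
    by (rule integrable_of_square[OF tends_in_prob_measurable(2)[OF lim] tends_in_prob_square_bound(1)[OF lim sq(1,2)]])
  have "(\<lambda>m. \<integral>\<omega>. ito_sum H m t \<omega> \<partial>M) \<longlonglongrightarrow> (\<integral>\<omega>. X t \<omega> - X 0 \<omega> - integral {0..t} (\<lambda>s. A s \<omega>) \<partial>M)"
    by (rule tends_in_prob_expectation[OF lim sq(1,2)])
  then show "(\<integral>\<omega>. X t \<omega> - X 0 \<omega> - integral {0..t} (\<lambda>s. A s \<omega>) \<partial>M) = 0"
    unfolding sq(3) using LIMSEQ_unique[OF tendsto_const] by metis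
qed

text \<open>For \<open>f = Z / (1 + \<epsilon> Z)\<close> the process \<open>exp (- c t) * f\<close> is bounded, has a bounded diffusion
  coefficient and a nonpositive drift, because \<open>f\<close> is concave and \<open>Z * f'(Z) \<le> f(Z)\<close>. This replaces
  a localization by stopping times.\<close>

lemma ito_process_bounded_moment:
  assumes Z: "ito_process Z D H" and nonneg: "\<And>t \<omega>. 0 \<le> Z t \<omega>" and "0 \<le> c" "0 < \<epsilon>"
    and growth: "AE \<omega> in M. \<forall>t\<in>{0..T}. D t \<omega> \<le> c * Z t \<omega> \<and> \<bar>H t \<omega>\<bar> \<le> c * Z t \<omega>"
    and init: "AE \<omega> in M. Z 0 \<omega> \<le> B" and t: "t \<in> {0..T}"
  shows "integrable M (\<lambda>\<omega>. Z t \<omega> / (1 + \<epsilon> * Z t \<omega>))" "(\<integral>\<omega>. Z t \<omega> / (1 + \<epsilon> * Z t \<omega>) \<partial>M) \<le> B * exp (c * t)"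
proof -
  define R where "R t \<omega> = inverse (1 + \<epsilon> * Z t \<omega>)" for t \<omega>
  define E where "E t = exp (- c * t)" for t
  have Vpos: "1 \<le> 1 + \<epsilon> * Z t \<omega>" for t \<omega> using nonneg[of t \<omega>] \<open>0 < \<epsilon>\<close> by simp
  have R1: "0 < R t \<omega>" "R t \<omega> \<le> 1" for t \<omega>
    using Vpos[of t \<omega>] by (auto simp: R_def inverse_le_1_iff intro: positive_imp_inverse_positive)
  \<comment> \<open>The truncated process is an affine function of the reciprocal \<open>R\<close>,
    so the rule for reciprocals already contains its Ito formula.\<close>
  have f_eq: "Z t \<omega> * R t \<omega> = 1/\<epsilon> * (1 - R t \<omega>)" for t \<omega>
    using Vpos[of t \<omega>] \<open>0 < \<epsilon>\<close> by (simp add: R_def field_simps)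
  have f_div: "Z t \<omega> / (1 + \<epsilon> * Z t \<omega>) = Z t \<omega> * R t \<omega>" for t \<omega> by (simp add: R_def divide_inverse)
  have f_bound: "0 \<le> Z t \<omega> * R t \<omega>" "Z t \<omega> * R t \<omega> \<le> 1/\<epsilon>" for t \<omega>
    using nonneg[of t \<omega>] R1[of t \<omega>] \<open>0 < \<epsilon>\<close> f_eq[of t \<omega>] by (auto simp: divide_right_mono)
  have V: "ito_process (\<lambda>t \<omega>. 1 + \<epsilon> * Z t \<omega>) (\<lambda>t \<omega>. \<epsilon> * D t \<omega>) (\<lambda>t \<omega>. \<epsilon> * H t \<omega>)"
    using ito_process_add[OF ito_process_const[of 1] ito_process_cmult[OF Z, of \<epsilon>]] by simp
  have R: "ito_process R (\<lambda>t \<omega>. - (R t \<omega>)\<^sup>2 * (\<epsilon> * D t \<omega>) + R t \<omega> ^ 3 * (\<epsilon> * H t \<omega>)\<^sup>2) (\<lambda>t \<omega>. - (R t \<omega>)\<^sup>2 * (\<epsilon> * H t \<omega>))"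
    using ito_process_inverse[OF V Vpos] by (simp add: R_def[abs_def])
  define Df where "Df t \<omega> = (R t \<omega>)\<^sup>2 * D t \<omega> - \<epsilon> * R t \<omega> ^ 3 * (H t \<omega>)\<^sup>2" for t \<omega>
  have f: "ito_process (\<lambda>t \<omega>. Z t \<omega> * R t \<omega>) Df (\<lambda>t \<omega>. (R t \<omega>)\<^sup>2 * H t \<omega>)"
  proof -
    have "ito_process (\<lambda>t \<omega>. 1/\<epsilon> * (1 - R t \<omega>))
       (\<lambda>t \<omega>. 1/\<epsilon> * (0 - (- (R t \<omega>)\<^sup>2 * (\<epsilon> * D t \<omega>) + R t \<omega> ^ 3 * (\<epsilon> * H t \<omega>)\<^sup>2)))
       (\<lambda>t \<omega>. 1/\<epsilon> * (0 - (- (R t \<omega>)\<^sup>2 * (\<epsilon> * H t \<omega>))))"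
      by (intro ito_process_cmult ito_process_diff ito_process_const R)
    moreover have "Df = (\<lambda>t \<omega>. 1/\<epsilon> * (0 - (- (R t \<omega>)\<^sup>2 * (\<epsilon> * D t \<omega>) + R t \<omega> ^ 3 * (\<epsilon> * H t \<omega>)\<^sup>2)))"
      using \<open>0 < \<epsilon>\<close> by (intro ext) (simp add: Df_def field_simps power2_eq_square)
    moreover have "(R t \<omega>)\<^sup>2 * H t \<omega> = 1/\<epsilon> * (0 - (- (R t \<omega>)\<^sup>2 * (\<epsilon> * H t \<omega>)))" for t \<omega>
      using \<open>0 < \<epsilon>\<close> by simp
    ultimately show ?thesis by (simp only: f_eq)
  qed
  have "(E has_real_derivative - c * E t) (at t)" for t
    unfolding E_def by (auto intro!: derivative_eq_intros)
  then have Ep: "ito_process (\<lambda>t _. E t) (\<lambda>t _. - c * E t) (\<lambda>_ _. 0)"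
    by (rule ito_process_deterministic) (auto simp: E_def intro!: continuous_intros)
  have g: "ito_process (\<lambda>t \<omega>. E t * (Z t \<omega> * R t \<omega>))
      (\<lambda>t \<omega>. E t * Df t \<omega> + (Z t \<omega> * R t \<omega>) * (- c * E t) + 0 * ((R t \<omega>)\<^sup>2 * H t \<omega>))
      (\<lambda>t \<omega>. E t * ((R t \<omega>)\<^sup>2 * H t \<omega>) + (Z t \<omega> * R t \<omega>) * 0)"
    by (rule ito_process_mult[OF Ep f])
  let ?Dg = "\<lambda>t \<omega>. E t * Df t \<omega> + (Z t \<omega> * R t \<omega>) * (- c * E t) + 0 * ((R t \<omega>)\<^sup>2 * H t \<omega>)"
  let ?Hg = "\<lambda>t \<omega>. E t * ((R t \<omega>)\<^sup>2 * H t \<omega>) + (Z t \<omega> * R t \<omega>) * 0"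
  let ?I = "\<lambda>\<omega>. E t * (Z t \<omega> * R t \<omega>) - E 0 * (Z 0 \<omega> * R 0 \<omega>) - integral {0..t} (\<lambda>s. ?Dg s \<omega>)"
  have E1: "0 < E s" "E s \<le> 1" if "s \<in> {0..T}" for s
    using that \<open>0 \<le> c\<close> by (auto simp: E_def)
  \<comment> \<open>With \<open>f z = z / (1 + \<epsilon> * z)\<close> the derivative is the square
    of the reciprocal, so this is the inequality between \<open>Z * f'(Z)\<close> and
    \<open>f(Z)\<close>.\<close>
  have R2: "(R s \<omega>)\<^sup>2 * Z s \<omega> \<le> Z s \<omega> * R s \<omega>" for s \<omega>
  proof -
    have "(Z s \<omega> * R s \<omega>) * R s \<omega> \<le> (Z s \<omega> * R s \<omega>) * 1" using f_bound R1 by (intro mult_left_mono) auto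
    then show ?thesis by (simp add: power2_eq_square mult_ac)
  qed
  have H_bound: "AE \<omega> in M. norm ((?Hg s \<omega>)\<^sup>2) \<le> (c * (1/\<epsilon>))\<^sup>2" if s: "s \<in> {0..T}" for s
    using growth
  proof eventually_elim
    case (elim \<omega>)
    have "\<bar>?Hg s \<omega>\<bar> = E s * ((R s \<omega>)\<^sup>2 * \<bar>H s \<omega>\<bar>)" using E1[OF s] by (simp add: abs_mult)
    also have "\<dots> \<le> 1 * ((R s \<omega>)\<^sup>2 * (c * Z s \<omega>))"
      using E1[OF s] elim s by (intro mult_mono mult_left_mono) auto
    also have "\<dots> = c * ((R s \<omega>)\<^sup>2 * Z s \<omega>)" by simp
    also have "\<dots> \<le> c * (1/\<epsilon>)"
      using \<open>0 \<le> c\<close> R2[of s \<omega>] f_bound(2)[of s \<omega>] by (intro mult_left_mono) auto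
    finally show ?case using power_mono[of "\<bar>?Hg s \<omega>\<bar>" "c * (1/\<epsilon>)" 2] by simp
  qed
  have H_int: "integrable M (\<lambda>\<omega>. (?Hg s \<omega>)\<^sup>2)" if "s \<in> {0..T}" for s
    using H_bound[OF that] cont_adapted_measM[OF ito_process_cont_adapted(3)[OF g] that]
    by (intro integrable_const_bound[of _ "(c * (1/\<epsilon>))\<^sup>2"] borel_measurable_power)
  have H_le: "(\<integral>\<omega>. (?Hg s \<omega>)\<^sup>2 \<partial>M) \<le> (c * (1/\<epsilon>))\<^sup>2" if "s \<in> {0..T}" for s
  proof -
    have "(\<integral>\<omega>. (?Hg s \<omega>)\<^sup>2 \<partial>M) \<le> (\<integral>\<omega>. (c * (1/\<epsilon>))\<^sup>2 \<partial>M)"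
      using H_bound[OF that] by (intro integral_mono_AE H_int[OF that]) auto
    then show ?thesis by (simp add: prob_space)
  qed
  note mart = ito_process_martingale_part[OF g t H_int H_le]
  have f_int: "integrable M (\<lambda>\<omega>. Z s \<omega> * R s \<omega>)" if "s \<in> {0..T}" for s
    using f_bound cont_adapted_measM[OF ito_process_cont_adapted(1)[OF f] that]
    by (intro integrable_const_bound[of _ "1/\<epsilon>"]) (auto simp: abs_of_nonneg)
  have T0: "0 \<in> {0..T}" using T_pos by simp
  have drift: "AE \<omega> in M. E t * (Z t \<omega> * R t \<omega>) - E 0 * (Z 0 \<omega> * R 0 \<omega>) \<le> ?I \<omega>"
    using growth AE_space
  proof eventually_elim
    case (elim \<omega>)
    have "?Dg s \<omega> \<le> 0" if "s \<in> {0..t}" for s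
    proof -
      have s: "s \<in> {0..T}" using that t by auto
      \<comment> \<open>The dropped term is the second order one, nonpositive because
        \<open>f\<close> is concave. What is left grows at most with rate \<open>c\<close> and is
        cancelled by the decay of \<open>E\<close>.\<close>
      have "Df s \<omega> \<le> (R s \<omega>)\<^sup>2 * D s \<omega>"
        using \<open>0 < \<epsilon>\<close> R1[of s \<omega>] by (simp add: Df_def)
      also have "\<dots> \<le> (R s \<omega>)\<^sup>2 * (c * Z s \<omega>)" using elim s by (intro mult_left_mono) auto
      also have "\<dots> = c * ((R s \<omega>)\<^sup>2 * Z s \<omega>)" by simp
      also have "\<dots> \<le> c * (Z s \<omega> * R s \<omega>)" using R2 \<open>0 \<le> c\<close> by (intro mult_left_mono) auto
      finally have "E s * Df s \<omega> \<le> E s * (c * (Z s \<omega> * R s \<omega>))" using E1[OF s] by (intro mult_left_mono) auto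
      then show ?thesis by (simp add: algebra_simps)
    qed
    moreover have "(\<lambda>s. ?Dg s \<omega>) integrable_on {0..t}"
      by (rule cont_adapted_integrable[OF ito_process_cont_adapted(2)[OF g] elim(2) t])
    ultimately have "integral {0..t} (\<lambda>s. ?Dg s \<omega>) \<le> integral {0..t} (\<lambda>s. 0)"
      by (intro integral_le) auto
    then show ?case by simp
  qed
  have "(\<integral>\<omega>. E t * (Z t \<omega> * R t \<omega>) - E 0 * (Z 0 \<omega> * R 0 \<omega>) \<partial>M) \<le> (\<integral>\<omega>. ?I \<omega> \<partial>M)"
    by (rule integral_mono_AE[OF _ mart(1) drift]) (intro Bochner_Integration.integrable_diff integrable_mult_right f_int t T0)
  then have "E t * (\<integral>\<omega>. Z t \<omega> * R t \<omega> \<partial>M) \<le> E 0 * (\<integral>\<omega>. Z 0 \<omega> * R 0 \<omega> \<partial>M)"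
    using f_int[OF t] f_int[OF T0] mart(2) by simp
  also have "\<dots> \<le> E 0 * (\<integral>\<omega>. B \<partial>M)"
  proof (rule mult_left_mono[OF integral_mono_AE[OF f_int[OF T0]]])
    show "AE \<omega> in M. Z 0 \<omega> * R 0 \<omega> \<le> B"
      using init
    proof eventually_elim
      case (elim \<omega>)
      have "Z 0 \<omega> * R 0 \<omega> \<le> Z 0 \<omega> * 1" using R1 nonneg by (intro mult_left_mono) auto
      then show ?case using elim by simp
    qed
  qed (auto simp: E_def)
  finally have "E t * (\<integral>\<omega>. Z t \<omega> * R t \<omega> \<partial>M) \<le> B" by (simp add: E_def prob_space)
  then have "exp (c * t) * (E t * (\<integral>\<omega>. Z t \<omega> * R t \<omega> \<partial>M)) \<le> exp (c * t) * B" by (intro mult_left_mono) auto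
  then show "(\<integral>\<omega>. Z t \<omega> / (1 + \<epsilon> * Z t \<omega>) \<partial>M) \<le> B * exp (c * t)"
    unfolding f_div by (simp add: E_def mult.assoc[symmetric] exp_add[symmetric] mult.commute[of B])
  show "integrable M (\<lambda>\<omega>. Z t \<omega> / (1 + \<epsilon> * Z t \<omega>))" unfolding f_div by (rule f_int[OF t])
qed

text \<open>The bound for the truncated process does not depend on \<open>\<epsilon>\<close>, so
  Fatou's lemma applies as \<open>\<epsilon>\<close> runs through the reciprocals of the positive
  integers.\<close>

lemma ito_process_moment:
  assumes Z: "ito_process Z D H" and nonneg: "\<And>t \<omega>. 0 \<le> Z t \<omega>" and "0 \<le> c"
    and growth: "AE \<omega> in M. \<forall>t\<in>{0..T}. D t \<omega> \<le> c * Z t \<omega> \<and> \<bar>H t \<omega>\<bar> \<le> c * Z t \<omega>"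
    and init: "AE \<omega> in M. Z 0 \<omega> \<le> B" and t: "t \<in> {0..T}"
  shows "integrable M (Z t)" "(\<integral>\<omega>. Z t \<omega> \<partial>M) \<le> B * exp (c * t)"
proof -
  \<comment> \<open>Taking the root lets the statement on second moments stand in for Fatou's lemma
    on a nonnegative sequence.\<close>
  define X where "X m \<omega> = sqrt (Z t \<omega> / (1 + inverse (real (Suc m)) * Z t \<omega>))" for m \<omega>
  have sq: "(X m \<omega>)\<^sup>2 = Z t \<omega> / (1 + inverse (real (Suc m)) * Z t \<omega>)" for m \<omega>
    using nonneg[of t \<omega>] by (simp add: X_def)
  have [measurable]: "Z t \<in> borel_measurable M" by (rule cont_adapted_measM[OF ito_process_cont_adapted(1)[OF Z] t])
  have lim: "tends_in_prob M X (\<lambda>\<omega>. sqrt (Z t \<omega>))"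
  proof (rule tends_in_prob_AE)
    show "AE \<omega> in M. (\<lambda>m. X m \<omega>) \<longlonglongrightarrow> sqrt (Z t \<omega>)"
    proof (rule AE_I2)
      fix \<omega>
      have "(\<lambda>m. X m \<omega>) \<longlonglongrightarrow> sqrt (Z t \<omega> / (1 + 0 * Z t \<omega>))"
        unfolding X_def by (intro tendsto_intros LIMSEQ_inverse_real_of_nat) auto
      then show "(\<lambda>m. X m \<omega>) \<longlonglongrightarrow> sqrt (Z t \<omega>)" by simp
    qed
  qed (auto simp: X_def[abs_def])
  note bound = ito_process_bounded_moment[OF Z nonneg \<open>0 \<le> c\<close> _ growth init t]
  note res = tends_in_prob_square_bound[OF lim, of "B * exp (c * t)", unfolded sq]
  show "integrable M (Z t)" "(\<integral>\<omega>. Z t \<omega> \<partial>M) \<le> B * exp (c * t)"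
    using res bound[of "inverse (real (Suc _))"] nonneg by simp_all
qed

end

section \<open>Polynomials on the mesh\<close>

lemma sigma_admissible_derivs:
  assumes "sigma_admissible \<sigma>"
  shows "(\<sigma> has_real_derivative deriv \<sigma> y) (at y)"
    "(deriv \<sigma> has_real_derivative deriv (deriv \<sigma>) y) (at y)"
    "continuous_on A \<sigma>" "continuous_on A (deriv \<sigma>)" "continuous_on A (deriv (deriv \<sigma>))"
    "dsq \<sigma> y = 2 * \<sigma> y * deriv \<sigma> y"
    "deriv (dsq \<sigma>) y = 2 * (deriv \<sigma> y)\<^sup>2 + 2 * \<sigma> y * deriv (deriv \<sigma>) y"
proof -
  have C2: "C2_real \<sigma>" using assms by (simp add: sigma_admissible_def)
  have d1: "(\<sigma> has_real_derivative deriv \<sigma> y) (at y)" for y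
    using C2 by (simp add: C2_real_def DERIV_deriv_iff_field_differentiable)
  have d2: "(deriv \<sigma> has_real_derivative deriv (deriv \<sigma>) y) (at y)" for y
    using C2 by (simp add: C2_real_def DERIV_deriv_iff_field_differentiable)
  show "(\<sigma> has_real_derivative deriv \<sigma> y) (at y)"
    "(deriv \<sigma> has_real_derivative deriv (deriv \<sigma>) y) (at y)" by (rule d1 d2)+
  show "continuous_on A \<sigma>" using d1 DERIV_isCont by (blast intro: continuous_at_imp_continuous_on)
  show "continuous_on A (deriv \<sigma>)" using d2 DERIV_isCont by (blast intro: continuous_at_imp_continuous_on)
  show "continuous_on A (deriv (deriv \<sigma>))" using C2 by (auto simp: C2_real_def intro: continuous_on_subset)
  have dsq: "dsq \<sigma> y = 2 * \<sigma> y * deriv \<sigma> y" for y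
    by (rule DERIV_imp_deriv) (auto intro!: derivative_eq_intros d1)
  then show "dsq \<sigma> y = 2 * \<sigma> y * deriv \<sigma> y" .
  have "dsq \<sigma> = (\<lambda>y. 2 * \<sigma> y * deriv \<sigma> y)" using dsq by (rule ext)
  moreover have "deriv (\<lambda>y. 2 * \<sigma> y * deriv \<sigma> y) y = 2 * (deriv \<sigma> y)\<^sup>2 + 2 * \<sigma> y * deriv (deriv \<sigma>) y"
    by (rule DERIV_imp_deriv) (auto intro!: derivative_eq_intros d1 d2 simp: power2_eq_square)
  ultimately show "deriv (dsq \<sigma>) y = 2 * (deriv \<sigma> y)\<^sup>2 + 2 * \<sigma> y * deriv (deriv \<sigma>) y" by simp
qed

lemma integral_poly_square_pos:
  fixes p :: "real poly"
  assumes "a < b" "p \<noteq> 0"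
  shows "0 < integral {a..b} (\<lambda>y. poly p y * poly p y)"
proof -
  have c: "continuous_on {a..b} (\<lambda>y. poly p y * poly p y)" by (intro continuous_intros)
  have "0 \<le> integral {a..b} (\<lambda>y. poly p y * poly p y)"
    by (rule Henstock_Kurzweil_Integration.integral_nonneg[OF integrable_continuous_real[OF c]]) simp
  moreover have "integral {a..b} (\<lambda>y. poly p y * poly p y) \<noteq> 0"
  proof
    assume "integral {a..b} (\<lambda>y. poly p y * poly p y) = 0"
    then have "\<forall>y\<in>{a..b}. poly p y * poly p y = 0"
      using integral_eq_0_iff[OF c \<open>a < b\<close>] by simp
    then have "{a..b} \<subseteq> {y. poly p y = 0}" by auto
    then show False using poly_roots_finite[OF \<open>p \<noteq> 0\<close>] \<open>a < b\<close> infinite_Icc finite_subset by blast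
  qed
  ultimately show ?thesis by linarith
qed

lemma integral_mult_sum_poly:
  fixes f :: "real \<Rightarrow> real" and c :: "'i \<Rightarrow> real"
  assumes "continuous_on {a..b} f" "finite I"
  shows "integral {a..b} (\<lambda>y. f y * poly (\<Sum>i\<in>I. smult (c i) (p i)) y) = (\<Sum>i\<in>I. c i * integral {a..b} (\<lambda>y. f y * poly (p i) y))"
proof -
  have "integral {a..b} (\<lambda>y. f y * poly (\<Sum>i\<in>I. smult (c i) (p i)) y) = integral {a..b} (\<lambda>y. \<Sum>i\<in>I. c i * (f y * poly (p i) y))"
    by (simp add: poly_sum sum_distrib_left mult.left_commute)
  also have "\<dots> = (\<Sum>i\<in>I. integral {a..b} (\<lambda>y. c i * (f y * poly (p i) y)))"
    using assms by (intro integral_sum integrable_continuous_real continuous_intros)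
  finally show ?thesis by simp
qed

text \<open>Gram-Schmidt by induction on the degree. The expansion of every polynomial is the
  property recorded, since Parseval's identity, bounds by coordinates and linearity arguments all
  follow from it.\<close>

lemma orthonormal_poly_basis:
  fixes a b :: real
  assumes "a < b"
  shows "\<exists>e. (\<forall>i\<le>k. degree (e i) \<le> k) \<and>
    (\<forall>v. degree v \<le> k \<longrightarrow> v = (\<Sum>i\<le>k. smult (integral {a..b} (\<lambda>y. poly (e i) y * poly v y)) (e i)))"
proof (induction k)
  case 0
  \<comment> \<open>Only the index 0 counts here; the constant is normalized by the length of the
    interval.\<close>
  define e where "e = (\<lambda>_::nat. [:1 / sqrt (b - a):])"
  have "v = smult (integral {a..b} (\<lambda>y. poly (e 0) y * poly v y)) (e 0)" if deg: "degree v \<le> 0" for v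
  proof -
    obtain c where v: "v = [:c:]" using degree0_coeffs deg by blast
    have "integral {a..b} (\<lambda>y. poly (e 0) y * poly v y) = (b - a) * (c / sqrt (b - a))"
      using assms by (simp add: v e_def)
    then show ?thesis using assms by (simp add: v e_def)
  qed
  then show ?case by (intro exI[of _ e]) (auto simp: e_def)
next
  case (Suc k)
  obtain e where e: "\<And>i. i \<le> k \<Longrightarrow> degree (e i) \<le> k"
    and exp: "\<And>v. degree v \<le> k \<Longrightarrow> v = (\<Sum>i\<le>k. smult (integral {a..b} (\<lambda>y. poly (e i) y * poly v y)) (e i))"
    using Suc by blast
  define ip where "ip p q = integral {a..b} (\<lambda>y. poly p y * poly q y)" for p q :: "real poly"
  have ip_sum: "ip p (\<Sum>i\<in>I. smult (c i) (f i)) = (\<Sum>i\<in>I. c i * ip p (f i))" if "finite I"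
    for p c f and I :: "nat set"
    unfolding ip_def using that by (intro integral_mult_sum_poly continuous_intros)
  have ip_diff: "ip p (q - r) = ip p q - ip p r" for p q r
    unfolding ip_def by (simp add: right_diff_distrib, rule integral_diff) (intro integrable_continuous_real continuous_intros)+
  have ip_add: "ip p (q + r) = ip p q + ip p r" for p q r
    unfolding ip_def by (simp add: distrib_left, rule integral_add) (intro integrable_continuous_real continuous_intros)+
  have ip_smult: "ip p (smult c q) = c * ip p q" for p q c
    unfolding ip_def by (simp add: mult.left_commute)
  have ip_comm: "ip p q = ip q p" for p q unfolding ip_def by (simp add: mult.commute)
  \<comment> \<open>The next monomial minus its projection. The leading coefficient 1 ensures that
    the remainder is nonzero, so it can be normalized.\<close>
  define m where "m = (monom 1 (Suc k) :: real poly)"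
  define p where "p = m - (\<Sum>i\<le>k. smult (ip (e i) m) (e i))"
  have deg_s: "degree (\<Sum>i\<le>k. smult (ip (e i) m) (e i)) \<le> k"
    using e by (intro degree_sum_le) (auto intro: order_trans[OF degree_smult_le])
  have deg_p: "degree p \<le> Suc k"
    unfolding p_def using deg_s by (intro degree_diff_le) (auto simp: m_def degree_monom_eq)
  have coeff_p: "coeff p (Suc k) = 1"
    unfolding p_def using deg_s by (simp add: m_def coeff_eq_0)
  have "p \<noteq> 0" using coeff_p by auto
  then have pos: "0 < ip p p" unfolding ip_def by (rule integral_poly_square_pos[OF assms])
  \<comment> \<open>Expanding \<open>v\<close> in the old basis turns \<open>ip m v\<close> into the
    very sum that the projection part of \<open>p\<close> contributes, so the two cancel.\<close>
  have orth: "ip p v = 0" if "degree v \<le> k" for v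
  proof -
    have v: "v = (\<Sum>i\<le>k. smult (ip (e i) v) (e i))" using exp[OF that] by (simp only: ip_def)
    have "ip m v = (\<Sum>i\<le>k. ip (e i) v * ip m (e i))"
      by (subst v, subst ip_sum) auto
    moreover have "ip v (\<Sum>i\<le>k. smult (ip (e i) m) (e i)) = (\<Sum>i\<le>k. ip (e i) m * ip v (e i))"
      by (subst ip_sum) auto
    moreover have "(\<Sum>i\<le>k. ip (e i) v * ip m (e i)) = (\<Sum>i\<le>k. ip (e i) m * ip v (e i))"
      by (intro sum.cong refl) (simp add: ip_comm[of m] ip_comm[of v])
    moreover have "ip p v = ip v m - ip v (\<Sum>i\<le>k. smult (ip (e i) m) (e i))"
      unfolding ip_comm[of p v] by (simp only: p_def ip_diff)
    ultimately show ?thesis by (simp only: ip_comm[of v m])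
  qed
  define n where "n = smult (1 / sqrt (ip p p)) p"
  define e' where "e' i = (if i = Suc k then n else e i)" for i
  have "v = (\<Sum>i\<le>Suc k. smult (ip (e' i) v) (e' i))" if deg: "degree v \<le> Suc k" for v
  proof -
    \<comment> \<open>Subtracting the multiple \<open>c\<close> of \<open>p\<close> removes the top
      coefficient of \<open>v\<close>, and the induction hypothesis expands the rest.\<close>
    define c where "c = coeff v (Suc k)"
    define w where "w = v - smult c p"
    have degw1: "degree w \<le> Suc k"
      unfolding w_def using deg deg_p by (intro degree_diff_le) (auto intro: order_trans[OF degree_smult_le])
    have coeffw: "coeff w (Suc k) = 0" by (simp add: w_def c_def coeff_p)
    have deg_w: "degree w \<le> k"
    proof (rule degree_le, intro allI impI)
      fix i assume "k < i"
      then show "coeff w i = 0"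
        using coeffw coeff_eq_0[of w i] degw1 by (cases "i = Suc k") auto
    qed
    have v: "v = w + smult c p" by (simp add: w_def)
    have "ip (e i) v = ip (e i) w" if "i \<le> k" for i
      unfolding v ip_add ip_smult using orth[OF e[OF that]] by (simp add: ip_comm)
    then have "(\<Sum>i\<le>k. smult (ip (e i) v) (e i)) = (\<Sum>i\<le>k. smult (ip (e i) w) (e i))" by simp
    also have "\<dots> = w" using exp[OF deg_w] by (simp add: ip_def)
    finally have 1: "(\<Sum>i\<le>k. smult (ip (e i) v) (e i)) = w" .
    have "ip n v = 1 / sqrt (ip p p) * (c * ip p p)"
    proof -
      have "ip n v = 1 / sqrt (ip p p) * ip p v"
        by (subst ip_comm) (simp only: n_def ip_smult ip_comm[of v p])
      moreover have "ip p v = c * ip p p" unfolding v ip_add ip_smult orth[OF deg_w] by simp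
      ultimately show ?thesis by simp
    qed
    then have "smult (ip n v) n = smult c p" using pos by (simp add: n_def)
    then show ?thesis using 1 v by (simp add: e'_def)
  qed
  moreover have "degree (e' i) \<le> Suc k" if "i \<le> Suc k" for i
    using e[of i] that deg_p by (auto simp: e'_def n_def le_Suc_eq intro: order_trans[OF degree_smult_le])
  ultimately show ?case by (intro exI[of _ e']) (auto simp: ip_def)
qed

lemma pderiv_sum_smult:
  fixes c :: "'i \<Rightarrow> real"
  shows "pderiv (\<Sum>i\<in>I. smult (c i) (p i)) = (\<Sum>i\<in>I. smult (c i) (pderiv (p i)))"
  by (induction I rule: infinite_finite_induct) (auto simp: pderiv_add pderiv_smult)

section \<open>Coordinates and the energy norm on the mesh\<close>

locale dg_mesh =
  fixes N k :: nat and x :: "nat \<Rightarrow> real"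
  assumes mesh: "mesh N x"
begin

lemma mesh_less: "j < N \<Longrightarrow> x j < x (Suc j)"
  using mesh by (simp add: mesh_def)

lemma N_pos: "0 < N"
  using mesh by (simp add: mesh_def)

definition basis :: "nat \<Rightarrow> nat \<Rightarrow> real poly" where
  "basis j = (SOME e. (\<forall>i\<le>k. degree (e i) \<le> k) \<and> (\<forall>v. degree v \<le> k \<longrightarrow>
     v = (\<Sum>i\<le>k. smult (integral (cell x j) (\<lambda>y. poly (e i) y * poly v y)) (e i))))"

definition coord :: "nat \<Rightarrow> nat \<Rightarrow> broken_poly \<Rightarrow> real" where
  "coord j i v = integral (cell x j) (\<lambda>y. poly (basis j i) y * poly (v j) y)"

text \<open>On the broken space this is the squared \<open>L^2\<close> norm. Written in coordinates
  it is a polynomial in scalar Ito processes, and it is nonnegative for every argument, also outside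
  the broken space.\<close>

definition energy :: "broken_poly \<Rightarrow> real" where
  "energy v = (\<Sum>j<N. \<Sum>i\<le>k. (coord j i v)\<^sup>2)"

definition dg_norm :: "broken_poly \<Rightarrow> real" where
  "dg_norm v = sqrt (energy v)"

lemma basis:
  assumes "j < N"
  shows "i \<le> k \<Longrightarrow> degree (basis j i) \<le> k"
    "degree v \<le> k \<Longrightarrow> v = (\<Sum>i\<le>k. smult (integral (cell x j) (\<lambda>y. poly (basis j i) y * poly v y)) (basis j i))"
  using someI_ex[OF orthonormal_poly_basis[OF mesh_less[OF assms], of k, folded cell_def], folded basis_def]
  by blast+

definition basis_fun :: "nat \<Rightarrow> nat \<Rightarrow> broken_poly" where
  "basis_fun j i = (\<lambda>l. if l = j then basis j i else 0)"

lemma basis_fun_in: "j < N \<Longrightarrow> i \<le> k \<Longrightarrow> basis_fun j i \<in> broken_space N k"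
  using basis(1) by (auto simp: broken_space_def basis_fun_def)

lemma expansion:
  "v \<in> broken_space N k \<Longrightarrow> j < N \<Longrightarrow> v j = (\<Sum>i\<le>k. smult (coord j i v) (basis j i))"
  using basis(2)[of j "v j"] by (simp add: coord_def broken_space_def)

lemma poly_expansion:
  "v \<in> broken_space N k \<Longrightarrow> j < N \<Longrightarrow> poly (v j) y = (\<Sum>i\<le>k. coord j i v * poly (basis j i) y)"
  by (subst expansion) (auto simp: poly_sum)

lemma pderiv_expansion:
  "v \<in> broken_space N k \<Longrightarrow> j < N \<Longrightarrow> poly (pderiv (v j)) y = (\<Sum>i\<le>k. coord j i v * poly (pderiv (basis j i)) y)"
  by (subst expansion) (auto simp: poly_sum pderiv_sum_smult)

lemma inner_product_expansion:
  assumes "v \<in> broken_space N k" "j < N"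
  shows "integral (cell x j) (\<lambda>y. poly (w j) y * poly (v j) y) = (\<Sum>i\<le>k. coord j i v * coord j i w)"
proof -
  have "integral (cell x j) (\<lambda>y. poly (w j) y * poly (v j) y)
      = integral (cell x j) (\<lambda>y. poly (w j) y * poly (\<Sum>i\<le>k. smult (coord j i v) (basis j i)) y)"
    by (subst expansion[OF assms]) simp
  also have "\<dots> = (\<Sum>i\<le>k. coord j i v * integral (cell x j) (\<lambda>y. poly (w j) y * poly (basis j i) y))"
    unfolding cell_def by (intro integral_mult_sum_poly continuous_intros) simp
  finally show ?thesis by (simp add: coord_def mult.commute)
qed

lemma energy_nonneg: "0 \<le> energy v"
  unfolding energy_def by (intro sum_nonneg) auto

lemma dg_norm_nonneg: "0 \<le> dg_norm v"
  by (simp add: dg_norm_def energy_nonneg)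

lemma dg_norm_square: "(dg_norm v)\<^sup>2 = energy v"
  by (simp add: dg_norm_def energy_nonneg)

lemma coord_le_norm: "j < N \<Longrightarrow> i \<le> k \<Longrightarrow> \<bar>coord j i v\<bar> \<le> dg_norm v"
proof -
  assume "j < N" "i \<le> k"
  have "(coord j i v)\<^sup>2 \<le> (\<Sum>i\<le>k. (coord j i v)\<^sup>2)"
    using \<open>i \<le> k\<close> by (intro member_le_sum) auto
  also have "\<dots> \<le> energy v"
    unfolding energy_def using \<open>j < N\<close> by (intro member_le_sum[where f="\<lambda>j. \<Sum>i\<le>k. (coord j i v)\<^sup>2"]) (auto intro: sum_nonneg)
  finally show ?thesis unfolding dg_norm_def by (metis real_sqrt_abs real_sqrt_le_iff)
qed

text \<open>All norms on a finite-dimensional space are equivalent; the constant adds up the suprema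
  of the basis polynomials and of their derivatives over all cells.\<close>

lemma sup_bound:
  "\<exists>C\<ge>0. \<forall>v\<in>broken_space N k. \<forall>j<N. \<forall>y\<in>cell x j.
     \<bar>poly (v j) y\<bar> \<le> C * dg_norm v \<and> \<bar>poly (pderiv (v j)) y\<bar> \<le> C * dg_norm v"
proof -
  have "\<exists>B. \<forall>y\<in>cell x j. \<bar>poly p y\<bar> \<le> B" for j and p :: "real poly"
  proof -
    have "bounded (poly p ` cell x j)"
      unfolding cell_def by (intro compact_imp_bounded compact_continuous_image continuous_intros) simp
    then show ?thesis unfolding bounded_iff by (metis imageI real_norm_def)
  qed
  then obtain B where B: "\<And>j p y. y \<in> cell x j \<Longrightarrow> \<bar>poly p y\<bar> \<le> B j p" by metis
  define C where "C = (\<Sum>j<N. \<Sum>i\<le>k. \<bar>B j (basis j i)\<bar> + \<bar>B j (pderiv (basis j i))\<bar>)"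
  have C0: "0 \<le> C" unfolding C_def by (intro sum_nonneg add_nonneg_nonneg) auto
  have main: "\<bar>\<Sum>i\<le>k. coord j i v * poly (p i) y\<bar> \<le> C * dg_norm v"
    if "j < N" "y \<in> cell x j" "\<And>i. i \<le> k \<Longrightarrow> \<bar>B j (p i)\<bar> \<le> \<bar>B j (basis j i)\<bar> + \<bar>B j (pderiv (basis j i))\<bar>" for j y v p
  proof -
    have "\<bar>\<Sum>i\<le>k. coord j i v * poly (p i) y\<bar> \<le> (\<Sum>i\<le>k. dg_norm v * (\<bar>B j (basis j i)\<bar> + \<bar>B j (pderiv (basis j i))\<bar>))"
    proof (rule order_trans[OF sum_abs sum_mono])
      fix i assume "i \<in> {..k}"
      then show "\<bar>coord j i v * poly (p i) y\<bar> \<le> dg_norm v * (\<bar>B j (basis j i)\<bar> + \<bar>B j (pderiv (basis j i))\<bar>)"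
        unfolding abs_mult using coord_le_norm[OF that(1), of i v] B[OF that(2), of "p i"] that(3)[of i]
        by (intro mult_mono) (auto simp: dg_norm_nonneg)
    qed
    also have "\<dots> = dg_norm v * (\<Sum>i\<le>k. \<bar>B j (basis j i)\<bar> + \<bar>B j (pderiv (basis j i))\<bar>)"
      by (simp only: sum_distrib_left)
    also have "\<dots> \<le> dg_norm v * C"
      unfolding C_def using that(1) dg_norm_nonneg
      by (intro mult_left_mono member_le_sum[where f="\<lambda>j. \<Sum>i\<le>k. \<bar>B j (basis j i)\<bar> + \<bar>B j (pderiv (basis j i))\<bar>"])
        (auto intro: sum_nonneg)
    finally show ?thesis by (simp add: mult.commute)
  qed
  show ?thesis
  proof (intro exI[of _ C] conjI C0 ballI allI impI)
    fix v j y assume v: "v \<in> broken_space N k" "j < N" "y \<in> cell x j"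
    show "\<bar>poly (v j) y\<bar> \<le> C * dg_norm v"
      unfolding poly_expansion[OF v(1,2)] by (rule main[OF v(2,3)]) simp
    show "\<bar>poly (pderiv (v j)) y\<bar> \<le> C * dg_norm v"
      unfolding pderiv_expansion[OF v(1,2)] by (rule main[OF v(2,3)]) simp
  qed
qed

lemma trm_eq: "j < N \<Longrightarrow> trm x v (Suc j) = poly (v j) (x (Suc j))"
  by (simp add: trm_def)

lemma trp_eq: "j < N \<Longrightarrow> trp N x v j = poly (v j) (x j)"
  by (simp add: trp_def)

lemma jump_ends: "jump N x v 0 = 0" "jump N x v N = 0"
  using N_pos by (auto simp: jump_def trp_def trm_def)

lemma trace_bound:
  "\<exists>C\<ge>0. \<forall>v\<in>broken_space N k. \<forall>i\<le>N. \<bar>trm x v i\<bar> \<le> C * dg_norm v \<and> \<bar>trp N x v i\<bar> \<le> C * dg_norm v"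
proof -
  obtain C where C: "0 \<le> C" "\<And>v j y. v \<in> broken_space N k \<Longrightarrow> j < N \<Longrightarrow> y \<in> cell x j \<Longrightarrow> \<bar>poly (v j) y\<bar> \<le> C * dg_norm v"
    using sup_bound by blast
  have cells: "x j \<in> cell x j" "x (Suc j) \<in> cell x j" if "j < N" for j
    using mesh_less[OF that] by (auto simp: cell_def)
  have "\<bar>trm x v i\<bar> \<le> C * dg_norm v" "\<bar>trp N x v i\<bar> \<le> C * dg_norm v" if "v \<in> broken_space N k" "i \<le> N" for v i
    using C(2)[OF that(1)] cells[of 0] cells[of "i - 1"] cells[of "N - 1"] cells[of i] that(2) N_pos
    by (auto simp: trm_def trp_def)
  then show ?thesis using C(1) by blast
qed

lemma energy_eq:
  assumes "v \<in> broken_space N k"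
  shows "energy v = (\<Sum>j<N. integral (cell x j) (\<lambda>y. poly (v j) y * poly (v j) y))"
  unfolding energy_def using inner_product_expansion[OF assms, of _ v] by (auto intro!: sum.cong simp: power2_eq_square)

lemma cell_integral_bound:
  assumes "continuous_on (cell x j) f" "\<And>y. y \<in> cell x j \<Longrightarrow> \<bar>f y\<bar> \<le> B" "j < N"
  shows "\<bar>integral (cell x j) f\<bar> \<le> B * (x (Suc j) - x j)"
  using integral_bound[of "x j" "x (Suc j)" f B] assms mesh_less[OF assms(3)] by (simp add: cell_def)

text \<open>The equation is tested with \<open>q\<close> and summed over the cells. The right side
  contains \<open>q\<close> as an unknown only in the flux part weighted by \<open>\<eta>u\<close>,
  whose sum is nonpositive. All other terms are linear in \<open>u\<close> and linear in
  \<open>q\<close>, and one factor of the norm of \<open>q\<close> cancels.\<close>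

lemma coercivity:
  assumes \<sigma>: "continuous_on UNIV \<sigma>" and "0 \<le> \<eta>u" and \<theta>: "\<theta> \<in> {0..1}"
  shows "\<exists>C\<ge>0. \<forall>u\<in>broken_space N k. \<forall>q\<in>broken_space N k.
    (\<forall>j<N. q_equation N x \<sigma> \<theta> \<eta>u j u q q) \<longrightarrow> dg_norm q \<le> C * dg_norm u"
proof -
  obtain C1 where C1: "0 \<le> C1" "\<And>v j y. v \<in> broken_space N k \<Longrightarrow> j < N \<Longrightarrow> y \<in> cell x j \<Longrightarrow>
     \<bar>poly (v j) y\<bar> \<le> C1 * dg_norm v \<and> \<bar>poly (pderiv (v j)) y\<bar> \<le> C1 * dg_norm v"
    using sup_bound by blast
  obtain C2 where C2: "0 \<le> C2" "\<And>v i. v \<in> broken_space N k \<Longrightarrow> i \<le> N \<Longrightarrow>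
     \<bar>trm x v i\<bar> \<le> C2 * dg_norm v \<and> \<bar>trp N x v i\<bar> \<le> C2 * dg_norm v"
    using trace_bound by blast
  have "\<exists>B. \<forall>y\<in>cell x j. \<bar>\<sigma> y\<bar> \<le> B" for j
  proof -
    have "bounded (\<sigma> ` cell x j)"
      unfolding cell_def by (intro compact_imp_bounded compact_continuous_image continuous_on_subset[OF \<sigma>]) auto
    then show ?thesis unfolding bounded_iff by (metis imageI real_norm_def)
  qed
  then obtain B where B: "\<And>j y. y \<in> cell x j \<Longrightarrow> \<bar>\<sigma> y\<bar> \<le> B j" by metis
  \<comment> \<open>One summand per cell: the volume term with its length, and one trace product at
    each of the two nodes.\<close>
  define K where "K = (\<Sum>j<N. C1 * \<bar>B j\<bar> * C1 * (x (Suc j) - x j) + \<bar>\<sigma> (x (Suc j))\<bar> * C2 * C2 + \<bar>\<sigma> (x j)\<bar> * C2 * C2)"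
  have K0: "0 \<le> K"
    unfolding K_def using C1(1) C2(1) mesh_less by (intro sum_nonneg add_nonneg_nonneg mult_nonneg_nonneg) (auto simp: less_imp_le)
  have "dg_norm q \<le> K * dg_norm u"
    if u: "u \<in> broken_space N k" and q: "q \<in> broken_space N k" and eq: "\<forall>j<N. q_equation N x \<sigma> \<theta> \<eta>u j u q q" for u q
  proof -
    define L where "L i = \<theta> * trm x u i + (1 - \<theta>) * trp N x u i" for i
    define s where "s i = \<eta>u * \<bar>\<sigma> (x i)\<bar> * jump N x q i" for i
    define J where "J j = integral (cell x j) (\<lambda>y. deriv (poly (q j)) y * \<sigma> y * poly (u j) y)" for j
    have flux: "\<sigma> (x i) * flux_tFu N x \<sigma> \<theta> \<eta>u u q i = \<sigma> (x i) * L i + s i" for i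
      by (simp add: flux_tFu_def L_def s_def algebra_simps abs_sgn[of "\<sigma> (x i)"])
    have cell_eq: "integral (cell x j) (\<lambda>y. poly (q j) y * poly (q j) y)
        = (- J j + \<sigma> (x (Suc j)) * L (Suc j) * trm x q (Suc j) - \<sigma> (x j) * L j * trp N x q j)
          + (s (Suc j) * trm x q (Suc j) - s j * trp N x q j)" if "j < N" for j
      using eq that unfolding q_equation_def flux J_def by (simp add: trm_eq trp_eq algebra_simps)
    have L_bound: "\<bar>L i\<bar> \<le> C2 * dg_norm u" if "i \<le> N" for i
    proof -
      have "\<bar>L i\<bar> \<le> \<theta> * \<bar>trm x u i\<bar> + (1 - \<theta>) * \<bar>trp N x u i\<bar>"
        unfolding L_def using \<theta> by (intro order_trans[OF abs_triangle_ineq]) (auto simp: abs_mult)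
      also have "\<dots> \<le> \<theta> * (C2 * dg_norm u) + (1 - \<theta>) * (C2 * dg_norm u)"
        using C2(2)[OF u that] \<theta> by (intro add_mono mult_left_mono) auto
      finally show ?thesis by (simp add: algebra_simps)
    qed
    have J_bound: "\<bar>J j\<bar> \<le> (C1 * dg_norm q * \<bar>B j\<bar> * (C1 * dg_norm u)) * (x (Suc j) - x j)" if "j < N" for j
      unfolding J_def
    proof (rule cell_integral_bound[OF _ _ that])
      show "continuous_on (cell x j) (\<lambda>y. deriv (poly (q j)) y * \<sigma> y * poly (u j) y)"
        by (simp add: poly_DERIV[THEN DERIV_imp_deriv]) (intro continuous_intros continuous_on_subset[OF \<sigma>], simp)
      fix y assume y: "y \<in> cell x j"
      show "\<bar>deriv (poly (q j)) y * \<sigma> y * poly (u j) y\<bar> \<le> C1 * dg_norm q * \<bar>B j\<bar> * (C1 * dg_norm u)"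
        unfolding abs_mult poly_DERIV[THEN DERIV_imp_deriv]
        using C1(2)[OF q that y] C1(2)[OF u that y] B[OF y] C1(1)
        by (intro mult_mono) (auto simp: dg_norm_nonneg)
    qed
    \<comment> \<open>Shifting the first sum by one node matches the left trace with the right trace
      at each node and leaves minus the squared jump. No boundary term remains, because the jump
      vanishes at both end nodes.\<close>
    have tel: "(\<Sum>j<N. s (Suc j) * trm x q (Suc j) - s j * trp N x q j) \<le> 0"
    proof -
      have s0: "s 0 = 0" "s N = 0" by (auto simp: s_def jump_ends)
      have "(\<Sum>j<N. s (Suc j) * trm x q (Suc j)) = (\<Sum>j<Suc N. s j * trm x q j)"
        by (subst sum.lessThan_Suc_shift) (simp add: s0)
      also have "\<dots> = (\<Sum>j<N. s j * trm x q j)" by (simp add: s0)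
      finally have "(\<Sum>j<N. s (Suc j) * trm x q (Suc j) - s j * trp N x q j) = (\<Sum>j<N. - (\<eta>u * \<bar>\<sigma> (x j)\<bar> * (jump N x q j)\<^sup>2))"
        by (simp add: sum_subtractf, simp add: sum_subtractf[symmetric])
          (intro sum.cong refl, simp add: s_def jump_def power2_eq_square algebra_simps)
      also have "\<dots> \<le> 0" using \<open>0 \<le> \<eta>u\<close> by (intro sum_nonpos) auto
      finally show ?thesis .
    qed
    have "energy q = (\<Sum>j<N. - J j + \<sigma> (x (Suc j)) * L (Suc j) * trm x q (Suc j) - \<sigma> (x j) * L j * trp N x q j)
        + (\<Sum>j<N. s (Suc j) * trm x q (Suc j) - s j * trp N x q j)"
      unfolding energy_eq[OF q] sum.distrib[symmetric] using cell_eq by (intro sum.cong) auto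
    also have "\<dots> \<le> (\<Sum>j<N. - J j + \<sigma> (x (Suc j)) * L (Suc j) * trm x q (Suc j) - \<sigma> (x j) * L j * trp N x q j)"
      using tel by simp
    also have "\<dots> \<le> (\<Sum>j<N. (C1 * \<bar>B j\<bar> * C1 * (x (Suc j) - x j) + \<bar>\<sigma> (x (Suc j))\<bar> * C2 * C2 + \<bar>\<sigma> (x j)\<bar> * C2 * C2) * (dg_norm q * dg_norm u))"
    proof (rule sum_mono)
      fix j assume "j \<in> {..<N}" then have j: "j < N" by simp
      have t: "\<bar>\<sigma> (x i) * L i * w\<bar> \<le> \<bar>\<sigma> (x i)\<bar> * (C2 * dg_norm u) * (C2 * dg_norm q)" if "i \<le> N" "\<bar>w\<bar> \<le> C2 * dg_norm q" for i w
        unfolding abs_mult using L_bound[OF that(1)] that(2) C2(1) by (intro mult_mono) (auto simp: dg_norm_nonneg)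
      have "\<sigma> (x (Suc j)) * L (Suc j) * trm x q (Suc j) \<le> \<bar>\<sigma> (x (Suc j))\<bar> * (C2 * dg_norm u) * (C2 * dg_norm q)"
        using t[of "Suc j" "trm x q (Suc j)"] C2(2)[OF q, of "Suc j"] j by auto
      moreover have "- (\<sigma> (x j) * L j * trp N x q j) \<le> \<bar>\<sigma> (x j)\<bar> * (C2 * dg_norm u) * (C2 * dg_norm q)"
        using t[of j "trp N x q j"] C2(2)[OF q, of j] j by auto
      moreover have "- J j \<le> (C1 * dg_norm q * \<bar>B j\<bar> * (C1 * dg_norm u)) * (x (Suc j) - x j)"
        using J_bound[OF j] by auto
      ultimately show "- J j + \<sigma> (x (Suc j)) * L (Suc j) * trm x q (Suc j) - \<sigma> (x j) * L j * trp N x q j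
          \<le> (C1 * \<bar>B j\<bar> * C1 * (x (Suc j) - x j) + \<bar>\<sigma> (x (Suc j))\<bar> * C2 * C2 + \<bar>\<sigma> (x j)\<bar> * C2 * C2) * (dg_norm q * dg_norm u)"
        by (simp add: algebra_simps)
    qed
    also have "\<dots> = K * dg_norm u * dg_norm q"
      by (simp only: K_def sum_distrib_right[symmetric] mult.assoc mult.commute[of "dg_norm q"])
    finally have "dg_norm q * dg_norm q \<le> K * dg_norm u * dg_norm q"
      by (simp add: dg_norm_square[symmetric] power2_eq_square)
    then show ?thesis
      using dg_norm_nonneg[of q] dg_norm_nonneg[of u] K0 by (cases "dg_norm q = 0") (auto simp: mult_le_cancel_right)
  qed
  then show ?thesis using K0 by blast
qed

end

text \<open>The upwind value differs from the average by half a jump, signed like \<open>d\<close>.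
  The flux is thus the average plus the weight \<open>\<gamma> / 2 + \<gamma>t\<close> times a
  signed jump; replacing one trace by the other kills the average part and leaves the
  penalty.\<close>

lemma penalty_advection:
  fixes d um up \<gamma> \<gamma>t Fu :: real
  assumes "Fu = \<gamma> * (if d \<ge> 0 then up else um) + (1 - \<gamma>) * ((up + um) / 2) + \<gamma>t * sgn d * (up - um)"
  shows "1/4 * d * (2 * Fu - up) * up = 1/4 * d * (2 * Fu - um) * um + 1/4 * (\<gamma> + 2 * \<gamma>t) * \<bar>d\<bar> * (up - um)\<^sup>2"
proof -
  have "d * (Fu - (up + um) / 2) = (\<gamma> / 2 + \<gamma>t) * \<bar>d\<bar> * (up - um)"
    unfolding assms by (cases "d > 0"; cases "d = 0") (auto simp: field_simps)
  then have dFu: "d * Fu = (\<gamma> / 2 + \<gamma>t) * \<bar>d\<bar> * (up - um) + d * ((up + um) / 2)" by (simp add: algebra_simps)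
  have "1/4 * d * (2 * Fu - up) * up - 1/4 * d * (2 * Fu - um) * um
      = 1/2 * (d * Fu) * (up - um) - 1/4 * d * (up * up - um * um)" by (simp add: field_simps)
  also have "\<dots> = 1/4 * (\<gamma> + 2 * \<gamma>t) * \<bar>d\<bar> * (up - um)\<^sup>2"
    unfolding dFu by (simp add: field_simps power2_eq_square)
  finally show ?thesis by simp
qed

text \<open>The weights \<open>\<theta>\<close> and \<open>1 - \<theta>\<close> are placed crosswise
  in the two fluxes, so for every \<open>\<theta>\<close> the jumps of both factors combine by the
  discrete product rule to the jump of the product, which cancels. Only the stabilizing terms
  survive.\<close>

lemma penalty_diffusion:
  fixes s um up qm qp \<theta> \<eta>u \<eta>q :: real
  assumes "Fu = \<theta> * um + (1 - \<theta>) * up + \<eta>u * sgn s * (qp - qm)"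
    and "Fq = (1 - \<theta>) * qm + \<theta> * qp + \<eta>q * sgn s * (up - um)"
  shows "s * (up * Fq + Fu * qp - up * qp) = s * (um * Fq + Fu * qm - um * qm)
    + \<bar>s\<bar> * (\<eta>u * (qp - qm)\<^sup>2 + \<eta>q * (up - um)\<^sup>2)"
  unfolding assms abs_sgn[of s] by (simp add: algebra_simps power2_eq_square)

text \<open>Bookkeeping with the interior traces \<open>p\<close> of the solution and
  \<open>r\<close> of the auxiliary variable at the right and left node, \<open>d\<close> and
  \<open>s\<close> being the coefficients there. The premises are the two integrations by parts, the
  volume integrals being treated as unknowns to be eliminated.\<close>

lemma energy_identity_algebra:
  fixes A :: real
  assumes "A + K = 1/4 * dR * pR\<^sup>2 - 1/4 * dL * pL\<^sup>2" "B + J = sR * pR * rR - sL * pL * rL"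
  shows "- A + 1/2 * (dR * FuR * pR - dL * FuL * pL) + (- B + (sR * tqR * pR - sL * tqL * pL))
      + (- J + (sR * tuR * rR - sL * tuL * rL))
    = K + (1/4 * dR * (2 * FuR - pR) * pR + sR * (pR * tqR + tuR * rR - pR * rR))
      - (1/4 * dL * (2 * FuL - pL) * pL + sL * (pL * tqL + tuL * rL - pL * rL))"
proof -
  have "A = 1/4 * dR * pR\<^sup>2 - 1/4 * dL * pL\<^sup>2 - K" "B = sR * pR * rR - sL * pL * rL - J"
    using assms by simp_all
  then show ?thesis by (simp add: field_simps power2_eq_square)
qed

section \<open>The local energy identity\<close>

context dg_mesh
begin

text \<open>The square integral of \<open>q\<close>, which Ito's formula contributes as quadratic
  variation, is replaced by the equation for \<open>q\<close>. All volume terms then combine to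
  total derivatives and the reaction term, and what remains are fluxes paired with interior
  traces.\<close>

lemma energy_identity:
  assumes \<sigma>: "sigma_admissible \<sigma>" and j: "j < N" and q_eq: "q_equation N x \<sigma> \<theta> \<eta>u j u q q"
  shows "2 * (a_form N x \<sigma> \<gamma> \<gamma>t j u u + b_form N x \<sigma> \<theta> \<eta>q j u q u) + integral (cell x j) (\<lambda>y. poly (q j) y * poly (q j) y)
    = ((2 * Phi_flux N x \<sigma> \<gamma> \<gamma>t u (Suc j) + Lambda_flux N x \<sigma> \<theta> \<eta>u \<eta>q u q (Suc j))
       - (2 * Phi_flux N x \<sigma> \<gamma> \<gamma>t u j + Lambda_flux N x \<sigma> \<theta> \<eta>u \<eta>q u q j))
      - 1/4 * (\<gamma> + 2 * \<gamma>t) * \<bar>dsq \<sigma> (x j)\<bar> * (jump N x u j)\<^sup>2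
      - \<bar>\<sigma> (x j)\<bar> * (\<eta>u * (jump N x q j)\<^sup>2 + \<eta>q * (jump N x u j)\<^sup>2)
      + integral (cell x j) (\<lambda>y. ((deriv \<sigma> y)\<^sup>2 - (1/4) * deriv (dsq \<sigma>) y) * (poly (u j) y)\<^sup>2)"
proof -
  note d = sigma_admissible_derivs[OF \<sigma>]
  let ?a = "x j" and ?b = "x (Suc j)" and ?p = "poly (u j)" and ?r = "poly (q j)"
  have ab: "?a \<le> ?b" using mesh_less[OF j] by simp
  have dp: "(poly v has_real_derivative poly (pderiv v) y) (at y)" for v and y :: real by (rule poly_DERIV)
  have d1: "deriv (\<lambda>z. \<sigma> z * ?p z) y = deriv \<sigma> y * ?p y + \<sigma> y * poly (pderiv (u j)) y" for y
    by (rule DERIV_imp_deriv) (auto intro!: derivative_eq_intros d(1) dp)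
  have d2: "deriv (\<lambda>z. deriv \<sigma> z * ?p z) y = deriv (deriv \<sigma>) y * ?p y + deriv \<sigma> y * poly (pderiv (u j)) y" for y
    by (rule DERIV_imp_deriv) (auto intro!: derivative_eq_intros d(2) dp)
  have d3: "deriv ?r y = poly (pderiv (q j)) y" for y by (rule DERIV_imp_deriv) (rule dp)
  note c = d(3-5)
  let ?B = "integral (cell x j) (\<lambda>y. deriv (\<lambda>z. \<sigma> z * ?p z) y * ?r y)"
  let ?J = "integral (cell x j) (\<lambda>y. deriv ?r y * \<sigma> y * ?p y)"
  \<comment> \<open>The volume terms of the two diffusive equations add up to the derivative of the
    product of \<open>\<sigma>\<close>, \<open>u\<close> and \<open>q\<close>.\<close>
  have I1: "?B + ?J = \<sigma> ?b * ?p ?b * ?r ?b - \<sigma> ?a * ?p ?a * ?r ?a"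
  proof -
    have "((\<lambda>y. (deriv \<sigma> y * ?p y + \<sigma> y * poly (pderiv (u j)) y) * ?r y + poly (pderiv (q j)) y * \<sigma> y * ?p y)
        has_integral (\<sigma> ?b * ?p ?b * ?r ?b - \<sigma> ?a * ?p ?a * ?r ?a)) {?a..?b}"
      by (rule fundamental_theorem_of_calculus[OF ab])
        (auto intro!: derivative_eq_intros has_field_derivative_at_within[OF d(1)] has_field_derivative_at_within[OF dp]
          simp: has_real_derivative_iff_has_vector_derivative[symmetric] algebra_simps)
    then have "integral {?a..?b} (\<lambda>y. (deriv \<sigma> y * ?p y + \<sigma> y * poly (pderiv (u j)) y) * ?r y + poly (pderiv (q j)) y * \<sigma> y * ?p y)
        = \<sigma> ?b * ?p ?b * ?r ?b - \<sigma> ?a * ?p ?a * ?r ?a" by (rule integral_unique)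
    moreover have "integral {?a..?b} (\<lambda>y. (deriv \<sigma> y * ?p y + \<sigma> y * poly (pderiv (u j)) y) * ?r y + poly (pderiv (q j)) y * \<sigma> y * ?p y) = ?B + ?J"
      unfolding cell_def d1 d3 by (intro integral_add integrable_continuous_real continuous_intros c)
    ultimately show ?thesis by simp
  qed
  let ?A = "integral (cell x j) (\<lambda>y. deriv (\<lambda>z. deriv \<sigma> z * ?p z) y * \<sigma> y * ?p y)"
  let ?K = "integral (cell x j) (\<lambda>y. ((deriv \<sigma> y)\<^sup>2 - (1/4) * deriv (dsq \<sigma>) y) * (?p y)\<^sup>2)"
  \<comment> \<open>The reaction coefficient is exactly what the advective volume term lacks to be
    the derivative of a quarter of \<open>dsq \<sigma>\<close> times the squared solution.\<close>
  have I2: "?A + ?K = 1/4 * dsq \<sigma> ?b * (?p ?b)\<^sup>2 - 1/4 * dsq \<sigma> ?a * (?p ?a)\<^sup>2"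
  proof -
    have "((\<lambda>y. (deriv (deriv \<sigma>) y * ?p y + deriv \<sigma> y * poly (pderiv (u j)) y) * \<sigma> y * ?p y
        + ((deriv \<sigma> y)\<^sup>2 - (1/4) * (2 * (deriv \<sigma> y)\<^sup>2 + 2 * \<sigma> y * deriv (deriv \<sigma>) y)) * (?p y)\<^sup>2)
        has_integral (1/2 * \<sigma> ?b * deriv \<sigma> ?b * (?p ?b)\<^sup>2 - 1/2 * \<sigma> ?a * deriv \<sigma> ?a * (?p ?a)\<^sup>2)) {?a..?b}"
      by (rule fundamental_theorem_of_calculus[OF ab])
        (auto intro!: derivative_eq_intros has_field_derivative_at_within[OF d(1)] has_field_derivative_at_within[OF d(2)]
           has_field_derivative_at_within[OF dp]
          simp: has_real_derivative_iff_has_vector_derivative[symmetric] algebra_simps power2_eq_square)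
    then have "integral {?a..?b} (\<lambda>y. (deriv (deriv \<sigma>) y * ?p y + deriv \<sigma> y * poly (pderiv (u j)) y) * \<sigma> y * ?p y
        + ((deriv \<sigma> y)\<^sup>2 - (1/4) * (2 * (deriv \<sigma> y)\<^sup>2 + 2 * \<sigma> y * deriv (deriv \<sigma>) y)) * (?p y)\<^sup>2)
        = 1/2 * \<sigma> ?b * deriv \<sigma> ?b * (?p ?b)\<^sup>2 - 1/2 * \<sigma> ?a * deriv \<sigma> ?a * (?p ?a)\<^sup>2" by (rule integral_unique)
    moreover have "integral {?a..?b} (\<lambda>y. (deriv (deriv \<sigma>) y * ?p y + deriv \<sigma> y * poly (pderiv (u j)) y) * \<sigma> y * ?p y
        + ((deriv \<sigma> y)\<^sup>2 - (1/4) * (2 * (deriv \<sigma> y)\<^sup>2 + 2 * \<sigma> y * deriv (deriv \<sigma>) y)) * (?p y)\<^sup>2) = ?A + ?K"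
      unfolding cell_def d2 d(7) by (intro integral_add integrable_continuous_real continuous_intros c)
    ultimately show ?thesis by (simp add: d(6))
  qed
  define FuR FuL tuR tuL tqR tqL where defs: "FuR = flux_Fu N x \<sigma> \<gamma> \<gamma>t u (Suc j)" "FuL = flux_Fu N x \<sigma> \<gamma> \<gamma>t u j"
    "tuR = flux_tFu N x \<sigma> \<theta> \<eta>u u q (Suc j)" "tuL = flux_tFu N x \<sigma> \<theta> \<eta>u u q j"
    "tqR = flux_tFq N x \<sigma> \<theta> \<eta>q u q (Suc j)" "tqL = flux_tFq N x \<sigma> \<theta> \<eta>q u q j"
  have tr: "?p ?b = trm x u (Suc j)" "?p ?a = trp N x u j" "?r ?b = trm x q (Suc j)" "?r ?a = trp N x q j"
    using j by (simp_all add: trm_eq trp_eq)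
  have qe: "integral (cell x j) (\<lambda>y. ?r y * ?r y) = - ?J + (\<sigma> ?b * tuR * ?r ?b - \<sigma> ?a * tuL * ?r ?a)"
    using q_eq unfolding q_equation_def defs .
  have a: "2 * a_form N x \<sigma> \<gamma> \<gamma>t j u u = - ?A + 1/2 * (dsq \<sigma> ?b * FuR * ?p ?b - dsq \<sigma> ?a * FuL * ?p ?a)"
    unfolding a_form_def defs by (simp add: algebra_simps)
  have b: "2 * b_form N x \<sigma> \<theta> \<eta>q j u q u = - ?B + (\<sigma> ?b * tqR * ?p ?b - \<sigma> ?a * tqL * ?p ?a)"
    unfolding b_form_def defs by (simp add: algebra_simps)
  \<comment> \<open>At the left node the cell sees the trace \<open>trp\<close>, whereas the energy
    flux is written with \<open>trm\<close>; this exchange and the next produce all penalties. At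
    the right node \<open>trm\<close> is already interior.\<close>
  have adv: "1/4 * dsq \<sigma> ?a * (2 * FuL - trp N x u j) * trp N x u j
     = 1/4 * dsq \<sigma> ?a * (2 * FuL - trm x u j) * trm x u j + 1/4 * (\<gamma> + 2 * \<gamma>t) * \<bar>dsq \<sigma> ?a\<bar> * (trp N x u j - trm x u j)\<^sup>2"
    by (rule penalty_advection) (simp add: defs flux_Fu_def upwind_def avg_def jump_def)
  have dif: "\<sigma> ?a * (trp N x u j * tqL + tuL * trp N x q j - trp N x u j * trp N x q j)
     = \<sigma> ?a * (trm x u j * tqL + tuL * trm x q j - trm x u j * trm x q j)
       + \<bar>\<sigma> ?a\<bar> * (\<eta>u * (trp N x q j - trm x q j)\<^sup>2 + \<eta>q * (trp N x u j - trm x u j)\<^sup>2)"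
    by (rule penalty_diffusion) (simp_all add: defs flux_tFu_def flux_tFq_def jump_def)
  have Phi: "2 * Phi_flux N x \<sigma> \<gamma> \<gamma>t u (Suc j) = 1/4 * dsq \<sigma> ?b * (2 * FuR - trm x u (Suc j)) * trm x u (Suc j)"
    "2 * Phi_flux N x \<sigma> \<gamma> \<gamma>t u j = 1/4 * dsq \<sigma> ?a * (2 * FuL - trm x u j) * trm x u j"
    by (simp_all add: Phi_flux_def defs)
  have Lam: "Lambda_flux N x \<sigma> \<theta> \<eta>u \<eta>q u q (Suc j) = \<sigma> ?b * (trm x u (Suc j) * tqR + tuR * trm x q (Suc j) - trm x u (Suc j) * trm x q (Suc j))"
    "Lambda_flux N x \<sigma> \<theta> \<eta>u \<eta>q u q j = \<sigma> ?a * (trm x u j * tqL + tuL * trm x q j - trm x u j * trm x q j)"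
    by (simp_all add: Lambda_flux_def defs)
  have sum: "2 * (a_form N x \<sigma> \<gamma> \<gamma>t j u u + b_form N x \<sigma> \<theta> \<eta>q j u q u) + integral (cell x j) (\<lambda>y. ?r y * ?r y)
    = ?K + (1/4 * dsq \<sigma> ?b * (2 * FuR - trm x u (Suc j)) * trm x u (Suc j)
            + \<sigma> ?b * (trm x u (Suc j) * tqR + tuR * trm x q (Suc j) - trm x u (Suc j) * trm x q (Suc j)))
         - (1/4 * dsq \<sigma> ?a * (2 * FuL - trp N x u j) * trp N x u j
            + \<sigma> ?a * (trp N x u j * tqL + tuL * trp N x q j - trp N x u j * trp N x q j))"
    unfolding distrib_left a b qe tr by (rule energy_identity_algebra[OF I2[unfolded tr] I1[unfolded tr]])
  show ?thesis unfolding sum adv dif Phi Lam jump_def by (simp add: algebra_simps)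
qed

end

section \<open>Exceptional sets, expectations of time integrals, polynomial-valued processes\<close>

context brownian_basis
begin

lemma cont_adapted_cong:
  assumes X: "cont_adapted X" and eq: "\<And>t \<omega>. t \<in> {0..T} \<Longrightarrow> \<omega> \<in> space M \<Longrightarrow> Y t \<omega> = X t \<omega>"
  shows "cont_adapted Y"
  unfolding cont_adapted_def adapted_def
proof (intro conjI ballI)
  fix t assume t: "t \<in> {0..T}"
  show "Y t \<in> borel_measurable (F t)"
    using cont_adapted_meas[OF X t] by (subst measurable_cong[where g="X t"]) (auto simp: space_F eq[OF t])
next
  fix \<omega> assume \<omega>: "\<omega> \<in> space M"
  show "continuous_on {0..T} (\<lambda>t. Y t \<omega>)"
    using cont_adapted_cont[OF X \<omega>, of T] eq[OF _ \<omega>] by (subst continuous_on_cong[OF refl]) auto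
qed

lemma ito_process_cong:
  assumes P: "ito_process X A H"
    and X: "\<And>t \<omega>. t \<in> {0..T} \<Longrightarrow> \<omega> \<in> space M \<Longrightarrow> X' t \<omega> = X t \<omega>"
    and H: "\<And>t \<omega>. t \<in> {0..T} \<Longrightarrow> \<omega> \<in> space M \<Longrightarrow> H' t \<omega> = H t \<omega>"
  shows "ito_process X' A H'"
  unfolding ito_process_def
proof (intro conjI ballI)
  note ca = ito_process_cont_adapted[OF P]
  show ca': "cont_adapted X'" "cont_adapted A" "cont_adapted H'"
    using cont_adapted_cong[OF ca(1) X] ca(2) cont_adapted_cong[OF ca(3) H] by auto
  fix t assume t: "t \<in> {0..T}"
  have T0: "0 \<in> {0..T}" using T_pos by simp
  show "tends_in_prob M (\<lambda>m. ito_sum H' m t) (\<lambda>\<omega>. X' t \<omega> - X' 0 \<omega> - integral {0..t} (\<lambda>s. A s \<omega>))"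
  proof (rule tends_in_prob_cong_AE)
    show "tends_in_prob M (\<lambda>m. ito_sum H m t) (\<lambda>\<omega>. X t \<omega> - X 0 \<omega> - integral {0..t} (\<lambda>s. A s \<omega>))"
      using P t by (simp add: ito_process_def)
    show "ito_sum H' m t \<in> borel_measurable M" for m by (rule ito_sum_measurable[OF ca'(3) t])
    show "(\<lambda>\<omega>. X' t \<omega> - X' 0 \<omega> - integral {0..t} (\<lambda>s. A s \<omega>)) \<in> borel_measurable M"
      by (rule ito_process_target_measurable[OF ca'(1,2) t])
    show "AE \<omega> in M. (\<forall>m. ito_sum H' m t \<omega> = ito_sum H m t \<omega>) \<and>
       X' t \<omega> - X' 0 \<omega> - integral {0..t} (\<lambda>s. A s \<omega>) = X t \<omega> - X 0 \<omega> - integral {0..t} (\<lambda>s. A s \<omega>)"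
      by (intro AE_I2) (simp add: X[OF t] X[OF T0] ito_sum_def H[OF grid_in[OF t]])
  qed
qed

text \<open>The equation for \<open>q\<close> holds only outside a null set, so the drift produced
  by the product rule agrees with the drift of the energy identity only almost surely.\<close>

lemma has_ito_differential_cong_drift:
  assumes d: "has_ito_differential M F T W X A H" and eq: "AE \<omega> in M. \<forall>t\<in>{0..T}. A' t \<omega> = A t \<omega>"
  shows "has_ito_differential M F T W X A' H"
proof -
  obtain I where I: "has_ito_integral M F T W H I"
    and AE: "AE \<omega> in M. \<forall>t\<in>{0..T}. (\<lambda>s. A s \<omega>) integrable_on {0..t} \<and>
      X t \<omega> = X 0 \<omega> + integral {0..t} (\<lambda>s. A s \<omega>) + I t \<omega>"
    using d unfolding has_ito_differential_def by blast
  have "AE \<omega> in M. \<forall>t\<in>{0..T}. (\<lambda>s. A' s \<omega>) integrable_on {0..t} \<and>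
      X t \<omega> = X 0 \<omega> + integral {0..t} (\<lambda>s. A' s \<omega>) + I t \<omega>"
    using AE eq
  proof eventually_elim
    case (elim \<omega>)
    have eq: "A' s \<omega> = A s \<omega>" if "t \<in> {0..T}" "s \<in> {0..t}" for s t using elim(2) that by simp
    have int: "integral {0..t} (\<lambda>s. A' s \<omega>) = integral {0..t} (\<lambda>s. A s \<omega>)" if "t \<in> {0..T}" for t
      by (rule Henstock_Kurzweil_Integration.integral_cong) (rule eq[OF that])
    have intble: "(\<lambda>s. A' s \<omega>) integrable_on {0..t} \<longleftrightarrow> (\<lambda>s. A s \<omega>) integrable_on {0..t}" if "t \<in> {0..T}" for t
      by (rule integrable_cong) (rule eq[OF that])
    show ?case
    proof
      fix t assume t: "t \<in> {0..T}"
      show "(\<lambda>s. A' s \<omega>) integrable_on {0..t} \<and> X t \<omega> = X 0 \<omega> + integral {0..t} (\<lambda>s. A' s \<omega>) + I t \<omega>"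
        unfolding int[OF t] intble[OF t] using elim(1) t by blast
    qed
  qed
  then show ?thesis using I unfolding has_ito_differential_def by blast
qed

text \<open>Continuity of paths gives convergence along sequences of times, and the uniform second
  moment lets expectations follow.\<close>

lemma expectation_continuous:
  assumes X: "cont_adapted X" and int: "\<And>s. s \<in> {0..T} \<Longrightarrow> integrable M (\<lambda>\<omega>. (X s \<omega>)\<^sup>2)"
    and le: "\<And>s. s \<in> {0..T} \<Longrightarrow> (\<integral>\<omega>. (X s \<omega>)\<^sup>2 \<partial>M) \<le> C"
  shows "continuous_on {0..T} (\<lambda>s. \<integral>\<omega>. X s \<omega> \<partial>M)"
proof (rule continuous_on_sequentiallyI)
  fix r :: "nat \<Rightarrow> real" and s assume r: "\<forall>n. r n \<in> {0..T}" "s \<in> {0..T}" "r \<longlonglongrightarrow> s"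
  have "tends_in_prob M (\<lambda>n. X (r n)) (X s)"
  proof (rule tends_in_prob_AE)
    show "AE \<omega> in M. (\<lambda>n. X (r n) \<omega>) \<longlonglongrightarrow> X s \<omega>"
      using r cont_adapted_cont[OF X, of _ T]
      by (intro AE_I2 continuous_on_tendsto_compose[where f="\<lambda>s. X s _"]) auto
  qed (use r cont_adapted_measM[OF X] in auto)
  then show "(\<lambda>n. \<integral>\<omega>. X (r n) \<omega> \<partial>M) \<longlonglongrightarrow> (\<integral>\<omega>. X s \<omega> \<partial>M)"
    by (rule tends_in_prob_expectation) (use r int le in auto)
qed

text \<open>Expectation and time integral are exchanged on Riemann sums, where the exchange is
  finite additivity. Both sides then converge, the left one because the sums have uniformly bounded
  second moments.\<close>

lemma expectation_integral:
  assumes X: "cont_adapted X" and int: "\<And>s. s \<in> {0..T} \<Longrightarrow> integrable M (\<lambda>\<omega>. (X s \<omega>)\<^sup>2)"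
    and le: "\<And>s. s \<in> {0..T} \<Longrightarrow> (\<integral>\<omega>. (X s \<omega>)\<^sup>2 \<partial>M) \<le> C" and t: "t \<in> {0..T}"
  shows "integrable M (\<lambda>\<omega>. integral {0..t} (\<lambda>s. X s \<omega>))"
    "(\<integral>\<omega>. integral {0..t} (\<lambda>s. X s \<omega>) \<partial>M) = integral {0..t} (\<lambda>s. \<integral>\<omega>. X s \<omega> \<partial>M)"
proof -
  have t': "0 \<le> t" "t \<le> T" using t by auto
  let ?p = "grid T t"
  let ?\<Delta> = "\<lambda>m i. ?p m (Suc i) - ?p m i"
  define Z where "Z m \<omega> = (\<Sum>i<Suc m. X (?p m i) \<omega> * ?\<Delta> m i)" for m \<omega>
  have \<Delta>: "0 \<le> ?\<Delta> m i" for m i using grid_mono_Suc by simp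
  have \<Delta>_sum: "(\<Sum>i<Suc m. ?\<Delta> m i) = t" for m
    using sum_lessThan_telescope[of "?p m" "Suc m"] t' by (simp add: grid_first grid_last)
  have XM: "X (?p m i) \<in> borel_measurable M" for m i by (rule grid_value_measurable[OF X t])
  have intX: "integrable M (X (?p m i))" for m i
    by (rule integrable_of_square[OF XM int[OF grid_in[OF t]]])
  have lim: "tends_in_prob M Z (\<lambda>\<omega>. integral {0..t} (\<lambda>s. X s \<omega>))"
  proof (rule tends_in_prob_AE)
    show "Z m \<in> borel_measurable M" for m
      unfolding Z_def using XM by (intro borel_measurable_sum borel_measurable_times) auto
    show "(\<lambda>\<omega>. integral {0..t} (\<lambda>s. X s \<omega>)) \<in> borel_measurable M"
      by (rule cont_adapted_measM[OF cont_adapted_integral[OF X] t])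
    show "AE \<omega> in M. (\<lambda>m. Z m \<omega>) \<longlonglongrightarrow> integral {0..t} (\<lambda>s. X s \<omega>)"
      unfolding Z_def using cont_adapted_cont[OF X _ t'(2)]
      by (intro AE_I2 grid_riemann_sum_limit[OF t'])
  qed
  have C: "0 \<le> C" using le[OF t] by (rule order_trans[rotated]) auto
  have Z_le: "(Z m \<omega>)\<^sup>2 \<le> t * (\<Sum>i<Suc m. ?\<Delta> m i * (X (?p m i) \<omega>)\<^sup>2)" for m \<omega>
  proof -
    \<comment> \<open>Each step is split evenly between the two factors of Cauchy-Schwarz, so that
      the first factor sums to \<open>t\<close>.\<close>
    have "(\<Sum>i<Suc m. sqrt (?\<Delta> m i) * (sqrt (?\<Delta> m i) * X (?p m i) \<omega>))\<^sup>2
        \<le> (\<Sum>i<Suc m. (sqrt (?\<Delta> m i))\<^sup>2) * (\<Sum>i<Suc m. (sqrt (?\<Delta> m i) * X (?p m i) \<omega>)\<^sup>2)"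
      by (rule Cauchy_Schwarz_ineq_sum)
    moreover have "(\<Sum>i<Suc m. sqrt (?\<Delta> m i) * (sqrt (?\<Delta> m i) * X (?p m i) \<omega>)) = Z m \<omega>"
      unfolding Z_def
    proof (intro sum.cong refl)
      fix i
      have "sqrt (?\<Delta> m i) * (sqrt (?\<Delta> m i) * X (?p m i) \<omega>) = (sqrt (?\<Delta> m i) * sqrt (?\<Delta> m i)) * X (?p m i) \<omega>"
        by (simp only: mult.assoc)
      then show "sqrt (?\<Delta> m i) * (sqrt (?\<Delta> m i) * X (?p m i) \<omega>) = X (?p m i) \<omega> * ?\<Delta> m i"
        using \<Delta>[of m i] by (simp only: real_sqrt_mult_self abs_of_nonneg mult.commute)
    qed
    ultimately show ?thesis
      using \<Delta> by (simp only: power_mult_distrib real_sqrt_pow2 \<Delta>_sum)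
  qed
  have int_sum: "integrable M (\<lambda>\<omega>. t * (\<Sum>i<Suc m. ?\<Delta> m i * (X (?p m i) \<omega>)\<^sup>2))" for m
    using int[OF grid_in[OF t]] by (intro integrable_mult_right Bochner_Integration.integrable_sum)
  have Z_int: "integrable M (\<lambda>\<omega>. (Z m \<omega>)\<^sup>2)" for m
  proof (rule Bochner_Integration.integrable_bound[OF int_sum[of m]])
    show "(\<lambda>\<omega>. (Z m \<omega>)\<^sup>2) \<in> borel_measurable M"
      using tends_in_prob_measurable(1)[OF lim, of m] by simp
    have "norm ((Z m \<omega>)\<^sup>2) \<le> norm (t * (\<Sum>i<Suc m. ?\<Delta> m i * (X (?p m i) \<omega>)\<^sup>2))" for \<omega>
      unfolding real_norm_def abs_power2 using Z_le[of m \<omega>] by (rule order_trans[OF _ abs_ge_self])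
    then show "AE \<omega> in M. norm ((Z m \<omega>)\<^sup>2) \<le> norm (t * (\<Sum>i<Suc m. ?\<Delta> m i * (X (?p m i) \<omega>)\<^sup>2))" by simp
  qed
  have Z_E: "(\<integral>\<omega>. (Z m \<omega>)\<^sup>2 \<partial>M) \<le> t * (t * C)" for m
  proof -
    have "(\<integral>\<omega>. (Z m \<omega>)\<^sup>2 \<partial>M) \<le> (\<integral>\<omega>. t * (\<Sum>i<Suc m. ?\<Delta> m i * (X (?p m i) \<omega>)\<^sup>2) \<partial>M)"
      by (intro integral_mono Z_int int_sum Z_le)
    also have "\<dots> = t * (\<Sum>i<Suc m. ?\<Delta> m i * (\<integral>\<omega>. (X (?p m i) \<omega>)\<^sup>2 \<partial>M))"
      using int[OF grid_in[OF t]] by (simp add: Bochner_Integration.integral_sum del: sum.lessThan_Suc)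
    also have "\<dots> \<le> t * (\<Sum>i<Suc m. ?\<Delta> m i * C)"
      using le[OF grid_in[OF t]] \<Delta> t' by (intro mult_left_mono sum_mono) auto
    also have "\<dots> = t * (t * C)" by (simp only: sum_distrib_right[symmetric] \<Delta>_sum)
    finally show ?thesis .
  qed
  show "integrable M (\<lambda>\<omega>. integral {0..t} (\<lambda>s. X s \<omega>))"
    by (rule integrable_of_square[OF tends_in_prob_measurable(2)[OF lim] tends_in_prob_square_bound(1)[OF lim Z_int Z_E]])
  have "(\<lambda>m. \<integral>\<omega>. Z m \<omega> \<partial>M) \<longlonglongrightarrow> (\<integral>\<omega>. integral {0..t} (\<lambda>s. X s \<omega>) \<partial>M)"
    by (rule tends_in_prob_expectation[OF lim Z_int Z_E])
  moreover have "(\<integral>\<omega>. Z m \<omega> \<partial>M) = (\<Sum>i<Suc m. (\<integral>\<omega>. X (?p m i) \<omega> \<partial>M) * ?\<Delta> m i)" for m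
    unfolding Z_def using intX by (simp add: Bochner_Integration.integral_sum del: sum.lessThan_Suc)
  moreover have "(\<lambda>m. \<Sum>i<Suc m. (\<integral>\<omega>. X (?p m i) \<omega> \<partial>M) * ?\<Delta> m i) \<longlonglongrightarrow> integral {0..t} (\<lambda>s. \<integral>\<omega>. X s \<omega> \<partial>M)"
    by (rule grid_riemann_sum_limit[OF t' continuous_on_subset[OF expectation_continuous[OF X int le]]]) (use t in auto)
  ultimately show "(\<integral>\<omega>. integral {0..t} (\<lambda>s. X s \<omega>) \<partial>M) = integral {0..t} (\<lambda>s. \<integral>\<omega>. X s \<omega> \<partial>M)"
    using LIMSEQ_unique by (simp only:) blast
qed

lemma broken_process_coeff:
  assumes "broken_process M F T N k v" "j < N"
  shows "cont_adapted (\<lambda>t \<omega>. coeff (v t \<omega> j) i)"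
  using assms unfolding broken_process_def cont_adapted_def by blast

lemma broken_process_monomials:
  assumes "broken_process M F T N k v" "j < N" "t \<in> {0..T}" "\<omega> \<in> space M"
  shows "v t \<omega> j = (\<Sum>i\<le>k. smult (coeff (v t \<omega> j) i) (monom 1 i))"
proof -
  have "degree (v t \<omega> j) \<le> k"
    using assms by (simp add: broken_process_def broken_space_def)
  then show ?thesis using poly_as_sum_of_monoms'[of "v t \<omega> j" k] by (simp add: smult_monom)
qed

lemma broken_process_poly:
  assumes v: "broken_process M F T N k v" "j < N"
  shows "cont_adapted (\<lambda>t \<omega>. poly (v t \<omega> j) y)"
proof (rule cont_adapted_cong)
  show "cont_adapted (\<lambda>t \<omega>. \<Sum>i\<le>k. y ^ i * coeff (v t \<omega> j) i)"
    by (intro cont_adapted_intros broken_process_coeff[OF v])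
  show "poly (v t \<omega> j) y = (\<Sum>i\<le>k. y ^ i * coeff (v t \<omega> j) i)" if "t \<in> {0..T}" "\<omega> \<in> space M" for t \<omega>
    by (subst broken_process_monomials[OF v that]) (simp add: poly_sum poly_monom mult.commute)
qed

lemma broken_process_integral:
  assumes v: "broken_process M F T N k v" "j < N" and g: "continuous_on (cell x j) g"
  shows "cont_adapted (\<lambda>t \<omega>. integral (cell x j) (\<lambda>y. g y * poly (v t \<omega> j) y))"
proof (rule cont_adapted_cong)
  show "cont_adapted (\<lambda>t \<omega>. \<Sum>i\<le>k. integral (cell x j) (\<lambda>y. g y * poly (monom 1 i) y) * coeff (v t \<omega> j) i)"
    by (intro cont_adapted_intros broken_process_coeff[OF v])
  show "integral (cell x j) (\<lambda>y. g y * poly (v t \<omega> j) y)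
    = (\<Sum>i\<le>k. integral (cell x j) (\<lambda>y. g y * poly (monom 1 i) y) * coeff (v t \<omega> j) i)"
    if "t \<in> {0..T}" "\<omega> \<in> space M" for t \<omega>
    using integral_mult_sum_poly[of "x j" "x (Suc j)" g "{..k}" "coeff (v t \<omega> j)" "monom 1"] g
    by (subst broken_process_monomials[OF v that]) (simp add: cell_def mult.commute)
qed

end

section \<open>Linearity in the test function and the initial projection\<close>

context dg_mesh
begin

text \<open>The product rule first turns \<open>deriv\<close> into an explicit expression, which is
  then visibly linear in the test polynomial.\<close>

lemma integral_deriv_test_function:
  assumes g: "\<And>y. (g has_real_derivative g' y) (at y)" "continuous_on UNIV g" "continuous_on UNIV g'"
    and h: "continuous_on (cell x j) h" and \<phi>: "\<phi> \<in> broken_space N k" and j: "j < N"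
  shows "integral (cell x j) (\<lambda>y. deriv (\<lambda>z. g z * poly (\<phi> j) z) y * h y)
    = (\<Sum>i\<le>k. coord j i \<phi> * integral (cell x j) (\<lambda>y. deriv (\<lambda>z. g z * poly (basis_fun j i j) z) y * h y))"
proof -
  have d: "deriv (\<lambda>z. g z * poly p z) y = g' y * poly p y + g y * poly (pderiv p) y" for p y
    by (rule DERIV_imp_deriv) (auto intro!: derivative_eq_intros g poly_DERIV)
  note c = continuous_on_subset[OF g(2) subset_UNIV] continuous_on_subset[OF g(3) subset_UNIV] h
  have "integral (cell x j) (\<lambda>y. deriv (\<lambda>z. g z * poly (\<phi> j) z) y * h y)
    = integral (cell x j) (\<lambda>y. \<Sum>i\<le>k. coord j i \<phi> * (deriv (\<lambda>z. g z * poly (basis_fun j i j) z) y * h y))"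
    unfolding d unfolding poly_expansion[OF \<phi> j] pderiv_expansion[OF \<phi> j]
    by (simp add: basis_fun_def sum_distrib_left sum_distrib_right sum.distrib[symmetric] algebra_simps)
  also have "\<dots> = (\<Sum>i\<le>k. integral (cell x j) (\<lambda>y. coord j i \<phi> * (deriv (\<lambda>z. g z * poly (basis_fun j i j) z) y * h y)))"
    unfolding d using c unfolding cell_def
    by (intro integral_sum integrable_continuous_real continuous_intros) auto
  finally show ?thesis by simp
qed

text \<open>The scheme admits only deterministic test functions, whereas the energy identity tests
  with \<open>u\<close> itself. Linearity bridges the gap: the form at the random function is a
  combination of its values at the fixed basis functions, with random coordinates.\<close>

lemma a_form_expansion:
  assumes \<sigma>: "sigma_admissible \<sigma>" and \<phi>: "\<phi> \<in> broken_space N k" and j: "j < N"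
  shows "a_form N x \<sigma> \<gamma> \<gamma>t j u \<phi> = (\<Sum>i\<le>k. coord j i \<phi> * a_form N x \<sigma> \<gamma> \<gamma>t j u (basis_fun j i))"
proof -
  note d = sigma_admissible_derivs[OF \<sigma>]
  have h: "continuous_on (cell x j) (\<lambda>y. \<sigma> y * poly (u j) y)" by (intro continuous_intros d)
  have I: "integral (cell x j) (\<lambda>y. deriv (\<lambda>z. deriv \<sigma> z * poly (\<phi> j) z) y * \<sigma> y * poly (u j) y)
    = (\<Sum>i\<le>k. coord j i \<phi> * integral (cell x j) (\<lambda>y. deriv (\<lambda>z. deriv \<sigma> z * poly (basis_fun j i j) z) y * \<sigma> y * poly (u j) y))"
    using integral_deriv_test_function[OF d(2) d(4,5) h \<phi> j] by (simp only: mult.assoc)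
  have P: "poly (\<phi> j) y = (\<Sum>i\<le>k. coord j i \<phi> * poly (basis_fun j i j) y)" for y
    by (simp add: poly_expansion[OF \<phi> j] basis_fun_def)
  show ?thesis
    unfolding a_form_def I unfolding P
    by (simp add: sum_distrib_left sum_distrib_right sum.distrib[symmetric] sum_subtractf[symmetric] sum_negf[symmetric] algebra_simps)
qed

lemma b_form_expansion:
  assumes \<sigma>: "sigma_admissible \<sigma>" and \<phi>: "\<phi> \<in> broken_space N k" and j: "j < N"
  shows "b_form N x \<sigma> \<theta> \<eta>q j u q \<phi> = (\<Sum>i\<le>k. coord j i \<phi> * b_form N x \<sigma> \<theta> \<eta>q j u q (basis_fun j i))"
proof -
  note d = sigma_admissible_derivs[OF \<sigma>]
  have h: "continuous_on (cell x j) (\<lambda>y. poly (q j) y)" by (intro continuous_intros)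
  have I: "integral (cell x j) (\<lambda>y. deriv (\<lambda>z. \<sigma> z * poly (\<phi> j) z) y * poly (q j) y)
    = (\<Sum>i\<le>k. coord j i \<phi> * integral (cell x j) (\<lambda>y. deriv (\<lambda>z. \<sigma> z * poly (basis_fun j i j) z) y * poly (q j) y))"
    by (rule integral_deriv_test_function[OF d(1) d(3,4) h \<phi> j])
  have P: "poly (\<phi> j) y = (\<Sum>i\<le>k. coord j i \<phi> * poly (basis_fun j i j) y)" for y
    by (simp add: poly_expansion[OF \<phi> j] basis_fun_def)
  show ?thesis
    unfolding b_form_def I unfolding P
    by (simp add: sum_distrib_left sum_distrib_right sum.distrib[symmetric] sum_subtractf[symmetric] sum_negf[symmetric] algebra_simps)
qed

text \<open>Testing the projection with one basis function on one cell expresses the coordinate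
  through the datum alone, so it is not random. Square integrability of \<open>f\<close> gives the
  integrability that permits splitting the integral of a difference.\<close>

lemma projection_coord:
  assumes L2: "L2_real f" and v: "is_L2_projection N x k f v" and j: "j < N" and i: "i \<le> k"
  shows "coord j i v = integral (cell x j) (\<lambda>y. poly (basis j i) y * f y)"
proof -
  have int: "(\<lambda>y. poly p y * f y) integrable_on cell x j" for p
    unfolding cell_def
  proof (rule measurable_bounded_by_integrable_imp_integrable)
    have fM: "f \<in> borel_measurable lebesgue" using L2 by (simp add: L2_real_def)
    have "continuous_on UNIV (poly p)" by (rule continuous_on_poly[OF continuous_on_id])
    then have "poly p \<in> borel_measurable borel" by (rule borel_measurable_continuous_onI)
    then have "poly p \<in> borel_measurable lborel" by simp
    then have "poly p \<in> borel_measurable lebesgue" by (rule measurable_completion)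
    then have "(\<lambda>y. poly p y * f y) \<in> borel_measurable lebesgue" using fM by (rule borel_measurable_times)
    then show "(\<lambda>y. poly p y * f y) \<in> borel_measurable (lebesgue_on {x j..x (Suc j)})"
      by (rule measurable_restrict_space1)
    have "(\<lambda>y. (f y)\<^sup>2) integrable_on UNIV" using L2 by (intro integrable_on_lebesgue) (simp add: L2_real_def)
    then have "(\<lambda>y. (f y)\<^sup>2) integrable_on {x j..x (Suc j)}" by (rule integrable_on_subinterval) simp
    moreover have "(\<lambda>y. (poly p y)\<^sup>2) integrable_on {x j..x (Suc j)}"
      by (intro integrable_continuous_real continuous_intros)
    ultimately show "(\<lambda>y. (poly p y)\<^sup>2 + (f y)\<^sup>2) integrable_on {x j..x (Suc j)}" by (intro integrable_add)
    have xy: "\<bar>a * b\<bar> \<le> a\<^sup>2 + b\<^sup>2" for a b :: real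
      using sum_squares_bound[of "\<bar>a\<bar>" "\<bar>b\<bar>"] mult_nonneg_nonneg[of "\<bar>a\<bar>" "\<bar>b\<bar>"]
      by (simp add: abs_mult del: mult_nonneg_nonneg abs_ge_zero zero_le_mult_iff) linarith
    show "norm (poly p y * f y) \<le> (poly p y)\<^sup>2 + (f y)\<^sup>2" for y unfolding real_norm_def by (rule xy)
  qed simp
  have intv: "(\<lambda>y. poly p y * poly (v j) y) integrable_on cell x j" for p
    unfolding cell_def by (intro integrable_continuous_real continuous_intros)
  have "(\<Sum>l<N. integral (cell x l) (\<lambda>y. poly (basis_fun j i l) y * (poly (v l) y - f y))) = 0"
    using v basis_fun_in[OF j i] by (simp add: is_L2_projection_def)
  moreover have "(\<Sum>l<N. integral (cell x l) (\<lambda>y. poly (basis_fun j i l) y * (poly (v l) y - f y)))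
      = (\<Sum>l<N. if l = j then integral (cell x j) (\<lambda>y. poly (basis j i) y * (poly (v j) y - f y)) else 0)"
    by (intro sum.cong refl) (simp add: basis_fun_def)
  ultimately have "integral (cell x j) (\<lambda>y. poly (basis j i) y * (poly (v j) y - f y)) = 0"
    using j by simp
  moreover have "integral (cell x j) (\<lambda>y. poly (basis j i) y * (poly (v j) y - f y))
      = coord j i v - integral (cell x j) (\<lambda>y. poly (basis j i) y * f y)"
    unfolding right_diff_distrib coord_def by (rule integral_diff[OF intv int])
  ultimately show ?thesis by simp
qed

end

section \<open>The LDG solution\<close>

locale ldg_setting = brownian_basis M F T W + dg_mesh N k x
  for M :: "'w measure" and F T W N k x +
  fixes \<sigma> ubar :: "real \<Rightarrow> real" and \<gamma> \<gamma>t \<theta> \<eta>u \<eta>q :: real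
    and u q :: "real \<Rightarrow> 'w \<Rightarrow> broken_poly"
  assumes sigma: "sigma_admissible \<sigma>" and ubar: "L2_real ubar"
    and \<gamma>: "\<gamma> \<in> {0..1}" and \<theta>: "\<theta> \<in> {0..1}"
    and \<gamma>t: "\<gamma>t \<ge> 0" and \<eta>u: "\<eta>u \<ge> 0" and \<eta>q: "\<eta>q \<ge> 0"
    and sol: "ldg_solution M F T W \<sigma> ubar N x k \<gamma> \<gamma>t \<theta> \<eta>u \<eta>q u q"
begin

lemmas sigma_derivs = sigma_admissible_derivs[OF sigma]

lemma process_u: "broken_process M F T N k u" and process_q: "broken_process M F T N k q"
  using sol by (auto simp: ldg_solution_def)

lemma u_in: "t \<in> {0..T} \<Longrightarrow> \<omega> \<in> space M \<Longrightarrow> u t \<omega> \<in> broken_space N k"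
  and q_in: "t \<in> {0..T} \<Longrightarrow> \<omega> \<in> space M \<Longrightarrow> q t \<omega> \<in> broken_space N k"
  using process_u process_q by (auto simp: broken_process_def)

text \<open>The relation that holds between solution and auxiliary variable on almost every path.
  Estimates on compatible pairs are deterministic, so the exceptional set is dealt with only
  once.\<close>

definition compatible :: "broken_poly \<Rightarrow> broken_poly \<Rightarrow> bool" where
  "compatible v w \<longleftrightarrow> v \<in> broken_space N k \<and> w \<in> broken_space N k \<and>
     (\<forall>j<N. q_equation N x \<sigma> \<theta> \<eta>u j v w w)"

lemma compatible_solution: "AE \<omega> in M. \<omega> \<in> space M \<and> (\<forall>t\<in>{0..T}. compatible (u t \<omega>) (q t \<omega>))"
proof -
  have "AE \<omega> in M. \<forall>t\<in>{0..T}. \<forall>j<N. \<forall>\<psi>\<in>broken_space N k. q_equation N x \<sigma> \<theta> \<eta>u j (u t \<omega>) (q t \<omega>) \<psi>"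
    using sol by (simp add: ldg_solution_def)
  then show ?thesis
    using AE_space
  proof eventually_elim
    case (elim \<omega>)
    then show ?case using u_in q_in unfolding compatible_def by blast
  qed
qed

text \<open>Only the norm of \<open>v\<close> appears: \<open>w\<close> is controlled by
  \<open>v\<close> through coercivity. The closure rules for this predicate replace explicit
  constants for fluxes, drift and energy.\<close>

definition bounded_form :: "(broken_poly \<Rightarrow> broken_poly \<Rightarrow> real) \<Rightarrow> bool" where
  "bounded_form f \<longleftrightarrow> (\<exists>C\<ge>0. \<forall>v w. compatible v w \<longrightarrow> \<bar>f v w\<bar> \<le> C * dg_norm v)"

definition bounded_quadratic :: "(broken_poly \<Rightarrow> broken_poly \<Rightarrow> real) \<Rightarrow> bool" where
  "bounded_quadratic f \<longleftrightarrow> (\<exists>C\<ge>0. \<forall>v w. compatible v w \<longrightarrow> \<bar>f v w\<bar> \<le> C * energy v)"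

lemma bounded_formI: "0 \<le> C \<Longrightarrow> (\<And>v w. compatible v w \<Longrightarrow> \<bar>f v w\<bar> \<le> C * dg_norm v) \<Longrightarrow> bounded_form f"
  unfolding bounded_form_def by blast

lemma bounded_form_add:
  assumes "bounded_form f" "bounded_form g" shows "bounded_form (\<lambda>v w. f v w + g v w)"
proof -
  obtain C D where "0 \<le> C" "\<And>v w. compatible v w \<Longrightarrow> \<bar>f v w\<bar> \<le> C * dg_norm v"
    "0 \<le> D" "\<And>v w. compatible v w \<Longrightarrow> \<bar>g v w\<bar> \<le> D * dg_norm v"
    using assms unfolding bounded_form_def by blast
  then show ?thesis
    by (intro bounded_formI[of "C + D"]) (auto simp: distrib_right intro!: order_trans[OF abs_triangle_ineq add_mono])
qed

lemma bounded_form_cmult: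
  assumes "bounded_form f" shows "bounded_form (\<lambda>v w. c * f v w)"
proof -
  obtain C where "0 \<le> C" "\<And>v w. compatible v w \<Longrightarrow> \<bar>f v w\<bar> \<le> C * dg_norm v"
    using assms unfolding bounded_form_def by blast
  then show ?thesis
    by (intro bounded_formI[of "\<bar>c\<bar> * C"]) (auto simp: abs_mult mult.assoc intro!: mult_left_mono)
qed

lemma bounded_form_diff: "bounded_form f \<Longrightarrow> bounded_form g \<Longrightarrow> bounded_form (\<lambda>v w. f v w - g v w)"
  using bounded_form_add[OF _ bounded_form_cmult[of g "-1"], of f] by simp

lemma bounded_form_cmult_right: "bounded_form f \<Longrightarrow> bounded_form (\<lambda>v w. f v w * c)"
  using bounded_form_cmult[of f c] by (simp add: mult.commute)

lemma bounded_form_norm_q: "\<exists>C\<ge>0. \<forall>v w. compatible v w \<longrightarrow> dg_norm w \<le> C * dg_norm v"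
  using coercivity[OF sigma_derivs(3) \<eta>u \<theta>] unfolding compatible_def by blast

text \<open>The second claim is the point where coercivity enters: a bound by the norm of the
  auxiliary variable is turned into one by the norm of the solution.\<close>

lemma bounded_form_of_norms:
  assumes "0 \<le> C" "\<And>v. v \<in> broken_space N k \<Longrightarrow> \<bar>f v\<bar> \<le> C * dg_norm v"
  shows "bounded_form (\<lambda>v w. f v)" "bounded_form (\<lambda>v w. f w)"
proof -
  show "bounded_form (\<lambda>v w. f v)"
    using assms by (intro bounded_formI[of C]) (auto simp: compatible_def)
  obtain D where D: "0 \<le> D" "\<And>v w. compatible v w \<Longrightarrow> dg_norm w \<le> D * dg_norm v"
    using bounded_form_norm_q by blast
  show "bounded_form (\<lambda>v w. f w)"
  proof (rule bounded_formI[of "C * D"])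
    fix v w assume c: "compatible v w"
    have "\<bar>f w\<bar> \<le> C * dg_norm w" using assms(2) c by (simp add: compatible_def)
    also have "\<dots> \<le> C * (D * dg_norm v)" using D(2)[OF c] assms(1) by (intro mult_left_mono)
    finally show "\<bar>f w\<bar> \<le> C * D * dg_norm v" by (simp add: mult.assoc)
  qed (use assms D in auto)
qed

lemma bounded_form_trm:
  assumes "i \<le> N" shows "bounded_form (\<lambda>v w. trm x v i)" "bounded_form (\<lambda>v w. trm x w i)"
proof -
  obtain C where C: "0 \<le> C" "\<And>v. v \<in> broken_space N k \<Longrightarrow> \<bar>trm x v i\<bar> \<le> C * dg_norm v"
    using trace_bound assms by blast
  show "bounded_form (\<lambda>v w. trm x v i)" "bounded_form (\<lambda>v w. trm x w i)" by (rule bounded_form_of_norms[OF C], assumption)+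
qed

lemma bounded_form_trp:
  assumes "i \<le> N" shows "bounded_form (\<lambda>v w. trp N x v i)" "bounded_form (\<lambda>v w. trp N x w i)"
proof -
  obtain C where C: "0 \<le> C" "\<And>v. v \<in> broken_space N k \<Longrightarrow> \<bar>trp N x v i\<bar> \<le> C * dg_norm v"
    using trace_bound assms by blast
  show "bounded_form (\<lambda>v w. trp N x v i)" "bounded_form (\<lambda>v w. trp N x w i)" by (rule bounded_form_of_norms[OF C], assumption)+
qed

lemma bounded_form_jump:
  assumes "i \<le> N" shows "bounded_form (\<lambda>v w. jump N x v i)" "bounded_form (\<lambda>v w. jump N x w i)"
  unfolding jump_def by (intro bounded_form_diff bounded_form_trm bounded_form_trp assms)+

lemma bounded_form_poly:
  assumes "j < N" "y \<in> cell x j" shows "bounded_form (\<lambda>v w. poly (v j) y)"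
proof -
  obtain C where "0 \<le> C" "\<And>v. v \<in> broken_space N k \<Longrightarrow> \<bar>poly (v j) y\<bar> \<le> C * dg_norm v"
    using sup_bound assms by blast
  then show ?thesis by (rule bounded_form_of_norms)
qed

lemma bounded_form_coord:
  assumes "j < N" "i \<le> k" shows "bounded_form (\<lambda>v w. coord j i v)" "bounded_form (\<lambda>v w. coord j i w)"
  using bounded_form_of_norms[of 1 "coord j i"] coord_le_norm[OF assms] by auto

lemma bounded_form_integral:
  assumes j: "j < N" and g: "continuous_on (cell x j) g"
  shows "bounded_form (\<lambda>v w. integral (cell x j) (\<lambda>y. g y * poly (v j) y))"
    "bounded_form (\<lambda>v w. integral (cell x j) (\<lambda>y. g y * poly (w j) y))"
proof -
  obtain C where C: "0 \<le> C" "\<And>v y. v \<in> broken_space N k \<Longrightarrow> y \<in> cell x j \<Longrightarrow> \<bar>poly (v j) y\<bar> \<le> C * dg_norm v"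
    using sup_bound j by blast
  have "bounded (g ` cell x j)"
    unfolding cell_def by (intro compact_imp_bounded compact_continuous_image g[unfolded cell_def]) simp
  then obtain B where B: "\<And>y. y \<in> cell x j \<Longrightarrow> \<bar>g y\<bar> \<le> B" unfolding bounded_iff by (metis imageI real_norm_def)
  have "x j \<in> cell x j" using mesh_less[OF j] by (simp add: cell_def)
  then have B0: "0 \<le> B" using B[of "x j"] by auto
  have le: "\<bar>integral (cell x j) (\<lambda>y. g y * poly (v j) y)\<bar> \<le> B * C * (x (Suc j) - x j) * dg_norm v"
    if "v \<in> broken_space N k" for v
  proof -
    have "\<bar>integral (cell x j) (\<lambda>y. g y * poly (v j) y)\<bar> \<le> B * (C * dg_norm v) * (x (Suc j) - x j)"
      using B C(2)[OF that] B0 by (intro cell_integral_bound[OF _ _ j] continuous_intros g) (auto simp: abs_mult intro!: mult_mono)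
    then show ?thesis by (simp add: mult_ac)
  qed
  have nn: "0 \<le> B * C * (x (Suc j) - x j)" using B0 C(1) mesh_less[OF j] by simp
  show "bounded_form (\<lambda>v w. integral (cell x j) (\<lambda>y. g y * poly (v j) y))"
    "bounded_form (\<lambda>v w. integral (cell x j) (\<lambda>y. g y * poly (w j) y))"
    by (rule bounded_form_of_norms[OF nn le], assumption)+
qed

lemma bounded_quadratic_mult:
  assumes "bounded_form f" "bounded_form g" shows "bounded_quadratic (\<lambda>v w. f v w * g v w)"
proof -
  obtain C D where CD: "0 \<le> C" "\<And>v w. compatible v w \<Longrightarrow> \<bar>f v w\<bar> \<le> C * dg_norm v"
    "0 \<le> D" "\<And>v w. compatible v w \<Longrightarrow> \<bar>g v w\<bar> \<le> D * dg_norm v"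
    using assms unfolding bounded_form_def by blast
  have "\<bar>f v w * g v w\<bar> \<le> (C * D) * energy v" if "compatible v w" for v w
  proof -
    have "\<bar>f v w * g v w\<bar> \<le> (C * dg_norm v) * (D * dg_norm v)"
      unfolding abs_mult using CD that dg_norm_nonneg by (intro mult_mono) auto
    then show ?thesis by (simp add: dg_norm_square[symmetric] power2_eq_square mult_ac)
  qed
  then show ?thesis unfolding bounded_quadratic_def using CD by (intro exI[of _ "C * D"]) auto
qed

lemma bounded_quadratic_add:
  assumes "bounded_quadratic f" "bounded_quadratic g" shows "bounded_quadratic (\<lambda>v w. f v w + g v w)"
proof -
  obtain C D where "0 \<le> C" "\<And>v w. compatible v w \<Longrightarrow> \<bar>f v w\<bar> \<le> C * energy v"
    "0 \<le> D" "\<And>v w. compatible v w \<Longrightarrow> \<bar>g v w\<bar> \<le> D * energy v"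
    using assms unfolding bounded_quadratic_def by blast
  then show ?thesis unfolding bounded_quadratic_def
    by (intro exI[of _ "C + D"]) (auto simp: distrib_right intro!: order_trans[OF abs_triangle_ineq add_mono])
qed

lemma bounded_quadratic_cmult:
  assumes "bounded_quadratic f" shows "bounded_quadratic (\<lambda>v w. c * f v w)"
proof -
  obtain C where "0 \<le> C" "\<And>v w. compatible v w \<Longrightarrow> \<bar>f v w\<bar> \<le> C * energy v"
    using assms unfolding bounded_quadratic_def by blast
  then show ?thesis unfolding bounded_quadratic_def
    by (intro exI[of _ "\<bar>c\<bar> * C"]) (auto simp: abs_mult mult.assoc intro!: mult_left_mono)
qed

lemma bounded_quadratic_diff:
  "bounded_quadratic f \<Longrightarrow> bounded_quadratic g \<Longrightarrow> bounded_quadratic (\<lambda>v w. f v w - g v w)"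
  using bounded_quadratic_add[OF _ bounded_quadratic_cmult[of g "-1"], of f] by simp

lemma bounded_quadratic_sum:
  "finite J \<Longrightarrow> (\<And>j. j \<in> J \<Longrightarrow> bounded_quadratic (f j)) \<Longrightarrow> bounded_quadratic (\<lambda>v w. \<Sum>j\<in>J. f j v w)"
proof (induction J rule: finite_induct)
  case empty
  then show ?case by (auto simp: bounded_quadratic_def intro!: exI[of _ 0])
next
  case (insert j J)
  then show ?case using bounded_quadratic_add[of "f j"] by simp
qed

lemma bounded_form_flux:
  assumes "i \<le> N"
  shows "bounded_form (\<lambda>v w. flux_Fu N x \<sigma> \<gamma> \<gamma>t v i)" "bounded_form (\<lambda>v w. flux_tFu N x \<sigma> \<theta> \<eta>u v w i)"
    "bounded_form (\<lambda>v w. flux_tFq N x \<sigma> \<theta> \<eta>q v w i)"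
proof -
  have "bounded_form (\<lambda>v w. upwind N x v i b)" for b
    using bounded_form_trm[OF assms] bounded_form_trp[OF assms] by (cases "b \<ge> 0") (auto simp: upwind_def)
  moreover have "bounded_form (\<lambda>v w. avg N x v i)"
    unfolding avg_def divide_inverse by (intro bounded_form_cmult_right bounded_form_add bounded_form_trm bounded_form_trp assms)
  ultimately show "bounded_form (\<lambda>v w. flux_Fu N x \<sigma> \<gamma> \<gamma>t v i)"
    unfolding flux_Fu_def by (intro bounded_form_add bounded_form_cmult bounded_form_jump assms)
  show "bounded_form (\<lambda>v w. flux_tFu N x \<sigma> \<theta> \<eta>u v w i)" "bounded_form (\<lambda>v w. flux_tFq N x \<sigma> \<theta> \<eta>q v w i)"
    unfolding flux_tFu_def flux_tFq_def
    by (intro bounded_form_add bounded_form_cmult bounded_form_trm bounded_form_trp bounded_form_jump assms)+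
qed

section \<open>The coordinates and the energies as Ito processes\<close>

definition drift_form :: "nat \<Rightarrow> nat \<Rightarrow> broken_poly \<Rightarrow> broken_poly \<Rightarrow> real" where
  "drift_form j i v w = a_form N x \<sigma> \<gamma> \<gamma>t j v (basis_fun j i) + b_form N x \<sigma> \<theta> \<eta>q j v w (basis_fun j i)"

lemma test_function_weights:
  "continuous_on A (\<lambda>y. deriv (\<lambda>z. deriv \<sigma> z * poly p z) y * \<sigma> y)"
  "continuous_on A (\<lambda>y. deriv (\<lambda>z. \<sigma> z * poly p z) y)"
proof -
  have d1: "deriv (\<lambda>z. \<sigma> z * poly p z) y = deriv \<sigma> y * poly p y + \<sigma> y * poly (pderiv p) y" for y
    by (rule DERIV_imp_deriv) (auto intro!: derivative_eq_intros sigma_derivs(1) poly_DERIV)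
  have d2: "deriv (\<lambda>z. deriv \<sigma> z * poly p z) y = deriv (deriv \<sigma>) y * poly p y + deriv \<sigma> y * poly (pderiv p) y" for y
    by (rule DERIV_imp_deriv) (auto intro!: derivative_eq_intros sigma_derivs(2) poly_DERIV)
  show "continuous_on A (\<lambda>y. deriv (\<lambda>z. deriv \<sigma> z * poly p z) y * \<sigma> y)"
    "continuous_on A (\<lambda>y. deriv (\<lambda>z. \<sigma> z * poly p z) y)"
    unfolding d1 d2 by (intro continuous_intros sigma_derivs)+
qed

lemma bounded_form_drift:
  assumes "j < N" shows "bounded_form (drift_form j i)"
proof -
  have "bounded_form (\<lambda>v w. drift_form j i v w)"
    unfolding drift_form_def a_form_def b_form_def using assms
    by (intro bounded_form_add bounded_form_diff bounded_form_cmult bounded_form_cmult_right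
        bounded_form_integral test_function_weights bounded_form_flux) auto
  then show ?thesis by simp
qed

lemma cont_adapted_trm:
  "i \<le> N \<Longrightarrow> cont_adapted (\<lambda>t \<omega>. trm x (u t \<omega>) i)" "i \<le> N \<Longrightarrow> cont_adapted (\<lambda>t \<omega>. trm x (q t \<omega>) i)"
  using N_pos broken_process_poly[OF process_u] broken_process_poly[OF process_q] by (cases i; simp add: trm_def)+

lemma cont_adapted_trp:
  "i \<le> N \<Longrightarrow> cont_adapted (\<lambda>t \<omega>. trp N x (u t \<omega>) i)" "i \<le> N \<Longrightarrow> cont_adapted (\<lambda>t \<omega>. trp N x (q t \<omega>) i)"
  using N_pos broken_process_poly[OF process_u] broken_process_poly[OF process_q] by (cases "i = N"; simp add: trp_def)+

lemma cont_adapted_jump: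
  assumes "i \<le> N"
  shows "cont_adapted (\<lambda>t \<omega>. jump N x (u t \<omega>) i)" "cont_adapted (\<lambda>t \<omega>. jump N x (q t \<omega>) i)"
  unfolding jump_def by (intro cont_adapted_diff cont_adapted_trm cont_adapted_trp assms)+

lemma cont_adapted_cmult_right: "cont_adapted X \<Longrightarrow> cont_adapted (\<lambda>t \<omega>. X t \<omega> * c)"
  using cont_adapted_cmult[of X c] by (simp add: mult.commute)

lemma cont_adapted_flux:
  assumes "i \<le> N"
  shows "cont_adapted (\<lambda>t \<omega>. flux_Fu N x \<sigma> \<gamma> \<gamma>t (u t \<omega>) i)"
    "cont_adapted (\<lambda>t \<omega>. flux_tFu N x \<sigma> \<theta> \<eta>u (u t \<omega>) (q t \<omega>) i)"
    "cont_adapted (\<lambda>t \<omega>. flux_tFq N x \<sigma> \<theta> \<eta>q (u t \<omega>) (q t \<omega>) i)"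
proof -
  have "cont_adapted (\<lambda>t \<omega>. upwind N x (u t \<omega>) i b)" for b
    using cont_adapted_trm[OF assms] cont_adapted_trp[OF assms] by (cases "b \<ge> 0") (auto simp: upwind_def)
  moreover have "cont_adapted (\<lambda>t \<omega>. avg N x (u t \<omega>) i)"
    unfolding avg_def divide_inverse by (intro cont_adapted_cmult_right cont_adapted_add cont_adapted_trm cont_adapted_trp assms)
  ultimately show "cont_adapted (\<lambda>t \<omega>. flux_Fu N x \<sigma> \<gamma> \<gamma>t (u t \<omega>) i)"
    unfolding flux_Fu_def by (intro cont_adapted_add cont_adapted_cmult cont_adapted_jump assms)
  show "cont_adapted (\<lambda>t \<omega>. flux_tFu N x \<sigma> \<theta> \<eta>u (u t \<omega>) (q t \<omega>) i)"
    "cont_adapted (\<lambda>t \<omega>. flux_tFq N x \<sigma> \<theta> \<eta>q (u t \<omega>) (q t \<omega>) i)"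
    unfolding flux_tFu_def flux_tFq_def
    by (intro cont_adapted_add cont_adapted_cmult cont_adapted_trm cont_adapted_trp cont_adapted_jump assms)+
qed

lemma cont_adapted_drift:
  assumes "j < N" shows "cont_adapted (\<lambda>t \<omega>. drift_form j i (u t \<omega>) (q t \<omega>))"
  unfolding drift_form_def a_form_def b_form_def using assms
  by (intro cont_adapted_add cont_adapted_diff cont_adapted_cmult cont_adapted_cmult_right
      broken_process_integral[OF process_u] broken_process_integral[OF process_q] test_function_weights cont_adapted_flux) auto

lemma cont_adapted_coord:
  assumes "j < N"
  shows "cont_adapted (\<lambda>t \<omega>. coord j i (u t \<omega>))" "cont_adapted (\<lambda>t \<omega>. coord j i (q t \<omega>))"
  unfolding coord_def
  by (intro broken_process_integral[OF process_u assms] broken_process_integral[OF process_q assms] continuous_intros)+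

text \<open>A basis function extended by zero to the other cells is an admissible deterministic test
  function, and testing with it isolates one coordinate.\<close>

lemma coord_process:
  assumes "j < N" "i \<le> k"
  shows "ito_process (\<lambda>t \<omega>. coord j i (u t \<omega>)) (\<lambda>t \<omega>. drift_form j i (u t \<omega>) (q t \<omega>)) (\<lambda>t \<omega>. - coord j i (q t \<omega>))"
proof (rule ito_processI)
  have "has_ito_differential M F T W
          (\<lambda>t \<omega>. integral (cell x j) (\<lambda>y. poly (basis_fun j i j) y * poly (u t \<omega> j) y))
          (\<lambda>t \<omega>. a_form N x \<sigma> \<gamma> \<gamma>t j (u t \<omega>) (basis_fun j i) + b_form N x \<sigma> \<theta> \<eta>q j (u t \<omega>) (q t \<omega>) (basis_fun j i))
          (\<lambda>t \<omega>. - integral (cell x j) (\<lambda>y. poly (basis_fun j i j) y * poly (q t \<omega> j) y))"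
    using sol assms(1) basis_fun_in[OF assms] unfolding ldg_solution_def by blast
  then show "has_ito_differential M F T W (\<lambda>t \<omega>. coord j i (u t \<omega>)) (\<lambda>t \<omega>. drift_form j i (u t \<omega>) (q t \<omega>)) (\<lambda>t \<omega>. - coord j i (q t \<omega>))"
    by (simp add: coord_def drift_form_def basis_fun_def[of j i])
qed (intro cont_adapted_coord cont_adapted_drift cont_adapted_uminus assms(1))+

definition cell_energy :: "nat \<Rightarrow> broken_poly \<Rightarrow> real" where
  "cell_energy j v = (\<Sum>i\<le>k. coord j i v * coord j i v)"

text \<open>Left in the literal shape that the product rule yields for a square, with doubled terms
  and signs, so that the rule applies directly. The last summand is the quadratic variation of a
  coordinate.\<close>

definition cell_drift :: "nat \<Rightarrow> broken_poly \<Rightarrow> broken_poly \<Rightarrow> real" where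
  "cell_drift j v w = (\<Sum>i\<le>k. coord j i v * drift_form j i v w + coord j i v * drift_form j i v w
     + (- coord j i w) * (- coord j i w))"

definition cell_diffusion :: "nat \<Rightarrow> broken_poly \<Rightarrow> broken_poly \<Rightarrow> real" where
  "cell_diffusion j v w = (\<Sum>i\<le>k. coord j i v * (- coord j i w) + coord j i v * (- coord j i w))"

lemma cell_energy_process:
  assumes "j < N"
  shows "ito_process (\<lambda>t \<omega>. cell_energy j (u t \<omega>)) (\<lambda>t \<omega>. cell_drift j (u t \<omega>) (q t \<omega>))
    (\<lambda>t \<omega>. cell_diffusion j (u t \<omega>) (q t \<omega>))"
  unfolding cell_energy_def cell_drift_def cell_diffusion_def
  by (intro ito_process_sum ito_process_mult coord_process assms) auto

lemma bounded_quadratic_cell: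
  assumes "j < N"
  shows "bounded_quadratic (cell_drift j)" "bounded_quadratic (cell_diffusion j)"
proof -
  have neg: "bounded_form (\<lambda>v w. - coord j i w)" if "i \<le> k" for i
    using bounded_form_cmult[OF bounded_form_coord(2)[OF assms that], of "-1"] by simp
  have "bounded_quadratic (\<lambda>v w. cell_drift j v w)" "bounded_quadratic (\<lambda>v w. cell_diffusion j v w)"
    unfolding cell_drift_def cell_diffusion_def
    by (intro bounded_quadratic_sum bounded_quadratic_add bounded_quadratic_mult bounded_form_coord bounded_form_drift neg assms; simp)+
  then show "bounded_quadratic (cell_drift j)" "bounded_quadratic (cell_diffusion j)" by simp_all
qed

lemma energy_cells: "energy v = (\<Sum>j<N. cell_energy j v)"
  by (simp add: energy_def cell_energy_def power2_eq_square)

lemma energy_process: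
  "ito_process (\<lambda>t \<omega>. energy (u t \<omega>)) (\<lambda>t \<omega>. \<Sum>j<N. cell_drift j (u t \<omega>) (q t \<omega>))
    (\<lambda>t \<omega>. \<Sum>j<N. cell_diffusion j (u t \<omega>) (q t \<omega>))"
  unfolding energy_cells by (intro ito_process_sum cell_energy_process) auto

lemma initial_energy: "\<exists>B. AE \<omega> in M. energy (u 0 \<omega>) = B"
proof -
  have "AE \<omega> in M. is_L2_projection N x k ubar (u 0 \<omega>)"
    using sol by (simp add: ldg_solution_def)
  then have "AE \<omega> in M. energy (u 0 \<omega>) = (\<Sum>j<N. \<Sum>i\<le>k. (integral (cell x j) (\<lambda>y. poly (basis j i) y * ubar y))\<^sup>2)"
  proof eventually_elim
    case (elim \<omega>)
    show ?case unfolding energy_def using projection_coord[OF ubar elim] by (intro sum.cong refl) auto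
  qed
  then show ?thesis by blast
qed

text \<open>Drift and diffusion of the total energy are bounded by multiples of the energy itself.
  The square of the energy therefore satisfies the growth condition of the moment bound, and it
  starts from an almost surely constant value.\<close>

lemma energy_second_moment:
  "\<exists>K\<ge>0. \<forall>t\<in>{0..T}. integrable M (\<lambda>\<omega>. (energy (u t \<omega>))\<^sup>2) \<and> (\<integral>\<omega>. (energy (u t \<omega>))\<^sup>2 \<partial>M) \<le> K"
proof -
  let ?E = "\<lambda>t \<omega>. energy (u t \<omega>)"
  let ?D = "\<lambda>t \<omega>. \<Sum>j<N. cell_drift j (u t \<omega>) (q t \<omega>)"
  let ?H = "\<lambda>t \<omega>. \<Sum>j<N. cell_diffusion j (u t \<omega>) (q t \<omega>)"
  have "bounded_quadratic (\<lambda>v w. \<Sum>j<N. cell_drift j v w)" "bounded_quadratic (\<lambda>v w. \<Sum>j<N. cell_diffusion j v w)"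
    by (intro bounded_quadratic_sum bounded_quadratic_cell; simp)+
  then obtain C1 C2 where C: "0 \<le> C1" "\<And>v w. compatible v w \<Longrightarrow> \<bar>\<Sum>j<N. cell_drift j v w\<bar> \<le> C1 * energy v"
    "0 \<le> C2" "\<And>v w. compatible v w \<Longrightarrow> \<bar>\<Sum>j<N. cell_diffusion j v w\<bar> \<le> C2 * energy v"
    unfolding bounded_quadratic_def by blast
  obtain B where B: "AE \<omega> in M. energy (u 0 \<omega>) = B" using initial_energy by blast
  \<comment> \<open>The drift of the squared energy needs \<open>2 * C1 + C2 * C2\<close>, its
    diffusion \<open>2 * C2\<close>; the sum serves both.\<close>
  define c where "c = 2 * C1 + C2 * C2 + 2 * C2"
  have c0: "0 \<le> c" using C(1,3) by (simp add: c_def)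
  have Z: "ito_process (\<lambda>t \<omega>. ?E t \<omega> * ?E t \<omega>) (\<lambda>t \<omega>. ?E t \<omega> * ?D t \<omega> + ?E t \<omega> * ?D t \<omega> + ?H t \<omega> * ?H t \<omega>)
    (\<lambda>t \<omega>. ?E t \<omega> * ?H t \<omega> + ?E t \<omega> * ?H t \<omega>)"
    by (rule ito_process_mult[OF energy_process energy_process])
  have growth: "AE \<omega> in M. \<forall>t\<in>{0..T}. ?E t \<omega> * ?D t \<omega> + ?E t \<omega> * ?D t \<omega> + ?H t \<omega> * ?H t \<omega> \<le> c * (?E t \<omega> * ?E t \<omega>) \<and>
      \<bar>?E t \<omega> * ?H t \<omega> + ?E t \<omega> * ?H t \<omega>\<bar> \<le> c * (?E t \<omega> * ?E t \<omega>)"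
    using compatible_solution
  proof eventually_elim
    case (elim \<omega>)
    show ?case
    proof
      fix t assume "t \<in> {0..T}"
      then have comp: "compatible (u t \<omega>) (q t \<omega>)" using elim by blast
      have E0: "0 \<le> ?E t \<omega>" by (rule energy_nonneg)
      have ED: "\<bar>?E t \<omega> * ?D t \<omega>\<bar> \<le> C1 * (?E t \<omega> * ?E t \<omega>)"
        using mult_left_mono[OF C(2)[OF comp] E0] E0 by (simp add: abs_mult mult_ac)
      have EH: "\<bar>?E t \<omega> * ?H t \<omega>\<bar> \<le> C2 * (?E t \<omega> * ?E t \<omega>)"
        using mult_left_mono[OF C(4)[OF comp] E0] E0 by (simp add: abs_mult mult_ac)
      have "\<bar>?H t \<omega>\<bar> * \<bar>?H t \<omega>\<bar> \<le> (C2 * ?E t \<omega>) * (C2 * ?E t \<omega>)"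
        using C(3) C(4)[OF comp] E0 by (intro mult_mono) auto
      then have HH: "?H t \<omega> * ?H t \<omega> \<le> C2 * C2 * (?E t \<omega> * ?E t \<omega>)" by (simp add: mult_ac)
      have nn: "0 \<le> C1 * (?E t \<omega> * ?E t \<omega>)" "0 \<le> C2 * (?E t \<omega> * ?E t \<omega>)" "0 \<le> C2 * C2 * (?E t \<omega> * ?E t \<omega>)"
        using C(1,3) E0 by auto
      have cE: "c * (?E t \<omega> * ?E t \<omega>) = 2 * (C1 * (?E t \<omega> * ?E t \<omega>)) + C2 * C2 * (?E t \<omega> * ?E t \<omega>) + 2 * (C2 * (?E t \<omega> * ?E t \<omega>))"
        by (simp add: c_def algebra_simps)
      show "?E t \<omega> * ?D t \<omega> + ?E t \<omega> * ?D t \<omega> + ?H t \<omega> * ?H t \<omega> \<le> c * (?E t \<omega> * ?E t \<omega>) \<and>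
        \<bar>?E t \<omega> * ?H t \<omega> + ?E t \<omega> * ?H t \<omega>\<bar> \<le> c * (?E t \<omega> * ?E t \<omega>)"
        unfolding cE using ED EH HH nn by linarith
    qed
  qed
  have init: "AE \<omega> in M. ?E 0 \<omega> * ?E 0 \<omega> \<le> B * B" using B by eventually_elim simp
  have mom: "integrable M (\<lambda>\<omega>. ?E t \<omega> * ?E t \<omega>)" "(\<integral>\<omega>. ?E t \<omega> * ?E t \<omega> \<partial>M) \<le> B * B * exp (c * t)" if "t \<in> {0..T}" for t
    by (rule ito_process_moment[OF Z _ c0 growth init that]; simp)+
  have "B * B * exp (c * t) \<le> B * B * exp (c * T)" if "t \<in> {0..T}" for t
    using that c0 by (intro mult_left_mono) (auto intro: mult_left_mono)
  then have "(\<integral>\<omega>. ?E t \<omega> * ?E t \<omega> \<partial>M) \<le> B * B * exp (c * T)" if "t \<in> {0..T}" for t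
    using order_trans[OF mom(2)[OF that]] that by blast
  then show ?thesis
    using mom(1) by (intro exI[of _ "B * B * exp (c * T)"]) (auto simp: power2_eq_square)
qed

text \<open>The square of a quadratic quantity is almost surely at most a multiple of the squared
  energy. The bound \<open>K\<close> is uniform in time, as the results on expectations
  require.\<close>

lemma quadratic_moments:
  assumes f: "bounded_quadratic f"
  shows "\<exists>K. \<forall>t\<in>{0..T}. (\<lambda>\<omega>. f (u t \<omega>) (q t \<omega>)) \<in> borel_measurable M \<longrightarrow>
     integrable M (\<lambda>\<omega>. f (u t \<omega>) (q t \<omega>)) \<and> integrable M (\<lambda>\<omega>. (f (u t \<omega>) (q t \<omega>))\<^sup>2) \<and>
     (\<integral>\<omega>. (f (u t \<omega>) (q t \<omega>))\<^sup>2 \<partial>M) \<le> K"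
proof -
  obtain C where C: "0 \<le> C" "\<And>v w. compatible v w \<Longrightarrow> \<bar>f v w\<bar> \<le> C * energy v"
    using f unfolding bounded_quadratic_def by blast
  obtain K where K: "\<And>t. t \<in> {0..T} \<Longrightarrow> integrable M (\<lambda>\<omega>. (energy (u t \<omega>))\<^sup>2)"
    "\<And>t. t \<in> {0..T} \<Longrightarrow> (\<integral>\<omega>. (energy (u t \<omega>))\<^sup>2 \<partial>M) \<le> K"
    using energy_second_moment by blast
  have "integrable M (\<lambda>\<omega>. f (u t \<omega>) (q t \<omega>)) \<and> integrable M (\<lambda>\<omega>. (f (u t \<omega>) (q t \<omega>))\<^sup>2) \<and>
     (\<integral>\<omega>. (f (u t \<omega>) (q t \<omega>))\<^sup>2 \<partial>M) \<le> C\<^sup>2 * K"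
    if t: "t \<in> {0..T}" and meas: "(\<lambda>\<omega>. f (u t \<omega>) (q t \<omega>)) \<in> borel_measurable M" for t
  proof -
    have le: "AE \<omega> in M. (f (u t \<omega>) (q t \<omega>))\<^sup>2 \<le> C\<^sup>2 * (energy (u t \<omega>))\<^sup>2"
      using compatible_solution
    proof eventually_elim
      case (elim \<omega>)
      have "\<bar>f (u t \<omega>) (q t \<omega>)\<bar> \<le> C * energy (u t \<omega>)" using C(2) elim t by blast
      from power_mono[OF this, of 2] show ?case by (simp add: power_mult_distrib)
    qed
    have int2: "integrable M (\<lambda>\<omega>. C\<^sup>2 * (energy (u t \<omega>))\<^sup>2)" using K(1)[OF t] by simp
    have sq: "integrable M (\<lambda>\<omega>. (f (u t \<omega>) (q t \<omega>))\<^sup>2)"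
    proof (rule Bochner_Integration.integrable_bound[OF int2])
      show "AE \<omega> in M. norm ((f (u t \<omega>) (q t \<omega>))\<^sup>2) \<le> norm (C\<^sup>2 * (energy (u t \<omega>))\<^sup>2)"
        using le by eventually_elim simp
    qed (use meas in auto)
    have "(\<integral>\<omega>. (f (u t \<omega>) (q t \<omega>))\<^sup>2 \<partial>M) \<le> (\<integral>\<omega>. C\<^sup>2 * (energy (u t \<omega>))\<^sup>2 \<partial>M)"
      by (rule integral_mono_AE[OF sq int2 le])
    also have "\<dots> \<le> C\<^sup>2 * K" using K(2)[OF t] by (simp add: mult_left_mono)
    finally show ?thesis using sq integrable_of_square[OF meas sq] by blast
  qed
  then show ?thesis by blast
qed

lemma cell_energy_eq:
  assumes "j < N" "t \<in> {0..T}" "\<omega> \<in> space M"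
  shows "cell_energy j (u t \<omega>) = integral (cell x j) (\<lambda>y. (poly (u t \<omega> j) y)\<^sup>2)"
  using inner_product_expansion[OF u_in[OF assms(2,3)] assms(1), of "u t \<omega>"] by (simp add: cell_energy_def power2_eq_square)

lemma cell_diffusion_eq:
  assumes "j < N" "t \<in> {0..T}" "\<omega> \<in> space M"
  shows "cell_diffusion j (u t \<omega>) (q t \<omega>) = - integral (cell x j) (\<lambda>y. 2 * poly (u t \<omega> j) y * poly (q t \<omega> j) y)"
proof -
  have "integral (cell x j) (\<lambda>y. 2 * (poly (u t \<omega> j) y * poly (q t \<omega> j) y)) = 2 * (\<Sum>i\<le>k. coord j i (q t \<omega>) * coord j i (u t \<omega>))"
    using inner_product_expansion[OF q_in[OF assms(2,3)] assms(1), of "u t \<omega>"] by simp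
  then show ?thesis
    by (simp add: cell_diffusion_def mult.assoc sum_negf sum.distrib[symmetric] sum_distrib_left mult.commute[of "coord j _ (q t \<omega>)"])
qed

section \<open>The identity on one cell and its expectation\<close>

definition energy_flux :: "nat \<Rightarrow> broken_poly \<Rightarrow> broken_poly \<Rightarrow> real" where
  "energy_flux i v w = 2 * Phi_flux N x \<sigma> \<gamma> \<gamma>t v i + Lambda_flux N x \<sigma> \<theta> \<eta>u \<eta>q v w i"

definition penalty :: "nat \<Rightarrow> broken_poly \<Rightarrow> broken_poly \<Rightarrow> real" where
  "penalty j v w = 1/4 * (\<gamma> + 2 * \<gamma>t) * \<bar>dsq \<sigma> (x j)\<bar> * (jump N x v j)\<^sup>2
     + \<bar>\<sigma> (x j)\<bar> * (\<eta>u * (jump N x w j)\<^sup>2 + \<eta>q * (jump N x v j)\<^sup>2)"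

definition reaction :: "real \<Rightarrow> real" where
  "reaction y = (deriv \<sigma> y)\<^sup>2 - (1/4) * deriv (dsq \<sigma>) y"

lemma reaction_continuous: "continuous_on A reaction"
  unfolding reaction_def sigma_derivs(7) by (intro continuous_intros sigma_derivs)

text \<open>By linearity the sums over the basis recombine to the forms tested with \<open>v\<close>
  itself, and by Parseval the quadratic variations add up to the square integral of
  \<open>w\<close>. This is the left side of the energy identity.\<close>

lemma cell_drift_eq:
  assumes j: "j < N" and c: "compatible v w"
  shows "cell_drift j v w = energy_flux (Suc j) v w - energy_flux j v w - penalty j v w
    + integral (cell x j) (\<lambda>y. reaction y * (poly (v j) y)\<^sup>2)"
proof -
  have V: "v \<in> broken_space N k" "w \<in> broken_space N k" and qe: "q_equation N x \<sigma> \<theta> \<eta>u j v w w"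
    using c j by (auto simp: compatible_def)
  have "cell_drift j v w = 2 * ((\<Sum>i\<le>k. coord j i v * a_form N x \<sigma> \<gamma> \<gamma>t j v (basis_fun j i))
      + (\<Sum>i\<le>k. coord j i v * b_form N x \<sigma> \<theta> \<eta>q j v w (basis_fun j i))) + (\<Sum>i\<le>k. coord j i w * coord j i w)"
    unfolding cell_drift_def drift_form_def
    by (simp add: sum_distrib_left sum.distrib[symmetric] algebra_simps)
  also have "\<dots> = 2 * (a_form N x \<sigma> \<gamma> \<gamma>t j v v + b_form N x \<sigma> \<theta> \<eta>q j v w v) + integral (cell x j) (\<lambda>y. poly (w j) y * poly (w j) y)"
    unfolding a_form_expansion[OF sigma V(1) j, symmetric] b_form_expansion[OF sigma V(1) j, symmetric]
      inner_product_expansion[OF V(2) j] ..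
  finally show ?thesis
    unfolding energy_identity[OF sigma j qe] energy_flux_def penalty_def reaction_def by simp
qed

lemma cell_energy_differential:
  assumes j: "j < N"
  shows "has_ito_differential M F T W (\<lambda>t \<omega>. integral (cell x j) (\<lambda>y. (poly (u t \<omega> j) y)\<^sup>2))
    (\<lambda>t \<omega>. energy_flux (Suc j) (u t \<omega>) (q t \<omega>) - energy_flux j (u t \<omega>) (q t \<omega>) - penalty j (u t \<omega>) (q t \<omega>)
      + integral (cell x j) (\<lambda>y. reaction y * (poly (u t \<omega> j) y)\<^sup>2))
    (\<lambda>t \<omega>. - integral (cell x j) (\<lambda>y. 2 * poly (u t \<omega> j) y * poly (q t \<omega> j) y))"
proof (rule has_ito_differential_cong_drift)
  show "has_ito_differential M F T W (\<lambda>t \<omega>. integral (cell x j) (\<lambda>y. (poly (u t \<omega> j) y)\<^sup>2))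
    (\<lambda>t \<omega>. cell_drift j (u t \<omega>) (q t \<omega>)) (\<lambda>t \<omega>. - integral (cell x j) (\<lambda>y. 2 * poly (u t \<omega> j) y * poly (q t \<omega> j) y))"
    by (rule ito_process_differential[OF ito_process_cong[OF cell_energy_process[OF j]]])
      (simp_all add: cell_energy_eq[OF j] cell_diffusion_eq[OF j])
  show "AE \<omega> in M. \<forall>t\<in>{0..T}. energy_flux (Suc j) (u t \<omega>) (q t \<omega>) - energy_flux j (u t \<omega>) (q t \<omega>) - penalty j (u t \<omega>) (q t \<omega>)
      + integral (cell x j) (\<lambda>y. reaction y * (poly (u t \<omega> j) y)\<^sup>2) = cell_drift j (u t \<omega>) (q t \<omega>)"
    using compatible_solution by eventually_elim (simp add: cell_drift_eq[OF j])
qed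

lemma bounded_quadratic_flux:
  assumes "i \<le> N" shows "bounded_quadratic (energy_flux i)"
proof -
  have "energy_flux i = (\<lambda>v w. 1/4 * dsq \<sigma> (x i) * ((2 * flux_Fu N x \<sigma> \<gamma> \<gamma>t v i - trm x v i) * trm x v i)
     + \<sigma> (x i) * (trm x v i * flux_tFq N x \<sigma> \<theta> \<eta>q v w i + flux_tFu N x \<sigma> \<theta> \<eta>u v w i * trm x w i - trm x v i * trm x w i))"
    by (intro ext) (simp add: energy_flux_def Phi_flux_def Lambda_flux_def)
  then show ?thesis
    by (simp only:) (intro bounded_quadratic_add bounded_quadratic_diff bounded_quadratic_cmult bounded_quadratic_mult
      bounded_form_diff bounded_form_cmult bounded_form_flux bounded_form_trm assms)
qed

lemma cont_adapted_flux_process: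
  assumes "i \<le> N" shows "cont_adapted (\<lambda>t \<omega>. energy_flux i (u t \<omega>) (q t \<omega>))"
  unfolding energy_flux_def Phi_flux_def Lambda_flux_def
  by (intro cont_adapted_add cont_adapted_diff cont_adapted_cmult cont_adapted_mult cont_adapted_const
    cont_adapted_flux cont_adapted_trm assms)

lemma penalty_nonneg: "0 \<le> penalty j v w"
  unfolding penalty_def using \<gamma> \<gamma>t \<eta>u \<eta>q by (intro add_nonneg_nonneg mult_nonneg_nonneg) auto

text \<open>The square of the solution is a finite combination of deterministic polynomials with
  products of random coordinates as coefficients, so the exchange of the spatial integral and the
  expectation is one of finite sums.\<close>

lemma reaction_expectation:
  assumes j: "j < N" and t: "t \<in> {0..T}"
  shows "integrable M (\<lambda>\<omega>. integral (cell x j) (\<lambda>y. reaction y * (poly (u t \<omega> j) y)\<^sup>2))"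
    "(\<integral>\<omega>. integral (cell x j) (\<lambda>y. reaction y * (poly (u t \<omega> j) y)\<^sup>2) \<partial>M)
      = integral (cell x j) (\<lambda>y. reaction y * (\<integral>\<omega>. (poly (u t \<omega> j) y)\<^sup>2 \<partial>M))"
proof -
  let ?U = "\<lambda>i \<omega>. coord j i (u t \<omega>)" and ?e = "\<lambda>i y. poly (basis j i) y"
  define R where "R i l = integral (cell x j) (\<lambda>y. reaction y * (?e i y * ?e l y))" for i l
  have prod: "integrable M (\<lambda>\<omega>. ?U i \<omega> * ?U l \<omega>)" if "i \<le> k" "l \<le> k" for i l
  proof -
    have "bounded_quadratic (\<lambda>v w. coord j i v * coord j l v)"
      by (intro bounded_quadratic_mult bounded_form_coord j that)
    moreover have "(\<lambda>\<omega>. ?U i \<omega> * ?U l \<omega>) \<in> borel_measurable M"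
      by (intro cont_adapted_measM[OF cont_adapted_mult t] cont_adapted_coord j)
    ultimately show ?thesis using quadratic_moments t by blast
  qed
  have E_sum: "(\<integral>\<omega>. (\<Sum>i\<le>k. \<Sum>l\<le>k. (?U i \<omega> * ?U l \<omega>) * c i l) \<partial>M) = (\<Sum>i\<le>k. \<Sum>l\<le>k. (\<integral>\<omega>. ?U i \<omega> * ?U l \<omega> \<partial>M) * c i l)" for c
  proof -
    have "(\<integral>\<omega>. (\<Sum>i\<le>k. \<Sum>l\<le>k. (?U i \<omega> * ?U l \<omega>) * c i l) \<partial>M) = (\<Sum>i\<le>k. \<integral>\<omega>. (\<Sum>l\<le>k. (?U i \<omega> * ?U l \<omega>) * c i l) \<partial>M)"
      using prod by (intro Bochner_Integration.integral_sum Bochner_Integration.integrable_sum integrable_mult_left) auto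
    also have "\<dots> = (\<Sum>i\<le>k. \<Sum>l\<le>k. \<integral>\<omega>. (?U i \<omega> * ?U l \<omega>) * c i l \<partial>M)"
      using prod by (intro sum.cong refl Bochner_Integration.integral_sum integrable_mult_left) auto
    finally show ?thesis by simp
  qed
  have int: "(\<lambda>y. c * (reaction y * (?e i y * ?e l y))) integrable_on cell x j" for i l c
    unfolding cell_def by (intro integrable_continuous_real continuous_intros reaction_continuous)
  have sq: "(poly (u t \<omega> j) y)\<^sup>2 = (\<Sum>i\<le>k. \<Sum>l\<le>k. (?U i \<omega> * ?U l \<omega>) * (?e i y * ?e l y))" if "\<omega> \<in> space M" for \<omega> y
    unfolding poly_expansion[OF u_in[OF t that] j] power2_eq_square sum_product by (intro sum.cong refl) (simp add: mult_ac)
  have expand: "integral (cell x j) (\<lambda>y. reaction y * (\<Sum>i\<le>k. \<Sum>l\<le>k. c i l * (?e i y * ?e l y)))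
      = (\<Sum>i\<le>k. \<Sum>l\<le>k. c i l * R i l)" for c
  proof -
    have "integral (cell x j) (\<lambda>y. reaction y * (\<Sum>i\<le>k. \<Sum>l\<le>k. c i l * (?e i y * ?e l y)))
       = integral (cell x j) (\<lambda>y. \<Sum>i\<le>k. \<Sum>l\<le>k. c i l * (reaction y * (?e i y * ?e l y)))"
      by (simp add: sum_distrib_left mult_ac)
    also have "\<dots> = (\<Sum>i\<le>k. \<Sum>l\<le>k. integral (cell x j) (\<lambda>y. c i l * (reaction y * (?e i y * ?e l y))))"
      using int by (simp only: integral_sum integrable_sum finite_atMost)
    finally show ?thesis by (simp add: R_def)
  qed
  have eq: "integral (cell x j) (\<lambda>y. reaction y * (poly (u t \<omega> j) y)\<^sup>2) = (\<Sum>i\<le>k. \<Sum>l\<le>k. (?U i \<omega> * ?U l \<omega>) * R i l)"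
    if "\<omega> \<in> space M" for \<omega>
    unfolding sq[OF that] by (rule expand)
  have intR: "integrable M (\<lambda>\<omega>. \<Sum>i\<le>k. \<Sum>l\<le>k. (?U i \<omega> * ?U l \<omega>) * R i l)"
    using prod by (intro Bochner_Integration.integrable_sum integrable_mult_left) auto
  then show "integrable M (\<lambda>\<omega>. integral (cell x j) (\<lambda>y. reaction y * (poly (u t \<omega> j) y)\<^sup>2))"
    by (subst Bochner_Integration.integrable_cong[OF refl eq]) auto
  have "(\<integral>\<omega>. integral (cell x j) (\<lambda>y. reaction y * (poly (u t \<omega> j) y)\<^sup>2) \<partial>M)
      = (\<integral>\<omega>. (\<Sum>i\<le>k. \<Sum>l\<le>k. (?U i \<omega> * ?U l \<omega>) * R i l) \<partial>M)"
    by (rule Bochner_Integration.integral_cong[OF refl eq])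
  also have "\<dots> = (\<Sum>i\<le>k. \<Sum>l\<le>k. (\<integral>\<omega>. ?U i \<omega> * ?U l \<omega> \<partial>M) * R i l)"
    by (rule E_sum)
  also have "\<dots> = integral (cell x j) (\<lambda>y. reaction y * (\<Sum>i\<le>k. \<Sum>l\<le>k. (\<integral>\<omega>. ?U i \<omega> * ?U l \<omega> \<partial>M) * (?e i y * ?e l y)))"
    by (rule expand[symmetric])
  also have "\<dots> = integral (cell x j) (\<lambda>y. reaction y * (\<integral>\<omega>. (poly (u t \<omega> j) y)\<^sup>2 \<partial>M))"
  proof -
    have "(\<integral>\<omega>. (poly (u t \<omega> j) y)\<^sup>2 \<partial>M) = (\<Sum>i\<le>k. \<Sum>l\<le>k. (\<integral>\<omega>. ?U i \<omega> * ?U l \<omega> \<partial>M) * (?e i y * ?e l y))" for y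
    proof -
      have "(\<integral>\<omega>. (poly (u t \<omega> j) y)\<^sup>2 \<partial>M) = (\<integral>\<omega>. (\<Sum>i\<le>k. \<Sum>l\<le>k. (?U i \<omega> * ?U l \<omega>) * (?e i y * ?e l y)) \<partial>M)"
        by (rule Bochner_Integration.integral_cong[OF refl sq])
      then show ?thesis by (simp only: E_sum)
    qed
    then show ?thesis by simp
  qed
  finally show "(\<integral>\<omega>. integral (cell x j) (\<lambda>y. reaction y * (poly (u t \<omega> j) y)\<^sup>2) \<partial>M)
      = integral (cell x j) (\<lambda>y. reaction y * (\<integral>\<omega>. (poly (u t \<omega> j) y)\<^sup>2 \<partial>M))" .
qed

text \<open>The bound on the diffusion makes the Ito integral centred, so the mean energy is its
  initial value plus the time integral of the mean drift. That mean is continuous, and the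
  fundamental theorem of calculus gives a classical derivative, one-sided at the ends.\<close>

lemma mean_cell_energy_derivative:
  assumes j: "j < N" and t: "t \<in> {0..T}"
  shows "((\<lambda>r. \<integral>\<omega>. integral (cell x j) (\<lambda>y. (poly (u r \<omega> j) y)\<^sup>2) \<partial>M) has_real_derivative
     (\<integral>\<omega>. cell_drift j (u t \<omega>) (q t \<omega>) \<partial>M)) (at t within {0..T})"
proof -
  note P = cell_energy_process[OF j]
  note ca = ito_process_cont_adapted[OF P]
  have T0: "0 \<in> {0..T}" using T_pos by simp
  obtain K1 where K1: "\<And>s. s \<in> {0..T} \<Longrightarrow> integrable M (\<lambda>\<omega>. (cell_drift j (u s \<omega>) (q s \<omega>))\<^sup>2)"
     "\<And>s. s \<in> {0..T} \<Longrightarrow> (\<integral>\<omega>. (cell_drift j (u s \<omega>) (q s \<omega>))\<^sup>2 \<partial>M) \<le> K1"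
    using quadratic_moments[OF bounded_quadratic_cell(1)[OF j]] cont_adapted_measM[OF ca(2)] by blast
  obtain K2 where K2: "\<And>s. s \<in> {0..T} \<Longrightarrow> integrable M (\<lambda>\<omega>. (cell_diffusion j (u s \<omega>) (q s \<omega>))\<^sup>2)"
     "\<And>s. s \<in> {0..T} \<Longrightarrow> (\<integral>\<omega>. (cell_diffusion j (u s \<omega>) (q s \<omega>))\<^sup>2 \<partial>M) \<le> K2"
    using quadratic_moments[OF bounded_quadratic_cell(2)[OF j]] cont_adapted_measM[OF ca(3)] by blast
  let ?h = "\<lambda>s. \<integral>\<omega>. cell_drift j (u s \<omega>) (q s \<omega>) \<partial>M"
  have E_int: "integrable M (\<lambda>\<omega>. cell_energy j (u s \<omega>))" if "s \<in> {0..T}" for s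
  proof -
    have "bounded_quadratic (\<lambda>v w. cell_energy j v)"
      unfolding cell_energy_def by (intro bounded_quadratic_sum bounded_quadratic_mult bounded_form_coord j) auto
    then show ?thesis using quadratic_moments cont_adapted_measM[OF ca(1) that] that by blast
  qed
  have eq: "(\<integral>\<omega>. integral (cell x j) (\<lambda>y. (poly (u r \<omega> j) y)\<^sup>2) \<partial>M) = (\<integral>\<omega>. cell_energy j (u 0 \<omega>) \<partial>M) + integral {0..r} ?h"
    if r: "r \<in> {0..T}" for r
  proof -
    note mart = ito_process_martingale_part[OF P r K2]
    have D: "integrable M (\<lambda>\<omega>. integral {0..r} (\<lambda>s. cell_drift j (u s \<omega>) (q s \<omega>)))"
      "(\<integral>\<omega>. integral {0..r} (\<lambda>s. cell_drift j (u s \<omega>) (q s \<omega>)) \<partial>M) = integral {0..r} ?h"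
      by (rule expectation_integral[OF ca(2) K1 r]; assumption)+
    have "(\<integral>\<omega>. cell_energy j (u r \<omega>) - cell_energy j (u 0 \<omega>) - integral {0..r} (\<lambda>s. cell_drift j (u s \<omega>) (q s \<omega>)) \<partial>M)
      = (\<integral>\<omega>. cell_energy j (u r \<omega>) \<partial>M) - (\<integral>\<omega>. cell_energy j (u 0 \<omega>) \<partial>M) - integral {0..r} ?h"
      using E_int[OF r] E_int[OF T0] D by simp
    then have "(\<integral>\<omega>. cell_energy j (u r \<omega>) \<partial>M) = (\<integral>\<omega>. cell_energy j (u 0 \<omega>) \<partial>M) + integral {0..r} ?h"
      using mart(2) by simp
    moreover have "(\<integral>\<omega>. integral (cell x j) (\<lambda>y. (poly (u r \<omega> j) y)\<^sup>2) \<partial>M) = (\<integral>\<omega>. cell_energy j (u r \<omega>) \<partial>M)"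
      using cell_energy_eq[OF j r] by (intro Bochner_Integration.integral_cong) auto
    ultimately show ?thesis by simp
  qed
  have "((\<lambda>r. (\<integral>\<omega>. cell_energy j (u 0 \<omega>) \<partial>M) + integral {0..r} ?h) has_real_derivative 0 + ?h t) (at t within {0..T})"
    by (intro DERIV_add DERIV_const integral_has_real_derivative expectation_continuous[OF ca(2) K1] t)
  then have "((\<lambda>r. (\<integral>\<omega>. cell_energy j (u 0 \<omega>) \<partial>M) + integral {0..r} ?h) has_real_derivative ?h t) (at t within {0..T})"
    by simp
  then show ?thesis
    \<comment> \<open>The two functions agree on all of \<open>[0,T]\<close>, so any radius would
      do.\<close>
    by (rule has_field_derivative_transform_within[OF _ zero_less_one t]) (simp only: eq)
qed

text \<open>The inequality arises solely from dropping the nonnegative penalty under the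
  expectation, whence equality as soon as the penalty vanishes.\<close>

lemma mean_drift:
  assumes j: "j < N" and t: "t \<in> {0..T}"
  defines "R \<equiv> integral (cell x j) (\<lambda>y. reaction y * (\<integral>\<omega>. (poly (u t \<omega> j) y)\<^sup>2 \<partial>M))
     + (\<integral>\<omega>. energy_flux (Suc j) (u t \<omega>) (q t \<omega>) - energy_flux j (u t \<omega>) (q t \<omega>) \<partial>M)"
  shows "(\<integral>\<omega>. cell_drift j (u t \<omega>) (q t \<omega>) \<partial>M) \<le> R"
    "(\<And>v w. penalty j v w = 0) \<Longrightarrow> (\<integral>\<omega>. cell_drift j (u t \<omega>) (q t \<omega>) \<partial>M) = R"
    "integrable M (\<lambda>\<omega>. energy_flux (Suc j) (u t \<omega>) (q t \<omega>) - energy_flux j (u t \<omega>) (q t \<omega>))"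
proof -
  have jN: "j \<le> N" "Suc j \<le> N" using j by auto
  let ?Q = "\<lambda>\<omega>. energy_flux (Suc j) (u t \<omega>) (q t \<omega>) - energy_flux j (u t \<omega>) (q t \<omega>)"
  let ?S = "\<lambda>\<omega>. integral (cell x j) (\<lambda>y. reaction y * (poly (u t \<omega> j) y)\<^sup>2)"
  have "bounded_quadratic (\<lambda>v w. energy_flux (Suc j) v w - energy_flux j v w)"
    by (intro bounded_quadratic_diff bounded_quadratic_flux jN)
  moreover have "?Q \<in> borel_measurable M"
    by (intro cont_adapted_measM[OF cont_adapted_diff t] cont_adapted_flux_process jN)
  ultimately show Q: "integrable M ?Q" using quadratic_moments t by blast
  note S = reaction_expectation[OF j t]
  have D: "integrable M (\<lambda>\<omega>. cell_drift j (u t \<omega>) (q t \<omega>))"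
    using quadratic_moments[OF bounded_quadratic_cell(1)[OF j]] cont_adapted_measM[OF ito_process_cont_adapted(2)[OF cell_energy_process[OF j]]] t
    by blast
  have QS: "(\<integral>\<omega>. ?Q \<omega> + ?S \<omega> \<partial>M) = R"
    unfolding R_def using Q S by simp
  have drift: "AE \<omega> in M. cell_drift j (u t \<omega>) (q t \<omega>) = ?Q \<omega> + ?S \<omega> - penalty j (u t \<omega>) (q t \<omega>)"
    using compatible_solution by eventually_elim (use t in \<open>simp add: cell_drift_eq[OF j]\<close>)
  show "(\<integral>\<omega>. cell_drift j (u t \<omega>) (q t \<omega>) \<partial>M) \<le> R"
    unfolding QS[symmetric]
  proof (rule integral_mono_AE[OF D])
    show "AE \<omega> in M. cell_drift j (u t \<omega>) (q t \<omega>) \<le> ?Q \<omega> + ?S \<omega>"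
      using drift by eventually_elim (use penalty_nonneg in simp)
  qed (use Q S in auto)
  show "(\<integral>\<omega>. cell_drift j (u t \<omega>) (q t \<omega>) \<partial>M) = R" if "\<And>v w. penalty j v w = 0"
    unfolding QS[symmetric]
  proof (rule integral_cong_AE)
    show "AE \<omega> in M. cell_drift j (u t \<omega>) (q t \<omega>) = ?Q \<omega> + ?S \<omega>"
      using drift by eventually_elim (simp add: that)
  qed (use Q S D in auto)
qed

lemma poly_square_integrable:
  assumes j: "j < N" and t: "t \<in> {0..T}" and y: "y \<in> cell x j"
  shows "integrable M (\<lambda>\<omega>. (poly (u t \<omega> j) y)\<^sup>2)"
proof -
  have "bounded_quadratic (\<lambda>v w. (poly (v j) y)\<^sup>2)"
    unfolding power2_eq_square by (intro bounded_quadratic_mult bounded_form_poly j y)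
  moreover have "(\<lambda>\<omega>. (poly (u t \<omega> j) y)\<^sup>2) \<in> borel_measurable M"
    by (intro cont_adapted_measM[OF cont_adapted_power t] broken_process_poly[OF process_u j])
  ultimately show ?thesis using quadratic_moments t by blast
qed

lemma cell_energy_integrable:
  assumes j: "j < N" and t: "t \<in> {0..T}"
  shows "integrable M (\<lambda>\<omega>. integral (cell x j) (\<lambda>y. (poly (u t \<omega> j) y)\<^sup>2))"
proof -
  have "bounded_quadratic (\<lambda>v w. cell_energy j v)"
    unfolding cell_energy_def by (intro bounded_quadratic_sum bounded_quadratic_mult bounded_form_coord j) auto
  then have "integrable M (\<lambda>\<omega>. cell_energy j (u t \<omega>))"
    using quadratic_moments cont_adapted_measM[OF ito_process_cont_adapted(1)[OF cell_energy_process[OF j]] t] t by blast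
  then show ?thesis
    using cell_energy_eq[OF j t] by (subst Bochner_Integration.integrable_cong[OF refl]) auto
qed

end

theorem theorem3p13:
  fixes M :: "'w measure" and F :: "real \<Rightarrow> 'w measure" and T :: real
    and W :: "real \<Rightarrow> 'w \<Rightarrow> real"
    and \<sigma> ubar :: "real \<Rightarrow> real"
    and N k j :: nat and x :: "nat \<Rightarrow> real"
    and \<gamma> \<gamma>t \<theta> \<eta>u \<eta>q :: real
    and u q :: "real \<Rightarrow> 'w \<Rightarrow> broken_poly"
    and S :: "real \<Rightarrow> real"
    and Sj Q :: "nat \<Rightarrow> real \<Rightarrow> 'w \<Rightarrow> real"
  assumes "0 < T"
    and "filtered_prob_space M F T"
    and "brownian_motion M F T W"
    and "sigma_admissible \<sigma>"
    and "L2_real ubar"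
    and "mesh N x"
    and "\<gamma> \<in> {0..1}" and "\<theta> \<in> {0..1}"
    and "\<gamma>t \<ge> 0" and "\<eta>u \<ge> 0" and "\<eta>q \<ge> 0"
    and "ldg_solution M F T W \<sigma> ubar N x k \<gamma> \<gamma>t \<theta> \<eta>u \<eta>q u q"
    and S_def: "S = (\<lambda>r. r\<^sup>2)"
    and Sj_def: "Sj = (\<lambda>j t \<omega>. integral (cell x j) (\<lambda>y. S (poly (u t \<omega> j) y)))"
    and Q_def: "Q = (\<lambda>i t \<omega>. 2 * Phi_flux N x \<sigma> \<gamma> \<gamma>t (u t \<omega>) i
                              + Lambda_flux N x \<sigma> \<theta> \<eta>u \<eta>q (u t \<omega>) (q t \<omega>) i)"
    and "j < N"
  shows
    "has_ito_differential M F T W (Sj j)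
       (\<lambda>t \<omega>. (Q (Suc j) t \<omega> - Q j t \<omega>)
          - (1/16) * (\<gamma> + 2 * \<gamma>t) * (\<bar>dsq \<sigma> (x j)\<bar> * (jump_comp N x (deriv S) (u t \<omega>) j)\<^sup>2)
          - \<bar>\<sigma> (x j)\<bar> * (\<eta>u * (jump N x (q t \<omega>) j)\<^sup>2
                          + (\<eta>q / 4) * (jump_comp N x (deriv S) (u t \<omega>) j)\<^sup>2)
          + integral (cell x j)
              (\<lambda>y. ((deriv \<sigma> y)\<^sup>2 - (1/4) * deriv (dsq \<sigma>) y) * S (poly (u t \<omega> j) y)))
       (\<lambda>t \<omega>. - integral (cell x j) (\<lambda>y. deriv S (poly (u t \<omega> j) y) * poly (q t \<omega> j) y))
     \<and>
     (\<forall>t\<in>{0..T}.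
       integrable M (Sj j t) \<and>
       (\<forall>y\<in>cell x j. integrable M (\<lambda>\<omega>. S (poly (u t \<omega> j) y))) \<and>
       integrable M (\<lambda>\<omega>. Q (Suc j) t \<omega> - Q j t \<omega>) \<and>
       (\<exists>D. ((\<lambda>r. LINT \<omega>|M. Sj j r \<omega>) has_real_derivative D) (at t within {0..T}) \<and>
            (let R = integral (cell x j)
                       (\<lambda>y. ((deriv \<sigma> y)\<^sup>2 - (1/4) * deriv (dsq \<sigma>) y)
                             * (LINT \<omega>|M. S (poly (u t \<omega> j) y)))
                     + (LINT \<omega>|M. Q (Suc j) t \<omega> - Q j t \<omega>)
             in D \<le> R \<and> (\<gamma> = 0 \<and> \<gamma>t = 0 \<and> \<eta>u = 0 \<and> \<eta>q = 0 \<longrightarrow> D = R))))"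
proof -
  interpret ldg_setting M F T W N k x \<sigma> ubar \<gamma> \<gamma>t \<theta> \<eta>u \<eta>q u q
    by unfold_locales (use assms in auto)
  have dS: "deriv S = (\<lambda>r. 2 * r)"
    unfolding S_def by (intro ext DERIV_imp_deriv) (auto intro!: derivative_eq_intros)
  have jc: "jump_comp N x (deriv S) v i = 2 * jump N x v i" for v i
    by (simp add: dS jump_comp_def jump_def)
  have Q: "Q i t \<omega> = energy_flux i (u t \<omega>) (q t \<omega>)" for i t \<omega>
    by (simp add: Q_def energy_flux_def)
  have Sj: "Sj j = (\<lambda>t \<omega>. integral (cell x j) (\<lambda>y. (poly (u t \<omega> j) y)\<^sup>2))"
    by (simp add: Sj_def S_def)
  \<comment> \<open>Since \<open>deriv S r = 2 * r\<close>, the squared jump of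
    \<open>deriv S\<close> is four times that of the solution, so the weights 1/4 and
    \<open>\<eta>q\<close> found for the jump of the solution become 1/16 and
    \<open>\<eta>q / 4\<close>. The English identity displays these two weights twice as large; the
    ones here are those that the computation yields.\<close>
  have pen: "Qd - (1/16) * (\<gamma> + 2 * \<gamma>t) * (\<bar>dsq \<sigma> (x j)\<bar> * (jump_comp N x (deriv S) v j)\<^sup>2)
          - \<bar>\<sigma> (x j)\<bar> * (\<eta>u * (jump N x w j)\<^sup>2 + (\<eta>q / 4) * (jump_comp N x (deriv S) v j)\<^sup>2)
      = Qd - penalty j v w" for Qd v w
    unfolding jc penalty_def by (simp add: power_mult_distrib algebra_simps)
  have S: "S r = r\<^sup>2" for r by (simp add: S_def)
  show ?thesis
    unfolding Sj Q unfolding pen unfolding S dS reaction_def[symmetric]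
  proof (intro conjI ballI)
    show "has_ito_differential M F T W (\<lambda>t \<omega>. integral (cell x j) (\<lambda>y. (poly (u t \<omega> j) y)\<^sup>2))
      (\<lambda>t \<omega>. energy_flux (Suc j) (u t \<omega>) (q t \<omega>) - energy_flux j (u t \<omega>) (q t \<omega>) - penalty j (u t \<omega>) (q t \<omega>)
        + integral (cell x j) (\<lambda>y. reaction y * (poly (u t \<omega> j) y)\<^sup>2))
      (\<lambda>t \<omega>. - integral (cell x j) (\<lambda>y. 2 * poly (u t \<omega> j) y * poly (q t \<omega> j) y))"
      by (rule cell_energy_differential[OF \<open>j < N\<close>])
  next
    fix t assume t: "t \<in> {0..T}"
    note j = \<open>j < N\<close>
    show "integrable M (\<lambda>\<omega>. integral (cell x j) (\<lambda>y. (poly (u t \<omega> j) y)\<^sup>2))"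
      by (rule cell_energy_integrable[OF j t])
    show "integrable M (\<lambda>\<omega>. (poly (u t \<omega> j) y)\<^sup>2)" if "y \<in> cell x j" for y
      by (rule poly_square_integrable[OF j t that])
    show "integrable M (\<lambda>\<omega>. energy_flux (Suc j) (u t \<omega>) (q t \<omega>) - energy_flux j (u t \<omega>) (q t \<omega>))"
      by (rule mean_drift(3)[OF j t])
    have "penalty j v w = 0" if "\<gamma> = 0 \<and> \<gamma>t = 0 \<and> \<eta>u = 0 \<and> \<eta>q = 0" for v w
      using that unfolding penalty_def by simp
    then show "\<exists>D. ((\<lambda>r. \<integral>\<omega>. integral (cell x j) (\<lambda>y. (poly (u r \<omega> j) y)\<^sup>2) \<partial>M) has_real_derivative D) (at t within {0..T}) \<and>
      (let R = integral (cell x j) (\<lambda>y. reaction y * (\<integral>\<omega>. (poly (u t \<omega> j) y)\<^sup>2 \<partial>M))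
            + (\<integral>\<omega>. energy_flux (Suc j) (u t \<omega>) (q t \<omega>) - energy_flux j (u t \<omega>) (q t \<omega>) \<partial>M)
       in D \<le> R \<and> (\<gamma> = 0 \<and> \<gamma>t = 0 \<and> \<eta>u = 0 \<and> \<eta>q = 0 \<longrightarrow> D = R))"
      unfolding Let_def using mean_cell_energy_derivative[OF j t] mean_drift(1,2)[OF j t] by blast
  qed
qed

end
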